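(* Let $\gamma_0:=(\sqrt{\sigma_w}+\sqrt{\sigma_n})^2-2\sigma_{wn}>0$. Let $T>0$ and let $(S_w,S_n,p)$ be an exact solution on $\Omega\times[0,T]$, with $0<S_\alpha<1$ on $\overline\Omega\times[0,T]$, of $$\partial_tS_\alpha=\Delta(p+\mu_\alpha),\quad \mu_\alpha=\sigma_\alpha\ln(S_\alpha)+\sigma_{wn}(1-S_\alpha)\quad(\alpha=w,n),\qquad S_w+S_n=1,$$ with no-flow boundary condition $\nabla(p+\mu_\alpha)\cdot\mathbf n=0$ on $\partial\Omega$, and with the regularity $$S_\alpha\in W^{2,\infty}(0,T;L^2(\Omega))\cap L^\infty(0,T;W^{4,\infty}(\Omega)),\qquad p\in L^\infty(0,T;W^{4,\infty}(\Omega)).$$ Let $S_{\alpha,h}^k$ be the numerical solution of the first-order scheme (with mobilities $\check M_{\alpha,1}\equiv1$ and porosity $\phi_h\equiv1$) with initial data $S_{\alpha,h}^0=S_{\alpha,N}(\cdot,0)$ at the cell centers, and let $e_\alpha^k=S_{\alpha,N}(\cdot,t^k)-S_{\alpha,h}^k$ at the cell centers, $t^k=k\Delta t$. Then, provided $\Delta t$ and $h$ are sufficiently small, for every integer $m\ge0$ with $(m+1)\Delta t\le T$, $$\|e_\alpha^{m+1}\|_{-1,h}^2+\Delta t\sum_{k=0}^m\|e_\alpha^{k+1}\|_h^2\le C(\Delta t^2+h^4),\qquad\alpha=w,n,$$ where $C$ is a constant independent of $\Delta t$ and $h$.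
   Context: Grid. $d\in\{2,3\}$; $\Omega=\prod_{l=1}^d[a_l,b_l]$ is divided uniformly into cubic cells of side $h$, with $N_l=(b_l-a_l)/h$ cells in direction $l$, $N_l=2K_l+1$. $\mathcal C_h$ is the space of real functions on the set of cell centers, $(c,c')_h=h^d\sum_{\text{cells}}c\,c'$, $\|c\|_h=(c,c)_h^{1/2}$, and $\mathcal C_h^0$ is the subspace of functions with $\sum_{\text{cells}}c=0$. The discrete Neumann Laplacian $\Delta_h=\nabla_h\cdot\nabla_h$ is $(\Delta_hc)_P=h^{-2}\sum_{Q\sim P}(c_Q-c_P)$, the sum over cells $Q$ sharing a face with $P$ (zero flux through boundary faces). For $\varphi\in\mathcal C_h^0$, $(-\Delta_h)^{-1}\varphi$ is the unique $\psi\in\mathcal C_h^0$ with $-\Delta_h\psi=\varphi$, and $\|\varphi\|_{-1,h}^2=(\varphi,(-\Delta_h)^{-1}\varphi)_h$. Projection. $S_{\alpha,N}(\cdot,t)=\mathcal P_NS_\alpha(\cdot,t)$ is the Fourier cosine projection ($L^2$-orthogonal projection) of $S_\alpha(\cdot,t)$ onto the space of cosine polynomials spanned by $\prod_l\cos\big(k_l\pi(x_l-a_l)/(b_l-a_l)\big)$, $0\le k_l\le K_l$. One has $S_{w,N}+S_{n,N}\equiv1$, and $e_\alpha^k\in\mathcal C_h^0$, so $\|e_\alpha^k\|_{-1,h}$ is defined. Parameters. $\sigma_w,\sigma_n,\sigma_{wn}>0$ are real constants, $\Delta t>0$ is the time step; injection/production rates are zero. First-order scheme. Given $S_{w,h}^k$,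 $S_{n,h}^k=1-S_{w,h}^k$ with values in $(0,1)$, $S_{w,h}^{k+1}\in\mathcal C_h$ with values in $(0,1)$ is (uniquely) determined by: $S_{w,h}^{k+1}-S_{w,h}^k\in\mathcal C_h^0$ and $$\mu_{w,h}^{k+1}-\mu_{n,h}^{k+1}+\frac2{\Delta t}(-\Delta_h)^{-1}(S_{w,h}^{k+1}-S_{w,h}^k)=\text{constant on }\mathcal C_h\text{'s grid},$$ with $\mu_{w,h}^{k+1}=\sigma_w\ln(S_{w,h}^{k+1})+\sigma_{wn}S_{n,h}^k$, $\mu_{n,h}^{k+1}=\sigma_n\ln(1-S_{w,h}^{k+1})+\sigma_{wn}S_{w,h}^k$; then $S_{n,h}^{k+1}=1-S_{w,h}^{k+1}$. Equivalently, $2(S_{w,h}^{k+1}-S_{w,h}^k)/\Delta t=\Delta_h(\mu_{w,h}^{k+1}-\mu_{n,h}^{k+1})$. *)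

theory Defs
  imports "HOL-Analysis.Analysis"
begin

section \<open>Weak derivatives and Sobolev spaces of bounded functions\<close>

primrec iter_deriv :: "'a list \<Rightarrow> ('a::euclidean_space \<Rightarrow> real) \<Rightarrow> 'a \<Rightarrow> real" where
  "iter_deriv [] f = f"
| "iter_deriv (e # es) f = (\<lambda>x. frechet_derivative (iter_deriv es f) (at x) e)"

definition smooth_fun :: "('a::euclidean_space \<Rightarrow> real) \<Rightarrow> bool" where
  "smooth_fun f \<longleftrightarrow> (\<forall>es x. set es \<subseteq> Basis \<longrightarrow> iter_deriv es f differentiable (at x))"

definition test_fun :: "'a::euclidean_space set \<Rightarrow> ('a \<Rightarrow> real) \<Rightarrow> bool" where
  "test_fun U \<phi> \<longleftrightarrow> smooth_fun \<phi> \<and> compact (closure {x. \<phi> x \<noteq> 0}) \<and> closure {x. \<phi> x \<noteq> 0} \<subseteq> U"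

definition locally_integrable :: "'a::euclidean_space set \<Rightarrow> ('a \<Rightarrow> real) \<Rightarrow> bool" where
  "locally_integrable U u \<longleftrightarrow> (\<forall>C. compact C \<and> C \<subseteq> U \<longrightarrow> u absolutely_integrable_on C)"

text \<open>Multi-indices are written as lists of basis vectors, so their order is the length of
  the list. The derivative \<open>v\<close> is determined up to a null set.\<close>

definition weak_deriv ::
  "'a::euclidean_space set \<Rightarrow> 'a list \<Rightarrow> ('a \<Rightarrow> real) \<Rightarrow> ('a \<Rightarrow> real) \<Rightarrow> bool" where
  "weak_deriv U es u v \<longleftrightarrow> locally_integrable U u \<and> locally_integrable U v \<and>
     (\<forall>\<phi>. test_fun U \<phi> \<longrightarrow>
        (LINT x|lebesgue_on U. u x * iter_deriv es \<phi> x) =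
        (- 1) ^ length es * (LINT x|lebesgue_on U. v x * \<phi> x))"

text \<open>\<open>sobolev_inf U k\<close> is \<open>W\<^sup>k\<^sup>,\<^sup>\<infinity>(U)\<close>. The least bound \<open>C\<close> below is the maximum over
  all multi-indices of order at most \<open>k\<close> of the essential suprema of the weak derivatives.\<close>

definition sobolev_inf_bound ::
  "'a::euclidean_space set \<Rightarrow> nat \<Rightarrow> ('a \<Rightarrow> real) \<Rightarrow> real \<Rightarrow> bool" where
  "sobolev_inf_bound U k u C \<longleftrightarrow> 0 \<le> C \<and>
     (\<forall>es. set es \<subseteq> Basis \<and> length es \<le> k \<longrightarrow>
        (\<exists>v. weak_deriv U es u v \<and> (AE x in lebesgue_on U. \<bar>v x\<bar> \<le> C)))"

definition sobolev_inf :: "'a::euclidean_space set \<Rightarrow> nat \<Rightarrow> ('a \<Rightarrow> real) set" where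
  "sobolev_inf U k = {u. \<exists>C. sobolev_inf_bound U k u C}"

definition sobolev_inf_norm :: "'a::euclidean_space set \<Rightarrow> nat \<Rightarrow> ('a \<Rightarrow> real) \<Rightarrow> real" where
  "sobolev_inf_norm U k u = Inf {C. sobolev_inf_bound U k u C}"

definition L2_space :: "'a::euclidean_space set \<Rightarrow> ('a \<Rightarrow> real) set" where
  "L2_space U = {f \<in> borel_measurable (lebesgue_on U). integrable (lebesgue_on U) (\<lambda>x. (f x)\<^sup>2)}"

definition L2_norm :: "'a::euclidean_space set \<Rightarrow> ('a \<Rightarrow> real) \<Rightarrow> real" where
  "L2_norm U f = sqrt (LINT x|lebesgue_on U. (f x)\<^sup>2)"


section \<open>Bochner spaces over a bounded time interval\<close>

text \<open>The target is a space \<open>V\<close> of real functions with a seminorm \<open>N\<close>; functions at \<open>N\<close>-distance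
  zero stand for the same element of the normed space. These are the usual Bochner notions.
  The library's Bochner integral is not applicable because \<open>V\<close> is not a type of class
  \<open>banach\<close> and \<open>W\<^sup>4\<^sup>,\<^sup>\<infinity>\<close> is not separable.\<close>

definition simple_into ::
  "real set \<Rightarrow> ('x \<Rightarrow> real) set \<Rightarrow> (real \<Rightarrow> 'x \<Rightarrow> real) \<Rightarrow> bool" where
  "simple_into I V s \<longleftrightarrow> finite (s ` I) \<and> s ` I \<subseteq> V \<and> (\<forall>y. {t \<in> I. s t = y} \<in> sets lebesgue)"

definition simple_integral_into :: "real set \<Rightarrow> (real \<Rightarrow> 'x \<Rightarrow> real) \<Rightarrow> 'x \<Rightarrow> real" where
  "simple_integral_into I s = (\<lambda>x. \<Sum>y\<in>s ` I. measure lebesgue {t \<in> I. s t = y} * y x)"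

definition simple_approx ::
  "real set \<Rightarrow> ('x \<Rightarrow> real) set \<Rightarrow> (('x \<Rightarrow> real) \<Rightarrow> real) \<Rightarrow> (real \<Rightarrow> 'x \<Rightarrow> real) \<Rightarrow>
   (nat \<Rightarrow> real \<Rightarrow> 'x \<Rightarrow> real) \<Rightarrow> bool" where
  "simple_approx I V N u s \<longleftrightarrow>
     (\<forall>n. simple_into I V (s n)) \<and>
     (AE t in lebesgue_on I. u t \<in> V \<and> (\<lambda>n. N (\<lambda>x. u t x - s n t x)) \<longlonglongrightarrow> 0)"

definition Linf_time ::
  "real set \<Rightarrow> ('x \<Rightarrow> real) set \<Rightarrow> (('x \<Rightarrow> real) \<Rightarrow> real) \<Rightarrow> (real \<Rightarrow> 'x \<Rightarrow> real) \<Rightarrow> bool" where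
  "Linf_time I V N u \<longleftrightarrow>
     (\<exists>s. simple_approx I V N u s) \<and> (\<exists>C. AE t in lebesgue_on I. N (u t) \<le> C)"

definition has_bochner_integral_into ::
  "real set \<Rightarrow> ('x \<Rightarrow> real) set \<Rightarrow> (('x \<Rightarrow> real) \<Rightarrow> real) \<Rightarrow> (real \<Rightarrow> 'x \<Rightarrow> real) \<Rightarrow>
   ('x \<Rightarrow> real) \<Rightarrow> bool" where
  "has_bochner_integral_into I V N u J \<longleftrightarrow> J \<in> V \<and>
     (\<exists>s. simple_approx I V N u s \<and>
        (\<lambda>n. \<integral>\<^sup>+ t. ennreal (N (\<lambda>x. u t x - s n t x)) \<partial>lebesgue_on I) \<longlonglongrightarrow> 0 \<and>
        (\<lambda>n. N (\<lambda>x. J x - simple_integral_into I (s n) x)) \<longlonglongrightarrow> 0)"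

definition weak_time_deriv ::
  "real set \<Rightarrow> ('x \<Rightarrow> real) set \<Rightarrow> (('x \<Rightarrow> real) \<Rightarrow> real) \<Rightarrow> (real \<Rightarrow> 'x \<Rightarrow> real) \<Rightarrow>
   (real \<Rightarrow> 'x \<Rightarrow> real) \<Rightarrow> bool" where
  "weak_time_deriv I V N u v \<longleftrightarrow>
     (\<forall>\<phi>. test_fun I \<phi> \<longrightarrow>
        (\<exists>J. has_bochner_integral_into I V N (\<lambda>t x. deriv \<phi> t * u t x) J \<and>
             has_bochner_integral_into I V N (\<lambda>t x. \<phi> t * v t x) (\<lambda>x. - J x)))"

text \<open>\<open>sobolev_time k I V N\<close> is the predicate of membership in \<open>W\<^sup>k\<^sup>,\<^sup>\<infinity>(I; V)\<close>.\<close>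

primrec sobolev_time ::
  "nat \<Rightarrow> real set \<Rightarrow> ('x \<Rightarrow> real) set \<Rightarrow> (('x \<Rightarrow> real) \<Rightarrow> real) \<Rightarrow> (real \<Rightarrow> 'x \<Rightarrow> real) \<Rightarrow>
   bool" where
  "sobolev_time 0 I V N u \<longleftrightarrow> Linf_time I V N u"
| "sobolev_time (Suc k) I V N u \<longleftrightarrow>
     Linf_time I V N u \<and> (\<exists>v. weak_time_deriv I V N u v \<and> sobolev_time k I V N v)"


section \<open>The continuous problem\<close>

datatype phase = Wet | NonWet

definition chem_pot :: "(phase \<Rightarrow> real) \<Rightarrow> real \<Rightarrow> phase \<Rightarrow> real \<Rightarrow> real" where
  "chem_pot \<sigma> \<sigma>wn \<alpha> s = \<sigma> \<alpha> * ln s + \<sigma>wn * (1 - s)"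

definition outer_normal :: "real^'n \<Rightarrow> real^'n \<Rightarrow> real^'n \<Rightarrow> real^'n \<Rightarrow> bool" where
  "outer_normal a b x \<nu> \<longleftrightarrow>
     (\<exists>l. x $ l = a $ l \<and> \<nu> = - axis l 1 \<or> x $ l = b $ l \<and> \<nu> = axis l 1)"

definition weak_laplacian ::
  "'a::euclidean_space set \<Rightarrow> ('a \<Rightarrow> real) \<Rightarrow> ('a \<Rightarrow> real) \<Rightarrow> bool" where
  "weak_laplacian U u g \<longleftrightarrow>
     (\<exists>w. (\<forall>e\<in>Basis. weak_deriv U [e, e] u (w e)) \<and>
          (AE x in lebesgue_on U. g x = (\<Sum>e\<in>Basis. w e x)))"

text \<open>An element of \<open>W\<^sup>4\<^sup>,\<^sup>\<infinity>\<close> of the box is an almost-everywhere class whose continuous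
  representative is continuously differentiable up to the boundary; the boundary condition is about
  that representative.\<close>

definition no_flow :: "real^'n \<Rightarrow> real^'n \<Rightarrow> (real^'n \<Rightarrow> real) \<Rightarrow> bool" where
  "no_flow a b u \<longleftrightarrow>
     (\<exists>w. continuous_on (cbox a b) w \<and> (AE x in lebesgue_on (cbox a b). w x = u x) \<and>
          (\<forall>x\<in>cbox a b. \<forall>\<nu>. outer_normal a b x \<nu> \<longrightarrow>
             (\<exists>D. (w has_derivative D) (at x within cbox a b) \<and> D \<nu> = 0)))"

text \<open>The regularity of the saturations gives them a representative that is continuous in
  space and time. Bounds at every point, initial values and values at the time levels refer to it,
  so \<open>S\<close> is taken to be this representative.\<close>

definition exact_solution ::
  "(phase \<Rightarrow> real) \<Rightarrow> real \<Rightarrow> real^'n \<Rightarrow> real^'n \<Rightarrow> real \<Rightarrow>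
   (phase \<Rightarrow> real \<Rightarrow> real^'n \<Rightarrow> real) \<Rightarrow> (real \<Rightarrow> real^'n \<Rightarrow> real) \<Rightarrow> bool" where
  "exact_solution \<sigma> \<sigma>wn a b T S p \<longleftrightarrow>
     Linf_time {0<..<T} (sobolev_inf (box a b) 4) (sobolev_inf_norm (box a b) 4) p \<and>
     (\<forall>t\<in>{0..T}. \<forall>x\<in>cbox a b. S Wet t x + S NonWet t x = 1) \<and>
     (\<forall>\<alpha>.
        sobolev_time 2 {0<..<T} (L2_space (box a b)) (L2_norm (box a b)) (S \<alpha>) \<and>
        Linf_time {0<..<T} (sobolev_inf (box a b) 4) (sobolev_inf_norm (box a b) 4) (S \<alpha>) \<and>
        continuous_on ({0..T} \<times> cbox a b) (\<lambda>(t, x). S \<alpha> t x) \<and>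
        (\<forall>t\<in>{0..T}. \<forall>x\<in>cbox a b. 0 < S \<alpha> t x \<and> S \<alpha> t x < 1) \<and>
        (\<exists>v. weak_time_deriv {0<..<T} (L2_space (box a b)) (L2_norm (box a b)) (S \<alpha>) v \<and>
             (AE t in lebesgue_on {0<..<T}.
                weak_laplacian (box a b) (\<lambda>x. p t x + chem_pot \<sigma> \<sigma>wn \<alpha> (S \<alpha> t x)) (v t))) \<and>
        (AE t in lebesgue_on {0<..<T}.
           no_flow a b (\<lambda>x. p t x + chem_pot \<sigma> \<sigma>wn \<alpha> (S \<alpha> t x))))"


section \<open>Grid functions\<close>

text \<open>Cells are numbered by multi-indices with \<open>0 \<le> i l < N l = 2 * K l + 1\<close>. A grid function is
  represented by a function on all multi-indices that vanishes off the grid.\<close>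

definition cells :: "('n \<Rightarrow> nat) \<Rightarrow> ('n \<Rightarrow> nat) set" where
  "cells K = {i. \<forall>l. i l < 2 * K l + 1}"

definition cell_center :: "real^'n \<Rightarrow> real \<Rightarrow> ('n \<Rightarrow> nat) \<Rightarrow> real^'n" where
  "cell_center a h i = (\<chi> l. a $ l + (real (i l) + 1 / 2) * h)"

definition grid_fun :: "('n \<Rightarrow> nat) \<Rightarrow> (('n \<Rightarrow> nat) \<Rightarrow> real) set" where
  "grid_fun K = {c. \<forall>i. i \<notin> cells K \<longrightarrow> c i = 0}"

definition grid_fun0 :: "('n \<Rightarrow> nat) \<Rightarrow> (('n \<Rightarrow> nat) \<Rightarrow> real) set" where
  "grid_fun0 K = {c \<in> grid_fun K. (\<Sum>i\<in>cells K. c i) = 0}"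

definition at_centers ::
  "('n \<Rightarrow> nat) \<Rightarrow> real^'n \<Rightarrow> real \<Rightarrow> (real^'n \<Rightarrow> real) \<Rightarrow> ('n \<Rightarrow> nat) \<Rightarrow> real" where
  "at_centers K a h f = (\<lambda>i. if i \<in> cells K then f (cell_center a h i) else 0)"

definition grid_inner ::
  "('n::finite \<Rightarrow> nat) \<Rightarrow> real \<Rightarrow> (('n \<Rightarrow> nat) \<Rightarrow> real) \<Rightarrow> (('n \<Rightarrow> nat) \<Rightarrow> real) \<Rightarrow> real" where
  "grid_inner K h c c' = h ^ CARD('n) * (\<Sum>i\<in>cells K. c i * c' i)"

definition grid_norm :: "('n::finite \<Rightarrow> nat) \<Rightarrow> real \<Rightarrow> (('n \<Rightarrow> nat) \<Rightarrow> real) \<Rightarrow> real" where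
  "grid_norm K h c = sqrt (grid_inner K h c c)"

definition share_face :: "('n \<Rightarrow> nat) \<Rightarrow> ('n \<Rightarrow> nat) \<Rightarrow> bool" where
  "share_face P Q \<longleftrightarrow>
     (\<exists>l. (Q l = P l + 1 \<or> P l = Q l + 1) \<and> (\<forall>m. m \<noteq> l \<longrightarrow> Q m = P m))"

definition grid_laplacian ::
  "('n \<Rightarrow> nat) \<Rightarrow> real \<Rightarrow> (('n \<Rightarrow> nat) \<Rightarrow> real) \<Rightarrow> ('n \<Rightarrow> nat) \<Rightarrow> real" where
  "grid_laplacian K h c P = (\<Sum>Q\<in>{Q \<in> cells K. share_face P Q}. c Q - c P) / h\<^sup>2"

definition inv_neg_laplacian ::
  "('n \<Rightarrow> nat) \<Rightarrow> real \<Rightarrow> (('n \<Rightarrow> nat) \<Rightarrow> real) \<Rightarrow> ('n \<Rightarrow> nat) \<Rightarrow> real" where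
  "inv_neg_laplacian K h \<phi> =
     (THE \<psi>. \<psi> \<in> grid_fun0 K \<and> (\<forall>i\<in>cells K. - grid_laplacian K h \<psi> i = \<phi> i))"

definition grid_neg_norm :: "('n::finite \<Rightarrow> nat) \<Rightarrow> real \<Rightarrow> (('n \<Rightarrow> nat) \<Rightarrow> real) \<Rightarrow> real" where
  "grid_neg_norm K h \<phi> = sqrt (grid_inner K h \<phi> (inv_neg_laplacian K h \<phi>))"


section \<open>Fourier cosine projection\<close>

definition cos_basis ::
  "real^'n \<Rightarrow> real^'n \<Rightarrow> ('n::finite \<Rightarrow> nat) \<Rightarrow> real^'n \<Rightarrow> real" where
  "cos_basis a b k x = (\<Prod>l\<in>UNIV. cos (real (k l) * pi * (x $ l - a $ l) / (b $ l - a $ l)))"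

definition cos_polys ::
  "real^'n \<Rightarrow> real^'n \<Rightarrow> ('n::finite \<Rightarrow> nat) \<Rightarrow> (real^'n \<Rightarrow> real) set" where
  "cos_polys a b K =
     {g. \<exists>c. g = (\<lambda>x. \<Sum>k\<in>{k. \<forall>l. k l \<le> K l}. c k * cos_basis a b k x)}"

definition cos_proj ::
  "real^'n \<Rightarrow> real^'n \<Rightarrow> ('n::finite \<Rightarrow> nat) \<Rightarrow> (real^'n \<Rightarrow> real) \<Rightarrow> real^'n \<Rightarrow> real" where
  "cos_proj a b K f =
     (THE g. g \<in> cos_polys a b K \<and>
        (\<forall>q\<in>cos_polys a b K. (LINT x|lebesgue_on (cbox a b). (f x - g x) * q x) = 0))"


section \<open>The first-order scheme\<close>

text \<open>In \<open>scheme_step\<close> the arguments \<open>s\<close> and \<open>s'\<close> are the saturations at the old and the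
  new time level. Each potential is implicit in its own saturation and explicit in the other.\<close>

definition scheme_pot ::
  "(phase \<Rightarrow> real) \<Rightarrow> real \<Rightarrow> (phase \<Rightarrow> ('n \<Rightarrow> nat) \<Rightarrow> real) \<Rightarrow>
   (phase \<Rightarrow> ('n \<Rightarrow> nat) \<Rightarrow> real) \<Rightarrow> phase \<Rightarrow> ('n \<Rightarrow> nat) \<Rightarrow> real" where
  "scheme_pot \<sigma> \<sigma>wn s s' \<alpha> i = \<sigma> \<alpha> * ln (s' \<alpha> i) +
     \<sigma>wn * s (case \<alpha> of Wet \<Rightarrow> NonWet | NonWet \<Rightarrow> Wet) i"

definition scheme_step ::
  "(phase \<Rightarrow> real) \<Rightarrow> real \<Rightarrow> ('n \<Rightarrow> nat) \<Rightarrow> real \<Rightarrow> real \<Rightarrow>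
   (phase \<Rightarrow> ('n \<Rightarrow> nat) \<Rightarrow> real) \<Rightarrow> (phase \<Rightarrow> ('n \<Rightarrow> nat) \<Rightarrow> real) \<Rightarrow> bool" where
  "scheme_step \<sigma> \<sigma>wn K h \<Delta>t s s' \<longleftrightarrow>
     (\<forall>\<alpha>. s' \<alpha> \<in> grid_fun K) \<and>
     (\<forall>i\<in>cells K. 0 < s' Wet i \<and> s' Wet i < 1 \<and> s' NonWet i = 1 - s' Wet i) \<and>
     (\<lambda>i. s' Wet i - s Wet i) \<in> grid_fun0 K \<and>
     (\<exists>\<kappa>. \<forall>i\<in>cells K.
        scheme_pot \<sigma> \<sigma>wn s s' Wet i - scheme_pot \<sigma> \<sigma>wn s s' NonWet i +
        2 / \<Delta>t * inv_neg_laplacian K h (\<lambda>j. s' Wet j - s Wet j) i = \<kappa>)"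

text \<open>The run of the scheme up to time \<open>T\<close> from the projected initial data; \<open>Sh \<alpha> k\<close> is the
  saturation of phase \<open>\<alpha>\<close> at time level \<open>k\<close>.\<close>

definition numerical_solution ::
  "(phase \<Rightarrow> real) \<Rightarrow> real \<Rightarrow> real^'n \<Rightarrow> real^'n \<Rightarrow> real \<Rightarrow>
   (phase \<Rightarrow> real \<Rightarrow> real^'n \<Rightarrow> real) \<Rightarrow> ('n::finite \<Rightarrow> nat) \<Rightarrow> real \<Rightarrow> real \<Rightarrow>
   (phase \<Rightarrow> nat \<Rightarrow> ('n \<Rightarrow> nat) \<Rightarrow> real) \<Rightarrow> bool" where
  "numerical_solution \<sigma> \<sigma>wn a b T S K h \<Delta>t Sh \<longleftrightarrow>
     (\<forall>\<alpha>. Sh \<alpha> 0 = at_centers K a h (cos_proj a b K (S \<alpha> 0))) \<and>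
     (\<forall>k. real (Suc k) * \<Delta>t \<le> T \<longrightarrow>
        scheme_step \<sigma> \<sigma>wn K h \<Delta>t (\<lambda>\<alpha>. Sh \<alpha> k) (\<lambda>\<alpha>. Sh \<alpha> (Suc k)))"

definition scheme_error ::
  "real^'n \<Rightarrow> real^'n \<Rightarrow> (phase \<Rightarrow> real \<Rightarrow> real^'n \<Rightarrow> real) \<Rightarrow> ('n::finite \<Rightarrow> nat) \<Rightarrow>
   real \<Rightarrow> real \<Rightarrow> (phase \<Rightarrow> nat \<Rightarrow> ('n \<Rightarrow> nat) \<Rightarrow> real) \<Rightarrow> phase \<Rightarrow> nat \<Rightarrow> ('n \<Rightarrow> nat) \<Rightarrow> real"
  where
  "scheme_error a b S K h \<Delta>t Sh \<alpha> k =
     (\<lambda>i. at_centers K a h (cos_proj a b K (S \<alpha> (real k * \<Delta>t))) i - Sh \<alpha> k i)"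

end

theory Submission
  imports Defs "HOL-Computational_Algebra.Polynomial"
begin

text \<open>Subtracting the two equations eliminates the pressure: \<open>w = S Wet\<close> satisfies
  \<open>2 w\<^sub>t = \<Delta> F(w)\<close>, where \<open>F\<close> is the difference of the chemical potentials. Because \<open>F\<close> increases
  at least linearly, the no-flow condition passes from \<open>F(w)\<close> to \<open>w\<close>, so that the even reflections of
  \<open>w\<close> and \<open>F(w)\<close> have bounded second differences. Tested against cosines this yields ordinary
  differential equations for the cosine coefficients and the decay of \<open>\<lambda>\<^sub>k\<close> times the coefficients in
  square mean.

  On cosine polynomials of degree at most \<open>K\<close> the grid cosines are orthogonal eigenvectors of the
  discrete Laplacian, with eigenvalues \<open>\<lambda>\<^sub>k\<close> up to a relative error \<open>O(h\<^sup>2 \<lambda>\<^sub>k)\<close>. So the projected solution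
  solves the scheme up to a residual that is \<open>O(\<Delta>t + h\<^sup>2)\<close> in the grid norm. Only the pairing of the
  time difference with a fixed grid function is needed, so the mean value theorem replaces a bound on
  the second time derivative. Testing the error equation with \<open>(-\<Delta>\<^sub>h)\<^sup>-\<^sup>1 e\<close>, the implicit logarithms give
  \<open>(\<surd>\<sigma>\<^sub>w + \<surd>\<sigma>\<^sub>n)\<^sup>2\<close> times the square norm of the new error, which absorbs the explicit term
  \<open>2 \<sigma>\<^sub>w\<^sub>n\<close> because \<open>\<gamma>\<^sub>0 > 0\<close>; the inequalities telescope without Gronwall.\<close>

section \<open>Smooth functions on the line and mollifiers\<close>

text \<open>Weak derivatives only see test functions that vanish near the boundary, whereas cosines
  do not vanish there. The solution is therefore never differentiated: regularity and no-flow
  condition are encoded together as inequalities for second differences and for the departure from a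
  face (\<open>neumann_class\<close>). These survive limits in time and composition with F, and they
  let a cut-off of the cosine cost only its L1 distance instead of its second derivatives. A second
  obstacle is that the projection error is controlled in L2 over the box but needed at the cell
  centres. Point values are recovered by symmetrised sampling: for some offset y, common to all
  cells, the error is small in mean square over the points that differ from a centre by y up to
  signs, and averaging over the signs costs only O(h^2). Finally, the logarithms need the projected
  saturation to stay inside (0,1) at the centres. One cell carries weight h^d in the squared grid
  norm, so a squared error O(h^4) leaves O(h^(4-d)) at each point, which is small because d \<le>
  3.\<close>

definition smooth_real :: "(real \<Rightarrow> real) \<Rightarrow> bool" where
  "smooth_real f \<longleftrightarrow> (\<forall>n x. (deriv ^^ n) f field_differentiable at x)"

text \<open>Iterated derivatives never leave the class X, so no formula for the n-th derivative is
  required; each use only has to name a class closed under differentiation.\<close>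

lemma smooth_real_coinduct:
  assumes "X f" and step: "\<And>f. X f \<Longrightarrow> \<exists>g. X g \<and> (\<forall>x. (f has_real_derivative g x) (at x))"
  shows "smooth_real f"
proof -
  have *: "X ((deriv ^^ n) f)" for n
  proof (induction n)
    case (Suc n)
    then obtain g where g: "X g" "\<And>x. ((deriv ^^ n) f has_real_derivative g x) (at x)"
      using step by blast
    then have "deriv ((deriv ^^ n) f) = g"
      by (auto intro!: DERIV_imp_deriv)
    then show ?case using g by simp
  qed (use assms in auto)
  show ?thesis
    unfolding smooth_real_def
  proof (intro allI)
    fix n x
    obtain g where "\<And>x. ((deriv ^^ n) f has_real_derivative g x) (at x)"
      using step[OF *[of n]] by blast
    then show "(deriv ^^ n) f field_differentiable at x"
      by (auto simp: field_differentiable_def)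
  qed
qed

lemma smooth_real_deriv: "smooth_real f \<Longrightarrow> smooth_real (deriv f)"
  unfolding smooth_real_def by (metis funpow_Suc_right o_apply)

lemma smooth_real_has_deriv: "smooth_real f \<Longrightarrow> (f has_real_derivative deriv f x) (at x)"
  unfolding smooth_real_def by (metis DERIV_deriv_iff_field_differentiable funpow_0)

lemma smooth_real_funpow: "smooth_real f \<Longrightarrow> smooth_real ((deriv ^^ n) f)"
  by (induction n) (auto intro: smooth_real_deriv)

lemma smooth_real_antideriv:
  assumes "smooth_real g" "\<And>x. (f has_real_derivative g x) (at x)"
  shows "smooth_real f"
proof (rule smooth_real_coinduct[of "\<lambda>h. h = f \<or> smooth_real h"])
  fix h assume "h = f \<or> smooth_real h"
  then show "\<exists>g. (g = f \<or> smooth_real g) \<and> (\<forall>x. (h has_real_derivative g x) (at x))"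
    using assms smooth_real_deriv smooth_real_has_deriv by blast
qed simp

text \<open>Sums of products of smooth functions are closed under differentiation by Leibniz' rule;
  this is the coinduction class for \<open>smooth_real_mult\<close>, in place of binomial
  coefficients.\<close>

inductive smooth_prods :: "(real \<Rightarrow> real) \<Rightarrow> bool" where
  prod: "smooth_real f \<Longrightarrow> smooth_real g \<Longrightarrow> smooth_prods (\<lambda>x. f x * g x)"
| add: "smooth_prods f \<Longrightarrow> smooth_prods g \<Longrightarrow> smooth_prods (\<lambda>x. f x + g x)"

lemma smooth_real_mult:
  assumes "smooth_real f" "smooth_real g"
  shows "smooth_real (\<lambda>x. f x * g x)"
proof (rule smooth_real_coinduct[of smooth_prods])
  show "smooth_prods (\<lambda>x. f x * g x)"
    using assms by (rule smooth_prods.prod)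
  fix f assume "smooth_prods f"
  then show "\<exists>g. smooth_prods g \<and> (\<forall>x. (f has_real_derivative g x) (at x))"
  proof induction
    case (prod f g)
    have "smooth_prods (\<lambda>x. deriv f x * g x + f x * deriv g x)"
      using prod smooth_real_deriv by (intro smooth_prods.intros) auto
    moreover have "((\<lambda>x. f x * g x) has_real_derivative deriv f x * g x + f x * deriv g x) (at x)" for x
      using smooth_real_has_deriv[OF prod(1)] smooth_real_has_deriv[OF prod(2)]
      by (auto intro!: derivative_eq_intros)
    ultimately show ?case by blast
  next
    case (add f g)
    then obtain f' g' where "smooth_prods f'" "smooth_prods g'"
      "\<And>x. (f has_real_derivative f' x) (at x)" "\<And>x. (g has_real_derivative g' x) (at x)"
      by blast
    then show ?case
      by (intro exI[of _ "\<lambda>x. f' x + g' x"]) (auto intro!: derivative_eq_intros smooth_prods.intros)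
  qed
qed

lemma smooth_real_const: "smooth_real (\<lambda>x. c)"
  by (rule smooth_real_coinduct[of "\<lambda>f. \<exists>c. f = (\<lambda>x. c)"]) (auto intro!: exI[of _ "\<lambda>x. 0"])

lemma smooth_real_affine:
  assumes "smooth_real f"
  shows "smooth_real (\<lambda>x. f (m * x + c))"
\<comment> \<open>The factor \<open>d\<close> collects the powers of \<open>m\<close> that the chain
  rule produces.\<close>
proof (rule smooth_real_coinduct[of "\<lambda>h. \<exists>g d. smooth_real g \<and> h = (\<lambda>x. d * g (m * x + c))"])
  show "\<exists>g d. smooth_real g \<and> (\<lambda>x. f (m * x + c)) = (\<lambda>x. d * g (m * x + c))"
    using assms by (intro exI[of _ f] exI[of _ 1]) auto
  fix h assume "\<exists>g d. smooth_real g \<and> h = (\<lambda>x. d * g (m * x + c))"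
  then obtain g d where g: "smooth_real g" "h = (\<lambda>x. d * g (m * x + c))"
    by blast
  have "((\<lambda>x. g (m * x + c)) has_real_derivative deriv g (m * x + c) * m) (at x)" for x
    by (rule DERIV_chain2[OF smooth_real_has_deriv[OF g(1)]]) (auto intro!: derivative_eq_intros)
  then have "(h has_real_derivative (d * m) * deriv g (m * x + c)) (at x)" for x
    unfolding g(2) by (auto intro!: derivative_eq_intros)
  then show "\<exists>h'. (\<exists>g d. smooth_real g \<and> h' = (\<lambda>x. d * g (m * x + c))) \<and>
      (\<forall>x. (h has_real_derivative h' x) (at x))"
    using smooth_real_deriv[OF g(1)] by blast
qed

lemma smooth_real_cos: "smooth_real cos"
proof (rule smooth_real_coinduct[of "\<lambda>f. \<exists>c d. f = (\<lambda>x. c * cos x + d * sin x)"])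
  show "\<exists>c d. cos = (\<lambda>x::real. c * cos x + d * sin x)"
    by (intro exI[of _ 1] exI[of _ 0]) auto
  fix f :: "real \<Rightarrow> real" assume "\<exists>c d. f = (\<lambda>x. c * cos x + d * sin x)"
  then obtain c d where "f = (\<lambda>x. c * cos x + d * sin x)" by blast
  then have "(f has_real_derivative (d * cos x + (- c) * sin x)) (at x)" for x
    by (auto intro!: derivative_eq_intros)
  then show "\<exists>g. (\<exists>c d. g = (\<lambda>x. c * cos x + d * sin x)) \<and> (\<forall>x. (f has_real_derivative g x) (at x))"
    by blast
qed

section \<open>A smooth bump and a smooth step function\<close>

definition exp_inv_poly :: "real poly \<Rightarrow> real \<Rightarrow> real" where
  "exp_inv_poly p x = (if x \<le> 0 then 0 else poly p (1 / x) * exp (- (1 / x)))"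

lemma poly_exp_neg_tendsto: "((\<lambda>y. poly p y * exp (- y)) \<longlongrightarrow> 0) (at_top :: real filter)"
proof -
  have pw: "((\<lambda>y. y ^ k * exp (- y)) \<longlongrightarrow> 0) (at_top :: real filter)" for k
    using tendsto_power_div_exp_0[of k] by (simp add: exp_minus field_simps)
  have "((\<lambda>y. \<Sum>i\<le>degree p. coeff p i * (y ^ i * exp (- y))) \<longlongrightarrow>
      (\<Sum>i\<le>degree p. coeff p i * 0)) (at_top :: real filter)"
    by (intro tendsto_sum tendsto_mult tendsto_const pw)
  then show ?thesis
    by (simp only: poly_altdef sum_distrib_right mult.assoc mult_zero_right sum.neutral_const)
qed

text \<open>With y = 1/x the chain rule turns p(y) exp(-y) into (p(y) - p'(y)) y^2 exp(-y), so
  carrying a polynomial along makes this family of flat functions closed under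
  differentiation.\<close>

lemma exp_inv_poly_deriv:
  "(exp_inv_poly p has_real_derivative exp_inv_poly ((p - pderiv p) * [:0, 0, 1:]) x) (at x)"
proof (cases x "0::real" rule: linorder_cases)
  case less
  have "((\<lambda>x. 0) has_real_derivative 0) (at x)" by simp
  then have "(exp_inv_poly p has_real_derivative 0) (at x)"
    by (rule has_field_derivative_transform_within_open[of _ _ _ "{..<0}"])
       (use less in \<open>auto simp: exp_inv_poly_def\<close>)
  then show ?thesis using less by (simp add: exp_inv_poly_def)
next
  case greater
  have "((\<lambda>x. poly p (1 / x) * exp (- (1 / x))) has_real_derivative
     exp_inv_poly ((p - pderiv p) * [:0, 0, 1:]) x) (at x)"
    using greater unfolding exp_inv_poly_def
    by (auto intro!: derivative_eq_intros DERIV_chain2[OF poly_DERIV] simp: field_simps power2_eq_square)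
  then show ?thesis
    by (rule has_field_derivative_transform_within_open[of _ _ _ "{0<..}"])
       (use greater in \<open>auto simp: exp_inv_poly_def\<close>)
next
  case equal
  \<comment> \<open>For h > 0 the difference quotient at 0 is y p(y) exp(-y) with y = 1/h, hence the
    polynomial \<open>p * [:0, 1:]\<close>.\<close>
  have lim: "((\<lambda>h. poly (p * [:0, 1:]) (inverse h) * exp (- inverse h)) \<longlongrightarrow> 0) (at_right (0::real))"
    by (rule filterlim_compose[OF poly_exp_neg_tendsto filterlim_inverse_at_top_right])
  have right: "((\<lambda>h. (exp_inv_poly p (0 + h) - exp_inv_poly p 0) / h) \<longlongrightarrow> 0) (at_right 0)"
    by (rule Lim_transform_eventually[OF lim])
       (auto simp: eventually_at_filter exp_inv_poly_def field_simps)
  have left: "((\<lambda>h. (exp_inv_poly p (0 + h) - exp_inv_poly p 0) / h) \<longlongrightarrow> 0) (at_left 0)"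
    by (rule tendsto_eventually) (auto simp: eventually_at_filter exp_inv_poly_def)
  have "((\<lambda>h. (exp_inv_poly p (0 + h) - exp_inv_poly p 0) / h) \<longlongrightarrow> 0) (at 0)"
    using left right by (simp add: filterlim_split_at)
  then have "(exp_inv_poly p has_real_derivative 0) (at 0)"
    by (simp add: DERIV_def)
  then show ?thesis using equal by (simp add: exp_inv_poly_def)
qed

lemma smooth_real_exp_inv_poly: "smooth_real (exp_inv_poly p)"
  by (rule smooth_real_coinduct[of "\<lambda>f. \<exists>p. f = exp_inv_poly p"]) (use exp_inv_poly_deriv in blast)+

lemma smooth_bump_exists:
  "\<exists>\<rho>. smooth_real \<rho> \<and> (\<forall>x. 0 \<le> \<rho> x) \<and> (\<forall>x. \<bar>x\<bar> \<ge> 1 \<longrightarrow> \<rho> x = 0) \<and> (\<forall>x. \<bar>x\<bar> < 1 \<longrightarrow> 0 < \<rho> x)"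
proof (intro exI conjI)
  let ?\<rho> = "\<lambda>x. exp_inv_poly 1 (1 * x + 1) * exp_inv_poly 1 ((-1) * x + 1)"
  show "smooth_real ?\<rho>"
    by (intro smooth_real_mult smooth_real_affine smooth_real_exp_inv_poly)
qed (auto simp: exp_inv_poly_def)

lemma antideriv_left_zero:
  fixes \<rho> :: "real \<Rightarrow> real"
  assumes cont: "\<And>x. isCont \<rho> x" and zero: "\<And>x. x \<le> c \<Longrightarrow> \<rho> x = 0"
  shows "\<exists>G. (\<forall>x. (G has_real_derivative \<rho> x) (at x)) \<and> (\<forall>x\<le>c. G x = 0)"
proof -
  \<comment> \<open>The base point lies strictly left of \<open>c\<close>, so that every u \<ge> c
    is an interior point of the interval up to u + 1 and the fundamental theorem gives a two-sided
    derivative.\<close>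
  define G where "G u = integral {c - 1..u} \<rho>" for u
  have G_left: "G u = 0" if "u \<le> c" for u
  proof -
    have "integral {c - 1..u} \<rho> = integral {c - 1..u} (\<lambda>_. 0)"
      by (rule integral_cong) (use that zero in auto)
    then show ?thesis by (simp add: G_def)
  qed
  have dG: "(G has_real_derivative \<rho> u) (at u)" for u
  proof (cases "u < c")
    case True
    have "((\<lambda>_. 0) has_real_derivative 0) (at u)" by simp
    then have "(G has_real_derivative 0) (at u)"
      by (rule has_field_derivative_transform_within_open[of _ _ _ "{..<c}"])
         (use True G_left in auto)
    then show ?thesis using True zero by simp
  next
    case False
    have "(G has_vector_derivative \<rho> u) (at u within {c - 1..u + 1})"
      unfolding G_def using cont False
      by (intro integral_has_vector_derivative continuous_at_imp_continuous_on) auto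
    then show ?thesis
      using False at_within_Icc_at[of "c - 1" u "u + 1"]
      by (auto simp: has_real_derivative_iff_has_vector_derivative)
  qed
  show ?thesis using dG G_left by blast
qed

text \<open>The normalised antiderivative of a bump that lives on [-1, 1]; positivity of the bump
  inside makes the normalising value \<open>G 1\<close> nonzero.\<close>

lemma smooth_step_exists:
  "\<exists>B. smooth_real B \<and> (\<forall>x\<le>-1. B x = 0) \<and> (\<forall>x\<ge>1. B x = 1) \<and> mono B \<and>
     (\<forall>x. \<bar>x\<bar> < 1 \<longrightarrow> 0 < deriv B x)"
proof -
  obtain \<rho> where \<rho>: "smooth_real \<rho>" "\<And>x. 0 \<le> \<rho> x" "\<And>x. \<bar>x\<bar> \<ge> 1 \<Longrightarrow> \<rho> x = 0"
    "\<And>x. \<bar>x\<bar> < 1 \<Longrightarrow> 0 < \<rho> x"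
    using smooth_bump_exists by metis
  have cont: "isCont \<rho> x" for x
    using smooth_real_has_deriv[OF \<rho>(1)] DERIV_isCont by blast
  have "\<exists>G. (\<forall>x. (G has_real_derivative \<rho> x) (at x)) \<and> (\<forall>x\<le>-1. G x = 0)"
    by (rule antideriv_left_zero) (use cont \<rho>(3) in auto)
  then obtain G where dG: "\<And>x. (G has_real_derivative \<rho> x) (at x)"
    and G_left: "\<And>x. x \<le> -1 \<Longrightarrow> G x = 0"
    by metis
  have contG: "continuous_on A G" for A
    by (intro continuous_at_imp_continuous_on ballI DERIV_isCont[OF dG])
  have mono: "mono G"
  proof (rule monoI)
    fix x y :: real assume "x \<le> y"
    then show "G x \<le> G y"
      by (rule DERIV_nonneg_imp_nondecreasing) (metis dG \<rho>(2))
  qed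
  have G_right: "G u = G 1" if "1 \<le> u" for u
  proof (cases "u = 1")
    case False
    then have "1 < u" using that by simp
    then show ?thesis
    proof (rule DERIV_isconst_end)
      fix x :: real assume "1 < x" "x < u"
      then show "(G has_real_derivative 0) (at x)"
        using dG[of x] \<rho>(3)[of x] by simp
    qed (rule contG)
  qed auto
  have "G (-1) < G 1"
  proof (rule DERIV_pos_imp_increasing_open[where f = G])
    fix x :: real assume "-1 < x" "x < 1"
    then have "0 < \<rho> x" by (intro \<rho>(4)) auto
    then show "\<exists>y. (G has_real_derivative y) (at x) \<and> 0 < y"
      using dG by blast
  qed (auto intro: contG)
  then have pos: "0 < G 1" using G_left by simp
  have smooth: "smooth_real G"
    using smooth_real_antideriv \<rho>(1) dG by blast
  have dB: "((\<lambda>x. G x * (1 / G 1)) has_real_derivative \<rho> x * (1 / G 1)) (at x)" for x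
    using dG by (intro DERIV_cmult_right)
  show ?thesis
  proof (intro exI conjI)
    show "smooth_real (\<lambda>x. G x * (1 / G 1))"
      by (intro smooth_real_mult smooth smooth_real_const)
    show "mono (\<lambda>x. G x * (1 / G 1))"
      using mono pos by (auto simp: mono_def divide_right_mono)
    show "\<forall>x. \<bar>x\<bar> < 1 \<longrightarrow> 0 < deriv (\<lambda>x. G x * (1 / G 1)) x"
      using \<rho>(4) pos by (subst DERIV_imp_deriv[OF dB]) auto
    show "\<forall>x\<le>-1. G x * (1 / G 1) = 0"
      using G_left by simp
    show "\<forall>x\<ge>1. G x * (1 / G 1) = 1"
    proof (intro allI impI)
      fix x :: real assume "1 \<le> x"
      from G_right[OF this] show "G x * (1 / G 1) = 1" using pos by simp
    qed
  qed
qed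

lemma smooth_real_isCont: "smooth_real f \<Longrightarrow> isCont f x"
  using smooth_real_has_deriv DERIV_isCont by blast

lemma smooth_real_continuous_on: "smooth_real f \<Longrightarrow> continuous_on A f"
  by (simp add: smooth_real_isCont continuous_at_imp_continuous_on)

lemma smooth_real_add:
  assumes "smooth_real f" "smooth_real g" shows "smooth_real (\<lambda>x. f x + g x)"
proof -
  have "((\<lambda>x. f x + g x) has_real_derivative deriv f x + deriv g x) (at x)" for x
    using assms smooth_real_has_deriv by (intro DERIV_add) auto
  moreover have "(deriv ^^ n) (\<lambda>x. f x + g x) = (\<lambda>x. (deriv ^^ n) f x + (deriv ^^ n) g x)" for n
  proof (induction n)
    case (Suc n)
    have "((\<lambda>x. (deriv ^^ n) f x + (deriv ^^ n) g x) has_real_derivative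
        deriv ((deriv ^^ n) f) x + deriv ((deriv ^^ n) g) x) (at x)" for x
      using assms smooth_real_funpow smooth_real_has_deriv by (intro DERIV_add) auto
    then have "deriv (\<lambda>x. (deriv ^^ n) f x + (deriv ^^ n) g x) =
        (\<lambda>x. deriv ((deriv ^^ n) f) x + deriv ((deriv ^^ n) g) x)"
      by (auto intro!: DERIV_imp_deriv)
    then show ?case using Suc by simp
  qed simp
  ultimately show ?thesis
    using assms unfolding smooth_real_def by (auto intro: field_differentiable_add)
qed

lemma smooth_real_cmult: "smooth_real f \<Longrightarrow> smooth_real (\<lambda>x. c * f x)"
  by (intro smooth_real_mult smooth_real_const)

section \<open>Test functions of product form\<close>

lemma has_derivative_prod_components:
  fixes f :: "'n::finite \<Rightarrow> real \<Rightarrow> real" and x :: "real^'n"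
  assumes "\<And>l. smooth_real (f l)"
  shows "((\<lambda>x. \<Prod>l\<in>UNIV. f l (x $ l)) has_derivative
    (\<lambda>y. \<Sum>l\<in>UNIV. (deriv (f l) (x $ l) * y $ l) * (\<Prod>j\<in>UNIV - {l}. f j (x $ j)))) (at x)"
proof (rule has_derivative_prod)
  fix l :: 'n
  have "(f l has_derivative (\<lambda>h. deriv (f l) (x $ l) * h)) (at (x $ l))"
    using smooth_real_has_deriv[OF assms] by (simp add: has_field_derivative_def)
  moreover have "((\<lambda>x::real^'n. x $ l) has_derivative (\<lambda>y. y $ l)) (at x)"
    by (rule bounded_linear_imp_has_derivative) (rule bounded_linear_vec_nth)
  ultimately show "((\<lambda>x. f l (x $ l)) has_derivative (\<lambda>y. deriv (f l) (x $ l) * y $ l)) (at x)"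
    using has_derivative_compose[where g = "f l"] by blast
qed

lemma frechet_derivative_prod_components:
  fixes f :: "'n::finite \<Rightarrow> real \<Rightarrow> real" and x :: "real^'n"
  assumes "\<And>l. smooth_real (f l)"
  shows "frechet_derivative (\<lambda>x. \<Prod>l\<in>UNIV. f l (x $ l)) (at x) (axis m 1) =
    (\<Prod>l\<in>UNIV. (if l = m then deriv (f l) else f l) (x $ l))"
proof -
  have "frechet_derivative (\<lambda>x. \<Prod>l\<in>UNIV. f l (x $ l)) (at x) =
    (\<lambda>y. \<Sum>l\<in>UNIV. (deriv (f l) (x $ l) * y $ l) * (\<Prod>j\<in>UNIV - {l}. f j (x $ j)))"
    by (rule frechet_derivative_at[symmetric]) (rule has_derivative_prod_components[OF assms])
  then have "frechet_derivative (\<lambda>x. \<Prod>l\<in>UNIV. f l (x $ l)) (at x) (axis m 1) =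
     (\<Sum>l\<in>UNIV. if l = m then deriv (f m) (x $ m) * (\<Prod>j\<in>UNIV - {m}. f j (x $ j)) else 0)"
    by (simp only:) (rule sum.cong, auto simp: axis_def)
  also have "\<dots> = deriv (f m) (x $ m) * (\<Prod>j\<in>UNIV - {m}. f j (x $ j))"
    by simp
  also have "\<dots> = (\<Prod>l\<in>UNIV. (if l = m then deriv (f l) else f l) (x $ l))"
    by (subst prod.remove[of UNIV m]) (auto intro!: prod.cong)
  finally show ?thesis .
qed

text \<open>All test functions in space are taken as products of one-variable functions;
  differentiation then acts factor by factor and only the number of occurrences of each direction
  matters.\<close>

lemma iter_deriv_prod_components:
  fixes f :: "'n::finite \<Rightarrow> real \<Rightarrow> real"
  assumes "\<And>l. smooth_real (f l)" "set es \<subseteq> Basis"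
  shows "iter_deriv es (\<lambda>x::real^'n. \<Prod>l\<in>UNIV. f l (x $ l)) =
    (\<lambda>x. \<Prod>l\<in>UNIV. (deriv ^^ count_list es (axis l 1)) (f l) (x $ l))"
  using assms(2)
proof (induction es)
  case (Cons e es)
  then obtain m where m: "e = axis m 1" by (auto simp: Basis_vec_def)
  have IH: "iter_deriv es (\<lambda>x::real^'n. \<Prod>l\<in>UNIV. f l (x $ l)) =
    (\<lambda>x. \<Prod>l\<in>UNIV. (deriv ^^ count_list es (axis l 1)) (f l) (x $ l))"
    using Cons by simp
  have "iter_deriv (e # es) (\<lambda>x::real^'n. \<Prod>l\<in>UNIV. f l (x $ l)) x =
     (\<Prod>l\<in>UNIV. (deriv ^^ count_list (e # es) (axis l 1)) (f l) (x $ l))" for x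
    by (simp only: iter_deriv.simps IH m)
       (subst frechet_derivative_prod_components,
        auto intro!: prod.cong smooth_real_funpow assms simp: axis_eq_axis)
  then show ?case by blast
qed simp

lemma smooth_fun_prod_components:
  fixes f :: "'n::finite \<Rightarrow> real \<Rightarrow> real"
  assumes "\<And>l. smooth_real (f l)"
  shows "smooth_fun (\<lambda>x::real^'n. \<Prod>l\<in>UNIV. f l (x $ l))"
  unfolding smooth_fun_def differentiable_def
  using has_derivative_prod_components[OF smooth_real_funpow[OF assms]]
  by (auto simp: iter_deriv_prod_components[OF assms] intro!: exI)

lemma test_fun_prod_components:
  fixes f :: "'n::finite \<Rightarrow> real \<Rightarrow> real" and a b \<alpha> \<beta> :: "real^'n"
  assumes "\<And>l. smooth_real (f l)" "\<And>l s. f l s \<noteq> 0 \<Longrightarrow> \<alpha> $ l \<le> s \<and> s \<le> \<beta> $ l"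
    and "\<And>l. a $ l < \<alpha> $ l" "\<And>l. \<beta> $ l < b $ l"
  shows "test_fun (box a b) (\<lambda>x::real^'n. \<Prod>l\<in>UNIV. f l (x $ l))"
proof -
  have "{x. (\<Prod>l\<in>UNIV. f l (x $ l)) \<noteq> 0} \<subseteq> cbox \<alpha> \<beta>"
    using assms(2) by (auto simp: mem_box_cart)
  then have sub: "closure {x. (\<Prod>l\<in>UNIV. f l (x $ l)) \<noteq> 0} \<subseteq> cbox \<alpha> \<beta>"
    by (intro closure_minimal closed_cbox)
  moreover have "cbox \<alpha> \<beta> \<subseteq> box a b"
    unfolding subset_iff mem_box_cart using assms(3,4) by (meson less_le_trans le_less_trans)
  moreover have "compact (closure {x. (\<Prod>l\<in>UNIV. f l (x $ l)) \<noteq> 0})"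
    using sub by (meson bounded_cbox bounded_subset closed_closure compact_eq_bounded_closed)
  ultimately show ?thesis
    using smooth_fun_prod_components[of f] assms(1) unfolding test_fun_def by blast
qed

lemma iter_deriv_real:
  assumes "smooth_real f" "set es \<subseteq> Basis"
  shows "iter_deriv es f = (deriv ^^ length es) f"
  using assms(2)
proof (induction es)
  case (Cons e es)
  have "(((deriv ^^ length es) f) has_derivative (\<lambda>h. deriv ((deriv ^^ length es) f) x * h)) (at x)" for x
    using smooth_real_has_deriv[OF smooth_real_funpow[OF assms(1)]]
    by (simp add: has_field_derivative_def)
  then have "frechet_derivative ((deriv ^^ length es) f) (at x) = (\<lambda>h. deriv ((deriv ^^ length es) f) x * h)" for x
    using frechet_derivative_at by metis
  then show ?case using Cons by auto
qed simp

lemma test_fun_real: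
  assumes "smooth_real f" "\<And>s. f s \<noteq> 0 \<Longrightarrow> \<alpha> \<le> s \<and> s \<le> \<beta>" "a < \<alpha>" "\<beta> < b"
  shows "test_fun {a<..<b} f"
proof -
  have "{x. f x \<noteq> 0} \<subseteq> {\<alpha>..\<beta>}" using assms(2) by auto
  then have sub: "closure {x. f x \<noteq> 0} \<subseteq> {\<alpha>..\<beta>}"
    by (simp add: closure_minimal)
  moreover have "compact (closure {x. f x \<noteq> 0})"
    using sub by (meson bounded_closed_interval bounded_subset closed_closure compact_eq_bounded_closed)
  moreover have "smooth_fun f"
    unfolding smooth_fun_def
    using smooth_real_has_deriv[OF smooth_real_funpow[OF assms(1)]]
    by (auto simp: iter_deriv_real[OF assms(1)] real_differentiable_def
        field_differentiable_imp_differentiable field_differentiable_def)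
  ultimately show ?thesis
    using assms(3,4) unfolding test_fun_def by auto
qed

section \<open>Lebesgue integrals and changes of variables\<close>

lemma integrable_bounded_support:
  fixes f :: "'a::euclidean_space \<Rightarrow> real"
  assumes [measurable]: "f \<in> borel_measurable borel"
    and "\<And>x. \<bar>f x\<bar> \<le> C" "\<And>x. x \<notin> cbox a b \<Longrightarrow> f x = 0"
  shows "integrable lborel f"
  by (rule integrableI_bounded_set[of "cbox a b" _ _ C])
     (use assms emeasure_lborel_cbox_finite in auto)

lemma integral_lebesgue_on_borel:
  fixes f :: "'a::euclidean_space \<Rightarrow> real"
  assumes [measurable]: "f \<in> borel_measurable borel" "A \<in> sets borel"
  shows "(LINT x|lebesgue_on A. f x) = (LINT x|lborel. indicator A x * f x)"
proof -
  have "(LINT x|lebesgue_on A. f x) = (LINT x|lebesgue. indicator A x *\<^sub>R f x)"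
    by (rule integral_restrict_space) (auto simp: sets_completionI_sets)
  also have "\<dots> = (LINT x|lborel. indicator A x *\<^sub>R f x)"
    by (rule integral_completion) auto
  finally show ?thesis by simp
qed

lemma integrable_lebesgue_on_borel:
  fixes f :: "'a::euclidean_space \<Rightarrow> real"
  assumes [measurable]: "f \<in> borel_measurable borel" "A \<in> sets borel"
  shows "integrable (lebesgue_on A) f \<longleftrightarrow> integrable lborel (\<lambda>x. indicator A x * f x)"
proof -
  have "integrable (lebesgue_on A) f \<longleftrightarrow> integrable lebesgue (\<lambda>x. indicator A x *\<^sub>R f x)"
    by (rule integrable_restrict_space) (auto simp: sets_completionI_sets)
  also have "\<dots> \<longleftrightarrow> integrable lborel (\<lambda>x. indicator A x *\<^sub>R f x)"
    by (rule integrable_completion) auto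
  finally show ?thesis by simp
qed

lemma integral_lborel_translate:
  fixes f :: "'a::euclidean_space \<Rightarrow> real"
  assumes [measurable]: "f \<in> borel_measurable borel"
  shows "(LINT x|lborel. f (x + v)) = (LINT x|lborel. f x)"
proof -
  have "(LINT x|lborel. f x) = (LINT x|distr lborel borel ((+) v). f x)"
    by (simp add: lborel_distr_plus)
  also have "\<dots> = (LINT x|lborel. f (v + x))"
    by (rule integral_distr) auto
  finally show ?thesis by (simp add: add.commute)
qed

text \<open>The map is the reflection in the hyperplane whose l-th coordinate is \<open>c\<close>:
  affine with a diagonal linear part of entries 1 and -1, so its Jacobian has modulus one.\<close>

lemma integral_lborel_reflect:
  fixes f :: "real^'n \<Rightarrow> real"
  assumes [measurable]: "f \<in> borel_measurable borel"
  shows "(LINT x|lborel. f (x + (2 * (c - x $ l)) *\<^sub>R axis l 1)) = (LINT x|lborel. f x)"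
proof -
  let ?c = "\<lambda>j::real^'n. if j = axis l 1 then -1 else (1::real)"
  let ?T = "\<lambda>x::real^'n. (2 * c) *\<^sub>R axis l 1 + (\<Sum>j\<in>Basis. (?c j * (x \<bullet> j)) *\<^sub>R j)"
  have T: "?T x = x + (2 * (c - x $ l)) *\<^sub>R axis l 1" for x
  proof -
    have "(\<Sum>j\<in>Basis. (?c j * (x \<bullet> j)) *\<^sub>R j) =
        (\<Sum>j\<in>Basis. (x \<bullet> j) *\<^sub>R j - (if j = axis l 1 then (2 * (x \<bullet> j)) *\<^sub>R j else 0))"
      by (intro sum.cong) (auto simp: algebra_simps scaleR_2[symmetric])
    also have "\<dots> = x - (2 * x $ l) *\<^sub>R axis l 1"
      by (simp add: sum_subtractf euclidean_representation inner_axis)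
    finally show ?thesis by (simp add: algebra_simps)
  qed
  have "lborel = density (distr lborel borel ?T) (\<lambda>_. (\<Prod>j\<in>Basis. \<bar>?c j\<bar>))"
    by (rule lborel_affine_euclidean) auto
  also have "\<dots> = distr lborel borel ?T"
    by (simp add: density_1 if_distrib[of abs] cong: if_cong)
  finally have "lborel = distr lborel borel (\<lambda>x. x + (2 * (c - x $ l)) *\<^sub>R axis l 1)"
    unfolding T .
  then have "(LINT x|lborel. f x) =
      (LINT x|distr lborel borel (\<lambda>x. x + (2 * (c - x $ l)) *\<^sub>R axis l 1). f x)"
    by simp
  also have "\<dots> = (LINT x|lborel. f (x + (2 * (c - x $ l)) *\<^sub>R axis l 1))"
    by (rule integral_distr) (auto intro!: borel_measurable_continuous_onI continuous_intros)
  finally show ?thesis by simp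
qed

text \<open>Fubini. Lebesgue measure is given as a product over basis vectors rather than over
  indices, and \<open>idx\<close> translates between the two.\<close>

lemma integral_prod_components:
  fixes f :: "'n::finite \<Rightarrow> real \<Rightarrow> real"
  assumes int: "\<And>l. integrable lborel (f l)"
  shows "integrable lborel (\<lambda>x::real^'n. \<Prod>l\<in>UNIV. f l (x $ l))"
    and "(LINT x|lborel. (\<Prod>l\<in>UNIV. f l ((x::real^'n) $ l))) = (\<Prod>l\<in>UNIV. LINT s|lborel. f l s)"
proof -
  interpret product_sigma_finite "\<lambda>_::real^'n. lborel :: real measure" ..
  define idx where "idx = inv (\<lambda>l::'n. axis l (1::real))"
  have inj: "inj (\<lambda>l::'n. axis l (1::real))" by (auto simp: inj_def axis_eq_axis)
  have Basis: "Basis = range (\<lambda>l::'n. axis l (1::real))" by (auto simp: Basis_vec_def)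
  have idx: "idx (axis l 1) = l" for l unfolding idx_def by (rule inv_f_f[OF inj])
  have [measurable]: "f l \<in> borel_measurable borel" for l
    using int[of l] by (auto dest: borel_measurable_integrable)
  have eq: "(\<Prod>l\<in>UNIV. f l ((\<Sum>b\<in>Basis. x b *\<^sub>R b) $ l)) = (\<Prod>b\<in>Basis. f (idx b) (x b))"
    for x :: "real^'n \<Rightarrow> real"
  proof -
    have "(\<Sum>b\<in>Basis. x b *\<^sub>R b) $ l = x (axis l 1)" for l
    proof -
      have "(\<Sum>b\<in>Basis. x b *\<^sub>R b) $ l = (\<Sum>b\<in>Basis. x b *\<^sub>R b) \<bullet> axis l 1"
        by (simp add: inner_axis)
      also have "\<dots> = x (axis l 1)"
        by (rule inner_sum_left_Basis) (simp add: axis_in_Basis_iff)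
      finally show ?thesis .
    qed
    then show ?thesis
      unfolding Basis by (simp add: prod.reindex[OF inj] idx)
  qed
  have L: "(lborel :: (real^'n) measure) =
      distr (\<Pi>\<^sub>M b\<in>Basis. lborel) borel (\<lambda>f. \<Sum>b\<in>Basis. f b *\<^sub>R b)"
    by (rule lborel_eq)
  have "integrable (\<Pi>\<^sub>M b\<in>Basis. lborel) (\<lambda>x. \<Prod>b\<in>(Basis :: (real^'n) set). f (idx b) (x b))"
    by (rule product_integrable_prod) (auto intro: int)
  then show "integrable lborel (\<lambda>x::real^'n. \<Prod>l\<in>UNIV. f l (x $ l))"
    unfolding L by (subst integrable_distr_eq) (auto simp: eq simp del: sum_component vector_scaleR_component)
  have "(LINT x|lborel. (\<Prod>l\<in>UNIV. f l ((x::real^'n) $ l))) =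
     (LINT x|(\<Pi>\<^sub>M b\<in>Basis. lborel). (\<Prod>b\<in>(Basis :: (real^'n) set). f (idx b) (x b)))"
    unfolding L by (subst integral_distr) (auto simp: eq simp del: sum_component vector_scaleR_component)
  also have "\<dots> = (\<Prod>b\<in>(Basis :: (real^'n) set). LINT s|lborel. f (idx b) s)"
    by (rule product_integral_prod) (auto intro: int)
  also have "\<dots> = (\<Prod>l\<in>UNIV. LINT s|lborel. f l s)"
    unfolding Basis by (simp add: prod.reindex[OF inj] idx)
  finally show "(LINT x|lborel. (\<Prod>l\<in>UNIV. f l ((x::real^'n) $ l))) = (\<Prod>l\<in>UNIV. LINT s|lborel. f l s)" .
qed

lemma mollified_value:
  fixes F \<rho> :: "'a::euclidean_space \<Rightarrow> real"
  assumes "integrable lborel \<rho>" "(LINT x|lborel. \<rho> x) = 1" "\<And>x. 0 \<le> \<rho> x"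
    and "integrable lborel (\<lambda>x. F x * \<rho> x)"
    and "\<And>x. \<rho> x \<noteq> 0 \<Longrightarrow> \<bar>F x - y\<bar> \<le> \<kappa>"
  shows "\<bar>(LINT x|lborel. F x * \<rho> x) - y\<bar> \<le> \<kappa>"
proof -
  have "(LINT x|lborel. F x * \<rho> x) - y = (LINT x|lborel. F x * \<rho> x - y * \<rho> x)"
    using assms by simp
  also have "\<bar>\<dots>\<bar> \<le> (LINT x|lborel. \<kappa> * \<rho> x)"
  proof (rule integral_abs_bound_integral)
    show "\<bar>F x * \<rho> x - y * \<rho> x\<bar> \<le> \<kappa> * \<rho> x" for x
    proof (cases "\<rho> x = 0")
      case False
      then have "\<bar>F x - y\<bar> * \<rho> x \<le> \<kappa> * \<rho> x" using assms by (intro mult_right_mono) auto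
      then show ?thesis using assms(3)[of x] by (simp add: abs_mult left_diff_distrib[symmetric])
    qed simp
  qed (use assms in auto)
  also have "\<dots> = \<kappa>" using assms by simp
  finally show ?thesis .
qed

section \<open>Weak second derivatives and second differences\<close>

lemma integrable_lborel_translate:
  fixes f :: "'a::euclidean_space \<Rightarrow> real"
  assumes "integrable lborel f"
  shows "integrable lborel (\<lambda>x. f (x + v))"
proof -
  have [measurable]: "f \<in> borel_measurable borel"
    using assms by (auto dest: borel_measurable_integrable)
  have "integrable (distr lborel borel ((+) v)) f"
    using assms by (simp add: lborel_distr_plus)
  then show ?thesis
    by (subst (asm) integrable_distr_eq) (auto simp: add.commute)
qed

text \<open>A smooth step rescaled to half-width \<epsilon> around z. Its derivative \<rho> has mass
  one by the fundamental theorem; B is kept because the hat function below is built from an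
  antiderivative of it.\<close>

lemma mollifier_1d:
  assumes "0 < \<epsilon>"
  shows "\<exists>B \<rho>. smooth_real B \<and> smooth_real \<rho> \<and> (\<forall>s. (B has_real_derivative \<rho> s) (at s)) \<and> mono B \<and>
    (\<forall>s\<le>z - \<epsilon>. B s = 0) \<and> (\<forall>s\<ge>z + \<epsilon>. B s = 1) \<and> (\<forall>s. 0 \<le> \<rho> s) \<and>
    (\<forall>s. \<rho> s \<noteq> 0 \<longrightarrow> \<bar>s - z\<bar> \<le> \<epsilon>) \<and> integrable lborel \<rho> \<and> (LINT s|lborel. \<rho> s) = 1"
proof -
  obtain B where B: "smooth_real B" "\<And>x. x \<le> -1 \<Longrightarrow> B x = 0" "\<And>x. x \<ge> 1 \<Longrightarrow> B x = 1" "mono B"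
    using smooth_step_exists by metis
  define C where "C s = B ((1 / \<epsilon>) * s + (- z / \<epsilon>))" for s
  have arg: "(1 / \<epsilon>) * s + (- z / \<epsilon>) = (s - z) / \<epsilon>" for s
    by (simp add: diff_divide_distrib)
  have C: "smooth_real C"
    unfolding C_def by (rule smooth_real_affine[OF B(1)])
  have C0: "C s = 0" if "s \<le> z - \<epsilon>" for s
    unfolding C_def arg by (rule B(2)) (use that assms in \<open>simp add: field_simps\<close>)
  have C1: "C s = 1" if "s \<ge> z + \<epsilon>" for s
    unfolding C_def arg by (rule B(3)) (use that assms in \<open>simp add: field_simps\<close>)
  have monoC: "mono C"
    unfolding mono_def C_def arg using assms
    by (auto intro!: monoD[OF B(4)] divide_right_mono)
  have dC: "(C has_real_derivative deriv C s) (at s)" for s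
    by (rule smooth_real_has_deriv[OF C])
  have nonneg: "0 \<le> deriv C s" for s
    by (rule mono_on_imp_deriv_nonneg[of UNIV C]) (use monoC dC in \<open>auto simp: mono_on_def mono_def\<close>)
  have out: "\<bar>s - z\<bar> \<le> \<epsilon>" if "deriv C s \<noteq> 0" for s
  proof (rule ccontr)
    assume "\<not> \<bar>s - z\<bar> \<le> \<epsilon>"
    then consider "s < z - \<epsilon>" | "s > z + \<epsilon>" by linarith
    then have "(C has_real_derivative 0) (at s)"
    proof cases
      case 1
      have "((\<lambda>_. 0) has_real_derivative 0) (at s)" by simp
      then show ?thesis
        by (rule has_field_derivative_transform_within_open[of _ _ _ "{..<z - \<epsilon>}"])
           (use 1 C0 in auto)
    next
      case 2
      have "((\<lambda>_. 1) has_real_derivative 0) (at s)" by simp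
      then show ?thesis
        by (rule has_field_derivative_transform_within_open[of _ _ _ "{z + \<epsilon><..}"])
           (use 2 C1 in auto)
    qed
    then show False using that dC DERIV_unique by blast
  qed
  have "has_bochner_integral lborel (\<lambda>x. deriv C x * indicator {z - \<epsilon> .. z + \<epsilon>} x) (C (z + \<epsilon>) - C (z - \<epsilon>))"
    using assms nonneg dC smooth_real_isCont[OF smooth_real_deriv[OF C]]
    by (intro has_bochner_integral_FTC_Icc_nonneg)
       (auto simp: has_real_derivative_iff_has_vector_derivative[symmetric]
         intro!: has_field_derivative_at_within borel_measurable_continuous_onI continuous_at_imp_continuous_on)
  moreover have "(\<lambda>x. deriv C x * indicator {z - \<epsilon> .. z + \<epsilon>} x) = deriv C"
    using out by (force simp: indicator_def abs_le_iff)
  ultimately have "has_bochner_integral lborel (deriv C) 1"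
    using C0 C1 by simp
  then show ?thesis
    using C C0 C1 monoC dC nonneg out smooth_real_deriv[OF C]
    by (intro exI[of _ C] exI[of _ "deriv C"]) (auto simp: has_bochner_integral_iff)
qed

text \<open>\<phi> is the second difference of a second antiderivative of \<rho>, that is, a
  smoothed hat. As a test function it turns a weak second derivative into a second difference of
  mollified values. The bounds on height and support control its integral.\<close>

lemma hat_1d:
  assumes "smooth_real B" "\<And>s. (B has_real_derivative \<rho> s) (at s)" "mono B"
    "\<And>s. s \<le> z - \<epsilon> \<Longrightarrow> B s = 0" "\<And>s. s \<ge> z + \<epsilon> \<Longrightarrow> B s = (1::real)" "0 < \<delta>" "0 < \<epsilon>"
  shows "\<exists>\<phi>. smooth_real \<phi> \<and> deriv (deriv \<phi>) = (\<lambda>s. \<rho> (s + \<delta>) - 2 * \<rho> s + \<rho> (s - \<delta>)) \<and>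
    (\<forall>s. 0 \<le> \<phi> s \<and> \<phi> s \<le> \<delta>) \<and> (\<forall>s. \<phi> s \<noteq> 0 \<longrightarrow> \<bar>s - z\<bar> \<le> \<epsilon> + \<delta>)"
proof -
  have "\<exists>G. (\<forall>x. (G has_real_derivative B x) (at x)) \<and> (\<forall>x\<le>z - \<epsilon>. G x = 0)"
    by (rule antideriv_left_zero) (use assms smooth_real_isCont in auto)
  then obtain \<Theta> where \<Theta>: "\<And>x. (\<Theta> has_real_derivative B x) (at x)" by blast
  have sm: "smooth_real \<Theta>" using smooth_real_antideriv assms(1) \<Theta> by blast
  define \<phi> where "\<phi> s = (\<Theta> (1 * s + \<delta>) + (-2) * \<Theta> s) + \<Theta> (1 * s + (- \<delta>))" for s
  have "smooth_real \<phi>"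
    unfolding \<phi>_def by (intro smooth_real_add smooth_real_affine smooth_real_cmult sm)
  have sh: "((\<lambda>s. f (1 * s + c)) has_real_derivative f' (1 * s + c)) (at s)"
    if "\<And>s. (f has_real_derivative f' s) (at s)" for f f' :: "real \<Rightarrow> real" and c s
  proof -
    have "((\<lambda>s. f (1 * s + c)) has_real_derivative f' (1 * s + c) * 1) (at s)"
      by (rule DERIV_chain2[OF that]) (auto intro!: derivative_eq_intros)
    then show ?thesis by simp
  qed
  have "(\<phi> has_real_derivative ((B (1 * s + \<delta>) + (-2) * B s) + B (1 * s + (- \<delta>)))) (at s)" for s
    unfolding \<phi>_def by (intro DERIV_add DERIV_cmult sh \<Theta>)
  then have d1: "deriv \<phi> = (\<lambda>s. (B (1 * s + \<delta>) + (-2) * B s) + B (1 * s + (- \<delta>)))"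
    by (auto intro!: DERIV_imp_deriv)
  have "((\<lambda>s. (B (1 * s + \<delta>) + (-2) * B s) + B (1 * s + (- \<delta>))) has_real_derivative
      ((\<rho> (1 * s + \<delta>) + (-2) * \<rho> s) + \<rho> (1 * s + (- \<delta>)))) (at s)" for s
    by (intro DERIV_add DERIV_cmult sh assms(2))
  then have d2: "deriv (deriv \<phi>) = (\<lambda>s. (\<rho> (1 * s + \<delta>) + (-2) * \<rho> s) + \<rho> (1 * s + (- \<delta>)))"
    unfolding d1 by (auto intro!: DERIV_imp_deriv)
  have bd: "0 \<le> B s" "B s \<le> 1" for s
    using assms(3)[THEN monoD, of "min s (z - \<epsilon>)" s] assms(3)[THEN monoD, of s "max s (z + \<epsilon>)"]
      assms(4)[of "min s (z - \<epsilon>)"] assms(5)[of "max s (z + \<epsilon>)"] by auto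
  \<comment> \<open>Each first difference of \<Theta> is \<delta> times a value of B, so \<phi> is
    \<delta> times an increment of the monotone function B.\<close>
  have mvt: "\<exists>\<xi>1 \<xi>2. s - \<delta> < \<xi>2 \<and> \<xi>2 < s \<and> s < \<xi>1 \<and> \<xi>1 < s + \<delta> \<and> \<phi> s = \<delta> * (B \<xi>1 - B \<xi>2)" for s
  proof -
    obtain \<xi>1 where 1: "s < \<xi>1" "\<xi>1 < s + \<delta>" "\<Theta> (s + \<delta>) - \<Theta> s = (s + \<delta> - s) * B \<xi>1"
      using MVT2[of s "s + \<delta>" \<Theta> B, OF _ \<Theta>] assms(6) by (metis less_add_same_cancel1)
    obtain \<xi>2 where 2: "s - \<delta> < \<xi>2" "\<xi>2 < s" "\<Theta> s - \<Theta> (s - \<delta>) = (s - (s - \<delta>)) * B \<xi>2"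
      using MVT2[of "s - \<delta>" s \<Theta> B, OF _ \<Theta>] assms(6) by (metis diff_less_eq less_add_same_cancel1)
    have "\<phi> s = (\<Theta> (s + \<delta>) - \<Theta> s) - (\<Theta> s - \<Theta> (s - \<delta>))" by (simp add: \<phi>_def)
    also have "\<dots> = \<delta> * (B \<xi>1 - B \<xi>2)" unfolding 1(3) 2(3) by (simp add: right_diff_distrib)
    finally show ?thesis using 1 2 by blast
  qed
  have range: "0 \<le> \<phi> s \<and> \<phi> s \<le> \<delta>" for s
  proof -
    obtain \<xi>1 \<xi>2 where x: "\<xi>2 < s" "s < \<xi>1" "\<phi> s = \<delta> * (B \<xi>1 - B \<xi>2)" using mvt[of s] by blast
    have "0 \<le> B \<xi>1 - B \<xi>2" "B \<xi>1 - B \<xi>2 \<le> 1"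
      using monoD[OF assms(3), of \<xi>2 \<xi>1] x bd[of \<xi>1] bd[of \<xi>2] by auto
    then show ?thesis using x(3) assms(6) by (auto simp: mult_left_le)
  qed
  have supp: "\<bar>s - z\<bar> \<le> \<epsilon> + \<delta>" if "\<phi> s \<noteq> 0" for s
  proof (rule ccontr)
    assume far: "\<not> \<bar>s - z\<bar> \<le> \<epsilon> + \<delta>"
    obtain \<xi>1 \<xi>2 where x: "s - \<delta> < \<xi>2" "\<xi>2 < s" "s < \<xi>1" "\<xi>1 < s + \<delta>" "\<phi> s = \<delta> * (B \<xi>1 - B \<xi>2)"
      using mvt[of s] by blast
    from far consider "s < z - \<epsilon> - \<delta>" | "s > z + \<epsilon> + \<delta>" by linarith
    then have "B \<xi>1 = B \<xi>2"
    proof cases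
      case 1
      then show ?thesis using x assms(4)[of \<xi>1] assms(4)[of \<xi>2] by auto
    next
      case 2
      then show ?thesis using x assms(5)[of \<xi>1] assms(5)[of \<xi>2] by auto
    qed
    then show False using that x by simp
  qed
  show ?thesis
    using \<open>smooth_real \<phi>\<close> d2 range supp by (intro exI[of _ \<phi>]) auto
qed

definition second_diff :: "'n \<Rightarrow> real \<Rightarrow> (real^'n \<Rightarrow> real) \<Rightarrow> real^'n \<Rightarrow> real" where
  "second_diff l \<delta> u x = u (x + \<delta> *\<^sub>R axis l 1) + u (x - \<delta> *\<^sub>R axis l 1) - 2 * u x"

lemma borel_measurable_indicator_cbox:
  fixes u :: "'a::euclidean_space \<Rightarrow> real"
  assumes "continuous_on (cbox a b) u"
  shows "(\<lambda>x. indicator (cbox a b) x * u x) \<in> borel_measurable borel"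
  using borel_measurable_continuous_on_indicator[OF _ assms] by simp

lemma continuous_cbox_bounded:
  fixes u :: "'a::euclidean_space \<Rightarrow> real"
  assumes "continuous_on (cbox a b) u"
  obtains C where "0 \<le> C" "\<And>x. x \<in> cbox a b \<Longrightarrow> \<bar>u x\<bar> \<le> C"
proof -
  have "bounded (u ` cbox a b)"
    using assms by (intro compact_imp_bounded compact_continuous_image) auto
  then obtain C where "\<forall>y\<in>u ` cbox a b. norm y \<le> C" unfolding bounded_iff by blast
  then show ?thesis by (intro that[of "max 0 C"]) auto
qed

text \<open>Test with a hat in direction l times mollifiers in the other directions. One side is a
  mollified second difference, the other at most M times the integral of the hat. A hat has integral
  \<delta>^2; the factor 4 is the crude product of height \<delta> and width 2 (\<epsilon> +
  \<delta>) with \<epsilon> \<le> \<delta>.\<close>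

lemma weak_second_deriv_second_diff:
  fixes a b z :: "real^'n" and u v :: "real^'n \<Rightarrow> real"
  assumes wd: "weak_deriv (box a b) [axis l 1, axis l 1] u v"
    and v: "AE x in lebesgue_on (box a b). \<bar>v x\<bar> \<le> M" and M: "0 \<le> M"
    and cont: "continuous_on (cbox a b) u"
    and z: "z \<in> box a b" "z + \<delta> *\<^sub>R axis l 1 \<in> box a b" "z - \<delta> *\<^sub>R axis l 1 \<in> box a b"
    and \<delta>: "0 < \<delta>"
  shows "\<bar>second_diff l \<delta> u z\<bar> \<le> 4 * M * \<delta>\<^sup>2"
proof (rule field_le_epsilon)
  fix \<kappa> :: real assume \<kappa>: "0 < \<kappa>"
  let ?e = "axis l 1 :: real^'n"
  have isC: "isCont u x" if "x \<in> box a b" for x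
    using cont that by (metis continuous_on_interior interior_cbox)
  have lim: "(second_diff l \<delta> u \<longlongrightarrow> second_diff l \<delta> u z) (nhds z)"
  proof -
    have "((\<lambda>x. u (x + c *\<^sub>R ?e)) \<longlongrightarrow> u (z + c *\<^sub>R ?e)) (nhds z)" if "z + c *\<^sub>R ?e \<in> box a b" for c
    proof -
      have "isCont (\<lambda>x. u (x + c *\<^sub>R ?e)) z"
        by (rule continuous_at_compose[unfolded o_def, where f = "\<lambda>x. x + c *\<^sub>R ?e"])
           (auto intro!: isC that continuous_intros)
      then show ?thesis using tendsto_at_iff_tendsto_nhds[of "\<lambda>x. u (x + c *\<^sub>R ?e)" z] by (simp add: continuous_at)
    qed
    from this[of \<delta>] this[of "- \<delta>"] this[of 0] z show ?thesis
      unfolding second_diff_def by (auto intro!: tendsto_intros)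
  qed
  have "\<forall>\<^sub>F x in nhds z. \<bar>second_diff l \<delta> u x - second_diff l \<delta> u z\<bar> < \<kappa>"
    using tendstoD[OF lim \<kappa>] by (simp add: dist_real_def)
  moreover have "\<forall>\<^sub>F x in nhds z. x + c *\<^sub>R ?e \<in> box a b" if "z + c *\<^sub>R ?e \<in> box a b" for c
  proof (rule topological_tendstoD[OF _ open_box that])
    show "((\<lambda>x. x + c *\<^sub>R ?e) \<longlongrightarrow> z + c *\<^sub>R ?e) (nhds z)"
      by (intro tendsto_intros filterlim_ident)
  qed
  from this[of 0] this[of \<delta>] this[of "- \<delta>"] z
  have "\<forall>\<^sub>F x in nhds z. x \<in> box a b" "\<forall>\<^sub>F x in nhds z. x + \<delta> *\<^sub>R ?e \<in> box a b"
    "\<forall>\<^sub>F x in nhds z. x - \<delta> *\<^sub>R ?e \<in> box a b" by auto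
  ultimately have "\<forall>\<^sub>F x in nhds z. \<bar>second_diff l \<delta> u x - second_diff l \<delta> u z\<bar> < \<kappa> \<and>
      x \<in> box a b \<and> x + \<delta> *\<^sub>R ?e \<in> box a b \<and> x - \<delta> *\<^sub>R ?e \<in> box a b"
    by eventually_elim simp
  then obtain d where d: "0 < d" and near: "\<And>x. dist x z < d \<Longrightarrow>
     \<bar>second_diff l \<delta> u x - second_diff l \<delta> u z\<bar> < \<kappa> \<and>
      x \<in> box a b \<and> x + \<delta> *\<^sub>R ?e \<in> box a b \<and> x - \<delta> *\<^sub>R ?e \<in> box a b"
    unfolding eventually_nhds_metric by blast
  \<comment> \<open>Dividing by the dimension plus one puts the cube of half-width \<epsilon> into
    the ball of radius \<open>d\<close>, by comparison with the l1 norm; \<epsilon> \<le> \<delta>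
    serves the integral of the hat.\<close>
  define \<epsilon> where "\<epsilon> = min \<delta> (d / (real CARD('n) + 1))"
  have \<epsilon>: "0 < \<epsilon>" "\<epsilon> \<le> \<delta>" using d \<delta> by (auto simp: \<epsilon>_def)
  have cube: "dist x z < d" if "\<And>m. \<bar>x $ m - z $ m\<bar> \<le> \<epsilon>" for x
  proof -
    have "dist x z \<le> (\<Sum>m\<in>UNIV. \<bar>(x - z) $ m\<bar>)" unfolding dist_norm by (rule norm_le_l1_cart)
    also have "\<dots> \<le> (\<Sum>m\<in>(UNIV::'n set). \<epsilon>)" using that by (intro sum_mono) simp
    also have "\<dots> \<le> real CARD('n) * (d / (real CARD('n) + 1))"
      unfolding sum_constant by (intro mult_left_mono) (auto simp: \<epsilon>_def)
    also have "\<dots> < d" using d by (simp add: field_simps)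
    finally show ?thesis .
  qed
  have "\<forall>m. \<exists>B \<rho>. smooth_real B \<and> smooth_real \<rho> \<and> (\<forall>s. (B has_real_derivative \<rho> s) (at s)) \<and> mono B \<and>
    (\<forall>s\<le>z $ m - \<epsilon>. B s = 0) \<and> (\<forall>s\<ge>z $ m + \<epsilon>. B s = 1) \<and> (\<forall>s. 0 \<le> \<rho> s) \<and>
    (\<forall>s. \<rho> s \<noteq> 0 \<longrightarrow> \<bar>s - z $ m\<bar> \<le> \<epsilon>) \<and> integrable lborel \<rho> \<and> (LINT s|lborel. \<rho> s) = 1"
    using mollifier_1d[OF \<epsilon>(1)] by blast
  then obtain B \<rho> where B: "\<And>m. smooth_real (B m)" "\<And>m s. (B m has_real_derivative \<rho> m s) (at s)"
      "\<And>m. mono (B m)" "\<And>m s. s \<le> z $ m - \<epsilon> \<Longrightarrow> B m s = 0" "\<And>m s. s \<ge> z $ m + \<epsilon> \<Longrightarrow> B m s = 1"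
    and \<rho>: "\<And>m. smooth_real (\<rho> m)" "\<And>m s. 0 \<le> \<rho> m s" "\<And>m s. \<rho> m s \<noteq> 0 \<Longrightarrow> \<bar>s - z $ m\<bar> \<le> \<epsilon>"
      "\<And>m. integrable lborel (\<rho> m)" "\<And>m. (LINT s|lborel. \<rho> m s) = 1"
    by metis
  obtain \<phi> where \<phi>: "smooth_real \<phi>" "deriv (deriv \<phi>) = (\<lambda>s. \<rho> l (s + \<delta>) - 2 * \<rho> l s + \<rho> l (s - \<delta>))"
    "\<And>s. 0 \<le> \<phi> s" "\<And>s. \<phi> s \<le> \<delta>" "\<And>s. \<phi> s \<noteq> 0 \<Longrightarrow> \<bar>s - z $ l\<bar> \<le> \<epsilon> + \<delta>"
    using hat_1d[of "B l" "\<rho> l" "z $ l" \<epsilon> \<delta>, OF B(1-5)[where m = l] \<delta> \<epsilon>(1)] by auto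
  define f where "f m = (if m = l then \<phi> else \<rho> m)" for m
  define \<Phi> where "\<Phi> x = (\<Prod>m\<in>UNIV. f m (x $ m))" for x :: "real^'n"
  define r where "r x = (\<Prod>m\<in>UNIV. \<rho> m (x $ m))" for x :: "real^'n"
  have sf: "smooth_real (f m)" for m by (simp add: f_def \<phi> \<rho>)
  have test: "test_fun (box a b) \<Phi>"
    unfolding \<Phi>_def
  proof (rule test_fun_prod_components[where \<alpha> = "\<chi> m. z $ m - \<epsilon> - (if m = l then \<delta> else 0)"
        and \<beta> = "\<chi> m. z $ m + \<epsilon> + (if m = l then \<delta> else 0)"])
    show "smooth_real (f m)" for m by (rule sf)
    show "(\<chi> m. z $ m - \<epsilon> - (if m = l then \<delta> else 0)) $ m \<le> s \<and>
        s \<le> (\<chi> m. z $ m + \<epsilon> + (if m = l then \<delta> else 0)) $ m" if "f m s \<noteq> 0" for m s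
      using that \<phi>(5)[of s] \<rho>(3)[of m s] by (auto simp: f_def split: if_splits)
    show "a $ m < (\<chi> m. z $ m - \<epsilon> - (if m = l then \<delta> else 0)) $ m" for m
    proof -
      have "dist (z - \<epsilon> *\<^sub>R axis m 1) z < d" by (rule cube) (use \<epsilon> in \<open>auto simp: axis_def\<close>)
      from near[OF this, unfolded mem_box_cart] have "a $ m < (z - \<epsilon> *\<^sub>R axis m 1) $ m" "a $ m < (z - \<epsilon> *\<^sub>R axis m 1 - \<delta> *\<^sub>R ?e) $ m"
        by blast+
      then show ?thesis by (auto simp: axis_def)
    qed
    show "(\<chi> m. z $ m + \<epsilon> + (if m = l then \<delta> else 0)) $ m < b $ m" for m
    proof -
      have "dist (z + \<epsilon> *\<^sub>R axis m 1) z < d" by (rule cube) (use \<epsilon> in \<open>auto simp: axis_def\<close>)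
      from near[OF this, unfolded mem_box_cart] have "(z + \<epsilon> *\<^sub>R axis m 1) $ m < b $ m" "(z + \<epsilon> *\<^sub>R axis m 1 + \<delta> *\<^sub>R ?e) $ m < b $ m"
        by blast+
      then show ?thesis by (auto simp: axis_def)
    qed
  qed
  have eq: "(LINT x|lebesgue_on (box a b). u x * iter_deriv [?e, ?e] \<Phi> x) =
      (LINT x|lebesgue_on (box a b). v x * \<Phi> x)"
    using wd test unfolding weak_deriv_def by simp
  have \<Phi>out: "\<Phi> x = 0" if "x \<notin> box a b" for x
    using test that closure_subset[of "{x. \<Phi> x \<noteq> 0}"] unfolding test_fun_def by blast
  have \<Phi>nn: "0 \<le> \<Phi> x" for x unfolding \<Phi>_def f_def by (auto intro!: prod_nonneg \<phi> \<rho>)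
  have cont\<Phi>: "continuous_on UNIV \<Phi>"
    unfolding \<Phi>_def
    by (intro continuous_on_prod continuous_on_compose2[OF smooth_real_continuous_on[OF sf, of UNIV]] continuous_intros) auto
  have contr: "continuous_on UNIV r"
    unfolding r_def
    by (intro continuous_on_prod continuous_on_compose2[OF smooth_real_continuous_on[OF \<rho>(1), of UNIV]] continuous_intros) auto
  have [measurable]: "\<Phi> \<in> borel_measurable borel" "r \<in> borel_measurable borel"
    using cont\<Phi> contr by (auto intro: borel_measurable_continuous_onI)
  have int\<phi>: "integrable lborel \<phi>"
    by (rule integrable_bounded_support[where C = \<delta> and a = "z $ l - \<epsilon> - \<delta>" and b = "z $ l + \<epsilon> + \<delta>"])
       (use \<phi>(3-5) smooth_real_continuous_on[OF \<phi>(1)] in \<open>force intro: borel_measurable_continuous_onI\<close>)+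
  have "(LINT s|lborel. \<phi> s) \<le> (LINT s|lborel. \<delta> * indicator {z $ l - \<epsilon> - \<delta>..z $ l + \<epsilon> + \<delta>} s)"
  proof (rule integral_mono)
    show "\<phi> s \<le> \<delta> * indicator {z $ l - \<epsilon> - \<delta>..z $ l + \<epsilon> + \<delta>} s" for s
      using \<phi>(4)[of s] \<phi>(5)[of s] by (cases "\<phi> s = 0") (auto simp: indicator_def \<delta> less_imp_le)
  qed (use int\<phi> in \<open>auto simp: emeasure_lborel_Icc_eq intro!: integrable_real_indicator\<close>)
  also have "\<dots> = \<delta> * (2 * (\<epsilon> + \<delta>))" using \<epsilon> \<delta> by simp
  also have "\<dots> \<le> 4 * \<delta>\<^sup>2" using \<epsilon> \<delta> by (simp add: power2_eq_square algebra_simps)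
  finally have int\<phi>4: "(LINT s|lborel. \<phi> s) \<le> 4 * \<delta>\<^sup>2" .
  have intf: "integrable lborel (f m)" for m by (simp add: f_def int\<phi> \<rho>)
  have int\<Phi>: "integrable lborel \<Phi>" "(LINT x|lborel. \<Phi> x) = (\<Prod>m\<in>UNIV. LINT s|lborel. f m s)"
    using integral_prod_components[of f, OF intf] unfolding \<Phi>_def by auto
  have "(\<Prod>m\<in>UNIV. LINT s|lborel. f m s) = (LINT s|lborel. \<phi> s)"
    by (subst prod.remove[of UNIV l]) (auto simp: f_def \<rho> intro!: prod.neutral)
  then have \<Phi>4: "(LINT x|lborel. \<Phi> x) \<le> 4 * \<delta>\<^sup>2" using int\<phi>4 int\<Phi> by simp
  have ind: "indicator (box a b) x * \<Phi> x = \<Phi> x" for x using \<Phi>out[of x] by (auto simp: indicator_def)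
  have "\<bar>LINT x|lebesgue_on (box a b). v x * \<Phi> x\<bar> \<le> (LINT x|lebesgue_on (box a b). \<bar>v x * \<Phi> x\<bar>)"
    by (rule integral_abs_bound)
  also have "\<dots> \<le> (LINT x|lebesgue_on (box a b). M * \<Phi> x)"
  proof (rule integral_mono_AE')
    show "integrable (lebesgue_on (box a b)) (\<lambda>x. M * \<Phi> x)"
      by (subst integrable_lebesgue_on_borel) (auto simp: ind int\<Phi> mult.left_commute)
    show "AE x in lebesgue_on (box a b). \<bar>v x * \<Phi> x\<bar> \<le> M * \<Phi> x"
      using v by eventually_elim (auto simp: abs_mult \<Phi>nn intro!: mult_right_mono)
  qed (use M \<Phi>nn in auto)
  also have "\<dots> = M * (LINT x|lborel. \<Phi> x)"
    by (subst integral_lebesgue_on_borel) (auto simp: ind mult.left_commute)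
  also have "\<dots> \<le> M * (4 * \<delta>\<^sup>2)" using \<Phi>4 M by (rule mult_left_mono)
  finally have rhs: "\<bar>LINT x|lebesgue_on (box a b). v x * \<Phi> x\<bar> \<le> 4 * M * \<delta>\<^sup>2" by simp
  \<comment> \<open>Extension by zero gives a Borel function on the whole space, so that integrals
    can be translated; the support of the mollifier keeps all evaluation points inside the
    box.\<close>
  define u0 where "u0 x = indicator (cbox a b) x * u x" for x
  have [measurable]: "u0 \<in> borel_measurable borel"
    unfolding u0_def using cont by (rule borel_measurable_indicator_cbox)
  obtain C where C: "0 \<le> C" "\<And>x. x \<in> cbox a b \<Longrightarrow> \<bar>u x\<bar> \<le> C"
    using continuous_cbox_bounded[OF cont] by blast
  have u0C: "\<bar>u0 x\<bar> \<le> C" for x using C by (auto simp: u0_def indicator_def)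
  have prodl: "(\<Prod>m\<in>UNIV. g m) = g l * (\<Prod>m\<in>UNIV - {l}. g m)" for g :: "'n \<Rightarrow> real"
    by (rule prod.remove) auto
  have rshift: "r (x + c *\<^sub>R ?e) = \<rho> l (x $ l + c) * (\<Prod>m\<in>UNIV - {l}. \<rho> m (x $ m))" for x c
    unfolding r_def by (subst prodl) (auto intro!: prod.cong simp: axis_def)
  have D\<Phi>: "iter_deriv [?e, ?e] \<Phi> x = r (x + \<delta> *\<^sub>R ?e) + r (x + (- \<delta>) *\<^sub>R ?e) - 2 * r (x + 0 *\<^sub>R ?e)" for x
  proof -
    have "iter_deriv [?e, ?e] \<Phi> x = (\<Prod>m\<in>UNIV. (deriv ^^ count_list [?e, ?e] (axis m 1)) (f m) (x $ m))"
      unfolding \<Phi>_def by (subst iter_deriv_prod_components[OF sf]) (auto simp: axis_in_Basis_iff)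
    also have "\<dots> = deriv (deriv \<phi>) (x $ l) * (\<Prod>m\<in>UNIV - {l}. \<rho> m (x $ m))"
      by (subst prodl) (auto intro!: prod.cong simp: axis_eq_axis f_def)
    finally show ?thesis unfolding rshift \<phi>(2) by (simp add: algebra_simps)
  qed
  have intr: "integrable lborel r" "(LINT x|lborel. r x) = 1"
    using integral_prod_components[of \<rho>, OF \<rho>(4)] unfolding r_def by (auto simp: \<rho>)
  have rnn: "0 \<le> r x" for x unfolding r_def by (auto intro!: prod_nonneg \<rho>)
  have rsupp: "dist x z < d" if "r x \<noteq> 0" for x
    by (rule cube) (use that \<rho>(3) in \<open>auto simp: r_def\<close>)
  have intur: "integrable lborel (\<lambda>x. u0 (x + c *\<^sub>R ?e) * r x)" for c
    by (rule Bochner_Integration.integrable_bound[of _ "\<lambda>x. C * r x"])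
       (use u0C rnn C(1) in \<open>auto simp: intr abs_mult intro!: mult_right_mono AE_I2\<close>)
  have inturs: "integrable lborel (\<lambda>x. u0 x * r (x + c *\<^sub>R ?e))"
    and eqs: "(LINT x|lborel. u0 x * r (x + c *\<^sub>R ?e)) = (LINT x|lborel. u0 (x + (- c) *\<^sub>R ?e) * r x)" for c
  proof -
    show "(LINT x|lborel. u0 x * r (x + c *\<^sub>R ?e)) = (LINT x|lborel. u0 (x + (- c) *\<^sub>R ?e) * r x)"
      using integral_lborel_translate[of "\<lambda>x. u0 (x + (- c) *\<^sub>R ?e) * r x" "c *\<^sub>R ?e"] by simp
    have "integrable lborel (\<lambda>x. (C * r (x + c *\<^sub>R ?e)))"
      using integrable_lborel_translate[OF intr(1)] by simp
    then show "integrable lborel (\<lambda>x. u0 x * r (x + c *\<^sub>R ?e))"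
      by (rule Bochner_Integration.integrable_bound)
         (use u0C rnn C(1) in \<open>auto simp: add.commute abs_mult intro!: mult_right_mono AE_I2\<close>)
  qed
  have rout: "r (x + c *\<^sub>R ?e) = 0" if "c \<in> {0, \<delta>, - \<delta>}" "x \<notin> box a b" for x c
  proof (rule ccontr)
    assume "r (x + c *\<^sub>R ?e) \<noteq> 0"
    from near[OF rsupp[OF this]] that show False by auto
  qed
  have "(LINT x|lebesgue_on (box a b). u x * iter_deriv [?e, ?e] \<Phi> x) =
      (LINT x|lebesgue_on (box a b). u0 x * (r (x + \<delta> *\<^sub>R ?e) + r (x + (- \<delta>) *\<^sub>R ?e) - 2 * r (x + 0 *\<^sub>R ?e)))"
    using box_subset_cbox[of a b] unfolding D\<Phi>
    by (intro Bochner_Integration.integral_cong) (auto simp: u0_def indicator_def)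
  also have "\<dots> = (LINT x|lborel. indicator (box a b) x * (u0 x * (r (x + \<delta> *\<^sub>R ?e) + r (x + (- \<delta>) *\<^sub>R ?e) - 2 * r (x + 0 *\<^sub>R ?e))))"
    by (rule integral_lebesgue_on_borel) auto
  also have "\<dots> = (LINT x|lborel. u0 x * r (x + \<delta> *\<^sub>R ?e) + u0 x * r (x + (- \<delta>) *\<^sub>R ?e) - 2 * (u0 x * r (x + 0 *\<^sub>R ?e)))"
    using rout[of 0] rout[of \<delta>] rout[of "- \<delta>"] by (intro Bochner_Integration.integral_cong) (auto simp: indicator_def algebra_simps)
  also have "\<dots> = (LINT x|lborel. u0 x * r (x + \<delta> *\<^sub>R ?e)) + (LINT x|lborel. u0 x * r (x + (- \<delta>) *\<^sub>R ?e))
      - 2 * (LINT x|lborel. u0 x * r (x + 0 *\<^sub>R ?e))"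
    using inturs[of \<delta>] inturs[of "- \<delta>"] inturs[of 0] by simp
  also have "\<dots> = (LINT x|lborel. (u0 (x + \<delta> *\<^sub>R ?e) + u0 (x + (- \<delta>) *\<^sub>R ?e) - 2 * u0 (x + 0 *\<^sub>R ?e)) * r x)"
    unfolding eqs using intur[of \<delta>] intur[of "- \<delta>"] intur[of 0] by (simp add: distrib_right left_diff_distrib mult.assoc)
  finally have lhs: "(LINT x|lebesgue_on (box a b). u x * iter_deriv [?e, ?e] \<Phi> x) =
     (LINT x|lborel. (u0 (x + \<delta> *\<^sub>R ?e) + u0 (x + (- \<delta>) *\<^sub>R ?e) - 2 * u0 (x + 0 *\<^sub>R ?e)) * r x)" .
  have "\<bar>(LINT x|lborel. (u0 (x + \<delta> *\<^sub>R ?e) + u0 (x + (- \<delta>) *\<^sub>R ?e) - 2 * u0 (x + 0 *\<^sub>R ?e)) * r x)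
       - second_diff l \<delta> u z\<bar> \<le> \<kappa>"
  proof (rule mollified_value)
    show "integrable lborel (\<lambda>x. (u0 (x + \<delta> *\<^sub>R ?e) + u0 (x + (- \<delta>) *\<^sub>R ?e) - 2 * u0 (x + 0 *\<^sub>R ?e)) * r x)"
      using intur[of \<delta>] intur[of "- \<delta>"] intur[of 0] by (simp add: distrib_right left_diff_distrib mult.assoc)
    fix x assume "r x \<noteq> 0"
    from near[OF rsupp[OF this]]
    show "\<bar>u0 (x + \<delta> *\<^sub>R ?e) + u0 (x + (- \<delta>) *\<^sub>R ?e) - 2 * u0 (x + 0 *\<^sub>R ?e) - second_diff l \<delta> u z\<bar> \<le> \<kappa>"
      using box_subset_cbox[of a b] by (auto simp: u0_def second_diff_def indicator_def)
  qed (use intr rnn in auto)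
  then show "\<bar>second_diff l \<delta> u z\<bar> \<le> 4 * M * \<delta>\<^sup>2 + \<kappa>"
    using lhs eq rhs by linarith
qed

section \<open>Neumann regularity as difference inequalities\<close>

lemma mem_cbox_shift:
  fixes x a b :: "real^'n"
  assumes "x \<in> cbox a b"
  shows "x + s *\<^sub>R axis l 1 \<in> cbox a b \<longleftrightarrow> a $ l \<le> x $ l + s \<and> x $ l + s \<le> b $ l"
proof -
  have "(x + s *\<^sub>R axis l 1) $ i = (if i = l then x $ l + s else x $ i)" for i
    by (simp add: axis_def)
  then show ?thesis using assms by (auto simp: mem_box_cart)
qed

text \<open>A derivative-free form of bounded pure second derivatives together with a vanishing
  normal derivative: at a face the function departs only quadratically along the normal. Being made
  of pointwise inequalities, it passes to limits and to compositions.\<close>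

definition neumann_class :: "real^'n \<Rightarrow> real^'n \<Rightarrow> real \<Rightarrow> (real^'n \<Rightarrow> real) \<Rightarrow> bool" where
  "neumann_class a b M u \<longleftrightarrow> continuous_on (cbox a b) u \<and>
     (\<forall>l x \<delta>. 0 < \<delta> \<and> x \<in> cbox a b \<and> x + \<delta> *\<^sub>R axis l 1 \<in> cbox a b \<and> x - \<delta> *\<^sub>R axis l 1 \<in> cbox a b \<longrightarrow>
        \<bar>second_diff l \<delta> u x\<bar> \<le> M * \<delta>\<^sup>2) \<and>
     (\<forall>l x s. x \<in> cbox a b \<and> (x $ l = a $ l \<or> x $ l = b $ l) \<and> x + s *\<^sub>R axis l 1 \<in> cbox a b \<longrightarrow>
        \<bar>u (x + s *\<^sub>R axis l 1) - u x\<bar> \<le> M * s\<^sup>2)"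

text \<open>Contract the three points towards the centre of the box by the factor 1 - t, where the
  interior bound applies with step (1 - t) \<delta>, and let t tend to 0.\<close>

lemma second_diff_closed_box:
  fixes a b :: "real^'n"
  assumes ab: "\<And>i. a $ i < b $ i" and cont: "continuous_on (cbox a b) u"
    and int: "\<And>x \<delta>. 0 < \<delta> \<Longrightarrow> x \<in> box a b \<Longrightarrow> x + \<delta> *\<^sub>R axis l 1 \<in> box a b \<Longrightarrow>
       x - \<delta> *\<^sub>R axis l 1 \<in> box a b \<Longrightarrow> \<bar>second_diff l \<delta> u x\<bar> \<le> M * \<delta>\<^sup>2"
    and x: "0 < \<delta>" "x \<in> cbox a b" "x + \<delta> *\<^sub>R axis l 1 \<in> cbox a b" "x - \<delta> *\<^sub>R axis l 1 \<in> cbox a b"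
  shows "\<bar>second_diff l \<delta> u x\<bar> \<le> M * \<delta>\<^sup>2"
proof -
  define c where "c = (1 / 2) *\<^sub>R (a + b)"
  define g where "g t y = (1 - t) *\<^sub>R y + t *\<^sub>R c" for t and y :: "real^'n"
  have g_in: "g t y \<in> box a b" if "y \<in> cbox a b" "0 < t" "t \<le> 1" for t y
  proof -
    have "a $ i < (1 - t) * y $ i + t * ((a $ i + b $ i) / 2)" "(1 - t) * y $ i + t * ((a $ i + b $ i) / 2) < b $ i" for i
    proof -
      have y: "a $ i \<le> y $ i" "y $ i \<le> b $ i" using that by (auto simp: mem_box_cart)
      have "(1 - t) * a $ i \<le> (1 - t) * y $ i" "(1 - t) * y $ i \<le> (1 - t) * b $ i"
        using y that by (auto intro!: mult_left_mono)
      moreover have "t * a $ i < t * ((a $ i + b $ i) / 2)" "t * ((a $ i + b $ i) / 2) < t * b $ i"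
        using ab[of i] that by auto
      moreover have "(1 - t) * a $ i = a $ i - t * a $ i" "(1 - t) * b $ i = b $ i - t * b $ i"
        by (simp_all add: left_diff_distrib)
      ultimately show "a $ i < (1 - t) * y $ i + t * ((a $ i + b $ i) / 2)"
        "(1 - t) * y $ i + t * ((a $ i + b $ i) / 2) < b $ i"
        by linarith+
    qed
    then show ?thesis by (simp add: g_def c_def mem_box_cart)
  qed
  have lim: "((\<lambda>t. u (g t y)) \<longlongrightarrow> u y) (at_right 0)" if "y \<in> cbox a b" for y
  proof -
    have "(u \<longlongrightarrow> u y) (at y within cbox a b)" using cont that by (auto simp: continuous_on_def)
    moreover have "((\<lambda>t. g t y) \<longlongrightarrow> y) (at_right 0)"
      unfolding g_def by (auto intro!: tendsto_eq_intros)
    moreover have "\<forall>\<^sub>F t in at_right 0. g t y \<in> cbox a b"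
      using eventually_at_right[of 0 "1::real"] g_in[OF that] box_subset_cbox[of a b]
      by (auto simp: eventually_at_right_field intro!: exI[of _ 1])
    ultimately show ?thesis
      using continuous_on_tendsto_compose[OF cont] that by blast
  qed
  have gs: "g t (x + s *\<^sub>R axis l 1) = g t x + ((1 - t) * s) *\<^sub>R axis l 1" for t s
    by (simp add: g_def algebra_simps)
  have ev: "\<bar>u (g t (x + \<delta> *\<^sub>R axis l 1)) + u (g t (x - \<delta> *\<^sub>R axis l 1)) - 2 * u (g t x)\<bar> \<le> M * ((1 - t) * \<delta>)\<^sup>2"
    if "0 < t" "t < 1" for t
  proof -
    have "g t x + ((1 - t) * \<delta>) *\<^sub>R axis l 1 \<in> box a b"
      using g_in[OF x(3), of t] gs[of t \<delta>] that by simp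
    moreover have "g t x - ((1 - t) * \<delta>) *\<^sub>R axis l 1 \<in> box a b"
      using g_in[OF x(4), of t] gs[of t "- \<delta>"] that by simp
    ultimately have "\<bar>second_diff l ((1 - t) * \<delta>) u (g t x)\<bar> \<le> M * ((1 - t) * \<delta>)\<^sup>2"
      using that x g_in[OF x(2), of t] by (intro int) auto
    then show ?thesis using gs[of t \<delta>] gs[of t "- \<delta>"] by (simp add: second_diff_def)
  qed
  have "\<bar>u (x + \<delta> *\<^sub>R axis l 1) + u (x - \<delta> *\<^sub>R axis l 1) - 2 * u x\<bar> \<le> M * ((1 - 0) * \<delta>)\<^sup>2"
  proof (rule tendsto_le[of "at_right (0::real)"])
    show "((\<lambda>t. \<bar>u (g t (x + \<delta> *\<^sub>R axis l 1)) + u (g t (x - \<delta> *\<^sub>R axis l 1)) - 2 * u (g t x)\<bar>) \<longlongrightarrow>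
        \<bar>u (x + \<delta> *\<^sub>R axis l 1) + u (x - \<delta> *\<^sub>R axis l 1) - 2 * u x\<bar>) (at_right 0)"
      by (intro tendsto_intros lim x)
    show "((\<lambda>t. M * ((1 - t) * \<delta>)\<^sup>2) \<longlongrightarrow> M * ((1 - 0) * \<delta>)\<^sup>2) (at_right (0::real))"
      by (intro tendsto_intros)
    show "\<forall>\<^sub>F t in at_right 0. \<bar>u (g t (x + \<delta> *\<^sub>R axis l 1)) + u (g t (x - \<delta> *\<^sub>R axis l 1)) - 2 * u (g t x)\<bar> \<le> M * ((1 - t) * \<delta>)\<^sup>2"
      using ev by (auto simp: eventually_at_right_field intro!: exI[of _ 1])
  qed simp
  then show ?thesis by (simp add: second_diff_def)
qed

text \<open>The slopes r(s) = (f s - f 0) / s satisfy |r(t) - r(t/2)| \<le> M t / 4, by the second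
  difference at t/2. Summing over dyadic scales gives at most M s / 2, and the slopes tend to 0 by
  \<open>lim\<close>.\<close>

lemma quadratic_growth_from_second_diff:
  fixes f :: "real \<Rightarrow> real"
  assumes sd: "\<And>s. 0 < s \<Longrightarrow> 2 * s \<le> L \<Longrightarrow> \<bar>f (2 * s) - 2 * f s + f 0\<bar> \<le> M * s\<^sup>2"
    and lim: "((\<lambda>s. (f s - f 0) / s) \<longlongrightarrow> 0) (at_right 0)"
    and s: "0 \<le> s" "s \<le> L"
  shows "\<bar>f s - f 0\<bar> \<le> M * s\<^sup>2"
proof (cases "s = 0")
  case False
  then have s0: "0 < s" using s by simp
  define r where "r s = (f s - f 0) / s" for s
  have half: "\<bar>r t - r (t / 2)\<bar> \<le> M * t / 4" if "0 < t" "t \<le> L" for t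
  proof -
    have "r t - r (t / 2) = (f (2 * (t / 2)) - 2 * f (t / 2) + f 0) / t"
      using that by (simp add: r_def field_simps)
    also have "\<bar>\<dots>\<bar> \<le> M * (t / 2)\<^sup>2 / t"
      using sd[of "t / 2"] that by (simp add: abs_divide divide_right_mono)
    finally show ?thesis using that by (simp add: power2_eq_square)
  qed
  have M: "0 \<le> M" using half[OF s0 s(2)] s0 by (smt (verit) mult_neg_pos zero_le_divide_iff)
  have step: "\<bar>r s - r (s / 2 ^ n)\<bar> \<le> M * s / 2 * (1 - 1 / 2 ^ n)" for n
  proof (induction n)
    case (Suc n)
    have "s / 2 ^ n \<le> s" using s0 by (simp add: field_simps)
    then have "\<bar>r (s / 2 ^ n) - r (s / 2 ^ n / 2)\<bar> \<le> M * (s / 2 ^ n) / 4"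
      using s0 s by (intro half) auto
    moreover have "s / 2 ^ n / 2 = s / 2 ^ Suc n" by simp
    ultimately have "\<bar>r (s / 2 ^ n) - r (s / 2 ^ Suc n)\<bar> \<le> M * (s / 2 ^ n) / 4"
      by (simp only:)
    then have "\<bar>r s - r (s / 2 ^ Suc n)\<bar> \<le> M * s / 2 * (1 - 1 / 2 ^ n) + M * (s / 2 ^ n) / 4"
      using Suc by linarith
    also have "\<dots> = M * s / 2 * (1 - 1 / 2 ^ Suc n)" by (simp add: field_simps)
    finally show ?case .
  qed simp
  have "(\<lambda>n. s * (1 / 2) ^ n) \<longlonglongrightarrow> s * 0"
    by (intro tendsto_intros LIMSEQ_realpow_zero) auto
  then have "(\<lambda>n. s / 2 ^ n) \<longlonglongrightarrow> 0" by (simp add: power_one_over)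
  then have "filterlim (\<lambda>n. s / 2 ^ n) (at_right 0) sequentially"
    using s0 by (auto simp: filterlim_at)
  then have "(\<lambda>n. r (s / 2 ^ n)) \<longlonglongrightarrow> 0"
    using filterlim_compose[OF lim] unfolding r_def by blast
  then have "(\<lambda>n. \<bar>r s - r (s / 2 ^ n)\<bar>) \<longlonglongrightarrow> \<bar>r s - 0\<bar>"
    by (intro tendsto_intros)
  moreover have "\<bar>r s - r (s / 2 ^ n)\<bar> \<le> M * s" for n
  proof -
    have "M * s / 2 * (1 - 1 / 2 ^ n) \<le> M * s / 2 * 1"
      using M s0 by (intro mult_left_mono) auto
    moreover have "0 \<le> M * s" using M s0 by simp
    ultimately show ?thesis using step[of n] by linarith
  qed
  ultimately have "\<bar>r s\<bar> \<le> M * s" using LIMSEQ_le_const2 by fastforce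
  then show ?thesis using s0 by (simp add: r_def abs_divide field_simps power2_eq_square)
qed simp

text \<open>First differences of step \<delta> change by at most M \<delta>^2 when the base point
  moves by \<delta>. Within \<delta> of 0 the quadratic growth bounds them by 5 M \<delta>^2, and at
  most L / \<delta> moves lead there.\<close>

lemma lipschitz_from_second_diff:
  fixes f :: "real \<Rightarrow> real"
  assumes sd: "\<And>s \<delta>. 0 < \<delta> \<Longrightarrow> \<delta> \<le> s \<Longrightarrow> s + \<delta> \<le> L \<Longrightarrow> \<bar>f (s + \<delta>) + f (s - \<delta>) - 2 * f s\<bar> \<le> M * \<delta>\<^sup>2"
    and q: "\<And>s. 0 \<le> s \<Longrightarrow> s \<le> L \<Longrightarrow> \<bar>f s - f 0\<bar> \<le> M * s\<^sup>2" and M: "0 \<le> M"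
    and s: "0 \<le> s" "0 < \<delta>" "s + \<delta> \<le> L"
  shows "\<bar>f (s + \<delta>) - f s\<bar> \<le> 6 * L * M * \<delta>"
proof -
  have ind: "\<bar>f (s + \<delta>) - f s\<bar> \<le> (real n + 5) * M * \<delta>\<^sup>2"
    if "0 \<le> s" "s < (real n + 1) * \<delta>" "s + \<delta> \<le> L" for s n
    using that
  proof (induction n arbitrary: s)
    case 0
    have "\<bar>f (s + \<delta>) - f 0\<bar> \<le> M * (s + \<delta>)\<^sup>2" "\<bar>f s - f 0\<bar> \<le> M * s\<^sup>2"
      using 0 \<open>0 < \<delta>\<close> by (auto intro!: q)
    moreover have "(s + \<delta>)\<^sup>2 \<le> (2 * \<delta>)\<^sup>2" "s\<^sup>2 \<le> \<delta>\<^sup>2"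
      using 0 by (intro power_mono; simp)+
    then have "M * (s + \<delta>)\<^sup>2 \<le> M * (2 * \<delta>)\<^sup>2" "M * s\<^sup>2 \<le> M * \<delta>\<^sup>2"
      using M by (intro mult_left_mono; simp)+
    ultimately show ?case by (simp add: power2_eq_square)
  next
    case (Suc n)
    show ?case
    proof (cases "s < \<delta>")
      case True
      have "\<bar>f (s + \<delta>) - f s\<bar> \<le> (real n + 5) * M * \<delta>\<^sup>2"
        by (rule Suc.IH) (use Suc.prems True \<open>0 < \<delta>\<close> in \<open>auto simp: algebra_simps intro: less_le_trans\<close>)
      also have "\<dots> \<le> (real (Suc n) + 5) * M * \<delta>\<^sup>2"
        using M by (intro mult_right_mono) auto
      finally show ?thesis .
    next
      case False
      have "\<bar>f (s - \<delta> + \<delta>) - f (s - \<delta>)\<bar> \<le> (real n + 5) * M * \<delta>\<^sup>2"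
        by (rule Suc.IH) (use Suc.prems False \<open>0 < \<delta>\<close> in \<open>auto simp: algebra_simps\<close>)
      moreover have "\<bar>f (s + \<delta>) + f (s - \<delta>) - 2 * f s\<bar> \<le> M * \<delta>\<^sup>2"
        using Suc.prems False \<open>0 < \<delta>\<close> by (intro sd) auto
      ultimately show ?thesis by (simp add: algebra_simps)
    qed
  qed
  define n where "n = nat \<lfloor>s / \<delta>\<rfloor>"
  have n: "real n \<le> s / \<delta>" "s / \<delta> < real n + 1"
    using s unfolding n_def by (auto simp: of_nat_nat)
  have "\<bar>f (s + \<delta>) - f s\<bar> \<le> (real n + 5) * M * \<delta>\<^sup>2"
    using s n(2) by (intro ind) (auto simp: field_simps)
  also have "\<dots> = (real n * \<delta> + 5 * \<delta>) * (M * \<delta>)" by (simp add: power2_eq_square algebra_simps)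
  also have "\<dots> \<le> (6 * L) * (M * \<delta>)"
  proof (rule mult_right_mono)
    have "real n * \<delta> \<le> s" using n(1) s by (simp add: field_simps)
    then show "real n * \<delta> + 5 * \<delta> \<le> 6 * L" using s by simp
  qed (use M s in auto)
  finally show ?thesis by (simp add: algebra_simps)
qed

lemma neumann_class_lipschitz:
  fixes a b :: "real^'n"
  assumes u: "neumann_class a b M u" and M: "0 \<le> M"
    and x: "x \<in> cbox a b" "x + \<delta> *\<^sub>R axis l 1 \<in> cbox a b"
  shows "\<bar>u (x + \<delta> *\<^sub>R axis l 1) - u x\<bar> \<le> 6 * (b $ l - a $ l) * M * \<bar>\<delta>\<bar>"
proof -
  have pos: "\<bar>u (x + \<delta> *\<^sub>R axis l 1) - u x\<bar> \<le> 6 * (b $ l - a $ l) * M * \<delta>"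
    if x: "x \<in> cbox a b" "x + \<delta> *\<^sub>R axis l 1 \<in> cbox a b" and \<delta>: "0 < \<delta>" for x \<delta>
  proof -
    define x0 where "x0 = x + (a $ l - x $ l) *\<^sub>R axis l 1"
    have x0: "x0 \<in> cbox a b" "x0 $ l = a $ l"
      using x mem_cbox_shift[OF x(1)] by (auto simp: x0_def axis_def mem_box_cart)
    have in_iff: "x0 + s *\<^sub>R axis l 1 \<in> cbox a b \<longleftrightarrow> 0 \<le> s \<and> s \<le> b $ l - a $ l" for s
      using mem_cbox_shift[OF x0(1)] x0(2) by auto
    let ?f = "\<lambda>s. u (x0 + s *\<^sub>R axis l 1)"
    have "\<bar>?f ((x $ l - a $ l) + \<delta>) - ?f (x $ l - a $ l)\<bar> \<le> 6 * (b $ l - a $ l) * M * \<delta>"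
    proof (rule lipschitz_from_second_diff)
      show "\<bar>?f (s + \<delta>) + ?f (s - \<delta>) - 2 * ?f s\<bar> \<le> M * \<delta>\<^sup>2"
        if "0 < \<delta>" "\<delta> \<le> s" "s + \<delta> \<le> b $ l - a $ l" for s \<delta>
      proof -
        have "\<bar>second_diff l \<delta> u (x0 + s *\<^sub>R axis l 1)\<bar> \<le> M * \<delta>\<^sup>2"
          using u that in_iff[of s] in_iff[of "s + \<delta>"] in_iff[of "s - \<delta>"] unfolding neumann_class_def
          by (auto simp: algebra_simps)
        then show ?thesis by (simp add: second_diff_def algebra_simps)
      qed
      show "\<bar>?f s - ?f 0\<bar> \<le> M * s\<^sup>2" if "0 \<le> s" "s \<le> b $ l - a $ l" for s
        using u x0 that in_iff[of s] unfolding neumann_class_def by auto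
      show "0 \<le> x $ l - a $ l" using x by (auto simp: mem_box_cart)
      show "x $ l - a $ l + \<delta> \<le> b $ l - a $ l"
        using mem_cbox_shift[OF x(1), of \<delta>] x by auto
    qed (use M \<delta> in auto)
    then show ?thesis by (simp add: x0_def algebra_simps)
  qed
  consider "\<delta> = 0" | "0 < \<delta>" | "\<delta> < 0" by linarith
  then show ?thesis
  proof cases
    case 3
    have "\<bar>u ((x + \<delta> *\<^sub>R axis l 1) + (- \<delta>) *\<^sub>R axis l 1) - u (x + \<delta> *\<^sub>R axis l 1)\<bar> \<le> 6 * (b $ l - a $ l) * M * (- \<delta>)"
      by (rule pos) (use x 3 in auto)
    then show ?thesis using 3 by (simp add: abs_minus_commute)
  qed (use pos[OF x] in auto)
qed

text \<open>The second difference of the composition is F'(u) times that of u plus two Taylor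
  remainders, which are quadratic in first differences and hence O(\<delta>^2) by
  \<open>neumann_class_lipschitz\<close>. At a face the Lipschitz bound of F is enough.\<close>

lemma neumann_class_compose:
  fixes a b :: "real^'n"
  assumes u: "neumann_class a b M u" and M: "0 \<le> M" and I: "\<And>x. x \<in> cbox a b \<Longrightarrow> u x \<in> I"
    and F: "\<And>p q. p \<in> I \<Longrightarrow> q \<in> I \<Longrightarrow> \<bar>F p - F q - F' q * (p - q)\<bar> \<le> C2 * (p - q)\<^sup>2"
    and F': "\<And>q. q \<in> I \<Longrightarrow> \<bar>F' q\<bar> \<le> C1" and lip: "\<And>p q. p \<in> I \<Longrightarrow> q \<in> I \<Longrightarrow> \<bar>F p - F q\<bar> \<le> C1 * \<bar>p - q\<bar>"
    and C: "0 \<le> C1" "0 \<le> C2" and L: "\<And>l. b $ l - a $ l \<le> L"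
    and cF: "continuous_on I F"
  shows "neumann_class a b (C1 * M + 2 * C2 * (6 * L * M)\<^sup>2) (\<lambda>x. F (u x))"
  unfolding neumann_class_def
proof (intro conjI allI impI; (elim conjE)?)
  have "continuous_on (cbox a b) u" using u by (simp add: neumann_class_def)
  then show "continuous_on (cbox a b) (\<lambda>x. F (u x))"
    by (rule continuous_on_compose2[OF cF]) (use I in auto)
next
  fix l x \<delta>
  assume A: "0 < \<delta>" "x \<in> cbox a b" "x + \<delta> *\<^sub>R axis l 1 \<in> cbox a b" "x - \<delta> *\<^sub>R axis l 1 \<in> cbox a b"
  let ?p = "u (x + \<delta> *\<^sub>R axis l 1)" and ?r = "u (x - \<delta> *\<^sub>R axis l 1)" and ?q = "u x"
  have sd: "\<bar>?p + ?r - 2 * ?q\<bar> \<le> M * \<delta>\<^sup>2"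
    using u A unfolding neumann_class_def second_diff_def by blast
  have L0: "6 * (b $ l - a $ l) * M * \<delta> \<le> 6 * L * M * \<delta>"
    using L[of l] M A by (intro mult_right_mono) auto
  have sq: "(w - ?q)\<^sup>2 \<le> (6 * L * M * \<delta>)\<^sup>2" if "\<bar>w - ?q\<bar> \<le> 6 * (b $ l - a $ l) * M * \<delta>" for w
    using that L0 by (metis abs_ge_zero order_trans power2_abs power_mono)
  have pq: "(?p - ?q)\<^sup>2 \<le> (6 * L * M * \<delta>)\<^sup>2"
    using neumann_class_lipschitz[OF u M A(2,3)] A by (intro sq) auto
  have rq: "(?r - ?q)\<^sup>2 \<le> (6 * L * M * \<delta>)\<^sup>2"
    using neumann_class_lipschitz[OF u M A(2), of "- \<delta>" l] A by (intro sq) auto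
  have tri: "\<bar>X + Y + Z\<bar> \<le> \<bar>X\<bar> + y + z" if "\<bar>Y\<bar> \<le> y" "\<bar>Z\<bar> \<le> z" for X Y Z y z :: real
    using that by linarith
  have "\<bar>F ?p + F ?r - 2 * F ?q\<bar> =
     \<bar>F' ?q * (?p + ?r - 2 * ?q) + (F ?p - F ?q - F' ?q * (?p - ?q)) + (F ?r - F ?q - F' ?q * (?r - ?q))\<bar>"
    by (rule arg_cong[of _ _ abs]) (simp add: algebra_simps)
  also have "\<dots> \<le> \<bar>F' ?q * (?p + ?r - 2 * ?q)\<bar> + C2 * (?p - ?q)\<^sup>2 + C2 * (?r - ?q)\<^sup>2"
    by (rule tri[OF F[OF I[OF A(3)] I[OF A(2)]] F[OF I[OF A(4)] I[OF A(2)]]])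
  also have "\<dots> \<le> C1 * (M * \<delta>\<^sup>2) + C2 * (6 * L * M * \<delta>)\<^sup>2 + C2 * (6 * L * M * \<delta>)\<^sup>2"
  proof (intro add_mono)
    show "\<bar>F' ?q * (?p + ?r - 2 * ?q)\<bar> \<le> C1 * (M * \<delta>\<^sup>2)"
      unfolding abs_mult using F'[OF I[OF A(2)]] sd C(1) by (intro mult_mono) auto
  qed (use pq rq C(2) in \<open>auto intro: mult_left_mono\<close>)
  also have "\<dots> = (C1 * M + 2 * C2 * (6 * L * M)\<^sup>2) * \<delta>\<^sup>2"
    by (simp add: power2_eq_square algebra_simps)
  finally show "\<bar>second_diff l \<delta> (\<lambda>x. F (u x)) x\<bar> \<le> (C1 * M + 2 * C2 * (6 * L * M)\<^sup>2) * \<delta>\<^sup>2"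
    by (simp add: second_diff_def)
next
  fix l x s
  assume A: "x \<in> cbox a b" "x $ l = a $ l \<or> x $ l = b $ l" "x + s *\<^sub>R axis l 1 \<in> cbox a b"
  have "\<bar>F (u (x + s *\<^sub>R axis l 1)) - F (u x)\<bar> \<le> C1 * \<bar>u (x + s *\<^sub>R axis l 1) - u x\<bar>"
    by (rule lip[OF I[OF A(3)] I[OF A(1)]])
  also have "\<dots> \<le> C1 * (M * s\<^sup>2)"
    using u A C unfolding neumann_class_def by (intro mult_left_mono) auto
  also have "\<dots> \<le> (C1 * M + 2 * C2 * (6 * L * M)\<^sup>2) * s\<^sup>2"
    using C by (simp add: algebra_simps)
  finally show "\<bar>F (u (x + s *\<^sub>R axis l 1)) - F (u x)\<bar> \<le> (C1 * M + 2 * C2 * (6 * L * M)\<^sup>2) * s\<^sup>2" .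
qed

section \<open>Even reflection at the faces\<close>

definition refl_hi :: "real^'n \<Rightarrow> 'n \<Rightarrow> real \<Rightarrow> real^'n \<Rightarrow> real^'n" where
  "refl_hi b l \<delta> x = x + (min (x $ l + \<delta>) (2 * b $ l - \<delta> - x $ l) - x $ l) *\<^sub>R axis l 1"

definition refl_lo :: "real^'n \<Rightarrow> 'n \<Rightarrow> real \<Rightarrow> real^'n \<Rightarrow> real^'n" where
  "refl_lo a l \<delta> x = x + (max (x $ l - \<delta>) (2 * a $ l + \<delta> - x $ l) - x $ l) *\<^sub>R axis l 1"

text \<open>The sum of the values at x + \<delta> and x - \<delta> of the extension of u by even
  reflection. For \<delta> up to the side length, \<open>min\<close> and \<open>max\<close> in
  \<open>refl_hi\<close> and \<open>refl_lo\<close> select the shifted point or its mirror image,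
  whichever lies in the box, so the extension itself is never formed.\<close>

definition even_shift :: "real^'n \<Rightarrow> real^'n \<Rightarrow> 'n \<Rightarrow> real \<Rightarrow> (real^'n \<Rightarrow> real) \<Rightarrow> real^'n \<Rightarrow> real" where
  "even_shift a b l \<delta> u x = u (refl_hi b l \<delta> x) + u (refl_lo a l \<delta> x)"

lemma refl_in_cbox:
  fixes a b :: "real^'n"
  assumes "x \<in> cbox a b" "0 \<le> \<delta>" "\<delta> \<le> b $ l - a $ l"
  shows "refl_hi b l \<delta> x \<in> cbox a b" "refl_lo a l \<delta> x \<in> cbox a b"
proof -
  have "a $ l \<le> x $ l" "x $ l \<le> b $ l" using assms by (auto simp: mem_box_cart)
  then show "refl_hi b l \<delta> x \<in> cbox a b" "refl_lo a l \<delta> x \<in> cbox a b"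
    unfolding refl_hi_def refl_lo_def mem_cbox_shift[OF assms(1)] using assms by auto
qed

lemma continuous_on_even_shift:
  fixes a b :: "real^'n"
  assumes "continuous_on (cbox a b) u" "0 \<le> \<delta>" "\<delta> \<le> b $ l - a $ l"
  shows "continuous_on (cbox a b) (even_shift a b l \<delta> u)"
  unfolding even_shift_def
  by (intro continuous_on_add continuous_on_compose2[OF assms(1)])
     (use refl_in_cbox[OF _ assms(2,3)] in \<open>auto simp: refl_hi_def refl_lo_def intro!: continuous_intros\<close>)

text \<open>Near a face let s be the distance of x to its foot point. The evaluation points lie at
  distances \<delta> + s, \<delta> - s and s from the foot on the same inward ray, and quadratic
  departure gives M (2 \<delta>^2 + 4 s^2) \<le> 6 M \<delta>^2. The bound on 2 \<delta> keeps the
  opposite face out of play.\<close>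

lemma even_shift_neumann:
  fixes a b :: "real^'n"
  assumes u: "neumann_class a b M u" and M: "0 \<le> M" and x: "x \<in> cbox a b"
    and \<delta>: "0 < \<delta>" "2 * \<delta> \<le> b $ l - a $ l"
  shows "\<bar>even_shift a b l \<delta> u x - 2 * u x\<bar> \<le> 6 * M * \<delta>\<^sup>2"
proof -
  let ?e = "axis l 1 :: real^'n"
  have xl: "a $ l \<le> x $ l" "x $ l \<le> b $ l" using x by (auto simp: mem_box_cart)
  have face: "\<bar>u (x0 + s *\<^sub>R ?e) - u x0\<bar> \<le> M * s\<^sup>2"
    if "x0 \<in> cbox a b" "x0 $ l = a $ l \<or> x0 $ l = b $ l" "x0 + s *\<^sub>R ?e \<in> cbox a b" for x0 s
    using u that unfolding neumann_class_def by blast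
  have quad: "\<bar>p + r - 2 * q\<bar> \<le> 6 * M * \<delta>\<^sup>2"
    if "\<bar>p - w\<bar> \<le> M * (\<delta> + s)\<^sup>2" "\<bar>r - w\<bar> \<le> M * (\<delta> - s)\<^sup>2" "\<bar>q - w\<bar> \<le> M * s\<^sup>2" "0 \<le> s" "s \<le> \<delta>" for p q r w s
  proof -
    have "\<bar>p + r - 2 * q\<bar> \<le> M * (\<delta> + s)\<^sup>2 + M * (\<delta> - s)\<^sup>2 + 2 * (M * s\<^sup>2)"
      using that by linarith
    also have "\<dots> = M * (2 * \<delta>\<^sup>2 + 4 * s\<^sup>2)" by (simp add: power2_eq_square algebra_simps)
    also have "\<dots> \<le> M * (2 * \<delta>\<^sup>2 + 4 * \<delta>\<^sup>2)"
      using that M by (intro mult_left_mono add_mono power_mono) auto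
    finally show ?thesis by simp
  qed
  consider (mid) "x $ l + \<delta> \<le> b $ l" "a $ l \<le> x $ l - \<delta>" | (lo) "x $ l - \<delta> < a $ l" | (hi) "b $ l < x $ l + \<delta>"
    by linarith
  then show ?thesis
  proof cases
    case mid
    then have "min (x $ l + \<delta>) (2 * b $ l - \<delta> - x $ l) = x $ l + \<delta>"
      "max (x $ l - \<delta>) (2 * a $ l + \<delta> - x $ l) = x $ l - \<delta>" by auto
    then have "even_shift a b l \<delta> u x - 2 * u x = second_diff l \<delta> u x"
      by (simp add: even_shift_def refl_hi_def refl_lo_def second_diff_def)
    moreover have "\<bar>second_diff l \<delta> u x\<bar> \<le> M * \<delta>\<^sup>2"
      using u x \<delta> mid mem_cbox_shift[OF x, of \<delta> l] mem_cbox_shift[OF x, of "- \<delta>" l] xl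
      unfolding neumann_class_def by auto
    ultimately show ?thesis using M by (simp add: mult_nonneg_nonneg order_trans)
  next
    case lo
    define x0 where "x0 = x + (a $ l - x $ l) *\<^sub>R ?e"
    have x0: "x0 \<in> cbox a b" "x0 $ l = a $ l"
      unfolding x0_def using mem_cbox_shift[OF x] xl by (auto simp: axis_def)
    let ?s = "x $ l - a $ l"
    have "even_shift a b l \<delta> u x = u (x0 + (\<delta> + ?s) *\<^sub>R ?e) + u (x0 + (\<delta> - ?s) *\<^sub>R ?e)"
    proof -
      have m: "min (x $ l + \<delta>) (2 * b $ l - \<delta> - x $ l) = x $ l + \<delta>"
        "max (x $ l - \<delta>) (2 * a $ l + \<delta> - x $ l) = 2 * a $ l + \<delta> - x $ l"
        using lo \<delta> by auto
      have "refl_hi b l \<delta> x = x0 + (\<delta> + ?s) *\<^sub>R ?e" "refl_lo a l \<delta> x = x0 + (\<delta> - ?s) *\<^sub>R ?e"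
        unfolding refl_hi_def refl_lo_def m x0_def by (auto simp: vec_eq_iff axis_def)
      then show ?thesis by (simp add: even_shift_def)
    qed
    moreover have "u x = u (x0 + ?s *\<^sub>R ?e)" by (simp add: x0_def algebra_simps)
    moreover have "\<bar>u (x0 + t *\<^sub>R ?e) - u x0\<bar> \<le> M * t\<^sup>2" if "0 \<le> t" "t \<le> b $ l - a $ l" for t
      by (rule face) (use x0 that mem_cbox_shift[OF x0(1)] in auto)
    ultimately show ?thesis
      using quad[of "u (x0 + (\<delta> + ?s) *\<^sub>R ?e)" "u x0" ?s "u (x0 + (\<delta> - ?s) *\<^sub>R ?e)" "u x"] lo \<delta> xl
      by simp
  next
    case hi
    define x0 where "x0 = x + (b $ l - x $ l) *\<^sub>R ?e"
    have x0: "x0 \<in> cbox a b" "x0 $ l = b $ l"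
      unfolding x0_def using mem_cbox_shift[OF x] xl by (auto simp: axis_def)
    let ?s = "b $ l - x $ l"
    have e1: "even_shift a b l \<delta> u x = u (x0 + (- (\<delta> - ?s)) *\<^sub>R ?e) + u (x0 + (- (\<delta> + ?s)) *\<^sub>R ?e)"
    proof -
      have m: "min (x $ l + \<delta>) (2 * b $ l - \<delta> - x $ l) = 2 * b $ l - \<delta> - x $ l"
        "max (x $ l - \<delta>) (2 * a $ l + \<delta> - x $ l) = x $ l - \<delta>"
        using hi \<delta> by auto
      have "refl_hi b l \<delta> x = x0 + (- (\<delta> - ?s)) *\<^sub>R ?e" "refl_lo a l \<delta> x = x0 + (- (\<delta> + ?s)) *\<^sub>R ?e"
        unfolding refl_hi_def refl_lo_def m x0_def by (auto simp: vec_eq_iff axis_def)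
      then show ?thesis by (simp add: even_shift_def)
    qed
    have e2: "u x = u (x0 + (- ?s) *\<^sub>R ?e)" by (simp add: x0_def algebra_simps)
    have fb: "\<bar>u (x0 + (- t) *\<^sub>R ?e) - u x0\<bar> \<le> M * t\<^sup>2" if "0 \<le> t" "t \<le> b $ l - a $ l" for t
      using face[of x0 "- t"] x0 that mem_cbox_shift[OF x0(1), of "- t" l] by auto
    have "\<bar>u (x0 + (- (\<delta> + ?s)) *\<^sub>R ?e) + u (x0 + (- (\<delta> - ?s)) *\<^sub>R ?e) - 2 * u (x0 + (- ?s) *\<^sub>R ?e)\<bar>
        \<le> 6 * M * \<delta>\<^sup>2"
      by (rule quad[where s = ?s and w = "u x0", OF fb fb fb]) (use hi \<delta> xl in auto)
    then show ?thesis using e1 e2 by linarith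
  qed
qed

text \<open>After extension by zero the even shift is a sum of two translations, inverse to each
  other, and two reflections, each its own inverse; all four preserve Lebesgue measure, so each
  integral can be moved to the other factor.\<close>

lemma even_shift_selfadjoint:
  fixes a b :: "real^'n"
  assumes cu: "continuous_on (cbox a b) u" and cc: "continuous_on (cbox a b) c"
    and \<delta>: "0 < \<delta>" "\<delta> \<le> b $ l - a $ l"
  shows "(LINT x|lebesgue_on (cbox a b). even_shift a b l \<delta> u x * c x) =
    (LINT x|lebesgue_on (cbox a b). u x * even_shift a b l \<delta> c x)"
proof -
  let ?e = "axis l 1 :: real^'n"
  \<comment> \<open>Shifting by \<delta> and then reflecting in the upper face is the reflection in
    the hyperplane \<delta> / 2 below that face; similarly for \<open>Ra\<close>.\<close>
  define Rb where "Rb x = x + (2 * ((b $ l - \<delta> / 2) - x $ l)) *\<^sub>R ?e" for x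
  define Ra where "Ra x = x + (2 * ((a $ l + \<delta> / 2) - x $ l)) *\<^sub>R ?e" for x
  define z where "z w x = indicator (cbox a b) x * w x" for w :: "real^'n \<Rightarrow> real" and x
  define Q where "Q u c x = (z u (x + \<delta> *\<^sub>R ?e) + z u (x + (- \<delta>) *\<^sub>R ?e) + z u (Rb x) + z u (Ra x)) * z c x"
    for u c :: "real^'n \<Rightarrow> real" and x
  have RR: "Rb (Rb x) = x" "Ra (Ra x) = x" for x
    by (auto simp: Rb_def Ra_def axis_def algebra_simps)
  have z_meas: "z w \<in> borel_measurable borel" if "continuous_on (cbox a b) w" for w
    unfolding z_def by (rule borel_measurable_indicator_cbox[OF that])
  have [measurable]: "Rb \<in> borel_measurable borel" "Ra \<in> borel_measurable borel"
    unfolding Rb_def Ra_def by (auto intro!: borel_measurable_continuous_onI continuous_intros)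
  have key: "(LINT x|lebesgue_on (cbox a b). even_shift a b l \<delta> u x * c x) = (LINT x|lborel. Q u c x)"
    if cu: "continuous_on (cbox a b) u" and cc: "continuous_on (cbox a b) c" for u c
  proof -
    have [measurable]: "z u \<in> borel_measurable borel" "z c \<in> borel_measurable borel"
      using z_meas that by auto
    have [measurable]: "z (\<lambda>x. even_shift a b l \<delta> u x * c x) \<in> borel_measurable borel"
      by (rule z_meas) (use continuous_on_even_shift[OF cu] cc \<delta> in \<open>auto intro!: continuous_intros\<close>)
    have "(LINT x|lebesgue_on (cbox a b). even_shift a b l \<delta> u x * c x) =
       (LINT x|lebesgue_on (cbox a b). z (\<lambda>x. even_shift a b l \<delta> u x * c x) x)"
      by (intro Bochner_Integration.integral_cong) (auto simp: z_def)
    also have "\<dots> = (LINT x|lborel. indicator (cbox a b) x * z (\<lambda>x. even_shift a b l \<delta> u x * c x) x)"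
      by (rule integral_lebesgue_on_borel) auto
    also have "\<dots> = (LINT x|lborel. Q u c x)"
    proof (rule integral_cong_AE)
      \<comment> \<open>On these two hyperplanes the shifted point and its mirror image coincide on
        the face and would be counted twice; elsewhere exactly one of them lies in the box.\<close>
      have "AE x in lborel. x \<bullet> ?e \<noteq> b $ l - \<delta>" "AE x in lborel. x \<bullet> ?e \<noteq> a $ l + \<delta>"
        by (auto intro!: AE_lborel_inner_neq simp: axis_in_Basis_iff)
      then show "AE x in lborel. indicator (cbox a b) x * z (\<lambda>x. even_shift a b l \<delta> u x * c x) x = Q u c x"
      proof eventually_elim
        fix x :: "real^'n" assume ne: "x \<bullet> ?e \<noteq> b $ l - \<delta>" "x \<bullet> ?e \<noteq> a $ l + \<delta>"
        show "indicator (cbox a b) x * z (\<lambda>x. even_shift a b l \<delta> u x * c x) x = Q u c x"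
        proof (cases "x \<in> cbox a b")
          case True
          have xl: "a $ l \<le> x $ l" "x $ l \<le> b $ l" using True by (auto simp: mem_box_cart)
          have ne': "x $ l \<noteq> b $ l - \<delta>" "x $ l \<noteq> a $ l + \<delta>" using ne by (auto simp: inner_axis)
          have hi: "z u (x + \<delta> *\<^sub>R ?e) + z u (Rb x) = u (refl_hi b l \<delta> x)"
          proof (cases "x $ l + \<delta> < b $ l")
            case True
            then have "x + \<delta> *\<^sub>R ?e \<in> cbox a b" "Rb x \<notin> cbox a b"
              "min (x $ l + \<delta>) (2 * b $ l - \<delta> - x $ l) = x $ l + \<delta>"
              using xl \<delta> unfolding Rb_def mem_cbox_shift[OF \<open>x \<in> cbox a b\<close>] by auto
            then show ?thesis by (simp add: z_def refl_hi_def)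
          next
            case False
            then have f: "x + \<delta> *\<^sub>R ?e \<notin> cbox a b" "Rb x \<in> cbox a b"
              "min (x $ l + \<delta>) (2 * b $ l - \<delta> - x $ l) = 2 * b $ l - \<delta> - x $ l"
              using xl \<delta> ne' unfolding Rb_def mem_cbox_shift[OF \<open>x \<in> cbox a b\<close>] by auto
            have "Rb x = refl_hi b l \<delta> x" unfolding refl_hi_def f Rb_def by (simp add: algebra_simps)
            then show ?thesis using f by (simp add: z_def)
          qed
          have lo: "z u (x + (- \<delta>) *\<^sub>R ?e) + z u (Ra x) = u (refl_lo a l \<delta> x)"
          proof (cases "a $ l < x $ l - \<delta>")
            case True
            then have "x + (- \<delta>) *\<^sub>R ?e \<in> cbox a b" "Ra x \<notin> cbox a b"
              "max (x $ l - \<delta>) (2 * a $ l + \<delta> - x $ l) = x $ l - \<delta>"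
              using xl \<delta> unfolding Ra_def mem_cbox_shift[OF \<open>x \<in> cbox a b\<close>] by auto
            then show ?thesis by (simp add: z_def refl_lo_def)
          next
            case False
            then have f: "x + (- \<delta>) *\<^sub>R ?e \<notin> cbox a b" "Ra x \<in> cbox a b"
              "max (x $ l - \<delta>) (2 * a $ l + \<delta> - x $ l) = 2 * a $ l + \<delta> - x $ l"
              using xl \<delta> ne' unfolding Ra_def mem_cbox_shift[OF \<open>x \<in> cbox a b\<close>] by auto
            have "Ra x = refl_lo a l \<delta> x" unfolding refl_lo_def f Ra_def by (simp add: algebra_simps)
            then show ?thesis using f by (simp add: z_def)
          qed
          have "Q u c x = ((z u (x + \<delta> *\<^sub>R ?e) + z u (Rb x)) + (z u (x + (- \<delta>) *\<^sub>R ?e) + z u (Ra x))) * z c x"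
            by (simp add: Q_def)
          then show ?thesis unfolding hi lo using True by (simp add: z_def even_shift_def)
        qed (simp add: Q_def z_def)
      qed
    qed (unfold Q_def, measurable)
    finally show ?thesis .
  qed
  have zu[measurable]: "z u \<in> borel_measurable borel" and zc[measurable]: "z c \<in> borel_measurable borel"
    using z_meas cu cc by auto
  obtain Cu where Cu: "0 \<le> Cu" "\<And>x. x \<in> cbox a b \<Longrightarrow> \<bar>u x\<bar> \<le> Cu" using continuous_cbox_bounded[OF cu] by blast
  obtain Cc where Cc: "0 \<le> Cc" "\<And>x. x \<in> cbox a b \<Longrightarrow> \<bar>c x\<bar> \<le> Cc" using continuous_cbox_bounded[OF cc] by blast
  have zuC: "\<bar>z u x\<bar> \<le> Cu" and zcC: "\<bar>z c x\<bar> \<le> Cc" for x using Cu Cc by (auto simp: z_def indicator_def)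
  have int: "integrable lborel (\<lambda>x. z u (f x) * z c x)" "integrable lborel (\<lambda>x. z c (f x) * z u x)"
    if [measurable]: "f \<in> borel_measurable borel" for f
  proof -
    show "integrable lborel (\<lambda>x. z u (f x) * z c x)"
      by (rule integrable_bounded_support[where C = "Cu * Cc" and a = a and b = b])
         (use zuC zcC Cu Cc in \<open>auto simp: abs_mult intro!: mult_mono, auto simp: z_def\<close>)
    show "integrable lborel (\<lambda>x. z c (f x) * z u x)"
      by (rule integrable_bounded_support[where C = "Cc * Cu" and a = a and b = b])
         (use zuC zcC Cu Cc in \<open>auto simp: abs_mult intro!: mult_mono, auto simp: z_def\<close>)
  qed
  have tr: "(LINT x|lborel. z u (x + s *\<^sub>R ?e) * z c x) = (LINT x|lborel. z c (x + (- s) *\<^sub>R ?e) * z u x)" for s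
    using integral_lborel_translate[of "\<lambda>x. z c (x + (- s) *\<^sub>R ?e) * z u x" "s *\<^sub>R ?e"] by (simp add: mult.commute)
  have rb: "(LINT x|lborel. z u (Rb x) * z c x) = (LINT x|lborel. z c (Rb x) * z u x)"
    using integral_lborel_reflect[of "\<lambda>x. z u (Rb x) * z c x" "b $ l - \<delta> / 2" l]
    unfolding Rb_def[symmetric] RR by (simp add: mult.commute)
  have ra: "(LINT x|lborel. z u (Ra x) * z c x) = (LINT x|lborel. z c (Ra x) * z u x)"
    using integral_lborel_reflect[of "\<lambda>x. z u (Ra x) * z c x" "a $ l + \<delta> / 2" l]
    unfolding Ra_def[symmetric] RR by (simp add: mult.commute)
  have "(LINT x|lborel. Q u c x) = (LINT x|lborel. Q c u x)"
    unfolding Q_def distrib_right using tr[of \<delta>] tr[of "- \<delta>"] ra rb by (simp add: int)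
  then show ?thesis using key[OF cu cc] key[OF cc cu] by (simp add: mult.commute)
qed

section \<open>Cosine series on a box\<close>

lemma lambda_eq_axis_sum:
  fixes f :: "real^'n \<Rightarrow> real"
  assumes "bounded_linear f"
  shows "f y = (\<Sum>l\<in>UNIV. f (axis l 1) * y $ l)"
proof -
  interpret bounded_linear f by fact
  have "f y = f (\<Sum>l\<in>UNIV. y $ l *\<^sub>R axis l 1)"
    using basis_expansion[of y] by (simp add: scalar_mult_eq_scaleR)
  then show ?thesis by (simp add: sum scaleR mult.commute)
qed

locale cosine_box =
  fixes a b :: "real^'n"
  assumes ab: "a $ l < b $ l"
begin

abbreviation Q :: "(real^'n) measure" where "Q \<equiv> lebesgue_on (cbox a b)"
abbreviation cc :: "('n \<Rightarrow> nat) \<Rightarrow> real^'n \<Rightarrow> real" where "cc \<equiv> cos_basis a b"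

definition freq :: "('n \<Rightarrow> nat) \<Rightarrow> 'n \<Rightarrow> real" where
  "freq k l = real (k l) * pi / (b $ l - a $ l)"

definition lam :: "('n \<Rightarrow> nat) \<Rightarrow> real" where "lam k = (\<Sum>l\<in>UNIV. (freq k l)\<^sup>2)"

definition vol :: real where "vol = (LINT x|Q. 1)"

definition nrm :: "('n \<Rightarrow> nat) \<Rightarrow> real" where "nrm k = (LINT x|Q. cc k x * cc k x)"

text \<open>Not normalised: the Fourier coefficient is \<open>coef u k / nrm k\<close>.\<close>

definition coef :: "(real^'n \<Rightarrow> real) \<Rightarrow> ('n \<Rightarrow> nat) \<Rightarrow> real" where
  "coef u k = (LINT x|Q. u x * cc k x)"

definition modes :: "('n \<Rightarrow> nat) \<Rightarrow> ('n \<Rightarrow> nat) set" where "modes K = {k. \<forall>l. k l \<le> K l}"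

definition proj :: "('n \<Rightarrow> nat) set \<Rightarrow> (real^'n \<Rightarrow> real) \<Rightarrow> real^'n \<Rightarrow> real" where
  "proj \<Lambda> u x = (\<Sum>k\<in>\<Lambda>. coef u k / nrm k * cc k x)"

lemma len_pos: "0 < b $ l - a $ l" using ab[of l] by simp

lemma cc_eq: "cc k x = (\<Prod>l\<in>UNIV. cos (freq k l * (x $ l - a $ l)))"
  by (simp add: cos_basis_def freq_def)

lemma cont_cc [continuous_intros]: "continuous_on A (cc k)"
  unfolding cc_eq[abs_def] by (intro continuous_intros)

lemma abs_cc_le: "\<bar>cc k x\<bar> \<le> 1"
  unfolding cc_eq abs_prod by (rule prod_le_1) auto

lemma integrable_Q: "continuous_on (cbox a b) (f :: real^'n \<Rightarrow> real) \<Longrightarrow> integrable Q f"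
  by (rule continuous_imp_integrable)

lemma integral_Q_cong: "(\<And>x. x \<in> cbox a b \<Longrightarrow> f x = g x) \<Longrightarrow> (LINT x|Q. f x) = (LINT x|Q. g x)"
  for f g :: "real^'n \<Rightarrow> real"
  by (rule Bochner_Integration.integral_cong) auto

lemma finite_modes: "finite (modes K)"
proof -
  have "modes K = (\<Pi>\<^sub>E l\<in>UNIV. {..K l})" by (auto simp: modes_def PiE_def)
  then show ?thesis by (simp add: finite_PiE)
qed

lemma cc_split: "cc k x = cos (freq k l * (x $ l - a $ l)) * (\<Prod>m\<in>UNIV - {l}. cos (freq k m * (x $ m - a $ m)))"
  unfolding cc_eq by (rule prod.remove) auto

lemma cc_shift: "cc k (x + s *\<^sub>R axis l 1) =
   cos (freq k l * (x $ l + s - a $ l)) * (\<Prod>m\<in>UNIV - {l}. cos (freq k m * (x $ m - a $ m)))"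
  by (subst cc_split[of _ _ l]) (auto simp: axis_def intro!: prod.cong)

lemma cos_periodic_reflect:
  "cos (freq k l * (2 * b $ l - s - a $ l)) = cos (freq k l * (s - a $ l))"
proof -
  have "freq k l * (b $ l - a $ l) = real (k l) * pi"
    using len_pos[of l] by (simp add: freq_def)
  then have "freq k l * (2 * b $ l - s - a $ l) = 2 * (real (k l) * pi) - freq k l * (s - a $ l)"
    by (simp add: algebra_simps)
  then show ?thesis
    using cos_2npi[of "k l"] sin_2npi[of "k l"] by (simp add: cos_diff mult.assoc)
qed

text \<open>Across both faces the cosines are their own even continuation, so reflected points may
  be replaced by shifted ones; the addition theorem then makes each cosine an eigenfunction of the
  even shift.\<close>

lemma cc_even_shift:
  "even_shift a b l \<delta> (cc k) x = 2 * cos (freq k l * \<delta>) * cc k x"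
proof -
  let ?P = "\<Prod>m\<in>UNIV - {l}. cos (freq k m * (x $ m - a $ m))"
  have "cc k (refl_hi b l \<delta> x) = cos (freq k l * (x $ l + \<delta> - a $ l)) * ?P"
    unfolding refl_hi_def cc_shift
    using cos_periodic_reflect[of k l "x $ l + \<delta>"] by (simp add: min_def algebra_simps)
  moreover have "cc k (refl_lo a l \<delta> x) = cos (freq k l * (x $ l - \<delta> - a $ l)) * ?P"
  proof -
    have "cos (freq k l * (2 * a $ l + \<delta> - x $ l - a $ l)) = cos (- (freq k l * (x $ l - \<delta> - a $ l)))"
      by (rule arg_cong[of _ _ cos]) (simp add: algebra_simps)
    then show ?thesis unfolding refl_lo_def cc_shift by (simp add: max_def)
  qed
  moreover have "cos (freq k l * (x $ l + \<delta> - a $ l)) + cos (freq k l * (x $ l - \<delta> - a $ l)) =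
      2 * cos (freq k l * \<delta>) * cos (freq k l * (x $ l - a $ l))"
  proof -
    have "freq k l * (x $ l + \<delta> - a $ l) = freq k l * (x $ l - a $ l) + freq k l * \<delta>"
      "freq k l * (x $ l - \<delta> - a $ l) = freq k l * (x $ l - a $ l) - freq k l * \<delta>"
      by (simp_all add: algebra_simps)
    then show ?thesis by (simp add: cos_add cos_diff)
  qed
  ultimately show ?thesis
    unfolding even_shift_def by (subst (3) cc_split[of _ _ l]) (simp add: distrib_right[symmetric])
qed

lemma coef_even_shift:
  assumes "continuous_on (cbox a b) u" "0 < \<delta>" "\<delta> \<le> b $ l - a $ l"
  shows "coef (even_shift a b l \<delta> u) k = 2 * cos (freq k l * \<delta>) * coef u k"
proof -
  have "(\<lambda>x. u x * even_shift a b l \<delta> (cc k) x) = (\<lambda>x. (2 * cos (freq k l * \<delta>)) * (u x * cc k x))"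
    by (auto simp: cc_even_shift)
  then show ?thesis
    unfolding coef_def even_shift_selfadjoint[OF assms(1) cont_cc assms(2,3), of k]
    by (simp only: integral_mult_right_zero)
qed

text \<open>Eigenfunctions of the self-adjoint even shift with different eigenvalues are orthogonal;
  no integral is computed.\<close>

lemma cc_orthogonal:
  assumes "k \<noteq> k'" shows "(LINT x|Q. cc k x * cc k' x) = 0"
proof -
  obtain l where l: "k l \<noteq> k' l" using assms by auto
  define m where "m = max (k l) (k' l)"
  \<comment> \<open>With this step the eigenvalues are 2 cos(j pi / m) with j \<le> m, and the
    cosine is injective on [0, pi].\<close>
  define \<delta> where "\<delta> = (b $ l - a $ l) / real m"
  have m: "1 \<le> m" "k l \<le> m" "k' l \<le> m" using l by (auto simp: m_def)
  have \<delta>: "0 < \<delta>" "\<delta> \<le> b $ l - a $ l"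
    using m len_pos[of l] divide_left_mono[of 1 "real m" "b $ l - a $ l"] by (auto simp: \<delta>_def)
  have f: "freq j l * \<delta> = real (j l) * (pi / real m)" for j
    using len_pos[of l] m by (simp add: freq_def \<delta>_def)
  have le: "real j * (pi / real m) \<le> pi" if "j \<le> m" for j
  proof -
    have "real j * (pi / real m) \<le> real m * (pi / real m)"
      using that by (intro mult_right_mono) auto
    then show ?thesis using m(1) by simp
  qed
  have "cos (freq k l * \<delta>) \<noteq> cos (freq k' l * \<delta>)"
  proof
    assume "cos (freq k l * \<delta>) = cos (freq k' l * \<delta>)"
    then have e: "cos (real (k l) * (pi / real m)) = cos (real (k' l) * (pi / real m))"
      by (simp only: f)
    have "real (k l) * (pi / real m) = real (k' l) * (pi / real m)"
      by (rule cos_inj_pi[OF _ le[OF m(2)] _ le[OF m(3)] e]) auto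
    then have "real (k l) = real (k' l)" using m(1) by (subst (asm) mult_cancel_right) auto
    then show False using l by simp
  qed
  moreover have "coef (cc k) k' * (2 * cos (freq k l * \<delta>)) = coef (cc k) k' * (2 * cos (freq k' l * \<delta>))"
  proof -
    have "coef (even_shift a b l \<delta> (cc k)) k' = 2 * cos (freq k l * \<delta>) * coef (cc k) k'"
      unfolding coef_def cc_even_shift by (simp add: mult.assoc)
    then show ?thesis using coef_even_shift[OF cont_cc \<delta>, of k k'] by auto
  qed
  ultimately show ?thesis by (simp add: coef_def)
qed

lemma vol_pos: "0 < vol"
proof -
  have "vol = measure lebesgue (cbox a b)" by (simp add: vol_def measure_restrict_space)
  also have "\<dots> = (\<Prod>i\<in>UNIV. b $ i - a $ i)"
    by (subst measure_completion, simp)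
       (rule content_cbox_cart, use ab in \<open>auto simp: set_eq_iff mem_box_cart less_imp_le intro!: exI[of _ a]\<close>)
  finally show ?thesis using len_pos by (auto intro!: prod_pos)
qed

lemma cc_zero: "cc (\<lambda>_. 0) x = 1" by (simp add: cos_basis_def)

lemma integral_cc: "(LINT x|Q. cc k x) = (if k = (\<lambda>_. 0) then vol else 0)"
  using cc_orthogonal[of k "\<lambda>_. 0"] by (auto simp: cc_zero vol_def)

text \<open>Writing each squared cosine as half of one plus the cosine of the doubled angle and
  expanding gives a sum over subsets of doubled modes. Their integrals are 0 or \<open>vol\<close>,
  and the empty subset contributes \<open>vol\<close>.\<close>

lemma nrm_ge: "vol / 2 ^ CARD('n) \<le> nrm k"
proof -
  have e: "cc k x * cc k x = (\<Sum>A\<in>Pow UNIV. cc (\<lambda>l. if l \<in> A then 2 * k l else 0) x) / 2 ^ CARD('n)" for x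
  proof -
    let ?t = "\<lambda>l. freq k l * (x $ l - a $ l)"
    have "cc k x * cc k x = (\<Prod>l\<in>UNIV. (cos (?t l))\<^sup>2)"
      unfolding cc_eq by (simp add: prod.distrib[symmetric] power2_eq_square)
    also have "\<dots> = (\<Prod>l\<in>UNIV. (cos (2 * ?t l) + 1) / 2)"
      by (intro prod.cong refl) (simp only: cos_squared_eq cos_double_cos, simp)
    also have "\<dots> = (\<Prod>l\<in>UNIV. cos (2 * ?t l) + 1) / 2 ^ CARD('n)"
      by (simp add: prod_dividef)
    also have "(\<Prod>l\<in>UNIV. cos (2 * ?t l) + 1) = (\<Sum>A\<in>Pow UNIV. \<Prod>l\<in>A. cos (2 * ?t l))"
      by (subst prod_add) auto
    also have "\<dots> = (\<Sum>A\<in>Pow UNIV. cc (\<lambda>l. if l \<in> A then 2 * k l else 0) x)"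
    proof (rule sum.cong)
      fix A :: "'n set"
      have "(\<Prod>l\<in>A. cos (2 * ?t l)) = (\<Prod>l\<in>UNIV. if l \<in> A then cos (2 * ?t l) else 1)"
        by (simp add: prod.If_cases)
      also have "\<dots> = cc (\<lambda>l. if l \<in> A then 2 * k l else 0) x"
        unfolding cc_eq by (intro prod.cong) (auto simp: freq_def mult.assoc)
      finally show "(\<Prod>l\<in>A. cos (2 * ?t l)) = cc (\<lambda>l. if l \<in> A then 2 * k l else 0) x" .
    qed auto
    finally show ?thesis .
  qed
  have "nrm k = (\<Sum>A\<in>Pow UNIV. LINT x|Q. cc (\<lambda>l. if l \<in> A then 2 * k l else 0) x) / 2 ^ CARD('n)"
    unfolding nrm_def e by (simp add: integrable_Q cont_cc)
  also have "(\<Sum>A\<in>Pow UNIV. LINT x|Q. cc (\<lambda>l. if l \<in> A then 2 * k l else 0) x) \<ge>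
     (\<Sum>A\<in>{{}}. LINT x|Q. cc (\<lambda>l. if l \<in> A then 2 * k l else 0) x)"
    using vol_pos by (intro sum_mono2) (auto simp: integral_cc)
  then have "(\<Sum>A\<in>Pow UNIV. LINT x|Q. cc (\<lambda>l. if l \<in> A then 2 * k l else 0) x) / 2 ^ CARD('n) \<ge> vol / 2 ^ CARD('n)"
    by (intro divide_right_mono) (auto simp: integral_cc)
  finally show ?thesis by simp
qed

lemma nrm_pos: "0 < nrm k"
  using nrm_ge[of k] vol_pos by (meson divide_pos_pos less_le_trans zero_less_numeral zero_less_power)

lemma coef_cc: "coef (cc k) j = (if j = k then nrm k else 0)"
  unfolding coef_def using cc_orthogonal[of k j] by (auto simp: nrm_def)

lemma coef_cmult: "coef (\<lambda>x. c * u x) k = c * coef u k"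
  unfolding coef_def by (simp add: mult.assoc)

lemma coef_diff:
  assumes "continuous_on (cbox a b) u" "continuous_on (cbox a b) v"
  shows "coef (\<lambda>x. u x - v x) k = coef u k - coef v k"
  unfolding coef_def left_diff_distrib
  by (rule Bochner_Integration.integral_diff) (intro integrable_Q continuous_intros assms)+

lemma coef_cong: "(\<And>x. x \<in> cbox a b \<Longrightarrow> u x = v x) \<Longrightarrow> coef u = coef v"
  unfolding coef_def by (auto intro!: integral_Q_cong)

lemma coef_sum_cc:
  assumes "finite \<Lambda>"
  shows "coef (\<lambda>x. \<Sum>k\<in>\<Lambda>. \<alpha> k * cc k x) j = (if j \<in> \<Lambda> then \<alpha> j * nrm j else 0)"
proof -
  have "coef (\<lambda>x. \<Sum>k\<in>\<Lambda>. \<alpha> k * cc k x) j = (\<Sum>k\<in>\<Lambda>. coef (\<lambda>x. \<alpha> k * cc k x) j)"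
    unfolding coef_def sum_distrib_right
    by (rule Bochner_Integration.integral_sum) (intro integrable_Q continuous_intros)
  also have "\<dots> = (\<Sum>k\<in>\<Lambda>. if k = j then \<alpha> k * nrm k else 0)"
    by (intro sum.cong) (auto simp: coef_cmult coef_cc)
  finally show ?thesis using assms by simp
qed

lemma cont_sum_cc: "continuous_on A (\<lambda>x. \<Sum>k\<in>\<Lambda>. \<alpha> k * cc k x)"
  by (intro continuous_intros)

lemma cont_proj: "continuous_on A (proj \<Lambda> u)"
  unfolding proj_def[abs_def] by (rule cont_sum_cc)

lemma integral_mult_sum_cc:
  assumes "continuous_on (cbox a b) u"
  shows "(LINT x|Q. u x * (\<Sum>k\<in>\<Lambda>. \<alpha> k * cc k x)) = (\<Sum>k\<in>\<Lambda>. \<alpha> k * coef u k)"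
proof -
  have "(LINT x|Q. u x * (\<Sum>k\<in>\<Lambda>. \<alpha> k * cc k x)) = (LINT x|Q. (\<Sum>k\<in>\<Lambda>. \<alpha> k * (u x * cc k x)))"
    by (simp add: sum_distrib_left mult.left_commute)
  also have "\<dots> = (\<Sum>k\<in>\<Lambda>. LINT x|Q. \<alpha> k * (u x * cc k x))"
    by (rule Bochner_Integration.integral_sum) (intro integrable_Q continuous_intros assms)
  finally show ?thesis by (simp add: coef_def)
qed

text \<open>Completing the square in each coefficient. Optimal coefficients yield the projection
  error and Bessel's inequality, arbitrary ones the best approximation property.\<close>

lemma square_expand:
  assumes u: "continuous_on (cbox a b) u" and fin: "finite \<Lambda>"
  shows "(LINT x|Q. (u x - (\<Sum>k\<in>\<Lambda>. \<alpha> k * cc k x))\<^sup>2) =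
    (LINT x|Q. (u x)\<^sup>2) - (\<Sum>k\<in>\<Lambda>. (coef u k)\<^sup>2 / nrm k) + (\<Sum>k\<in>\<Lambda>. (\<alpha> k - coef u k / nrm k)\<^sup>2 * nrm k)"
proof -
  let ?p = "\<lambda>x. \<Sum>k\<in>\<Lambda>. \<alpha> k * cc k x"
  have "(LINT x|Q. (u x - ?p x)\<^sup>2) = (LINT x|Q. (u x)\<^sup>2 - 2 * (u x * ?p x) + ?p x * ?p x)"
    by (simp add: power2_eq_square algebra_simps)
  also have "\<dots> = (LINT x|Q. (u x)\<^sup>2) - 2 * (LINT x|Q. u x * ?p x) + (LINT x|Q. ?p x * ?p x)"
  proof -
    have "integrable Q (\<lambda>x. (u x)\<^sup>2)" "integrable Q (\<lambda>x. u x * ?p x)" "integrable Q (\<lambda>x. ?p x * ?p x)"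
      by (intro integrable_Q continuous_intros u)+
    then show ?thesis by simp
  qed
  also have "(LINT x|Q. u x * ?p x) = (\<Sum>k\<in>\<Lambda>. \<alpha> k * coef u k)" by (rule integral_mult_sum_cc[OF u])
  also have "(LINT x|Q. ?p x * ?p x) = (\<Sum>k\<in>\<Lambda>. \<alpha> k * (\<alpha> k * nrm k))"
    by (subst integral_mult_sum_cc[OF cont_sum_cc]) (auto simp: coef_sum_cc[OF fin] intro!: sum.cong)
  also have "(LINT x|Q. (u x)\<^sup>2) - 2 * (\<Sum>k\<in>\<Lambda>. \<alpha> k * coef u k) + (\<Sum>k\<in>\<Lambda>. \<alpha> k * (\<alpha> k * nrm k)) =
     (LINT x|Q. (u x)\<^sup>2) + (\<Sum>k\<in>\<Lambda>. \<alpha> k * (\<alpha> k * nrm k) - 2 * (\<alpha> k * coef u k))"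
    by (simp add: sum_subtractf sum_distrib_left)
  also have "(\<Sum>k\<in>\<Lambda>. \<alpha> k * (\<alpha> k * nrm k) - 2 * (\<alpha> k * coef u k)) =
     (\<Sum>k\<in>\<Lambda>. (\<alpha> k - coef u k / nrm k)\<^sup>2 * nrm k - (coef u k)\<^sup>2 / nrm k)"
  proof (rule sum.cong)
    fix k show "\<alpha> k * (\<alpha> k * nrm k) - 2 * (\<alpha> k * coef u k) = (\<alpha> k - coef u k / nrm k)\<^sup>2 * nrm k - (coef u k)\<^sup>2 / nrm k"
      using nrm_pos[of k] by (simp add: field_simps power2_eq_square)
  qed simp
  finally show ?thesis by (simp add: sum_subtractf)
qed

lemma proj_error:
  assumes "continuous_on (cbox a b) u" "finite \<Lambda>"
  shows "(LINT x|Q. (u x - proj \<Lambda> u x)\<^sup>2) = (LINT x|Q. (u x)\<^sup>2) - (\<Sum>k\<in>\<Lambda>. (coef u k)\<^sup>2 / nrm k)"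
  unfolding proj_def by (subst square_expand[OF assms]) simp

lemma integral_square_nonneg: "0 \<le> (LINT x|Q. (f x)\<^sup>2)" for f :: "real^'n \<Rightarrow> real"
  by (rule integral_nonneg_AE) auto

lemma bessel:
  assumes "continuous_on (cbox a b) u" "finite \<Lambda>"
  shows "(\<Sum>k\<in>\<Lambda>. (coef u k)\<^sup>2 / nrm k) \<le> (LINT x|Q. (u x)\<^sup>2)"
  using proj_error[OF assms] integral_square_nonneg[of "\<lambda>x. u x - proj \<Lambda> u x"] by simp

lemma integral_square_le:
  fixes f :: "real^'n \<Rightarrow> real"
  assumes "continuous_on (cbox a b) f" "\<And>x. x \<in> cbox a b \<Longrightarrow> \<bar>f x\<bar> \<le> B"
  shows "(LINT x|Q. (f x)\<^sup>2) \<le> B\<^sup>2 * vol"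
proof -
  have "(LINT x|Q. (f x)\<^sup>2) \<le> (LINT x|Q. B\<^sup>2 * 1)"
  proof (rule integral_mono)
    fix x assume "x \<in> space Q"
    then have "\<bar>f x\<bar>\<^sup>2 \<le> B\<^sup>2" using assms(2) by (intro power_mono) auto
    then show "(f x)\<^sup>2 \<le> B\<^sup>2 * 1" by simp
  qed (intro integrable_Q continuous_intros assms(1))+
  also have "\<dots> = B\<^sup>2 * vol" unfolding vol_def by (rule integral_mult_right_zero)
  finally show ?thesis .
qed

text \<open>Resolves the definite description: the explicit sum leaves a remainder orthogonal to all
  cosine polynomials, and testing with a single cosine determines every coefficient.\<close>

lemma cos_proj_eq:
  assumes u: "continuous_on (cbox a b) u"
  shows "cos_proj a b K u = proj (modes K) u"
  unfolding cos_proj_def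
proof (rule the_equality)
  have orth: "(LINT x|Q. (u x - (\<Sum>k\<in>modes K. \<alpha> k * cc k x)) * (\<Sum>k\<in>modes K. \<beta> k * cc k x)) =
      (\<Sum>k\<in>modes K. \<beta> k * (coef u k - \<alpha> k * nrm k))" for \<alpha> \<beta>
    by (subst integral_mult_sum_cc)
       (auto intro!: continuous_intros u sum.cong simp: coef_diff[OF u cont_sum_cc] coef_sum_cc[OF finite_modes])
  show "proj (modes K) u \<in> cos_polys a b K \<and>
    (\<forall>q\<in>cos_polys a b K. (LINT x|Q. (u x - proj (modes K) u x) * q x) = 0)"
    unfolding cos_polys_def modes_def[symmetric] proj_def[abs_def]
    using orth[of "\<lambda>k. coef u k / nrm k"] nrm_pos by (fastforce simp: less_imp_neq[symmetric])
  fix g assume g: "g \<in> cos_polys a b K \<and> (\<forall>q\<in>cos_polys a b K. (LINT x|Q. (u x - g x) * q x) = 0)"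
  then obtain \<alpha> where \<alpha>: "g = (\<lambda>x. \<Sum>k\<in>modes K. \<alpha> k * cc k x)"
    unfolding cos_polys_def modes_def by blast
  have "\<alpha> j = coef u j / nrm j" if j: "j \<in> modes K" for j
  proof -
    have mem: "(\<lambda>x. \<Sum>k\<in>modes K. (if k = j then 1 else 0) * cc k x) \<in> cos_polys a b K"
      unfolding cos_polys_def modes_def by (rule CollectI) (rule exI, rule refl)
    have "(LINT x|Q. (u x - (\<Sum>k\<in>modes K. \<alpha> k * cc k x)) *
        (\<Sum>k\<in>modes K. (if k = j then 1 else 0) * cc k x)) = 0"
      using g[THEN conjunct2, rule_format, OF mem] unfolding \<alpha> .
    then have "(\<Sum>k\<in>modes K. (if k = j then 1 else 0) * (coef u k - \<alpha> k * nrm k)) = 0"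
      by (simp only: orth)
    also have "(\<Sum>k\<in>modes K. (if k = j then 1 else 0) * (coef u k - \<alpha> k * nrm k)) =
       (\<Sum>k\<in>modes K. if k = j then coef u k - \<alpha> k * nrm k else 0)" by (intro sum.cong) auto
    finally show ?thesis using j nrm_pos[of j] finite_modes by (simp add: field_simps)
  qed
  then show "g = proj (modes K) u" unfolding \<alpha> proj_def by auto
qed

section \<open>Decay of the cosine coefficients\<close>

lemma second_difference_symbol_limit:
  "((\<lambda>\<delta>. (2 * cos (w * \<delta>) - 2) / \<delta>\<^sup>2) \<longlongrightarrow> - w\<^sup>2) (at_right (0::real))"
proof -
  \<comment> \<open>2 cos(w \<delta>) - 2 is -4 times the squared sine of the half angle, written as
    -w^2 \<delta>^2 times a squared sinc; the value 1 filled in at 0 also covers w = 0.\<close>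
  have "((\<lambda>\<delta>. - w\<^sup>2 * (if w * \<delta> / 2 = 0 then 1 else sin (w * \<delta> / 2) / (w * \<delta> / 2))\<^sup>2) \<longlongrightarrow> - w\<^sup>2 * 1\<^sup>2) (at_right 0)"
  proof (intro tendsto_intros)
    have "isCont (\<lambda>x::real. if x = 0 then 1 else sin x / x) 0"
      using DERIV_sin[of "0::real"] by (simp add: isCont_def DERIV_def cong: LIM_cong)
    then have "((\<lambda>x::real. if x = 0 then 1 else sin x / x) \<longlongrightarrow> 1) (nhds 0)"
      using tendsto_at_iff_tendsto_nhds[of "\<lambda>x::real. if x = 0 then 1 else sin x / x" 0] by (simp add: isCont_def)
    moreover have "((\<lambda>\<delta>. w * \<delta> / 2) \<longlongrightarrow> 0) (at_right 0)"
      by (auto intro!: tendsto_eq_intros)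
    ultimately show "((\<lambda>\<delta>. if w * \<delta> / 2 = 0 then 1 else sin (w * \<delta> / 2) / (w * \<delta> / 2)) \<longlongrightarrow> 1) (at_right 0)"
      by (rule filterlim_compose)
  qed
  then have lim: "((\<lambda>\<delta>. - w\<^sup>2 * (if w * \<delta> / 2 = 0 then 1 else sin (w * \<delta> / 2) / (w * \<delta> / 2))\<^sup>2) \<longlongrightarrow> - w\<^sup>2) (at_right 0)"
    by (simp only: power_one mult_1_right)
  have "- w\<^sup>2 * (if w * \<delta> / 2 = 0 then 1 else sin (w * \<delta> / 2) / (w * \<delta> / 2))\<^sup>2 = (2 * cos (w * \<delta>) - 2) / \<delta>\<^sup>2"
    if "0 < \<delta>" for \<delta>
  proof (cases "w = 0")
    case False
    have "cos (w * \<delta>) = 1 - 2 * (sin (w * \<delta> / 2))\<^sup>2"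
      using cos_double_sin[of "w * \<delta> / 2"] by simp
    then show ?thesis using False that by (simp add: field_simps power2_eq_square)
  qed simp
  then show ?thesis
    by (intro Lim_transform_eventually[OF lim]) (auto intro: eventually_mono[OF eventually_at_right_less])
qed

lemma coef_second_diff:
  assumes "continuous_on (cbox a b) u" "0 < \<delta>" "\<delta> \<le> b $ l - a $ l"
  shows "coef (\<lambda>x. (even_shift a b l \<delta> u x - 2 * u x) / \<delta>\<^sup>2) k = (2 * cos (freq k l * \<delta>) - 2) / \<delta>\<^sup>2 * coef u k"
proof -
  have "coef (\<lambda>x. (1 / \<delta>\<^sup>2) * (even_shift a b l \<delta> u x - 2 * u x)) k =
      (1 / \<delta>\<^sup>2) * (coef (even_shift a b l \<delta> u) k - 2 * coef u k)"
    using assms by (subst coef_cmult, subst coef_diff)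
      (auto intro!: continuous_on_even_shift continuous_intros simp: coef_cmult)
  then show ?thesis unfolding coef_even_shift[OF assms] by (simp add: left_diff_distrib diff_divide_distrib)
qed

lemma eventually_small_shift: "\<forall>\<^sub>F \<delta> in at_right 0. 0 < \<delta> \<and> 2 * \<delta> \<le> b $ l - a $ l"
  using len_pos[of l] unfolding eventually_at_right_field by (intro exI[of _ "(b $ l - a $ l) / 2"]) auto

text \<open>Bessel's inequality for the second difference quotients of the even reflection, which
  are bounded by 6 M uniformly in the step; their coefficients are those of u times a symbol tending
  to minus the squared frequency. The limit is taken inside a finite sum, and Cauchy-Schwarz
  combines the directions.\<close>

lemma coef_decay:
  assumes u: "neumann_class a b M u" and M: "0 \<le> M" and fin: "finite \<Lambda>"
  shows "(\<Sum>k\<in>\<Lambda>. (lam k)\<^sup>2 * (coef u k)\<^sup>2 / nrm k) \<le> (6 * real CARD('n) * M)\<^sup>2 * vol"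
proof -
  have cu: "continuous_on (cbox a b) u" using u by (simp add: neumann_class_def)
  have dir: "(\<Sum>k\<in>\<Lambda>. ((freq k l)\<^sup>2)\<^sup>2 * (coef u k)\<^sup>2 / nrm k) \<le> (6 * M)\<^sup>2 * vol" for l
  proof (rule tendsto_upperbound)
    show "((\<lambda>\<delta>. \<Sum>k\<in>\<Lambda>. ((2 * cos (freq k l * \<delta>) - 2) / \<delta>\<^sup>2)\<^sup>2 * (coef u k)\<^sup>2 / nrm k) \<longlongrightarrow>
       (\<Sum>k\<in>\<Lambda>. ((freq k l)\<^sup>2)\<^sup>2 * (coef u k)\<^sup>2 / nrm k)) (at_right 0)"
    proof (intro tendsto_sum tendsto_divide tendsto_mult tendsto_const)
      fix k
      show "((\<lambda>\<delta>. ((2 * cos (freq k l * \<delta>) - 2) / \<delta>\<^sup>2)\<^sup>2) \<longlongrightarrow> ((freq k l)\<^sup>2)\<^sup>2) (at_right 0)"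
        using tendsto_power[OF second_difference_symbol_limit[of "freq k l"], of 2] by simp
      show "nrm k \<noteq> 0" using nrm_pos[of k] by simp
    qed
    show "\<forall>\<^sub>F \<delta> in at_right 0. (\<Sum>k\<in>\<Lambda>. ((2 * cos (freq k l * \<delta>) - 2) / \<delta>\<^sup>2)\<^sup>2 * (coef u k)\<^sup>2 / nrm k) \<le> (6 * M)\<^sup>2 * vol"
      using eventually_small_shift[of l]
    proof eventually_elim
      case (elim \<delta>)
      let ?v = "\<lambda>x. (even_shift a b l \<delta> u x - 2 * u x) / \<delta>\<^sup>2"
      have \<delta>: "0 < \<delta>" "\<delta> \<le> b $ l - a $ l" using elim by auto
      have cv: "continuous_on (cbox a b) ?v"
        using \<delta> by (intro continuous_intros continuous_on_even_shift cu) auto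
      have "(\<Sum>k\<in>\<Lambda>. ((2 * cos (freq k l * \<delta>) - 2) / \<delta>\<^sup>2)\<^sup>2 * (coef u k)\<^sup>2 / nrm k) = (\<Sum>k\<in>\<Lambda>. (coef ?v k)\<^sup>2 / nrm k)"
        unfolding coef_second_diff[OF cu \<delta>] power_mult_distrib ..
      also have "\<dots> \<le> (LINT x|Q. (?v x)\<^sup>2)" by (rule bessel[OF cv fin])
      also have "\<dots> \<le> (6 * M)\<^sup>2 * vol"
      proof (rule integral_square_le[OF cv])
        fix x assume "x \<in> cbox a b"
        from even_shift_neumann[OF u M this, of \<delta> l] elim
        show "\<bar>?v x\<bar> \<le> 6 * M" by (simp add: abs_divide field_simps)
      qed
      finally show ?case .
    qed
  qed simp
  have lam2: "(lam k)\<^sup>2 \<le> real CARD('n) * (\<Sum>l\<in>UNIV. ((freq k l)\<^sup>2)\<^sup>2)" for k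
    using sum_squared_le_sum_of_squares[of "\<lambda>l. (freq k l)\<^sup>2" UNIV] unfolding lam_def by (simp add: mult.commute)
  have "(\<Sum>k\<in>\<Lambda>. (lam k)\<^sup>2 * (coef u k)\<^sup>2 / nrm k) \<le>
      (\<Sum>k\<in>\<Lambda>. (real CARD('n) * (\<Sum>l\<in>UNIV. ((freq k l)\<^sup>2)\<^sup>2)) * (coef u k)\<^sup>2 / nrm k)"
    using lam2 nrm_pos by (intro sum_mono divide_right_mono mult_right_mono) (auto simp: less_imp_le)
  also have "\<dots> = real CARD('n) * (\<Sum>l\<in>UNIV. \<Sum>k\<in>\<Lambda>. ((freq k l)\<^sup>2)\<^sup>2 * (coef u k)\<^sup>2 / nrm k)"
    by (subst sum.swap) (simp add: sum_distrib_left sum_distrib_right sum_divide_distrib mult.assoc)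
  also have "\<dots> \<le> real CARD('n) * (\<Sum>l\<in>(UNIV::'n set). (6 * M)\<^sup>2 * vol)"
    by (intro mult_left_mono sum_mono dir) auto
  finally show ?thesis by (simp add: power2_eq_square algebra_simps)
qed

section \<open>Density of cosine polynomials\<close>

inductive_set cos_span :: "(real^'n \<Rightarrow> real) set" where
  basis: "cc k \<in> cos_span"
| scale: "f \<in> cos_span \<Longrightarrow> (\<lambda>x. c * f x) \<in> cos_span"
| add: "f \<in> cos_span \<Longrightarrow> g \<in> cos_span \<Longrightarrow> (\<lambda>x. f x + g x) \<in> cos_span"

lemma cos_span_repr:
  "f \<in> cos_span \<Longrightarrow> \<exists>\<Lambda> \<alpha>. finite \<Lambda> \<and> f = (\<lambda>x. \<Sum>k\<in>\<Lambda>. \<alpha> k * cc k x)"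
proof (induction rule: cos_span.induct)
  case (basis k)
  show ?case by (intro exI[of _ "{k}"] exI[of _ "\<lambda>_. 1"]) simp
next
  case (scale f c)
  then obtain \<Lambda> \<alpha> where "finite \<Lambda>" "f = (\<lambda>x. \<Sum>k\<in>\<Lambda>. \<alpha> k * cc k x)" by blast
  then show ?case by (intro exI[of _ \<Lambda>] exI[of _ "\<lambda>k. c * \<alpha> k"]) (simp add: sum_distrib_left mult.assoc)
next
  case (add f g)
  then obtain \<Lambda> \<alpha> \<Lambda>' \<beta> where fg: "finite \<Lambda>" "f = (\<lambda>x. \<Sum>k\<in>\<Lambda>. \<alpha> k * cc k x)"
    "finite \<Lambda>'" "g = (\<lambda>x. \<Sum>k\<in>\<Lambda>'. \<beta> k * cc k x)" by blast
  have "(\<Sum>k\<in>\<Lambda>. \<alpha> k * cc k x) = (\<Sum>k\<in>\<Lambda> \<union> \<Lambda>'. (if k \<in> \<Lambda> then \<alpha> k else 0) * cc k x)"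
    "(\<Sum>k\<in>\<Lambda>'. \<beta> k * cc k x) = (\<Sum>k\<in>\<Lambda> \<union> \<Lambda>'. (if k \<in> \<Lambda>' then \<beta> k else 0) * cc k x)" for x
    using fg by (auto intro!: sum.mono_neutral_cong_left)
  then have "(\<lambda>x. f x + g x) = (\<lambda>x. \<Sum>k\<in>\<Lambda> \<union> \<Lambda>'. ((if k \<in> \<Lambda> then \<alpha> k else 0) + (if k \<in> \<Lambda>' then \<beta> k else 0)) * cc k x)"
    unfolding fg by (simp add: sum.distrib distrib_right)
  then show ?case
    by (intro exI[of _ "\<Lambda> \<union> \<Lambda>'"] exI[of _ "\<lambda>k. (if k \<in> \<Lambda> then \<alpha> k else 0) + (if k \<in> \<Lambda>' then \<beta> k else 0)"] conjI finite_UnI fg(1,3))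
qed

text \<open>Product-to-sum: multiplying by the first cosine in direction l gives the mean of the two
  neighbouring modes.\<close>

lemma cos_span_mult_coordinate:
  "f \<in> cos_span \<Longrightarrow> (\<lambda>x. cos (pi * (x $ l - a $ l) / (b $ l - a $ l)) * f x) \<in> cos_span"
proof (induction rule: cos_span.induct)
  case (basis k)
  define k1 where "k1 = k(l := k l + 1)"
  \<comment> \<open>For \<open>k l = 0\<close> the lower neighbour has frequency -1, which the even
    cosine identifies with 1.\<close>
  define k2 where "k2 = k(l := (if k l = 0 then 1 else k l - 1))"
  have "cos (pi * (x $ l - a $ l) / (b $ l - a $ l)) * cc k x = (1 / 2) * cc k1 x + (1 / 2) * cc k2 x" for x
  proof -
    let ?t = "pi * (x $ l - a $ l) / (b $ l - a $ l)"
    let ?P = "\<Prod>m\<in>UNIV - {l}. cos (freq k m * (x $ m - a $ m))"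
    have e: "freq j l * (x $ l - a $ l) = real (j l) * ?t" for j by (simp add: freq_def)
    have P: "(\<Prod>m\<in>UNIV - {l}. cos (freq k1 m * (x $ m - a $ m))) = ?P"
      "(\<Prod>m\<in>UNIV - {l}. cos (freq k2 m * (x $ m - a $ m))) = ?P"
      by (auto intro!: prod.cong simp: freq_def k1_def k2_def)
    have 1: "cos (real (k1 l) * ?t) = cos (real (k l) * ?t + ?t)" 
      by (simp only: k1_def fun_upd_same of_nat_add of_nat_1 distrib_right mult_1_left)
    have 2: "cos (real (k2 l) * ?t) = cos (real (k l) * ?t - ?t)"
    proof (cases "k l = 0")
      case False
      then have "real (k2 l) = real (k l) - 1" by (simp add: k2_def of_nat_diff)
      then show ?thesis by (simp only: left_diff_distrib mult_1_left)
    qed (simp add: k2_def)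
    have "cos ?t * (cos (real (k l) * ?t) * ?P) =
        (1 / 2) * (cos (real (k1 l) * ?t) * ?P) + (1 / 2) * (cos (real (k2 l) * ?t) * ?P)"
      unfolding 1 2 cos_add cos_diff by (simp add: algebra_simps)
    then show ?thesis
      unfolding cc_split[of k x l] cc_split[of k1 x l] cc_split[of k2 x l] e P .
  qed
  then have "(\<lambda>x. cos (pi * (x $ l - a $ l) / (b $ l - a $ l)) * cc k x) = (\<lambda>x. (1 / 2) * cc k1 x + (1 / 2) * cc k2 x)"
    by blast
  then show ?case by (simp only:) (intro cos_span.intros)
next
  case (scale f c)
  then show ?case using cos_span.scale[OF scale.IH, of c] by (simp add: mult.left_commute)
next
  case (add f g)
  then show ?case using cos_span.add[OF add.IH] by (simp add: distrib_left)
qed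

text \<open>The polynomial acts on an arbitrary f of the span, so that a product of polynomials is
  just two multiplications in succession.\<close>

lemma cos_span_polynomial:
  assumes "real_polynomial_function g"
  shows "f \<in> cos_span \<Longrightarrow> (\<lambda>x. g (\<chi> l. cos (pi * (x $ l - a $ l) / (b $ l - a $ l))) * f x) \<in> cos_span"
  using assms
proof (induction arbitrary: f rule: real_polynomial_function.induct)
  case (linear h)
  have "(\<lambda>x. \<Sum>l\<in>A. h (axis l 1) * (cos (pi * (x $ l - a $ l) / (b $ l - a $ l)) * f x)) \<in> cos_span" for A
  proof (induction A rule: infinite_finite_induct)
    case (insert l A)
    then show ?case
      using cos_span.add[OF cos_span.scale[OF cos_span_mult_coordinate[OF linear(2)]] insert(3), of "h (axis l 1)" l]
      by simp
  qed (use cos_span.scale[OF cos_span.basis, of 0] in auto)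
  moreover have "h (\<chi> l. cos (pi * (x $ l - a $ l) / (b $ l - a $ l))) =
     (\<Sum>l\<in>UNIV. h (axis l 1) * cos (pi * (x $ l - a $ l) / (b $ l - a $ l)))" for x :: "real^'n"
    using lambda_eq_axis_sum[OF linear(1), of "\<chi> l. cos (pi * (x $ l - a $ l) / (b $ l - a $ l))"] by simp
  ultimately show ?case by (simp only: sum_distrib_right mult.assoc)
next
  case (const c)
  then show ?case by (rule cos_span.scale)
next
  case (add g h)
  then show ?case using cos_span.add[OF add(3)[OF add(5)] add(4)[OF add(5)]] by (simp add: distrib_right)
next
  case (mult g h)
  then show ?case using mult(3)[OF mult(4)[OF mult(5)]] by (simp add: mult.assoc)
qed

text \<open>The coordinates cos(pi (x - a) / (b - a)) map the box homeomorphically onto a cube with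
  sides [-1, 1], where Stone-Weierstrass supplies a polynomial; pulled back, it is a cosine
  polynomial.\<close>

lemma cos_approximation:
  assumes u: "continuous_on (cbox a b) u" and e: "0 < e"
  obtains \<Lambda> \<alpha> where "finite \<Lambda>" "\<And>x. x \<in> cbox a b \<Longrightarrow> \<bar>u x - (\<Sum>k\<in>\<Lambda>. \<alpha> k * cc k x)\<bar> \<le> e"
proof -
  let ?X = "\<lambda>y::real^'n. \<chi> l. a $ l + (b $ l - a $ l) / pi * arccos (y $ l)"
  let ?Y = "\<lambda>x::real^'n. \<chi> l. cos (pi * (x $ l - a $ l) / (b $ l - a $ l))"
  let ?C = "cbox (- 1) 1 :: (real^'n) set"
  have X_in: "?X y \<in> cbox a b" if "y \<in> ?C" for y
  proof -
    have "0 \<le> arccos (y $ l)" "arccos (y $ l) \<le> pi" for l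
      using that by (auto simp: mem_box_cart intro: arccos_lbound arccos_ubound)
    then have "0 \<le> (b $ l - a $ l) * arccos (y $ l) / pi \<and> (b $ l - a $ l) * arccos (y $ l) / pi \<le> b $ l - a $ l" for l
      using len_pos[of l] by (auto simp: pos_divide_le_eq intro!: mult_left_mono divide_nonneg_pos mult_nonneg_nonneg)
    then show ?thesis by (auto simp: mem_box_cart) (metis le_diff_eq add.commute)
  qed
  have "continuous_on ?C (\<lambda>y. u (?X y))"
    by (rule continuous_on_compose2[OF u])
       (use X_in in \<open>auto intro!: continuous_intros simp: mem_box_cart\<close>)
  then obtain g where g: "real_polynomial_function g" "\<And>y. y \<in> ?C \<Longrightarrow> \<bar>u (?X y) - g y\<bar> < e"
    using Stone_Weierstrass_real_polynomial_function[OF compact_cbox _ e] by blast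
  have "(\<lambda>x. g (?Y x) * cc (\<lambda>_. 0) x) \<in> cos_span"
    by (rule cos_span_polynomial[OF g(1) cos_span.basis])
  then obtain \<Lambda> \<alpha> where r: "finite \<Lambda>" "(\<lambda>x. g (?Y x) * cc (\<lambda>_. 0) x) = (\<lambda>x. \<Sum>k\<in>\<Lambda>. \<alpha> k * cc k x)"
    using cos_span_repr by blast
  have "\<bar>u x - (\<Sum>k\<in>\<Lambda>. \<alpha> k * cc k x)\<bar> \<le> e" if x: "x \<in> cbox a b" for x
  proof -
    have "?X (?Y x) = x"
    proof (subst vec_eq_iff, rule)
      fix l
      have "0 \<le> x $ l - a $ l" "x $ l - a $ l \<le> b $ l - a $ l" using x by (auto simp: mem_box_cart)
      then have "0 \<le> pi * (x $ l - a $ l) / (b $ l - a $ l)" "pi * (x $ l - a $ l) / (b $ l - a $ l) \<le> pi"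
        using len_pos[of l] by (auto simp: field_simps)
      then have "arccos (cos (pi * (x $ l - a $ l) / (b $ l - a $ l))) = pi * (x $ l - a $ l) / (b $ l - a $ l)"
        by (rule arccos_cos)
      then show "?X (?Y x) $ l = x $ l" using len_pos[of l] by simp
    qed
    moreover have "?Y x \<in> ?C" by (simp add: mem_box_cart)
    ultimately have "\<bar>u x - g (?Y x)\<bar> < e" using g(2)[of "?Y x"] by simp
    then show ?thesis using fun_cong[OF r(2), of x] by (simp add: cc_zero)
  qed
  then show ?thesis using r(1) that by blast
qed

text \<open>Instead of Parseval, a uniform cosine approximation provides a finite set \<Lambda>1
  that captures the square integral up to e. Modes outside \<Lambda> have \<open>lam\<close> at
  least m, so their share is at most 1 / m^2 times the sum in \<open>coef_decay\<close>.\<close>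

lemma projection_error_bound:
  assumes u: "neumann_class a b M u" and M: "0 \<le> M"
    and fin: "finite \<Lambda>" and low: "\<And>k. k \<notin> \<Lambda> \<Longrightarrow> m \<le> lam k" and m: "0 < m"
  shows "(LINT x|Q. (u x - proj \<Lambda> u x)\<^sup>2) \<le> (6 * real CARD('n) * M)\<^sup>2 * vol / m\<^sup>2"
proof (rule field_le_epsilon)
  have cu: "continuous_on (cbox a b) u" using u by (simp add: neumann_class_def)
  fix e :: real assume e: "0 < e"
  \<comment> \<open>A uniform error e' costs e'^2 times the volume in the square integral, which is
    e.\<close>
  define e' where "e' = sqrt (e / vol)"
  have e': "0 < e'" "e'\<^sup>2 * vol = e" using e vol_pos by (auto simp: e'_def)
  obtain \<Lambda>1 \<alpha> where app: "finite \<Lambda>1" "\<And>x. x \<in> cbox a b \<Longrightarrow> \<bar>u x - (\<Sum>k\<in>\<Lambda>1. \<alpha> k * cc k x)\<bar> \<le> e'"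
    using cos_approximation[OF cu e'(1)] by blast
  have "(LINT x|Q. (u x)\<^sup>2) - (\<Sum>k\<in>\<Lambda>1. (coef u k)\<^sup>2 / nrm k) \<le> (LINT x|Q. (u x - (\<Sum>k\<in>\<Lambda>1. \<alpha> k * cc k x))\<^sup>2)"
    unfolding square_expand[OF cu app(1)] using nrm_pos
    by (simp add: sum_nonneg less_imp_le)
  also have "\<dots> \<le> e'\<^sup>2 * vol"
    by (rule integral_square_le) (auto intro!: continuous_intros cu app)
  finally have 1: "(LINT x|Q. (u x)\<^sup>2) \<le> (\<Sum>k\<in>\<Lambda>1. (coef u k)\<^sup>2 / nrm k) + e" using e' by simp
  also have "(\<Sum>k\<in>\<Lambda>1. (coef u k)\<^sup>2 / nrm k) \<le> (\<Sum>k\<in>\<Lambda> \<union> \<Lambda>1. (coef u k)\<^sup>2 / nrm k)"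
    using app(1) fin nrm_pos by (intro sum_mono2) (auto simp: less_imp_le)
  also have "\<dots> = (\<Sum>k\<in>\<Lambda>. (coef u k)\<^sup>2 / nrm k) + (\<Sum>k\<in>\<Lambda>1 - \<Lambda>. (coef u k)\<^sup>2 / nrm k)"
    using app(1) fin by (subst Un_Diff_cancel[symmetric], subst sum.union_disjoint) auto
  also have "(\<Sum>k\<in>\<Lambda>1 - \<Lambda>. (coef u k)\<^sup>2 / nrm k) \<le> (\<Sum>k\<in>\<Lambda>1 - \<Lambda>. ((lam k)\<^sup>2 * (coef u k)\<^sup>2 / nrm k) / m\<^sup>2)"
  proof (rule sum_mono)
    fix k assume "k \<in> \<Lambda>1 - \<Lambda>"
    then have "m\<^sup>2 \<le> (lam k)\<^sup>2" using low m by (intro power_mono) auto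
    then have "m\<^sup>2 * ((coef u k)\<^sup>2 / nrm k) \<le> (lam k)\<^sup>2 * ((coef u k)\<^sup>2 / nrm k)"
      using nrm_pos[of k] by (intro mult_right_mono) auto
    then show "(coef u k)\<^sup>2 / nrm k \<le> ((lam k)\<^sup>2 * (coef u k)\<^sup>2 / nrm k) / m\<^sup>2"
      using m by (subst pos_le_divide_eq) (simp_all add: mult.commute[of _ "m\<^sup>2"])
  qed
  also have "\<dots> = (\<Sum>k\<in>\<Lambda>1 - \<Lambda>. (lam k)\<^sup>2 * (coef u k)\<^sup>2 / nrm k) / m\<^sup>2" by (rule sum_divide_distrib[symmetric])
  also have "\<dots> \<le> (6 * real CARD('n) * M)\<^sup>2 * vol / m\<^sup>2"
    by (intro divide_right_mono coef_decay[OF u M]) (use app in auto)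
  finally show "(LINT x|Q. (u x - proj \<Lambda> u x)\<^sup>2) \<le> (6 * real CARD('n) * M)\<^sup>2 * vol / m\<^sup>2 + e"
    unfolding proj_error[OF cu fin] by simp
qed

end

section \<open>Cosine coefficients of weak Laplacians\<close>

lemma smooth_deriv_support:
  fixes f :: "real \<Rightarrow> real"
  assumes "smooth_real f" "\<And>s. f s \<noteq> 0 \<Longrightarrow> \<alpha> \<le> s \<and> s \<le> \<beta>" "deriv f s \<noteq> 0"
  shows "\<alpha> \<le> s \<and> s \<le> \<beta>"
proof (rule ccontr)
  assume out: "\<not> (\<alpha> \<le> s \<and> s \<le> \<beta>)"
  have "((\<lambda>_. 0) has_real_derivative 0) (at s)" by simp
  then have "(f has_real_derivative 0) (at s)"
    by (rule has_field_derivative_transform_within_open[of _ _ _ "- {\<alpha>..\<beta>}"]) (use out assms(2) in auto)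
  then show False using DERIV_imp_deriv assms(3) by blast
qed

text \<open>Cauchy's mean value theorem compares f(s + t) + f(s - t) with t^2, and an ordinary mean
  value step on [s - c, s + c] produces the second derivative.\<close>

lemma second_difference_quotient_mvt:
  assumes f: "smooth_real f" and \<delta>: "0 < \<delta>"
  shows "\<exists>\<xi>. \<bar>\<xi> - s\<bar> < \<delta> \<and> f (s + \<delta>) + f (s - \<delta>) - 2 * f s = \<delta>\<^sup>2 * deriv (deriv f) \<xi>"
proof -
  define g where "g t = f (s + t) + f (s - t)" for t
  have dg: "(g has_real_derivative (deriv f (s + t) - deriv f (s - t))) (at t)" for t
  proof -
    have "((\<lambda>t. f (s + t)) has_real_derivative deriv f (s + t) * 1) (at t)"
      by (rule DERIV_chain2[OF smooth_real_has_deriv[OF f]]) (auto intro!: derivative_eq_intros)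
    moreover have "((\<lambda>t. f (s - t)) has_real_derivative deriv f (s - t) * (-1)) (at t)"
      by (rule DERIV_chain2[OF smooth_real_has_deriv[OF f]]) (auto intro!: derivative_eq_intros)
    ultimately have "(g has_real_derivative (deriv f (s + t) * 1 + deriv f (s - t) * (-1))) (at t)"
      unfolding g_def by (rule DERIV_add)
    then show ?thesis by simp
  qed
  have d2: "((\<lambda>t. t\<^sup>2) has_real_derivative 2 * t) (at t)" for t :: real
    by (auto intro!: derivative_eq_intros)
  have "\<exists>c. 0 < c \<and> c < \<delta> \<and> (g \<delta> - g 0) * (2 * c) = (\<delta>\<^sup>2 - 0\<^sup>2) * (deriv f (s + c) - deriv f (s - c))"
    by (rule GMVT'[OF \<delta> DERIV_isCont[OF dg] DERIV_isCont[OF d2] d2 dg])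
  then obtain c where c: "0 < c" "c < \<delta>" "(g \<delta> - g 0) * (2 * c) = \<delta>\<^sup>2 * (deriv f (s + c) - deriv f (s - c))"
    by auto
  obtain \<xi> where \<xi>: "s - c < \<xi>" "\<xi> < s + c" "deriv f (s + c) - deriv f (s - c) = (s + c - (s - c)) * deriv (deriv f) \<xi>"
    using MVT2[of "s - c" "s + c" "deriv f" "deriv (deriv f)", OF _ smooth_real_has_deriv[OF smooth_real_deriv[OF f]]] c(1)
    by auto
  have "(g \<delta> - g 0) * (2 * c) = (\<delta>\<^sup>2 * deriv (deriv f) \<xi>) * (2 * c)"
    using c(3) unfolding \<xi>(3) by simp
  then have "g \<delta> - g 0 = \<delta>\<^sup>2 * deriv (deriv f) \<xi>" using c(1) by simp
  then show ?thesis using \<xi> c by (intro exI[of _ \<xi>]) (auto simp: g_def)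
qed

text \<open>A rising and a falling step, centred at distance 2 \<epsilon> from the ends and of
  half-width \<epsilon>; hence the plateau starts at distance 3 \<epsilon>.\<close>

lemma cutoff_1d:
  assumes "0 < \<epsilon>"
  shows "\<exists>\<eta>. smooth_real \<eta> \<and> (\<forall>s. 0 \<le> \<eta> s \<and> \<eta> s \<le> 1) \<and> (\<forall>s. \<eta> s \<noteq> 0 \<longrightarrow> \<alpha> + \<epsilon> \<le> s \<and> s \<le> \<beta> - \<epsilon>) \<and>
    (\<forall>s. \<alpha> + 3 * \<epsilon> \<le> s \<and> s \<le> \<beta> - 3 * \<epsilon> \<longrightarrow> \<eta> s = (1::real))"
proof -
  obtain B1 where B1: "smooth_real B1" "mono B1" "\<And>s. s \<le> \<alpha> + 2 * \<epsilon> - \<epsilon> \<Longrightarrow> B1 s = 0" "\<And>s. s \<ge> \<alpha> + 2 * \<epsilon> + \<epsilon> \<Longrightarrow> B1 s = 1"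
    using mollifier_1d[OF assms, of "\<alpha> + 2 * \<epsilon>"] by blast
  obtain B2 where B2: "smooth_real B2" "mono B2" "\<And>s. s \<le> \<beta> - 2 * \<epsilon> - \<epsilon> \<Longrightarrow> B2 s = 0" "\<And>s. s \<ge> \<beta> - 2 * \<epsilon> + \<epsilon> \<Longrightarrow> B2 s = 1"
    using mollifier_1d[OF assms, of "\<beta> - 2 * \<epsilon>"] by blast
  have r1: "0 \<le> B1 s" "B1 s \<le> 1" for s
    using monoD[OF B1(2), of "min s (\<alpha> + \<epsilon>)" s] monoD[OF B1(2), of s "max s (\<alpha> + 3 * \<epsilon>)"]
      B1(3)[of "min s (\<alpha> + \<epsilon>)"] B1(4)[of "max s (\<alpha> + 3 * \<epsilon>)"] by auto
  have r2: "0 \<le> B2 s" "B2 s \<le> 1" for s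
    using monoD[OF B2(2), of "min s (\<beta> - 3 * \<epsilon>)" s] monoD[OF B2(2), of s "max s (\<beta> - \<epsilon>)"]
      B2(3)[of "min s (\<beta> - 3 * \<epsilon>)"] B2(4)[of "max s (\<beta> - \<epsilon>)"] by auto
  show ?thesis
  proof (intro exI conjI allI impI)
    let ?\<eta> = "\<lambda>s. B1 s * (1 + (-1) * B2 s)"
    show "smooth_real ?\<eta>"
      by (intro smooth_real_mult smooth_real_add smooth_real_const B1 B2)
    fix s
    show "0 \<le> ?\<eta> s" using r1[of s] r2[of s] by simp
    show "?\<eta> s \<le> 1" using r1[of s] r2[of s] by (simp add: mult_le_one)
    show "\<alpha> + \<epsilon> \<le> s" if "?\<eta> s \<noteq> 0" using that B1(3)[of s] by (cases "s \<le> \<alpha> + 2 * \<epsilon> - \<epsilon>") auto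
    show "s \<le> \<beta> - \<epsilon>" if "?\<eta> s \<noteq> 0" using that B2(4)[of s] by (cases "s \<ge> \<beta> - 2 * \<epsilon> + \<epsilon>") auto
    show "?\<eta> s = 1" if "\<alpha> + 3 * \<epsilon> \<le> s \<and> s \<le> \<beta> - 3 * \<epsilon>"
      using that B1(4)[of s] B2(3)[of s] by auto
  qed
qed

lemma integrable_local_mult:
  fixes u \<psi> :: "'a::euclidean_space \<Rightarrow> real"
  assumes u: "locally_integrable U u" and U: "U \<in> sets lebesgue" and \<psi>: "continuous_on UNIV \<psi>"
    and out: "\<And>x. x \<notin> cbox \<alpha> \<beta> \<Longrightarrow> \<psi> x = 0" and sub: "cbox \<alpha> \<beta> \<subseteq> U"
  shows "integrable (lebesgue_on U) (\<lambda>x. u x * \<psi> x)"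
proof -
  obtain C where C: "0 \<le> C" "\<And>x. x \<in> cbox \<alpha> \<beta> \<Longrightarrow> \<bar>\<psi> x\<bar> \<le> C"
    using continuous_cbox_bounded[OF continuous_on_subset[OF \<psi>]] by blast
  have int: "integrable lebesgue (\<lambda>x. indicator (cbox \<alpha> \<beta>) x *\<^sub>R u x)"
    using u sub unfolding locally_integrable_def set_integrable_def by auto
  have "\<psi> \<in> borel_measurable lebesgue"
    by (rule measurable_completion) (simp add: borel_measurable_continuous_onI[OF \<psi>])
  then have "integrable lebesgue (\<lambda>x. (indicator (cbox \<alpha> \<beta>) x *\<^sub>R u x) * \<psi> x)"
    using borel_measurable_integrable[OF int]
    by (intro Bochner_Integration.integrable_bound[OF integrable_mult_right[OF int, of C]])
       (auto simp: indicator_def abs_mult C mult.commute intro!: mult_right_mono)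
  moreover have "(\<lambda>x. (indicator (cbox \<alpha> \<beta>) x *\<^sub>R u x) * \<psi> x) = (\<lambda>x. indicator U x *\<^sub>R (u x * \<psi> x))"
    by (rule ext) (use out sub in \<open>auto simp: indicator_def\<close>)
  ultimately show ?thesis
    using U by (subst integrable_restrict_space) auto
qed

context cosine_box
begin

lemma AE_interior: "AE x in Q. x \<in> box a b"
proof -
  have "negligible (cbox a b - box a b)" by (rule negligible_frontier_interval)
  then have "AE x in lebesgue. x \<notin> cbox a b - box a b"
    using negligible_iff_null_sets AE_not_in by blast
  then show ?thesis by (subst AE_restrict_space_iff) auto
qed

lemma integral_box_eq_Q:
  assumes "f \<in> borel_measurable Q"
  shows "(LINT x|lebesgue_on (box a b). f x) = (LINT x|Q. f x :: real)"
proof -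
  have "(LINT x|lebesgue_on (box a b). f x) = (LINT x|lebesgue_on (box a b). (\<lambda>x. indicator (cbox a b) x *\<^sub>R f x) x)"
    using box_subset_cbox[of a b] by (intro Bochner_Integration.integral_cong) (auto simp: indicator_def)
  also have "\<dots> = (LINT x|lebesgue. indicator (box a b) x *\<^sub>R (indicator (cbox a b) x *\<^sub>R f x))"
    by (rule integral_restrict_space) auto
  also have "\<dots> = (LINT x|lebesgue. indicator (cbox a b) x *\<^sub>R f x)"
  proof (rule integral_cong_AE)
    have m: "(\<lambda>x. indicator (cbox a b) x *\<^sub>R f x) \<in> borel_measurable lebesgue"
      using assms by (subst (asm) borel_measurable_restrict_space_iff) auto
    then show "(\<lambda>x. indicator (cbox a b) x *\<^sub>R f x) \<in> borel_measurable lebesgue" .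
    show "(\<lambda>x. indicator (box a b) x *\<^sub>R (indicator (cbox a b) x *\<^sub>R f x)) \<in> borel_measurable lebesgue"
      by (intro borel_measurable_scaleR m borel_measurable_indicator) auto
    have "negligible (cbox a b - box a b)" by (rule negligible_frontier_interval)
    then have "AE x in lebesgue. x \<notin> cbox a b - box a b"
      using negligible_iff_null_sets AE_not_in by blast
    then show "AE x in lebesgue. indicator (box a b) x *\<^sub>R (indicator (cbox a b) x *\<^sub>R f x) = indicator (cbox a b) x *\<^sub>R f x"
      by eventually_elim (auto simp: indicator_def)
  qed
  also have "\<dots> = (LINT x|Q. f x)" by (rule integral_restrict_space[symmetric]) auto
  finally show ?thesis .
qed

lemma continuous_measurable_Q: "continuous_on (cbox a b) (f :: real^'n \<Rightarrow> real) \<Longrightarrow> f \<in> borel_measurable Q"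
  using integrable_Q borel_measurable_integrable by blast

text \<open>Second difference quotients are moved from \<phi> to u, where they are bounded by 6 M
  whatever \<phi> is. Replacing \<phi> by the cosine then costs only an L1 distance, although the
  derivatives of cut-off cosines blow up as the cut-off approaches the faces.\<close>

lemma second_deriv_pairing:
  fixes f :: "'n \<Rightarrow> real \<Rightarrow> real"
  assumes u: "neumann_class a b M u" and M: "0 \<le> M"
    and f: "\<And>l. smooth_real (f l)" "\<And>l s. f l s \<noteq> 0 \<Longrightarrow> \<alpha> $ l \<le> s \<and> s \<le> \<beta> $ l"
    and \<alpha>\<beta>: "\<And>l. a $ l < \<alpha> $ l" "\<And>l. \<beta> $ l < b $ l"
  defines "\<phi> \<equiv> \<lambda>x::real^'n. \<Prod>l\<in>UNIV. f l (x $ l)"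
  shows "\<bar>(LINT x|lebesgue_on (box a b). u x * iter_deriv [axis l 1, axis l 1] \<phi> x) + (freq k l)\<^sup>2 * coef u k\<bar>
     \<le> 6 * M * (LINT x|Q. \<bar>\<phi> x - cc k x\<bar>)"
proof -
  have cu: "continuous_on (cbox a b) u" using u by (simp add: neumann_class_def)
  let ?P = "\<lambda>x::real^'n. \<Prod>m\<in>UNIV - {l}. f m (x $ m)"
  have c\<phi>: "continuous_on A \<phi>" for A
    unfolding \<phi>_def
    by (intro continuous_on_prod continuous_on_compose2[OF smooth_real_continuous_on[OF f(1), of UNIV]] continuous_intros) auto
  have cP: "continuous_on A ?P" for A
    by (intro continuous_on_prod continuous_on_compose2[OF smooth_real_continuous_on[OF f(1), of UNIV]] continuous_intros) auto
  have sf2: "smooth_real (deriv (deriv (f l)))" by (intro smooth_real_deriv f)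
  have prodl: "(\<Prod>m\<in>UNIV. g m) = g l * (\<Prod>m\<in>UNIV - {l}. g m)" for g :: "'n \<Rightarrow> real"
    by (rule prod.remove) auto
  have D\<phi>: "iter_deriv [axis l 1, axis l 1] \<phi> = (\<lambda>x. deriv (deriv (f l)) (x $ l) * ?P x)"
    unfolding \<phi>_def
    by (subst iter_deriv_prod_components[OF f(1)], force simp: axis_in_Basis_iff, rule ext, subst prodl)
       (auto simp: axis_eq_axis intro!: prod.cong)
  have cD: "continuous_on A (\<lambda>x. deriv (deriv (f l)) (x $ l) * ?P x)" for A
    by (intro continuous_intros cP continuous_on_compose2[OF smooth_real_continuous_on[OF sf2, of UNIV]]) auto
  have shift\<phi>: "\<phi> (x + s *\<^sub>R axis l 1) = f l (x $ l + s) * ?P x" for x s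
    unfolding \<phi>_def by (subst prodl) (auto intro!: prod.cong simp: axis_def)
  \<comment> \<open>Steps below \<gamma> keep the shifted support away from the faces, so that the
    even shift of \<phi> is its ordinary two-sided shift; the last entry meets the step restriction
    of \<open>even_shift_neumann\<close>.\<close>
  define \<gamma> where "\<gamma> = Min {\<alpha> $ l - a $ l, b $ l - \<beta> $ l, (b $ l - a $ l) / 2}"
  have \<gamma>: "0 < \<gamma>" "\<gamma> \<le> \<alpha> $ l - a $ l" "\<gamma> \<le> b $ l - \<beta> $ l" "2 * \<gamma> \<le> b $ l - a $ l"
    using \<alpha>\<beta>[of l] len_pos[of l] by (auto simp: \<gamma>_def min_def)
  \<comment> \<open>The denominators start at 2, which makes every step strictly smaller than
    \<gamma>.\<close>
  define \<delta> where "\<delta> n = \<gamma> / real (Suc (Suc n))" for n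
  have \<delta>: "0 < \<delta> n" "\<delta> n < \<gamma>" for n using \<gamma>(1) divide_strict_left_mono[of 1 "real (Suc (Suc n))" \<gamma>] by (auto simp: \<delta>_def)
  have \<delta>_lim: "filterlim \<delta> (at_right 0) sequentially"
  proof -
    have "\<delta> \<longlonglongrightarrow> 0"
      unfolding \<delta>_def using LIMSEQ_ignore_initial_segment[OF lim_const_over_n[of \<gamma>], of 2] by simp
    then show ?thesis using \<delta>(1) by (intro tendsto_imp_filterlim_at_right) auto
  qed
  let ?D = "\<lambda>n v x. (even_shift a b l (\<delta> n) v x - 2 * v x) / (\<delta> n)\<^sup>2"
  have cont_D: "continuous_on (cbox a b) (?D n v)" if "continuous_on (cbox a b) v" for n v
    using \<delta>[of n] \<gamma> that by (intro continuous_intros continuous_on_even_shift) auto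
  have es\<phi>: "even_shift a b l (\<delta> n) \<phi> x = (f l (x $ l + \<delta> n) + f l (x $ l - \<delta> n)) * ?P x" if "x \<in> cbox a b" for n x
  proof -
    have xl: "a $ l \<le> x $ l" "x $ l \<le> b $ l" using that by (auto simp: mem_box_cart)
    have z: "f l s = 0" if "s < \<alpha> $ l \<or> \<beta> $ l < s" for s using f(2)[of l s] that by linarith
    have "f l (min (x $ l + \<delta> n) (2 * b $ l - \<delta> n - x $ l)) = f l (x $ l + \<delta> n)"
      using z[of "x $ l + \<delta> n"] z[of "2 * b $ l - \<delta> n - x $ l"] \<delta>[of n] \<gamma> xl by (auto simp: min_def)
    moreover have "f l (max (x $ l - \<delta> n) (2 * a $ l + \<delta> n - x $ l)) = f l (x $ l - \<delta> n)"
      using z[of "x $ l - \<delta> n"] z[of "2 * a $ l + \<delta> n - x $ l"] \<delta>[of n] \<gamma> xl by (auto simp: max_def)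
    ultimately show ?thesis
      unfolding even_shift_def refl_hi_def refl_lo_def shift\<phi> by (simp add: distrib_right)
  qed
  have sym: "(LINT x|Q. ?D n u x * \<phi> x) = (LINT x|Q. u x * ?D n \<phi> x)" for n
  proof -
    have "(LINT x|Q. ?D n u x * \<phi> x) = (LINT x|Q. (1 / (\<delta> n)\<^sup>2) * (even_shift a b l (\<delta> n) u x * \<phi> x - 2 * (u x * \<phi> x)))"
      by (simp add: left_diff_distrib diff_divide_distrib mult.assoc)
    also have "\<dots> = (1 / (\<delta> n)\<^sup>2) * ((LINT x|Q. even_shift a b l (\<delta> n) u x * \<phi> x) - 2 * (LINT x|Q. u x * \<phi> x))"
    proof -
      have "integrable Q (\<lambda>x. even_shift a b l (\<delta> n) u x * \<phi> x)" "integrable Q (\<lambda>x. u x * \<phi> x)"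
        using \<delta>[of n] \<gamma> by (intro integrable_Q continuous_intros continuous_on_even_shift cu c\<phi>; simp)+
      then show ?thesis by simp
    qed
    also have "(LINT x|Q. even_shift a b l (\<delta> n) u x * \<phi> x) = (LINT x|Q. u x * even_shift a b l (\<delta> n) \<phi> x)"
      using \<delta>[of n] \<gamma> by (intro even_shift_selfadjoint cu c\<phi>) auto
    also have "(1 / (\<delta> n)\<^sup>2) * ((LINT x|Q. u x * even_shift a b l (\<delta> n) \<phi> x) - 2 * (LINT x|Q. u x * \<phi> x)) =
        (LINT x|Q. (1 / (\<delta> n)\<^sup>2) * (u x * even_shift a b l (\<delta> n) \<phi> x - 2 * (u x * \<phi> x)))"
    proof -
      have "integrable Q (\<lambda>x. u x * even_shift a b l (\<delta> n) \<phi> x)" "integrable Q (\<lambda>x. u x * \<phi> x)"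
        using \<delta>[of n] \<gamma> by (intro integrable_Q continuous_intros continuous_on_even_shift cu c\<phi>; simp)+
      then show ?thesis by simp
    qed
    finally show ?thesis by (simp add: right_diff_distrib diff_divide_distrib mult.left_commute)
  qed
  obtain Cu where Cu: "0 \<le> Cu" "\<And>x. x \<in> cbox a b \<Longrightarrow> \<bar>u x\<bar> \<le> Cu" using continuous_cbox_bounded[OF cu] by blast
  obtain CP where CP: "0 \<le> CP" "\<And>x. x \<in> cbox a b \<Longrightarrow> \<bar>?P x\<bar> \<le> CP" using continuous_cbox_bounded[OF cP] by blast
  obtain CD where CD: "0 \<le> CD" "\<And>s. s \<in> cbox (a $ l - \<gamma>) (b $ l + \<gamma>) \<Longrightarrow> \<bar>deriv (deriv (f l)) s\<bar> \<le> CD"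
    using continuous_cbox_bounded[OF smooth_real_continuous_on[OF sf2]] by blast
  \<comment> \<open>The quotient is an exact second derivative at a nearby point, which provides
    both the pointwise limit and the dominating constant.\<close>
  have D\<phi>_mvt: "\<exists>\<xi>. \<bar>\<xi> - x $ l\<bar> < \<delta> n \<and> ?D n \<phi> x = deriv (deriv (f l)) \<xi> * ?P x" if x: "x \<in> cbox a b" for n x
  proof -
    obtain \<xi> where \<xi>: "\<bar>\<xi> - x $ l\<bar> < \<delta> n"
      "f l (x $ l + \<delta> n) + f l (x $ l - \<delta> n) - 2 * f l (x $ l) = (\<delta> n)\<^sup>2 * deriv (deriv (f l)) \<xi>"
      using second_difference_quotient_mvt[OF f(1) \<delta>(1)] by blast
    have "?D n \<phi> x = (f l (x $ l + \<delta> n) + f l (x $ l - \<delta> n) - 2 * f l (x $ l)) * ?P x / (\<delta> n)\<^sup>2"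
      unfolding es\<phi>[OF x] using shift\<phi>[of x 0] by (simp add: algebra_simps)
    also have "\<dots> = deriv (deriv (f l)) \<xi> * ?P x" unfolding \<xi>(2) using \<delta>(1)[of n] by simp
    finally show ?thesis using \<xi>(1) by blast
  qed
  have lim1: "(\<lambda>n. LINT x|Q. u x * ?D n \<phi> x) \<longlonglongrightarrow> (LINT x|Q. u x * (deriv (deriv (f l)) (x $ l) * ?P x))"
  proof (rule integral_dominated_convergence[where w = "\<lambda>_. Cu * (CD * CP)"])
    show "(\<lambda>x. u x * (deriv (deriv (f l)) (x $ l) * ?P x)) \<in> borel_measurable Q"
      by (intro continuous_measurable_Q continuous_intros cu cD)
    show "(\<lambda>x. u x * ?D n \<phi> x) \<in> borel_measurable Q" for n
      by (intro continuous_measurable_Q continuous_on_mult cu cont_D c\<phi>)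
    show "integrable Q (\<lambda>_. Cu * (CD * CP))" by (intro integrable_Q continuous_intros)
    show "AE x in Q. (\<lambda>n. u x * ?D n \<phi> x) \<longlonglongrightarrow> u x * (deriv (deriv (f l)) (x $ l) * ?P x)"
    proof (rule AE_I2)
      fix x assume "x \<in> space Q"
      then have x: "x \<in> cbox a b" by simp
      from D\<phi>_mvt[OF x] obtain \<xi> where \<xi>: "\<And>n. \<bar>\<xi> n - x $ l\<bar> < \<delta> n" "\<And>n. ?D n \<phi> x = deriv (deriv (f l)) (\<xi> n) * ?P x"
        by metis
      have "\<delta> \<longlonglongrightarrow> 0" using \<delta>_lim by (simp add: filterlim_at)
      then have "(\<lambda>n. \<xi> n - x $ l) \<longlonglongrightarrow> 0"
        by (rule Lim_null_comparison[rotated]) (use \<xi>(1) in \<open>auto intro!: always_eventually less_imp_le\<close>)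
      then have "\<xi> \<longlonglongrightarrow> x $ l" by (simp add: LIM_zero_iff)
      then have "(\<lambda>n. deriv (deriv (f l)) (\<xi> n)) \<longlonglongrightarrow> deriv (deriv (f l)) (x $ l)"
        using isCont_tendsto_compose[OF smooth_real_isCont[OF sf2]] by blast
      then show "(\<lambda>n. u x * ?D n \<phi> x) \<longlonglongrightarrow> u x * (deriv (deriv (f l)) (x $ l) * ?P x)"
        unfolding \<xi>(2) by (intro tendsto_intros)
    qed
    show "AE x in Q. norm (u x * ?D n \<phi> x) \<le> Cu * (CD * CP)" for n
    proof (rule AE_I2)
      fix x assume "x \<in> space Q"
      then have x: "x \<in> cbox a b" by simp
      then have xl: "a $ l \<le> x $ l" "x $ l \<le> b $ l" by (auto simp: mem_box_cart)
      obtain \<xi> where \<xi>: "\<bar>\<xi> - x $ l\<bar> < \<delta> n" "?D n \<phi> x = deriv (deriv (f l)) \<xi> * ?P x"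
        using D\<phi>_mvt[OF x] by blast
      have "\<xi> \<in> cbox (a $ l - \<gamma>) (b $ l + \<gamma>)" using \<xi>(1) \<delta>(2)[of n] xl by auto
      then show "norm (u x * ?D n \<phi> x) \<le> Cu * (CD * CP)"
        unfolding \<xi>(2) real_norm_def abs_mult using Cu CP(2)[OF x] CD CP(1) x
        by (intro mult_mono) auto
    qed
  qed
  have lim2: "(\<lambda>n. (LINT x|Q. ?D n u x * \<phi> x) - coef (?D n u) k) \<longlonglongrightarrow>
     (LINT x|Q. u x * (deriv (deriv (f l)) (x $ l) * ?P x)) - (- (freq k l)\<^sup>2) * coef u k"
  proof (intro tendsto_diff)
    show "(\<lambda>n. LINT x|Q. ?D n u x * \<phi> x) \<longlonglongrightarrow> (LINT x|Q. u x * (deriv (deriv (f l)) (x $ l) * ?P x))"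
      unfolding sym by (rule lim1)
    have "coef (?D n u) k = (2 * cos (freq k l * \<delta> n) - 2) / (\<delta> n)\<^sup>2 * coef u k" for n
      using \<delta>[of n] \<gamma> by (intro coef_second_diff cu) auto
    then show "(\<lambda>n. coef (?D n u) k) \<longlonglongrightarrow> (- (freq k l)\<^sup>2) * coef u k"
      by (simp only:) (intro tendsto_mult tendsto_const filterlim_compose[OF second_difference_symbol_limit \<delta>_lim])
  qed
  have bound: "\<bar>(LINT x|Q. ?D n u x * \<phi> x) - coef (?D n u) k\<bar> \<le> 6 * M * (LINT x|Q. \<bar>\<phi> x - cc k x\<bar>)" for n
  proof -
    have e: "(LINT x|Q. ?D n u x * \<phi> x) - coef (?D n u) k = (LINT x|Q. ?D n u x * \<phi> x - ?D n u x * cc k x)"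
      unfolding coef_def
      by (rule Bochner_Integration.integral_diff[symmetric]) (intro integrable_Q continuous_on_mult cont_D cu c\<phi> cont_cc)+
    have "\<bar>LINT x|Q. ?D n u x * \<phi> x - ?D n u x * cc k x\<bar> \<le> (LINT x|Q. 6 * M * \<bar>\<phi> x - cc k x\<bar>)"
    proof (rule integral_abs_bound_integral)
      show "integrable Q (\<lambda>x. ?D n u x * \<phi> x - ?D n u x * cc k x)"
        by (intro integrable_Q continuous_on_diff continuous_on_mult cont_D cu c\<phi> cont_cc)
      show "integrable Q (\<lambda>x. 6 * M * \<bar>\<phi> x - cc k x\<bar>)"
        by (intro integrable_Q continuous_intros c\<phi>)
      fix x assume "x \<in> space Q"
      then have x: "x \<in> cbox a b" by simp
      have "\<bar>?D n u x\<bar> \<le> 6 * M"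
        using even_shift_neumann[OF u M x, of "\<delta> n" l] \<delta>[of n] \<gamma> by (simp add: abs_divide field_simps)
      then show "\<bar>?D n u x * \<phi> x - ?D n u x * cc k x\<bar> \<le> 6 * M * \<bar>\<phi> x - cc k x\<bar>"
        unfolding right_diff_distrib[symmetric] abs_mult by (intro mult_right_mono) auto
    qed
    then show ?thesis unfolding e by (simp only: integral_mult_right_zero)
  qed
  have "\<bar>(LINT x|Q. u x * (deriv (deriv (f l)) (x $ l) * ?P x)) - (- (freq k l)\<^sup>2) * coef u k\<bar> \<le> 6 * M * (LINT x|Q. \<bar>\<phi> x - cc k x\<bar>)"
    by (rule LIMSEQ_le_const2[OF tendsto_rabs[OF lim2]]) (use bound in auto)
  moreover have "(LINT x|lebesgue_on (box a b). u x * iter_deriv [axis l 1, axis l 1] \<phi> x) =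
     (LINT x|Q. u x * (deriv (deriv (f l)) (x $ l) * ?P x))"
    unfolding D\<phi> by (intro integral_box_eq_Q continuous_measurable_Q continuous_on_mult cu cD)
  ultimately show ?thesis by simp
qed

text \<open>Apply \<open>lap\<close> to cosines cut off by plateau functions that tend to 1. The
  cut-off modes converge boundedly, so the pairing with g converges and the L1 error of
  \<open>second_deriv_pairing\<close> tends to 0.\<close>

lemma weak_laplacian_cosine:
  assumes u: "neumann_class a b M u" and M: "0 \<le> M"
    and lap: "\<And>f \<alpha> \<beta>. (\<And>l. smooth_real (f l)) \<Longrightarrow> (\<And>l s. f l s \<noteq> 0 \<Longrightarrow> \<alpha> $ l \<le> s \<and> s \<le> \<beta> $ l) \<Longrightarrow>
       (\<And>l. a $ l < \<alpha> $ l) \<Longrightarrow> (\<And>l. \<beta> $ l < b $ l) \<Longrightarrow>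
       (LINT x|lebesgue_on (box a b). g x * (\<Prod>l\<in>UNIV. f l (x $ l))) =
       (\<Sum>l\<in>UNIV. LINT x|lebesgue_on (box a b). u x * iter_deriv [axis l 1, axis l 1] (\<lambda>x. \<Prod>l\<in>UNIV. f l (x $ l)) x)"
    and g: "integrable (lebesgue_on (box a b)) g"
  shows "(LINT x|lebesgue_on (box a b). g x * cc k x) = - lam k * coef u k"
proof -
  \<comment> \<open>The margins at the two ends have total width 6 \<epsilon>, which is less than
    the side length.\<close>
  define \<epsilon> where "\<epsilon> n l = (b $ l - a $ l) / (8 * real (Suc n))" for n l
  have \<epsilon>: "0 < \<epsilon> n l" for n l using len_pos[of l] by (simp add: \<epsilon>_def)
  have "\<forall>n l. \<exists>\<eta>. smooth_real \<eta> \<and> (\<forall>s. 0 \<le> \<eta> s \<and> \<eta> s \<le> 1) \<and>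
     (\<forall>s. \<eta> s \<noteq> 0 \<longrightarrow> a $ l + \<epsilon> n l \<le> s \<and> s \<le> b $ l - \<epsilon> n l) \<and>
     (\<forall>s. a $ l + 3 * \<epsilon> n l \<le> s \<and> s \<le> b $ l - 3 * \<epsilon> n l \<longrightarrow> \<eta> s = (1::real))"
    using cutoff_1d[OF \<epsilon>] by blast
  then obtain \<eta> where \<eta>: "\<And>n l. smooth_real (\<eta> n l)" "\<And>n l s. 0 \<le> \<eta> n l s" "\<And>n l s. \<eta> n l s \<le> 1"
    "\<And>n l s. \<eta> n l s \<noteq> 0 \<Longrightarrow> a $ l + \<epsilon> n l \<le> s \<and> s \<le> b $ l - \<epsilon> n l"
    "\<And>n l s. a $ l + 3 * \<epsilon> n l \<le> s \<Longrightarrow> s \<le> b $ l - 3 * \<epsilon> n l \<Longrightarrow> \<eta> n l s = (1::real)"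
    by metis
  define f where "f n l s = \<eta> n l s * cos (freq k l * s + (- freq k l * a $ l))" for n l s
  define \<phi> where "\<phi> n x = (\<Prod>l\<in>UNIV. f n l (x $ l))" for n and x :: "real^'n"
  have sf: "smooth_real (f n l)" for n l
    unfolding f_def by (intro smooth_real_mult \<eta> smooth_real_affine smooth_real_cos)
  have \<phi>_eq: "\<phi> n x = (\<Prod>l\<in>UNIV. \<eta> n l (x $ l)) * cc k x" for n x
    unfolding \<phi>_def f_def cc_eq prod.distrib[symmetric] by (intro prod.cong) (auto simp: algebra_simps)
  have \<eta>1: "\<bar>\<Prod>l\<in>UNIV. \<eta> n l (x $ l)\<bar> \<le> 1" for n and x :: "real^'n"
    unfolding abs_prod by (rule prod_le_1) (use \<eta> in auto)
  have \<phi>1: "\<bar>\<phi> n x\<bar> \<le> 1" for n x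
    unfolding \<phi>_eq abs_mult using \<eta>1[of n x] abs_cc_le[of k x] by (simp add: mult_le_one)
  have c\<phi>: "continuous_on A (\<phi> n)" for A n
    unfolding \<phi>_def
    by (intro continuous_on_prod continuous_on_compose2[OF smooth_real_continuous_on[OF sf, of UNIV]] continuous_intros) auto
  have supp: "a $ l + \<epsilon> n l \<le> s \<and> s \<le> b $ l - \<epsilon> n l" if "f n l s \<noteq> 0" for n l s
    using that \<eta>(4)[of n l s] by (auto simp: f_def)
  have main: "\<bar>(LINT x|lebesgue_on (box a b). g x * \<phi> n x) + lam k * coef u k\<bar> \<le>
      real CARD('n) * (6 * M * (LINT x|Q. \<bar>\<phi> n x - cc k x\<bar>))" for n
  proof -
    let ?I = "\<lambda>l. LINT x|lebesgue_on (box a b). u x * iter_deriv [axis l 1, axis l 1] (\<phi> n) x"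
    have h: "a $ l < (\<chi> l. a $ l + \<epsilon> n l) $ l" "(\<chi> l. b $ l - \<epsilon> n l) $ l < b $ l" for l using \<epsilon>[of n l] by auto
    have "(LINT x|lebesgue_on (box a b). g x * \<phi> n x) = (\<Sum>l\<in>UNIV. ?I l)"
      unfolding \<phi>_def[abs_def]
      by (rule lap[of "f n" "\<chi> l. a $ l + \<epsilon> n l" "\<chi> l. b $ l - \<epsilon> n l"]) (use sf supp h in auto)
    then have e: "(LINT x|lebesgue_on (box a b). g x * \<phi> n x) + lam k * coef u k = (\<Sum>l\<in>UNIV. ?I l + (freq k l)\<^sup>2 * coef u k)"
      by (simp add: lam_def sum.distrib sum_distrib_right)
    have "\<bar>\<Sum>l\<in>UNIV. ?I l + (freq k l)\<^sup>2 * coef u k\<bar> \<le> (\<Sum>l\<in>UNIV. \<bar>?I l + (freq k l)\<^sup>2 * coef u k\<bar>)" by (rule sum_abs)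
    also have "\<dots> \<le> (\<Sum>l\<in>(UNIV::'n set). 6 * M * (LINT x|Q. \<bar>\<phi> n x - cc k x\<bar>))"
    proof (rule sum_mono)
      fix l :: 'n
      show "\<bar>?I l + (freq k l)\<^sup>2 * coef u k\<bar> \<le> 6 * M * (LINT x|Q. \<bar>\<phi> n x - cc k x\<bar>)"
        unfolding \<phi>_def[abs_def]
        by (rule second_deriv_pairing[OF u M, of "f n" "\<chi> l. a $ l + \<epsilon> n l" "\<chi> l. b $ l - \<epsilon> n l"]) (use sf supp h in auto)
    qed
    finally show ?thesis unfolding e by simp
  qed
  have ptw: "(\<lambda>n. \<phi> n x) \<longlonglongrightarrow> cc k x" if x: "x \<in> box a b" for x
  proof -
    have ev: "\<forall>\<^sub>F n in sequentially. \<eta> n l (x $ l) = 1" for l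
    proof -
      have "(\<lambda>n. 3 * ((b $ l - a $ l) / 8 / real (Suc n))) \<longlonglongrightarrow> 3 * 0"
        by (intro tendsto_intros LIMSEQ_Suc[OF lim_const_over_n])
      then have "(\<lambda>n. 3 * \<epsilon> n l) \<longlonglongrightarrow> 0" by (simp add: \<epsilon>_def divide_divide_eq_left)
      moreover have "0 < min (x $ l - a $ l) (b $ l - x $ l)" using x by (auto simp: mem_box_cart)
      ultimately have "\<forall>\<^sub>F n in sequentially. 3 * \<epsilon> n l < min (x $ l - a $ l) (b $ l - x $ l)"
        by (rule order_tendstoD(2))
      then show ?thesis by eventually_elim (intro \<eta>(5), auto)
    qed
    then have "\<forall>\<^sub>F n in sequentially. \<forall>l. \<eta> n l (x $ l) = 1"
      by (rule eventually_all_finite)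
    then have "\<forall>\<^sub>F n in sequentially. \<phi> n x = cc k x" by eventually_elim (simp add: \<phi>_eq)
    then show ?thesis by (rule tendsto_eventually)
  qed
  have lim0: "(\<lambda>n. LINT x|Q. \<bar>\<phi> n x - cc k x\<bar>) \<longlonglongrightarrow> (LINT x|Q. 0)"
  proof (rule integral_dominated_convergence[where w = "\<lambda>_. 2 :: real"])
    show "(\<lambda>x. \<bar>\<phi> n x - cc k x\<bar>) \<in> borel_measurable Q" for n
      by (intro continuous_measurable_Q continuous_intros c\<phi>)
    show "integrable Q (\<lambda>_. 2 :: real)" by (intro integrable_Q continuous_intros)
    show "AE x in Q. (\<lambda>n. \<bar>\<phi> n x - cc k x\<bar>) \<longlonglongrightarrow> 0"
      using AE_interior
    proof eventually_elim
      fix x assume "x \<in> box a b"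
      then have "(\<lambda>n. \<bar>\<phi> n x - cc k x\<bar>) \<longlonglongrightarrow> \<bar>cc k x - cc k x\<bar>" by (intro tendsto_intros ptw)
      then show "(\<lambda>n. \<bar>\<phi> n x - cc k x\<bar>) \<longlonglongrightarrow> 0" by simp
    qed
    show "AE x in Q. norm \<bar>\<phi> n x - cc k x\<bar> \<le> 2" for n
    proof (rule AE_I2)
      fix x show "norm \<bar>\<phi> n x - cc k x\<bar> \<le> 2"
        using \<phi>1[of n x] abs_cc_le[of k x] unfolding real_norm_def abs_le_iff by linarith
    qed
  qed simp
  have limg: "(\<lambda>n. LINT x|lebesgue_on (box a b). g x * \<phi> n x) \<longlonglongrightarrow> (LINT x|lebesgue_on (box a b). g x * cc k x)"
  proof (rule integral_dominated_convergence[where w = "\<lambda>x. \<bar>g x\<bar>"])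
    have gm: "g \<in> borel_measurable (lebesgue_on (box a b))" using g by (rule borel_measurable_integrable)
    have cm: "h \<in> borel_measurable (lebesgue_on (box a b))" if "continuous_on (box a b) h" for h :: "real^'n \<Rightarrow> real"
      using that by (rule continuous_imp_measurable_on_sets_lebesgue) auto
    show "(\<lambda>x. g x * cc k x) \<in> borel_measurable (lebesgue_on (box a b))"
      by (intro borel_measurable_times gm cm cont_cc)
    show "(\<lambda>x. g x * \<phi> n x) \<in> borel_measurable (lebesgue_on (box a b))" for n
      by (intro borel_measurable_times gm cm c\<phi>)
    show "integrable (lebesgue_on (box a b)) (\<lambda>x. \<bar>g x\<bar>)" using g by simp
    show "AE x in lebesgue_on (box a b). (\<lambda>n. g x * \<phi> n x) \<longlonglongrightarrow> g x * cc k x"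
      by (rule AE_I2) (auto intro!: tendsto_intros ptw)
    show "AE x in lebesgue_on (box a b). norm (g x * \<phi> n x) \<le> \<bar>g x\<bar>" for n
      by (rule AE_I2) (use \<phi>1 in \<open>auto simp: abs_mult mult_left_le\<close>)
  qed
  have "\<bar>(LINT x|lebesgue_on (box a b). g x * cc k x) + lam k * coef u k\<bar> \<le> real CARD('n) * (6 * M * (LINT x|Q. 0))"
    by (rule LIMSEQ_le[OF tendsto_rabs[OF tendsto_add[OF limg tendsto_const]] tendsto_mult[OF tendsto_const tendsto_mult[OF tendsto_const lim0]]])
       (use main in auto)
  then show ?thesis by simp
qed

end

section \<open>Weak derivatives in time\<close>

text \<open>Cauchy-Schwarz through |f c| \<le> t/2 f^2 + c^2/(2 t), with t optimised after
  integration. If the norm of f is zero, t = 1 / |pairing| contradicts a nonzero pairing.\<close>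

lemma L2_pairing_bound:
  assumes f: "f \<in> L2_space U" and c: "c \<in> L2_space U" "(LINT x|lebesgue_on U. (c x)\<^sup>2) \<le> 1"
  shows "integrable (lebesgue_on U) (\<lambda>x. f x * c x)" "\<bar>LINT x|lebesgue_on U. f x * c x\<bar> \<le> L2_norm U f"
proof -
  let ?M = "lebesgue_on U"
  have [measurable]: "f \<in> borel_measurable ?M" "c \<in> borel_measurable ?M"
    and f2: "integrable ?M (\<lambda>x. (f x)\<^sup>2)" and c2: "integrable ?M (\<lambda>x. (c x)\<^sup>2)"
    using f c by (auto simp: L2_space_def)
  have am: "\<bar>f x * c x\<bar> \<le> t / 2 * (f x)\<^sup>2 + 1 / (2 * t) * (c x)\<^sup>2" if "0 < t" for t x
  proof -
    have "0 \<le> (sqrt t * \<bar>f x\<bar> - \<bar>c x\<bar> / sqrt t)\<^sup>2" by simp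
    also have "\<dots> = t * (f x)\<^sup>2 + (c x)\<^sup>2 / t - 2 * \<bar>f x * c x\<bar>"
      using that by (simp add: power2_diff power_mult_distrib power_divide abs_mult)
    finally show ?thesis by simp
  qed
  show int: "integrable ?M (\<lambda>x. f x * c x)"
    by (rule Bochner_Integration.integrable_bound[of _ "\<lambda>x. 1 / 2 * (f x)\<^sup>2 + 1 / (2 * 1) * (c x)\<^sup>2"])
       (use f2 c2 am[of 1] in \<open>auto intro!: AE_I2 simp del: abs_mult intro: order_trans[OF _ abs_ge_self]\<close>)
  define n where "n = (LINT x|?M. (f x)\<^sup>2)"
  have n0: "0 \<le> n" unfolding n_def by (rule integral_nonneg_AE) auto
  have bd: "\<bar>LINT x|?M. f x * c x\<bar> \<le> t / 2 * n + 1 / (2 * t)" if t: "0 < t" for t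
  proof -
    have "\<bar>LINT x|?M. f x * c x\<bar> \<le> (LINT x|?M. t / 2 * (f x)\<^sup>2 + 1 / (2 * t) * (c x)\<^sup>2)"
      by (rule integral_abs_bound_integral[OF int]) (use f2 c2 am[OF t] in auto)
    also have "\<dots> = t / 2 * n + 1 / (2 * t) * (LINT x|?M. (c x)\<^sup>2)" using f2 c2 by (simp add: n_def)
    also have "\<dots> \<le> t / 2 * n + 1 / (2 * t) * 1" using c(2) t by (intro add_left_mono mult_left_mono) auto
    finally show ?thesis by simp
  qed
  have "\<bar>LINT x|?M. f x * c x\<bar> \<le> sqrt n"
  proof (cases "n = 0")
    case True
    show ?thesis
    proof (rule ccontr)
      assume "\<not> ?thesis"
      then have pos: "0 < \<bar>LINT x|?M. f x * c x\<bar>" using True by simp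
      show False using bd[of "1 / \<bar>LINT x|?M. f x * c x\<bar>"] pos True by simp
    qed
  next
    case False
    then have "0 < n" using n0 by simp
    moreover have "1 / sqrt n / 2 * n = sqrt n / 2" using real_div_sqrt[of n] n0 by simp
    ultimately show ?thesis using bd[of "1 / sqrt n"] by simp
  qed
  then show "\<bar>LINT x|?M. f x * c x\<bar> \<le> L2_norm U f" by (simp add: L2_norm_def n_def)
qed

lemma L2_space_scale: "f \<in> L2_space U \<Longrightarrow> (\<lambda>x. c * f x) \<in> L2_space U"
  by (auto simp: L2_space_def power_mult_distrib)

lemma L2_space_add:
  assumes "f \<in> L2_space U" "g \<in> L2_space U"
  shows "(\<lambda>x. f x + g x) \<in> L2_space U"
proof -
  have [measurable]: "f \<in> borel_measurable (lebesgue_on U)" "g \<in> borel_measurable (lebesgue_on U)"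
    and int: "integrable (lebesgue_on U) (\<lambda>x. 2 * (f x)\<^sup>2 + 2 * (g x)\<^sup>2)"
    using assms by (auto simp: L2_space_def)
  have "(f x + g x)\<^sup>2 \<le> 2 * (f x)\<^sup>2 + 2 * (g x)\<^sup>2" for x
    using sum_squares_bound[of "f x" "g x"] by (simp add: power2_sum)
  then have "integrable (lebesgue_on U) (\<lambda>x. (f x + g x)\<^sup>2)"
    by (intro Bochner_Integration.integrable_bound[OF int]) (auto intro!: AE_I2 intro: order_trans[OF _ abs_ge_self])
  then show ?thesis by (simp add: L2_space_def)
qed

lemma L2_space_diff: "f \<in> L2_space U \<Longrightarrow> g \<in> L2_space U \<Longrightarrow> (\<lambda>x. f x - g x) \<in> L2_space U"
  using L2_space_add[OF _ L2_space_scale[of g U "-1"], of f] by simp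

lemma L2_space_sum:
  assumes "finite A" "\<And>y. y \<in> A \<Longrightarrow> f y \<in> L2_space U"
  shows "(\<lambda>x. \<Sum>y\<in>A. f y x) \<in> L2_space U"
  using assms
proof (induction A)
  case empty
  then show ?case by (simp add: L2_space_def)
qed (auto intro: L2_space_add)

text \<open>Pairing with c is a bounded functional, so it commutes with the Bochner integral. P is
  the limit of the paired simple functions and thus measurable by construction; it agrees with the
  pairing of u almost everywhere.\<close>

lemma bochner_pairing:
  assumes hb: "has_bochner_integral_into I (L2_space U) (L2_norm U) u J"
    and c: "c \<in> L2_space U" "(LINT x|lebesgue_on U. (c x)\<^sup>2) \<le> 1"
    and I: "I \<in> lmeasurable"
  shows "\<exists>P. integrable (lebesgue_on I) P \<and> (AE t in lebesgue_on I. u t \<in> L2_space U \<and> P t = (LINT x|lebesgue_on U. u t x * c x)) \<and>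
    (LINT t|lebesgue_on I. P t) = (LINT x|lebesgue_on U. J x * c x)"
proof -
  let ?M = "lebesgue_on U"
  let ?pr = "\<lambda>f. LINT x|?M. f x * c x"
  obtain s where s: "simple_approx I (L2_space U) (L2_norm U) u s"
    and l1: "(\<lambda>n. \<integral>\<^sup>+ t. ennreal (L2_norm U (\<lambda>x. u t x - s n t x)) \<partial>lebesgue_on I) \<longlonglongrightarrow> 0"
    and J: "J \<in> L2_space U" "(\<lambda>n. L2_norm U (\<lambda>x. J x - simple_integral_into I (s n) x)) \<longlonglongrightarrow> 0"
    using hb unfolding has_bochner_integral_into_def by blast
  have simple: "finite (s n ` I)" "s n ` I \<subseteq> L2_space U" "{t \<in> I. s n t = y} \<in> sets lebesgue" for n y
    using s unfolding simple_approx_def simple_into_def by auto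
  have ae: "AE t in lebesgue_on I. u t \<in> L2_space U \<and> (\<lambda>n. L2_norm U (\<lambda>x. u t x - s n t x)) \<longlonglongrightarrow> 0"
    using s unfolding simple_approx_def by auto
  have pr_diff: "\<bar>?pr f - ?pr g\<bar> \<le> L2_norm U (\<lambda>x. f x - g x)" if "f \<in> L2_space U" "g \<in> L2_space U" for f g
  proof -
    have "?pr f - ?pr g = (LINT x|?M. (f x - g x) * c x)"
      using L2_pairing_bound(1)[OF _ c] that by (simp add: left_diff_distrib)
    then show ?thesis using L2_pairing_bound(2)[OF L2_space_diff[OF that] c] by simp
  qed
  \<comment> \<open>Written as a finite sum of indicators, the paired simple function shows its
    integrability and its integral.\<close>
  define \<psi> where "\<psi> n t = (\<Sum>y\<in>s n ` I. indicator {t \<in> I. s n t = y} t * ?pr y)" for n t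
  have \<psi>: "\<psi> n t = ?pr (s n t)" if "t \<in> I" for n t
  proof -
    have "\<psi> n t = (\<Sum>y\<in>s n ` I. if y = s n t then ?pr y else 0)"
      unfolding \<psi>_def using that by (intro sum.cong) (auto simp: indicator_def)
    then show ?thesis using that simple(1)[of n] by simp
  qed
  have sets_I: "{t \<in> I. s n t = y} \<in> sets (lebesgue_on I)" for n y
    using simple(3)[of n y] I by (auto simp: sets_restrict_space_iff fmeasurableD)
  have fin_I: "finite_measure (lebesgue_on I)" using I by (rule finite_measure_lebesgue_on)
  have \<psi>_int: "integrable (lebesgue_on I) (\<psi> n)" for n
    unfolding \<psi>_def
    by (intro Bochner_Integration.integrable_sum integrable_mult_left integrable_real_indicator sets_I)
       (metis fin_I finite_measure.emeasure_finite infinity_ennreal_def less_top)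
  have \<psi>_val: "(LINT t|lebesgue_on I. \<psi> n t) = ?pr (simple_integral_into I (s n))" for n
  proof -
    have "(LINT t|lebesgue_on I. \<psi> n t) = (\<Sum>y\<in>s n ` I. LINT t|lebesgue_on I. indicator {t \<in> I. s n t = y} t * ?pr y)"
      unfolding \<psi>_def
      by (intro Bochner_Integration.integral_sum integrable_mult_left integrable_real_indicator sets_I)
         (metis fin_I finite_measure.emeasure_finite infinity_ennreal_def less_top)
    also have "\<dots> = (\<Sum>y\<in>s n ` I. measure lebesgue {t \<in> I. s n t = y} * ?pr y)"
    proof (rule sum.cong)
      fix y
      have "measure (lebesgue_on I) {t \<in> I. s n t = y} = measure lebesgue {t \<in> I. s n t = y}"
        using I by (intro measure_restrict_space) (auto simp: fmeasurableD)
      moreover have "{t. t \<in> I \<and> s n t = y} \<inter> I = {t \<in> I. s n t = y}" by auto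
      ultimately show "(LINT t|lebesgue_on I. indicator {t \<in> I. s n t = y} t * ?pr y) = measure lebesgue {t \<in> I. s n t = y} * ?pr y"
        by simp
    qed simp
    also have "\<dots> = ?pr (simple_integral_into I (s n))"
      unfolding simple_integral_into_def sum_distrib_right mult.assoc
      by (subst Bochner_Integration.integral_sum)
         (use simple(2) L2_pairing_bound(1)[OF _ c] in \<open>auto intro!: integrable_mult_right\<close>)
    finally show ?thesis .
  qed
  define P where "P t = lim (\<lambda>n. \<psi> n t)" for t
  have P_meas: "P \<in> borel_measurable (lebesgue_on I)"
    unfolding P_def using borel_measurable_integrable[OF \<psi>_int] by (rule borel_measurable_lim_metric)
  have aeP: "AE t in lebesgue_on I. u t \<in> L2_space U \<and> P t = ?pr (u t) \<and> (\<forall>n. \<bar>\<psi> n t - P t\<bar> \<le> L2_norm U (\<lambda>x. u t x - s n t x))"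
    using ae AE_space
  proof eventually_elim
    case (elim t)
    then have tI: "t \<in> I" by simp
    have bd: "\<bar>\<psi> n t - ?pr (u t)\<bar> \<le> L2_norm U (\<lambda>x. u t x - s n t x)" for n
      using pr_diff[of "u t" "s n t"] elim simple(2)[of n] tI unfolding \<psi>[OF tI]
      by (auto simp: abs_minus_commute image_subset_iff)
    have "(\<lambda>n. \<psi> n t - ?pr (u t)) \<longlonglongrightarrow> 0"
      by (rule Lim_null_comparison[of _ "\<lambda>n. L2_norm U (\<lambda>x. u t x - s n t x)"]) (use bd elim in auto)
    then have "P t = ?pr (u t)" unfolding P_def by (intro limI) (simp add: LIM_zero_iff)
    then show ?case using bd elim by auto
  qed
  have nn: "(\<integral>\<^sup>+ t. ennreal (norm (\<psi> n t - P t)) \<partial>lebesgue_on I) \<le>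
     (\<integral>\<^sup>+ t. ennreal (L2_norm U (\<lambda>x. u t x - s n t x)) \<partial>lebesgue_on I)" for n
  proof (rule nn_integral_mono_AE)
    show "AE t in lebesgue_on I. ennreal (norm (\<psi> n t - P t)) \<le> ennreal (L2_norm U (\<lambda>x. u t x - s n t x))"
      using aeP by eventually_elim (auto intro: ennreal_leI)
  qed
  have nnl: "(\<lambda>n. \<integral>\<^sup>+ t. ennreal (norm (\<psi> n t - P t)) \<partial>lebesgue_on I) \<longlonglongrightarrow> 0"
    by (rule tendsto_sandwich[OF _ _ tendsto_const l1]) (use nn in auto)
  have P_int: "integrable (lebesgue_on I) P"
  proof -
    have "\<forall>\<^sub>F n in sequentially. (\<integral>\<^sup>+ t. ennreal (norm (\<psi> n t - P t)) \<partial>lebesgue_on I) < 1"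
      using order_tendstoD(2)[OF nnl] by simp
    then obtain n where "(\<integral>\<^sup>+ t. ennreal (norm (\<psi> n t - P t)) \<partial>lebesgue_on I) < 1"
      using eventually_happens'[OF sequentially_bot] by blast
    then have "(\<integral>\<^sup>+ t. ennreal (norm (\<psi> n t - P t)) \<partial>lebesgue_on I) < \<infinity>"
      unfolding infinity_ennreal_def by (rule less_trans[OF _ ennreal_one_less_top])
    then have "integrable (lebesgue_on I) (\<lambda>t. \<psi> n t - P t)"
      using P_meas borel_measurable_integrable[OF \<psi>_int[of n]] by (intro integrableI_bounded) auto
    from Bochner_Integration.integrable_diff[OF \<psi>_int[of n] this] show ?thesis by simp
  qed
  have "(\<lambda>n. LINT t|lebesgue_on I. \<psi> n t) \<longlonglongrightarrow> (LINT t|lebesgue_on I. P t)"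
    by (rule tendsto_L1_int[OF \<psi>_int P_int nnl])
  moreover have "(\<lambda>n. LINT t|lebesgue_on I. \<psi> n t) \<longlonglongrightarrow> ?pr J"
  proof -
    have "simple_integral_into I (s n) \<in> L2_space U" for n
      unfolding simple_integral_into_def using simple by (intro L2_space_sum L2_space_scale) auto
    then have "\<bar>?pr (simple_integral_into I (s n)) - ?pr J\<bar> \<le> L2_norm U (\<lambda>x. J x - simple_integral_into I (s n) x)" for n
      by (subst abs_minus_commute) (rule pr_diff[OF J(1)])
    then have "(\<lambda>n. ?pr (simple_integral_into I (s n)) - ?pr J) \<longlonglongrightarrow> 0"
      by (intro Lim_null_comparison[OF _ J(2)]) auto
    then show ?thesis unfolding \<psi>_val by (simp add: LIM_zero_iff)
  qed
  ultimately have "(LINT t|lebesgue_on I. P t) = ?pr J" by (rule LIMSEQ_unique)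
  then show ?thesis using P_int aeP by (intro exI[of _ P]) (auto elim: eventually_mono)
qed

text \<open>A set of full measure meets every nonempty open interval; properties known for almost
  every time thereby reach all times through continuity.\<close>

lemma AE_dense:
  assumes ae: "AE t in lebesgue_on {0<..<T}. P t" and t0: "t0 \<in> {0..T}" and e: "0 < e" and T: "0 < (T::real)"
  shows "\<exists>t. t \<in> {0<..<T} \<and> P t \<and> \<bar>t - t0\<bar> < e"
proof (rule ccontr)
  assume none: "\<not> ?thesis"
  define \<alpha> \<beta> where "\<alpha> = max 0 (t0 - e)" and "\<beta> = min T (t0 + e)"
  have lt: "\<alpha> < \<beta>" using t0 e T by (auto simp: \<alpha>_def \<beta>_def)
  have "AE t in lebesgue. t \<in> {0<..<T} \<longrightarrow> P t"
    using ae by (subst (asm) AE_restrict_space_iff) auto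
  then have "AE t in lebesgue. t \<notin> {\<alpha><..<\<beta>}"
  proof eventually_elim
    case (elim t)
    show ?case
    proof
      assume "t \<in> {\<alpha><..<\<beta>}"
      then have "t \<in> {0<..<T}" "\<bar>t - t0\<bar> < e" by (auto simp: \<alpha>_def \<beta>_def abs_less_iff)
      then show False using none elim by blast
    qed
  qed
  then have "{\<alpha><..<\<beta>} \<in> null_sets lebesgue" by (subst AE_iff_null_sets) auto
  then have "negligible {\<alpha><..<\<beta>}" by (simp add: negligible_iff_null_sets)
  then show False using open_not_negligible[of "{\<alpha><..<\<beta>}"] lt by auto
qed

text \<open>Du Bois-Reymond: testing with a smoothed indicator of [t1, t2], whose derivative is a
  difference of two mollifiers, gives s t2 - s t1 as the integral of f. The fundamental theorem does
  the rest.\<close>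

lemma weak_time_derivative_classical:
  fixes s f :: "real \<Rightarrow> real"
  assumes cs: "continuous_on {0..T} s" and cf: "continuous_on {0..T} f"
    and weak: "\<And>\<phi> \<alpha> \<beta>. smooth_real \<phi> \<Longrightarrow> 0 < \<alpha> \<Longrightarrow> \<beta> < T \<Longrightarrow> (\<And>t. \<phi> t \<noteq> 0 \<Longrightarrow> \<alpha> \<le> t \<and> t \<le> \<beta>) \<Longrightarrow>
       (LINT t|lebesgue_on {0<..<T}. deriv \<phi> t * s t) = - (LINT t|lebesgue_on {0<..<T}. \<phi> t * f t)"
    and t: "0 < t" "t < T"
  shows "(s has_real_derivative f t) (at t)"
proof -
  define s0 where "s0 x = indicator (cbox 0 T) x * s x" for x
  define f0 where "f0 x = indicator (cbox 0 T) x * f x" for x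
  have [measurable]: "s0 \<in> borel_measurable borel" "f0 \<in> borel_measurable borel"
    unfolding s0_def f0_def
    using borel_measurable_indicator_cbox[of 0 T s] borel_measurable_indicator_cbox[of 0 T f] cs cf by simp_all
  obtain C1 where C1: "0 \<le> C1" "\<And>x. x \<in> cbox 0 T \<Longrightarrow> \<bar>s x\<bar> \<le> C1" using continuous_cbox_bounded[of 0 T s] cs by auto
  obtain C2 where C2: "0 \<le> C2" "\<And>x. x \<in> cbox 0 T \<Longrightarrow> \<bar>f x\<bar> \<le> C2" using continuous_cbox_bounded[of 0 T f] cf by auto
  have bd: "\<bar>s0 x\<bar> \<le> C1" "\<bar>f0 x\<bar> \<le> C2" for x using C1 C2 by (auto simp: s0_def f0_def indicator_def)
  have key: "s t2 - s t1 = integral {t1..t2} f" if t12: "0 < t1" "t1 < t2" "t2 < T" for t1 t2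
  proof -
    have intf0: "integrable lborel (\<lambda>x. indicator {t1..t2} x * f0 x)"
      by (rule integrable_bounded_support[where C = C2 and a = t1 and b = t2])
         (use bd C2 in \<open>auto simp: indicator_def\<close>)
    have val: "(LINT x|lborel. indicator {t1..t2} x * f0 x) = integral {t1..t2} f"
    proof -
      have "(LINT x|lborel. indicator {t1..t2} x * f0 x) = (LINT x:{t1..t2}|lborel. f x)"
        unfolding set_lebesgue_integral_def
        using t12 by (intro Bochner_Integration.integral_cong) (auto simp: f0_def indicator_def)
      also have "\<dots> = integral {t1..t2} f"
        using t12 by (intro set_borel_integral_eq_integral(2) borel_integrable_atLeastAtMost' continuous_on_subset[OF cf]) auto
      finally show ?thesis .
    qed
    have "\<bar>(s t2 - s t1) - integral {t1..t2} f\<bar> \<le> \<kappa>" if \<kappa>: "0 < \<kappa>" for \<kappa>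
    proof -
      \<comment> \<open>Two mollification errors \<kappa>', together with the bound C2 of f on
        transition zones of total length 4 \<epsilon> \<le> 4 \<kappa>', add up to \<kappa>.\<close>
      define \<kappa>' where "\<kappa>' = \<kappa> / (2 + 4 * C2)"
      have \<kappa>': "0 < \<kappa>'" using \<kappa> C2 by (simp add: \<kappa>'_def add_pos_nonneg)
      have "\<exists>d>0. \<forall>x'. \<bar>x' - x\<bar> < d \<longrightarrow> \<bar>s x' - s x\<bar> < \<kappa>'" if "0 < x" "x < T" for x
        using cs that continuous_on_interior[of "{0..T}" s x] \<kappa>'
        by (simp add: continuous_at_eps_delta dist_real_def)
      from this[of t1] this[of t2] t12
      obtain d1 d2 where d: "0 < d1" "\<And>x. \<bar>x - t1\<bar> < d1 \<Longrightarrow> \<bar>s x - s t1\<bar> < \<kappa>'"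
        "0 < d2" "\<And>x. \<bar>x - t2\<bar> < d2 \<Longrightarrow> \<bar>s x - s t2\<bar> < \<kappa>'"
        by auto
      define \<epsilon> where "\<epsilon> = Min {d1 / 2, d2 / 2, \<kappa>', t1 / 2, (T - t2) / 2, (t2 - t1) / 2}"
      have \<epsilon>: "0 < \<epsilon>" "\<epsilon> < d1" "\<epsilon> < d2" "\<epsilon> \<le> \<kappa>'" "\<epsilon> < t1" "\<epsilon> < T - t2" "2 * \<epsilon> \<le> t2 - t1"
        using d \<kappa>' t12 by (auto simp: \<epsilon>_def min_def)
      obtain B1 \<rho>1 where B1: "smooth_real B1" "\<And>s. (B1 has_real_derivative \<rho>1 s) (at s)" "mono B1"
         "\<And>s. s \<le> t1 - \<epsilon> \<Longrightarrow> B1 s = 0" "\<And>s. s \<ge> t1 + \<epsilon> \<Longrightarrow> B1 s = 1"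
        and \<rho>1: "smooth_real \<rho>1" "\<And>s. 0 \<le> \<rho>1 s" "\<And>s. \<rho>1 s \<noteq> 0 \<Longrightarrow> \<bar>s - t1\<bar> \<le> \<epsilon>" "integrable lborel \<rho>1" "(LINT s|lborel. \<rho>1 s) = 1"
        using mollifier_1d[OF \<epsilon>(1), of t1] by blast
      obtain B2 \<rho>2 where B2: "smooth_real B2" "\<And>s. (B2 has_real_derivative \<rho>2 s) (at s)" "mono B2"
         "\<And>s. s \<le> t2 - \<epsilon> \<Longrightarrow> B2 s = 0" "\<And>s. s \<ge> t2 + \<epsilon> \<Longrightarrow> B2 s = 1"
        and \<rho>2: "smooth_real \<rho>2" "\<And>s. 0 \<le> \<rho>2 s" "\<And>s. \<rho>2 s \<noteq> 0 \<Longrightarrow> \<bar>s - t2\<bar> \<le> \<epsilon>" "integrable lborel \<rho>2" "(LINT s|lborel. \<rho>2 s) = 1"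
        using mollifier_1d[OF \<epsilon>(1), of t2] by blast
      have r1: "0 \<le> B1 x" "B1 x \<le> 1" for x
        using monoD[OF B1(3), of "min x (t1 - \<epsilon>)" x] monoD[OF B1(3), of x "max x (t1 + \<epsilon>)"]
          B1(4)[of "min x (t1 - \<epsilon>)"] B1(5)[of "max x (t1 + \<epsilon>)"] by auto
      have r2: "0 \<le> B2 x" "B2 x \<le> 1" for x
        using monoD[OF B2(3), of "min x (t2 - \<epsilon>)" x] monoD[OF B2(3), of x "max x (t2 + \<epsilon>)"]
          B2(4)[of "min x (t2 - \<epsilon>)"] B2(5)[of "max x (t2 + \<epsilon>)"] by auto
      define \<phi> where "\<phi> x = B1 x + (-1) * B2 x" for x
      have sm: "smooth_real \<phi>" unfolding \<phi>_def by (intro smooth_real_add smooth_real_cmult B1 B2)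
      have "(\<phi> has_real_derivative (\<rho>1 x + (-1) * \<rho>2 x)) (at x)" for x
        unfolding \<phi>_def by (intro DERIV_add DERIV_cmult B1 B2)
      then have d\<phi>: "deriv \<phi> = (\<lambda>x. \<rho>1 x + (-1) * \<rho>2 x)" by (auto intro!: DERIV_imp_deriv)
      have supp: "t1 - \<epsilon> \<le> x \<and> x \<le> t2 + \<epsilon>" if "\<phi> x \<noteq> 0" for x
      proof (rule ccontr)
        assume "\<not> (t1 - \<epsilon> \<le> x \<and> x \<le> t2 + \<epsilon>)"
        then have "x \<le> t1 - \<epsilon> \<and> x \<le> t2 - \<epsilon> \<or> x \<ge> t1 + \<epsilon> \<and> x \<ge> t2 + \<epsilon>" using t12 \<epsilon> by linarith
        then show False using that B1(4,5)[of x] B2(4,5)[of x] by (auto simp: \<phi>_def)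
      qed
      have eq: "(LINT t|lebesgue_on {0<..<T}. deriv \<phi> t * s t) = - (LINT t|lebesgue_on {0<..<T}. \<phi> t * f t)"
        by (rule weak[OF sm, of "t1 - \<epsilon>" "t2 + \<epsilon>"]) (use \<epsilon> supp in auto)
      have [measurable]: "\<phi> \<in> borel_measurable borel" "\<rho>1 \<in> borel_measurable borel" "\<rho>2 \<in> borel_measurable borel"
        using smooth_real_continuous_on[OF sm] smooth_real_continuous_on[OF \<rho>1(1)] smooth_real_continuous_on[OF \<rho>2(1)]
        by (auto intro!: borel_measurable_continuous_onI)
      have "integrable lborel (\<lambda>x. s0 x * r x)" if r: "integrable lborel r" for r
      proof (rule Bochner_Integration.integrable_bound[of _ "\<lambda>x. C1 * r x"])
        show "(\<lambda>x. s0 x * r x) \<in> borel_measurable lborel"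
          using borel_measurable_integrable[OF r] by simp
        show "AE x in lborel. norm (s0 x * r x) \<le> norm (C1 * r x)"
          using bd(1) C1(1) by (intro AE_I2) (simp add: abs_mult mult_right_mono)
      qed (use r in simp)
      then have i1: "integrable lborel (\<lambda>x. s0 x * \<rho>1 x)" "integrable lborel (\<lambda>x. s0 x * \<rho>2 x)"
        using \<rho>1(4) \<rho>2(4) by auto
      have "(LINT t|lebesgue_on {0<..<T}. deriv \<phi> t * s t) = (LINT t|lebesgue_on {0<..<T}. deriv \<phi> t * s0 t)"
        by (intro Bochner_Integration.integral_cong) (auto simp: s0_def)
      also have "\<dots> = (LINT x|lborel. indicator {0<..<T} x * (deriv \<phi> x * s0 x))"
        by (rule integral_lebesgue_on_borel) (auto simp: d\<phi>)
      also have "\<dots> = (LINT x|lborel. s0 x * \<rho>1 x - s0 x * \<rho>2 x)"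
      proof (rule Bochner_Integration.integral_cong)
        fix x
        have "\<rho>1 x = 0 \<and> \<rho>2 x = 0" if "x \<notin> {0<..<T}"
        proof -
          have "\<not> \<bar>x - t1\<bar> \<le> \<epsilon>" "\<not> \<bar>x - t2\<bar> \<le> \<epsilon>" using that \<epsilon> t12 by auto
          then show ?thesis using \<rho>1(3)[of x] \<rho>2(3)[of x] by blast
        qed
        then show "indicator {0<..<T} x * (deriv \<phi> x * s0 x) = s0 x * \<rho>1 x - s0 x * \<rho>2 x"
          by (auto simp: d\<phi> indicator_def algebra_simps)
      qed simp
      also have "\<dots> = (LINT x|lborel. s0 x * \<rho>1 x) - (LINT x|lborel. s0 x * \<rho>2 x)" using i1 by simp
      finally have L: "(LINT t|lebesgue_on {0<..<T}. deriv \<phi> t * s t) = (LINT x|lborel. s0 x * \<rho>1 x) - (LINT x|lborel. s0 x * \<rho>2 x)" .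
      have m1: "\<bar>(LINT x|lborel. s0 x * \<rho>1 x) - s t1\<bar> \<le> \<kappa>'"
      proof (rule mollified_value[OF \<rho>1(4,5,2) i1(1)])
        fix x assume "\<rho>1 x \<noteq> 0"
        then have "\<bar>x - t1\<bar> \<le> \<epsilon>" by (rule \<rho>1(3))
        then have "\<bar>x - t1\<bar> < d1" "s0 x = s x" using \<epsilon> t12 by (auto simp: s0_def indicator_def)
        then show "\<bar>s0 x - s t1\<bar> \<le> \<kappa>'" using d(2)[of x] by simp
      qed
      have m2: "\<bar>(LINT x|lborel. s0 x * \<rho>2 x) - s t2\<bar> \<le> \<kappa>'"
      proof (rule mollified_value[OF \<rho>2(4,5,2) i1(2)])
        fix x assume "\<rho>2 x \<noteq> 0"
        then have "\<bar>x - t2\<bar> \<le> \<epsilon>" by (rule \<rho>2(3))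
        then have "\<bar>x - t2\<bar> < d2" "s0 x = s x" using \<epsilon> t12 by (auto simp: s0_def indicator_def)
        then show "\<bar>s0 x - s t2\<bar> \<le> \<kappa>'" using d(4)[of x] by simp
      qed
      have \<phi>r: "\<bar>\<phi> x\<bar> \<le> 1" for x using r1[of x] r2[of x] by (auto simp: \<phi>_def abs_le_iff)
      have i2: "integrable lborel (\<lambda>x. \<phi> x * f0 x)"
      proof (rule integrable_bounded_support[where C = C2 and a = 0 and b = T])
        fix x show "\<bar>\<phi> x * f0 x\<bar> \<le> C2" using mult_mono[OF \<phi>r[of x] bd(2)[of x]] by (simp add: abs_mult)
        show "\<phi> x * f0 x = 0" if "x \<notin> cbox 0 T" using that by (simp add: f0_def)
      qed measurable
      have "(LINT t|lebesgue_on {0<..<T}. \<phi> t * f t) = (LINT t|lebesgue_on {0<..<T}. \<phi> t * f0 t)"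
        by (intro Bochner_Integration.integral_cong) (auto simp: f0_def)
      also have "\<dots> = (LINT x|lborel. indicator {0<..<T} x * (\<phi> x * f0 x))"
        by (rule integral_lebesgue_on_borel) auto
      also have "\<dots> = (LINT x|lborel. \<phi> x * f0 x)"
      proof (rule Bochner_Integration.integral_cong)
        fix x
        have "\<phi> x = 0" if "x \<notin> {0<..<T}" using that supp[of x] \<epsilon> by (cases "\<phi> x = 0") auto
        then show "indicator {0<..<T} x * (\<phi> x * f0 x) = \<phi> x * f0 x" by (auto simp: indicator_def)
      qed simp
      finally have R: "(LINT t|lebesgue_on {0<..<T}. \<phi> t * f t) = (LINT x|lborel. \<phi> x * f0 x)" .
      have "\<bar>(LINT x|lborel. \<phi> x * f0 x) - integral {t1..t2} f\<bar> = \<bar>LINT x|lborel. \<phi> x * f0 x - indicator {t1..t2} x * f0 x\<bar>"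
        unfolding val[symmetric] using i2 intf0 by simp
      also have "\<dots> \<le> (LINT x|lborel. C2 * (indicator {t1 - \<epsilon>..t1 + \<epsilon>} x + indicator {t2 - \<epsilon>..t2 + \<epsilon>} x))"
      proof (rule integral_abs_bound_integral)
        show "integrable lborel (\<lambda>x. \<phi> x * f0 x - indicator {t1..t2} x * f0 x)" using i2 intf0 by simp
        show "integrable lborel (\<lambda>x. C2 * (indicator {t1 - \<epsilon>..t1 + \<epsilon>} x + indicator {t2 - \<epsilon>..t2 + \<epsilon>} x))"
          by (intro integrable_mult_right Bochner_Integration.integrable_add integrable_real_indicator) (auto simp: emeasure_lborel_Icc_eq)
        fix x
        have "\<bar>\<phi> x - indicator {t1..t2} x\<bar> \<le> indicator {t1 - \<epsilon>..t1 + \<epsilon>} x + indicator {t2 - \<epsilon>..t2 + \<epsilon>} x"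
        proof (cases "x \<in> {t1 - \<epsilon>..t1 + \<epsilon>} \<union> {t2 - \<epsilon>..t2 + \<epsilon>}")
          case True
          have "\<bar>\<phi> x - indicator {t1..t2} x\<bar> \<le> 1"
          proof (cases "x \<in> {t1..t2}")
            case True
            have "0 \<le> \<phi> x"
              using B1(5)[of x] B2(4)[of x] r1[of x] r2[of x] \<epsilon> by (cases "x \<ge> t1 + \<epsilon>") (auto simp: \<phi>_def)
            then show ?thesis using True \<phi>r[of x] by simp
          qed (use \<phi>r[of x] in simp)
          then show ?thesis using True by (auto simp: indicator_def)
        next
          case False
          then consider "x < t1 - \<epsilon>" | "t1 + \<epsilon> < x" "x < t2 - \<epsilon>" | "t2 + \<epsilon> < x" by fastforce
          then have "\<phi> x = indicator {t1..t2} x"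
            by cases (use B1(4,5)[of x] B2(4,5)[of x] \<epsilon> t12 in \<open>auto simp: \<phi>_def indicator_def\<close>)
          then show ?thesis by simp
        qed
        then have "\<bar>\<phi> x - indicator {t1..t2} x\<bar> * \<bar>f0 x\<bar> \<le> (indicator {t1 - \<epsilon>..t1 + \<epsilon>} x + indicator {t2 - \<epsilon>..t2 + \<epsilon>} x) * C2"
          using bd(2)[of x] by (intro mult_mono) auto
        then show "\<bar>\<phi> x * f0 x - indicator {t1..t2} x * f0 x\<bar> \<le> C2 * (indicator {t1 - \<epsilon>..t1 + \<epsilon>} x + indicator {t2 - \<epsilon>..t2 + \<epsilon>} x)"
          unfolding left_diff_distrib[symmetric] abs_mult by (simp only: mult.commute[of C2])
      qed
      also have "\<dots> = C2 * (4 * \<epsilon>)"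
        using \<epsilon>(1) by (subst integral_mult_right_zero, subst Bochner_Integration.integral_add) (auto simp: emeasure_lborel_Icc_eq intro!: integrable_real_indicator)
      also have "\<dots> \<le> C2 * (4 * \<kappa>')" using \<epsilon> C2 by (intro mult_left_mono) auto
      finally have "\<bar>(LINT x|lborel. \<phi> x * f0 x) - integral {t1..t2} f\<bar> \<le> C2 * (4 * \<kappa>')" .
      then have "\<bar>(s t2 - s t1) - integral {t1..t2} f\<bar> \<le> 2 * \<kappa>' + C2 * (4 * \<kappa>')"
        using m1 m2 eq L R by linarith
      also have "\<dots> = (2 + 4 * C2) * \<kappa>'" by (simp add: algebra_simps)
      also have "\<dots> = \<kappa>" using C2(1) by (simp add: \<kappa>'_def add_nonneg_eq_0_iff)
      finally show ?thesis .
    qed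
    note close = this
    show ?thesis
    proof (rule ccontr)
      assume "s t2 - s t1 \<noteq> integral {t1..t2} f"
      then have pos: "0 < \<bar>(s t2 - s t1) - integral {t1..t2} f\<bar> / 2" by simp
      from close[OF pos] pos show False by simp
    qed
  qed
  have "((\<lambda>u. integral {t / 2..u} f) has_real_derivative f t) (at t within {t / 2..(t + T) / 2})"
    by (rule integral_has_real_derivative) (use t in \<open>auto intro: continuous_on_subset[OF cf]\<close>)
  then have "((\<lambda>u. integral {t / 2..u} f) has_real_derivative f t) (at t)"
    using at_within_Icc_at[of "t / 2" t "(t + T) / 2"] t by simp
  then have "((\<lambda>u. s (t / 2) + integral {t / 2..u} f) has_real_derivative 0 + f t) (at t)"
    by (intro DERIV_add DERIV_const)
  then have "((\<lambda>u. s (t / 2) + integral {t / 2..u} f) has_real_derivative f t) (at t)" by simp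
  then show ?thesis
  proof (rule has_field_derivative_transform_within_open[of _ _ _ "{t / 2<..<T}"])
    fix x assume "x \<in> {t / 2<..<T}"
    then have "s x - s (t / 2) = integral {t / 2..x} f" using t by (intro key) auto
    then show "s (t / 2) + integral {t / 2..x} f = s x" by simp
  qed (use t in auto)
qed

section \<open>The logarithmic potential\<close>

definition log_pot :: "(phase \<Rightarrow> real) \<Rightarrow> real \<Rightarrow> real" where
  "log_pot \<sigma> s = \<sigma> Wet * ln s - \<sigma> NonWet * ln (1 - s)"

text \<open>The difference of \<open>chem_pot\<close> for the wetting phase at s and for the other
  phase at 1 - s; the pressure has cancelled. \<open>log_pot\<close> is the part that the scheme
  takes at the new time level.\<close>

definition pot_diff :: "(phase \<Rightarrow> real) \<Rightarrow> real \<Rightarrow> real \<Rightarrow> real" where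
  "pot_diff \<sigma> \<sigma>wn s = log_pot \<sigma> s + \<sigma>wn * (1 - 2 * s)"

lemma log_pot_deriv:
  assumes "0 < s" "s < 1"
  shows "(log_pot \<sigma> has_real_derivative \<sigma> Wet / s + \<sigma> NonWet / (1 - s)) (at s)"
proof -
  have "((\<lambda>s. ln (1 - s)) has_real_derivative (1 / (1 - s)) * (-1)) (at s)"
    by (rule DERIV_chain2[OF DERIV_ln_divide]) (use assms in \<open>auto intro!: derivative_eq_intros\<close>)
  then have "((\<lambda>s. \<sigma> Wet * ln s - \<sigma> NonWet * ln (1 - s)) has_real_derivative
      \<sigma> Wet * (1 / s) - \<sigma> NonWet * ((1 / (1 - s)) * (-1))) (at s)"
    by (intro DERIV_diff DERIV_cmult DERIV_ln_divide) (use assms in auto)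
  then show ?thesis by (simp add: log_pot_def[abs_def])
qed

text \<open>The right side minus the left is an explicit square over s (1 - s). This lower bound for
  the slope of \<open>log_pot\<close> is the origin of the squared sum of roots in
  \<gamma>0.\<close>

lemma log_pot_deriv_lower:
  assumes "0 \<le> A" "0 \<le> B" "0 < s" "s < (1::real)"
  shows "(sqrt A + sqrt B)\<^sup>2 \<le> A / s + B / (1 - s)"
proof -
  have "A / s + B / (1 - s) - (sqrt A + sqrt B)\<^sup>2 = (sqrt A * (1 - s) - sqrt B * s)\<^sup>2 / (s * (1 - s))"
  proof -
    define \<alpha> \<beta> where "\<alpha> = sqrt A" "\<beta> = sqrt B"
    have AB: "A = \<alpha>\<^sup>2" "B = \<beta>\<^sup>2" using assms by (auto simp: \<alpha>_\<beta>_def)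
    have s: "s \<noteq> 0" "1 - s \<noteq> 0" using assms by auto
    show ?thesis
      unfolding \<alpha>_\<beta>_def[symmetric] AB using s
      by (simp add: divide_simps) (simp add: power2_eq_square algebra_simps)
  qed
  also have "\<dots> \<ge> 0" using assms by simp
  finally show ?thesis by simp
qed

lemma log_pot_mvt:
  assumes "0 < p" "p < 1" "0 < q" "q < 1"
  shows "\<exists>\<xi>. min p q \<le> \<xi> \<and> \<xi> \<le> max p q \<and> \<bar>\<xi> - q\<bar> \<le> \<bar>p - q\<bar> \<and>
    log_pot \<sigma> p - log_pot \<sigma> q = (\<sigma> Wet / \<xi> + \<sigma> NonWet / (1 - \<xi>)) * (p - q)"
proof (cases p q rule: linorder_cases)
  case equal
  then show ?thesis by (intro exI[of _ q]) auto
next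
  case less
  obtain \<xi> where \<xi>: "p < \<xi>" "\<xi> < q" "log_pot \<sigma> q - log_pot \<sigma> p = (q - p) * (\<sigma> Wet / \<xi> + \<sigma> NonWet / (1 - \<xi>))"
    using MVT2[OF less, of "log_pot \<sigma>" "\<lambda>s. \<sigma> Wet / s + \<sigma> NonWet / (1 - s)"] log_pot_deriv assms by force
  have "x - y = D * (p - q)" if "y - x = (q - p) * D" for x y D :: real
    using that by (simp add: algebra_simps)
  from this[OF \<xi>(3)] have e: "log_pot \<sigma> p - log_pot \<sigma> q = (\<sigma> Wet / \<xi> + \<sigma> NonWet / (1 - \<xi>)) * (p - q)" .
  have "min p q \<le> \<xi>" "\<xi> \<le> max p q" "\<bar>\<xi> - q\<bar> \<le> \<bar>p - q\<bar>" using \<xi>(1,2) by auto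
  with e show ?thesis by blast
next
  case greater
  obtain \<xi> where \<xi>: "q < \<xi>" "\<xi> < p" "log_pot \<sigma> p - log_pot \<sigma> q = (p - q) * (\<sigma> Wet / \<xi> + \<sigma> NonWet / (1 - \<xi>))"
    using MVT2[OF greater, of "log_pot \<sigma>" "\<lambda>s. \<sigma> Wet / s + \<sigma> NonWet / (1 - s)"] log_pot_deriv assms by force
  have "min p q \<le> \<xi>" "\<xi> \<le> max p q" "\<bar>\<xi> - q\<bar> \<le> \<bar>p - q\<bar>" using \<xi>(1,2) by auto
  with \<xi>(3) show ?thesis by (metis mult.commute)
qed

lemma log_pot_coercive:
  assumes \<sigma>: "\<And>\<alpha>. 0 < \<sigma> \<alpha>" and "0 < p" "p < 1" "0 < q" "q < 1"
  shows "(sqrt (\<sigma> Wet) + sqrt (\<sigma> NonWet))\<^sup>2 * (p - q)\<^sup>2 \<le> (log_pot \<sigma> p - log_pot \<sigma> q) * (p - q)"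
proof -
  obtain \<xi> where \<xi>: "min p q \<le> \<xi>" "\<xi> \<le> max p q"
    "log_pot \<sigma> p - log_pot \<sigma> q = (\<sigma> Wet / \<xi> + \<sigma> NonWet / (1 - \<xi>)) * (p - q)"
    using log_pot_mvt[OF assms(2-)] by blast
  have "(sqrt (\<sigma> Wet) + sqrt (\<sigma> NonWet))\<^sup>2 \<le> \<sigma> Wet / \<xi> + \<sigma> NonWet / (1 - \<xi>)"
    using \<xi> assms \<sigma>[THEN less_imp_le] by (intro log_pot_deriv_lower) auto
  then have "(sqrt (\<sigma> Wet) + sqrt (\<sigma> NonWet))\<^sup>2 * (p - q)\<^sup>2 \<le> (\<sigma> Wet / \<xi> + \<sigma> NonWet / (1 - \<xi>)) * (p - q)\<^sup>2"
    by (rule mult_right_mono) simp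
  then show ?thesis unfolding \<xi>(3) by (simp add: power2_eq_square mult.assoc)
qed

text \<open>On [m, 1 - m] the slope is at most (\<sigma>w + \<sigma>n) / m and is itself Lipschitz
  with constant (\<sigma>w + \<sigma>n) / m^2; the mean value form, with \<xi> between p and q,
  turns the latter into a quadratic remainder.\<close>

lemma log_pot_lipschitz:
  assumes \<sigma>: "\<And>\<alpha>. 0 < \<sigma> \<alpha>" and m: "0 < m" and pq: "p \<in> {m..1 - m}" "q \<in> {m..1 - m}"
  shows "\<bar>log_pot \<sigma> p - log_pot \<sigma> q\<bar> \<le> (\<sigma> Wet + \<sigma> NonWet) / m * \<bar>p - q\<bar>"
    and "\<bar>\<sigma> Wet / q + \<sigma> NonWet / (1 - q)\<bar> \<le> (\<sigma> Wet + \<sigma> NonWet) / m"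
    and "\<bar>log_pot \<sigma> p - log_pot \<sigma> q - (\<sigma> Wet / q + \<sigma> NonWet / (1 - q)) * (p - q)\<bar> \<le> (\<sigma> Wet + \<sigma> NonWet) / m\<^sup>2 * (p - q)\<^sup>2"
proof -
  have D: "\<bar>\<sigma> Wet / q + \<sigma> NonWet / (1 - q)\<bar> \<le> (\<sigma> Wet + \<sigma> NonWet) / m" if "q \<in> {m..1 - m}" for q
  proof -
    have "\<sigma> Wet / q \<le> \<sigma> Wet / m" "\<sigma> NonWet / (1 - q) \<le> \<sigma> NonWet / m"
      using that m \<sigma> by (auto intro!: divide_left_mono simp: less_imp_le)
    moreover have "0 \<le> \<sigma> Wet / q" "0 \<le> \<sigma> NonWet / (1 - q)" using that m \<sigma>[THEN less_imp_le] by auto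
    ultimately show ?thesis by (simp add: add_divide_distrib)
  qed
  show "\<bar>\<sigma> Wet / q + \<sigma> NonWet / (1 - q)\<bar> \<le> (\<sigma> Wet + \<sigma> NonWet) / m" by (rule D[OF pq(2)])
  obtain \<xi> where \<xi>: "min p q \<le> \<xi>" "\<xi> \<le> max p q" "\<bar>\<xi> - q\<bar> \<le> \<bar>p - q\<bar>"
    "log_pot \<sigma> p - log_pot \<sigma> q = (\<sigma> Wet / \<xi> + \<sigma> NonWet / (1 - \<xi>)) * (p - q)"
    using log_pot_mvt[of p q] pq m by auto
  have \<xi>I: "\<xi> \<in> {m..1 - m}" using \<xi>(1,2) pq by auto
  show "\<bar>log_pot \<sigma> p - log_pot \<sigma> q\<bar> \<le> (\<sigma> Wet + \<sigma> NonWet) / m * \<bar>p - q\<bar>"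
    unfolding \<xi>(4) abs_mult by (intro mult_right_mono D[OF \<xi>I]) auto
  have pos: "0 < \<xi>" "0 < q" "0 < 1 - \<xi>" "0 < 1 - q" using \<xi>I pq m by auto
  have "(\<sigma> Wet / \<xi> + \<sigma> NonWet / (1 - \<xi>)) - (\<sigma> Wet / q + \<sigma> NonWet / (1 - q)) =
     \<sigma> Wet / (\<xi> * q) * (q - \<xi>) + \<sigma> NonWet / ((1 - \<xi>) * (1 - q)) * (\<xi> - q)"
  proof -
    have "\<sigma> Wet / \<xi> - \<sigma> Wet / q = \<sigma> Wet / (\<xi> * q) * (q - \<xi>)" using pos by (simp add: field_simps)
    moreover have "\<sigma> NonWet / (1 - \<xi>) - \<sigma> NonWet / (1 - q) = \<sigma> NonWet / ((1 - \<xi>) * (1 - q)) * (\<xi> - q)"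
    proof -
      have "\<sigma> NonWet / x - \<sigma> NonWet / y = \<sigma> NonWet / (x * y) * (y - x)" if "0 < x" "0 < y" for x y
        using that by (simp add: field_simps)
      from this[OF pos(3,4)] show ?thesis by simp
    qed
    ultimately show ?thesis by linarith
  qed
  also have "\<bar>\<sigma> Wet / (\<xi> * q) * (q - \<xi>) + \<sigma> NonWet / ((1 - \<xi>) * (1 - q)) * (\<xi> - q)\<bar> \<le>
     \<sigma> Wet / m\<^sup>2 * \<bar>\<xi> - q\<bar> + \<sigma> NonWet / m\<^sup>2 * \<bar>\<xi> - q\<bar>"
  proof (rule order_trans[OF abs_triangle_ineq add_mono])
    have mm: "m\<^sup>2 \<le> x * y" if "m \<le> x" "m \<le> y" for x y
      unfolding power2_eq_square using that m by (intro mult_mono) auto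
    have "\<sigma> Wet / (\<xi> * q) \<le> \<sigma> Wet / m\<^sup>2" "\<sigma> NonWet / ((1 - \<xi>) * (1 - q)) \<le> \<sigma> NonWet / m\<^sup>2"
      using \<xi>I pq m pos \<sigma>[THEN less_imp_le] by (auto intro!: divide_left_mono mm)
    moreover have "0 \<le> \<sigma> Wet / (\<xi> * q)" "0 \<le> \<sigma> NonWet / ((1 - \<xi>) * (1 - q))"
      using pos \<sigma>[THEN less_imp_le] by auto
    moreover have "\<bar>x * y\<bar> \<le> z * \<bar>y\<bar>" if "0 \<le> x" "x \<le> z" for x y z :: real
      using that by (simp only: abs_mult abs_of_nonneg mult_right_mono abs_ge_zero)
    ultimately show "\<bar>\<sigma> Wet / (\<xi> * q) * (q - \<xi>)\<bar> \<le> \<sigma> Wet / m\<^sup>2 * \<bar>\<xi> - q\<bar>"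
      "\<bar>\<sigma> NonWet / ((1 - \<xi>) * (1 - q)) * (\<xi> - q)\<bar> \<le> \<sigma> NonWet / m\<^sup>2 * \<bar>\<xi> - q\<bar>"
      by (metis abs_minus_commute)+
  qed
  also have "\<dots> \<le> (\<sigma> Wet + \<sigma> NonWet) / m\<^sup>2 * \<bar>p - q\<bar>"
  proof -
    have "\<sigma> Wet / m\<^sup>2 * \<bar>\<xi> - q\<bar> + \<sigma> NonWet / m\<^sup>2 * \<bar>\<xi> - q\<bar> = (\<sigma> Wet + \<sigma> NonWet) / m\<^sup>2 * \<bar>\<xi> - q\<bar>"
      by (simp add: add_divide_distrib distrib_right)
    moreover have "0 \<le> (\<sigma> Wet + \<sigma> NonWet) / m\<^sup>2" using \<sigma>[THEN less_imp_le] by simp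
    ultimately show ?thesis using \<xi>(3) by (simp only: mult_left_mono)
  qed
  finally have d: "\<bar>(\<sigma> Wet / \<xi> + \<sigma> NonWet / (1 - \<xi>)) - (\<sigma> Wet / q + \<sigma> NonWet / (1 - q))\<bar> \<le> (\<sigma> Wet + \<sigma> NonWet) / m\<^sup>2 * \<bar>p - q\<bar>" .
  have "\<bar>log_pot \<sigma> p - log_pot \<sigma> q - (\<sigma> Wet / q + \<sigma> NonWet / (1 - q)) * (p - q)\<bar> =
     \<bar>(\<sigma> Wet / \<xi> + \<sigma> NonWet / (1 - \<xi>)) - (\<sigma> Wet / q + \<sigma> NonWet / (1 - q))\<bar> * \<bar>p - q\<bar>"
    unfolding \<xi>(4) by (simp add: left_diff_distrib[symmetric] abs_mult)
  also have "\<dots> \<le> ((\<sigma> Wet + \<sigma> NonWet) / m\<^sup>2 * \<bar>p - q\<bar>) * \<bar>p - q\<bar>" by (rule mult_right_mono[OF d]) simp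
  finally show "\<bar>log_pot \<sigma> p - log_pot \<sigma> q - (\<sigma> Wet / q + \<sigma> NonWet / (1 - q)) * (p - q)\<bar> \<le> (\<sigma> Wet + \<sigma> NonWet) / m\<^sup>2 * (p - q)\<^sup>2"
    by (simp only: mult.assoc abs_mult_self_eq power2_eq_square)
qed

section \<open>The no-flow condition and its inheritance\<close>

lemma continuous_AE_eq:
  fixes f g :: "'a::euclidean_space \<Rightarrow> real"
  assumes ne: "box a b \<noteq> {}" and cont: "continuous_on (cbox a b) f" "continuous_on (cbox a b) g"
    and ae: "AE x in lebesgue_on (cbox a b). f x = g x" and x: "x \<in> cbox a b"
  shows "f x = g x"
proof -
  have ae': "AE x in lebesgue. x \<in> cbox a b \<longrightarrow> f x = g x"
    using ae by (subst (asm) AE_restrict_space_iff) auto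
  have box: "f y - g y = 0" if y: "y \<in> box a b" for y
  proof (rule ccontr)
    assume neq: "f y - g y \<noteq> 0"
    have "continuous_on (box a b) (\<lambda>x. f x - g x)"
      using cont box_subset_cbox by (intro continuous_intros) (blast intro: continuous_on_subset)+
    then have op: "open (box a b \<inter> (\<lambda>x. f x - g x) -` (- {0}))"
      by (intro continuous_open_preimage) auto
    have "AE x in lebesgue. x \<notin> box a b \<inter> (\<lambda>x. f x - g x) -` (- {0})"
      using ae' by eventually_elim (use box_subset_cbox[of a b] in auto)
    then have "box a b \<inter> (\<lambda>x. f x - g x) -` (- {0}) \<in> null_sets lebesgue"
      using op by (subst AE_iff_null_sets) auto
    then have "negligible (box a b \<inter> (\<lambda>x. f x - g x) -` (- {0}))" by (simp add: negligible_iff_null_sets)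
    moreover have "y \<in> box a b \<inter> (\<lambda>x. f x - g x) -` (- {0})" using y neq by simp
    ultimately show False using open_not_negligible[OF op] by blast
  qed
  have "closure (box a b) = cbox a b" using ne by (rule closure_box)
  then have "f x - g x = 0"
    using continuous_constant_on_closure[of "box a b" "\<lambda>x. f x - g x" 0 x] box x cont
    by (auto intro!: continuous_intros)
  then show ?thesis by simp
qed

text \<open>The inward ray stays in the box, so the derivative within the box determines the
  one-sided quotient along it, and linearity of D makes that derivative 0.\<close>

lemma no_flow_normal_quotient:
  fixes w :: "real^'n \<Rightarrow> real"
  assumes D: "(w has_derivative D) (at x within cbox a b)" "D (d *\<^sub>R axis l 1) = 0"
    and inside: "\<And>s. 0 \<le> s \<Longrightarrow> s \<le> L \<Longrightarrow> x + (s * d) *\<^sub>R axis l 1 \<in> cbox a b" and L: "0 < L"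
  shows "((\<lambda>s. (w (x + (s * d) *\<^sub>R axis l 1) - w x) / s) \<longlongrightarrow> 0) (at_right 0)"
proof -
  let ?\<gamma> = "\<lambda>s::real. x + (s * d) *\<^sub>R axis l 1 :: real^'n"
  have "(?\<gamma> has_derivative (\<lambda>s. (s * d) *\<^sub>R axis l 1)) (at 0 within {0..L})"
    by (auto intro!: derivative_eq_intros)
  moreover have "(w has_derivative D) (at (?\<gamma> 0) within ?\<gamma> ` {0..L})"
    using D(1) inside by (auto intro: has_derivative_subset)
  ultimately have "((\<lambda>s. w (?\<gamma> s)) has_derivative (\<lambda>s. D ((s * d) *\<^sub>R axis l 1))) (at 0 within {0..L})"
    by (rule has_derivative_in_compose)
  moreover have "(\<lambda>s. D ((s * d) *\<^sub>R axis l 1)) = (*) 0"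
  proof
    fix s
    interpret bounded_linear D using D(1) by (rule has_derivative_bounded_linear)
    have "D ((s * d) *\<^sub>R axis l 1) = s * D (d *\<^sub>R axis l 1)" using scaleR[of s "d *\<^sub>R axis l 1"] by simp
    then show "D ((s * d) *\<^sub>R axis l 1) = 0 * s" using D(2) by simp
  qed
  ultimately have "((\<lambda>s. w (?\<gamma> s)) has_field_derivative 0) (at 0 within {0..L})"
    by (simp only: has_field_derivative_def)
  then have "((\<lambda>s. (w (?\<gamma> s) - w x) / s) \<longlongrightarrow> 0) (at 0 within {0..L})"
    by (simp add: has_field_derivative_iff)
  then show ?thesis using L by (simp add: at_within_Icc_at_right)
qed

context cosine_box
begin

lemma box_nonempty: "box a b \<noteq> {}"
proof -
  have "(1 / 2) *\<^sub>R (a + b) \<in> box a b" using ab by (auto simp: mem_box_cart field_simps)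
  then show ?thesis by blast
qed

text \<open>On a face the vanishing normal derivative is inherited by \<open>u\<close> from \<open>F \<circ> u\<close>, because \<open>F\<close>
  increases at least linearly.\<close>

lemma neumann_classI:
  fixes F :: "real \<Rightarrow> real"
  assumes cu: "continuous_on (cbox a b) u" and C: "0 \<le> C"
    and wd: "\<And>l. \<exists>v. weak_deriv (box a b) [axis l 1, axis l 1] u v \<and> (AE x in lebesgue_on (box a b). \<bar>v x\<bar> \<le> C)"
    and co: "\<And>x y. x \<in> cbox a b \<Longrightarrow> y \<in> cbox a b \<Longrightarrow> \<gamma> * \<bar>u x - u y\<bar> \<le> \<bar>F (u x) - F (u y)\<bar>" and \<gamma>: "0 < \<gamma>"
    and bc: "\<And>x \<nu>. x \<in> cbox a b \<Longrightarrow> outer_normal a b x \<nu> \<Longrightarrow>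
        \<exists>D. ((\<lambda>x. F (u x)) has_derivative D) (at x within cbox a b) \<and> D \<nu> = 0"
  shows "neumann_class a b (4 * C) u"
proof -
  have sd: "\<bar>second_diff l \<delta> u x\<bar> \<le> 4 * C * \<delta>\<^sup>2"
    if "0 < \<delta>" "x \<in> cbox a b" "x + \<delta> *\<^sub>R axis l 1 \<in> cbox a b" "x - \<delta> *\<^sub>R axis l 1 \<in> cbox a b" for l \<delta> x
  proof (rule second_diff_closed_box[OF ab cu _ that])
    fix y \<delta> assume y: "0 < \<delta>" "y \<in> box a b" "y + \<delta> *\<^sub>R axis l 1 \<in> box a b" "y - \<delta> *\<^sub>R axis l 1 \<in> box a b"
    obtain v where "weak_deriv (box a b) [axis l 1, axis l 1] u v" "AE x in lebesgue_on (box a b). \<bar>v x\<bar> \<le> C"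
      using wd[of l] by blast
    from weak_second_deriv_second_diff[OF this C cu y(2-4,1)]
    show "\<bar>second_diff l \<delta> u y\<bar> \<le> 4 * C * \<delta>\<^sup>2" .
  qed
  \<comment> \<open>The sign d points inwards: 1 on the lower face and -1 on the upper one, so that
    one argument serves both.\<close>
  have ray: "\<bar>u (x + (s * d) *\<^sub>R axis l 1) - u x\<bar> \<le> 4 * C * s\<^sup>2"
    if x: "x \<in> cbox a b" and d: "d = 1 \<and> x $ l = a $ l \<or> d = -1 \<and> x $ l = b $ l"
      and s: "0 \<le> s" "s \<le> b $ l - a $ l" for x d l s
  proof -
    let ?L = "b $ l - a $ l"
    let ?p = "\<lambda>s. x + (s * d) *\<^sub>R axis l 1"
    have inside: "?p s \<in> cbox a b" if "0 \<le> s" "s \<le> ?L" for s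
      using mem_cbox_shift[OF x, of "s * d" l] d that by auto
    have "outer_normal a b x (- d *\<^sub>R axis l 1)" using d unfolding outer_normal_def by auto
    from bc[OF x this] obtain D where D: "((\<lambda>x. F (u x)) has_derivative D) (at x within cbox a b)" "D (- d *\<^sub>R axis l 1) = 0"
      by blast
    have D0: "D (d *\<^sub>R axis l 1) = 0"
    proof -
      interpret bounded_linear D using D(1) by (rule has_derivative_bounded_linear)
      show ?thesis using D(2) neg[of "d *\<^sub>R axis l 1"] by simp
    qed
    have limF: "((\<lambda>s. (F (u (?p s)) - F (u x)) / s) \<longlongrightarrow> 0) (at_right 0)"
      by (rule no_flow_normal_quotient[where w = "\<lambda>x. F (u x)", OF D(1) D0 inside len_pos])
    have lim: "((\<lambda>s. (u (?p s) - u x) / s) \<longlongrightarrow> 0) (at_right 0)"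
    proof (rule Lim_null_comparison)
      show "((\<lambda>s. (1 / \<gamma>) * \<bar>(F (u (?p s)) - F (u x)) / s\<bar>) \<longlongrightarrow> 0) (at_right 0)"
        using tendsto_mult[OF tendsto_const[of "1 / \<gamma>"] tendsto_rabs[OF limF]] by simp
      have "\<bar>(u (?p s) - u x) / s\<bar> \<le> (1 / \<gamma>) * \<bar>(F (u (?p s)) - F (u x)) / s\<bar>" if "0 < s" "s < ?L" for s
        using co[OF inside[of s] x] that \<gamma> by (simp add: abs_divide field_simps)
      then show "\<forall>\<^sub>F s in at_right 0. norm ((u (?p s) - u x) / s) \<le> (1 / \<gamma>) * \<bar>(F (u (?p s)) - F (u x)) / s\<bar>"
        unfolding eventually_at_right_field using len_pos[of l] by (intro exI[of _ ?L]) auto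
    qed
    have "\<bar>u (?p s) - u (?p 0)\<bar> \<le> 4 * C * s\<^sup>2"
    proof (rule quadratic_growth_from_second_diff[where L = ?L and f = "\<lambda>s. u (?p s)"])
      show "((\<lambda>s. (u (?p s) - u (?p 0)) / s) \<longlongrightarrow> 0) (at_right 0)" using lim by simp
      fix r assume r: "0 < r" "2 * r \<le> ?L"
      have "\<bar>second_diff l r u (?p r)\<bar> \<le> 4 * C * r\<^sup>2"
      proof (rule sd)
        have "(r * d) + r = 2 * r * d \<and> r * d - r = 0 \<or> (r * d) + r = 0 \<and> r * d - r = 2 * r * d" using d by auto
        moreover have "x + (2 * r * d) *\<^sub>R axis l 1 \<in> cbox a b" "x + 0 *\<^sub>R axis l 1 \<in> cbox a b"
          using inside[of "2 * r"] x r by auto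
        moreover have "?p r + r *\<^sub>R axis l 1 = x + (r * d + r) *\<^sub>R axis l 1" "?p r - r *\<^sub>R axis l 1 = x + (r * d - r) *\<^sub>R axis l 1"
          by (simp_all add: scaleR_add_left scaleR_diff_left)
        ultimately show "?p r + r *\<^sub>R axis l 1 \<in> cbox a b" "?p r - r *\<^sub>R axis l 1 \<in> cbox a b"
          by metis+
      qed (use r inside in auto)
      moreover have "second_diff l r u (?p r) = u (?p (2 * r)) - 2 * u (?p r) + u (?p 0)"
      proof -
        have "u (?p r + r *\<^sub>R axis l 1) + u (?p r - r *\<^sub>R axis l 1) = u (?p (2 * r)) + u (?p 0)"
        proof (cases "d = 1")
          case True
          then have "?p r + r *\<^sub>R axis l 1 = ?p (2 * r)" "?p r - r *\<^sub>R axis l 1 = ?p 0"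
            by (auto simp: vec_eq_iff axis_def)
          then show ?thesis by (simp only:)
        next
          case False
          then have "?p r + r *\<^sub>R axis l 1 = ?p 0" "?p r - r *\<^sub>R axis l 1 = ?p (2 * r)"
            using d by (auto simp: vec_eq_iff axis_def)
          then show ?thesis by (simp only: add.commute)
        qed
        then show ?thesis unfolding second_diff_def by simp
      qed
      ultimately show "\<bar>u (?p (2 * r)) - 2 * u (?p r) + u (?p 0)\<bar> \<le> 4 * C * r\<^sup>2" by simp
    qed (use s in auto)
    then show ?thesis by simp
  qed
  show ?thesis
    unfolding neumann_class_def
  proof (intro conjI allI impI cu; (elim conjE)?)
    fix l x s assume A: "x \<in> cbox a b" "x $ l = a $ l \<or> x $ l = b $ l" "x + s *\<^sub>R axis l 1 \<in> cbox a b"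
    have s: "a $ l \<le> x $ l + s" "x $ l + s \<le> b $ l" using A(3) mem_cbox_shift[OF A(1)] by auto
    from A(2) show "\<bar>u (x + s *\<^sub>R axis l 1) - u x\<bar> \<le> 4 * C * s\<^sup>2"
    proof
      assume "x $ l = a $ l"
      then show ?thesis using ray[OF A(1), of 1 l s] s by simp
    next
      assume "x $ l = b $ l"
      then show ?thesis using ray[OF A(1), of "-1" l "- s"] s by simp
    qed
  qed (use sd in blast)
qed

text \<open>The weak second derivatives are added over all directions for one product test function.
  Its compact support makes locally integrable factors integrable; the second part permits the two
  phases to be subtracted.\<close>

lemma weak_laplacian_pairing:
  fixes f :: "'n \<Rightarrow> real \<Rightarrow> real"
  assumes lap: "weak_laplacian (box a b) U v" and v: "v \<in> borel_measurable (lebesgue_on (box a b))"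
    and f: "\<And>l. smooth_real (f l)" "\<And>l s. f l s \<noteq> 0 \<Longrightarrow> \<alpha> $ l \<le> s \<and> s \<le> \<beta> $ l"
    and \<alpha>\<beta>: "\<And>l. a $ l < \<alpha> $ l" "\<And>l. \<beta> $ l < b $ l"
  defines "\<phi> \<equiv> \<lambda>x::real^'n. \<Prod>l\<in>UNIV. f l (x $ l)"
  shows "(LINT x|lebesgue_on (box a b). v x * \<phi> x) =
      (\<Sum>l\<in>UNIV. LINT x|lebesgue_on (box a b). U x * iter_deriv [axis l 1, axis l 1] \<phi> x)"
    and "integrable (lebesgue_on (box a b)) (\<lambda>x. U x * iter_deriv [axis l 1, axis l 1] \<phi> x)"
proof -
  let ?B = "lebesgue_on (box a b)"
  obtain w where w: "\<And>e. e \<in> Basis \<Longrightarrow> weak_deriv (box a b) [e, e] U (w e)"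
    and ae: "AE x in ?B. v x = (\<Sum>e\<in>Basis. w e x)"
    using lap unfolding weak_laplacian_def by blast
  have sub: "cbox \<alpha> \<beta> \<subseteq> box a b"
    unfolding subset_iff mem_box_cart using \<alpha>\<beta> by (meson less_le_trans le_less_trans)
  have test: "test_fun (box a b) \<phi>" unfolding \<phi>_def by (rule test_fun_prod_components[OF f \<alpha>\<beta>])
  have c\<phi>: "continuous_on A \<phi>" for A
    unfolding \<phi>_def
    by (intro continuous_on_prod continuous_on_compose2[OF smooth_real_continuous_on[OF f(1), of UNIV]] continuous_intros) auto
  have \<phi>out: "\<phi> x = 0" if out: "x \<notin> cbox \<alpha> \<beta>" for x
  proof -
    obtain l where "\<not> (\<alpha> $ l \<le> x $ l \<and> x $ l \<le> \<beta> $ l)" using out unfolding mem_box_cart by blast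
    then have "f l (x $ l) = 0" using f(2) by blast
    then show ?thesis unfolding \<phi>_def by (metis UNIV_I finite prod_zero)
  qed
  have prodl: "(\<Prod>m\<in>UNIV. g m) = g l * (\<Prod>m\<in>UNIV - {l}. g m)" for g :: "'n \<Rightarrow> real" and l
    by (rule prod.remove) auto
  have D\<phi>: "iter_deriv [axis l 1, axis l 1] \<phi> = (\<lambda>x. deriv (deriv (f l)) (x $ l) * (\<Prod>m\<in>UNIV - {l}. f m (x $ m)))" for l
    unfolding \<phi>_def
    by (subst iter_deriv_prod_components[OF f(1)], force simp: axis_in_Basis_iff, rule ext, subst prodl[of _ l])
       (auto simp: axis_eq_axis intro!: prod.cong)
  have cD: "continuous_on A (iter_deriv [axis l 1, axis l 1] \<phi>)" for A l
    unfolding D\<phi>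
    by (intro continuous_intros continuous_on_prod
        continuous_on_compose2[OF smooth_real_continuous_on[OF f(1), of UNIV]]
        continuous_on_compose2[OF smooth_real_continuous_on[OF smooth_real_deriv[OF smooth_real_deriv[OF f(1)]], of UNIV]]) auto
  have Dout: "iter_deriv [axis l 1, axis l 1] \<phi> x = 0" if out: "x \<notin> cbox \<alpha> \<beta>" for x l
  proof -
    obtain m where m: "\<not> (\<alpha> $ m \<le> x $ m \<and> x $ m \<le> \<beta> $ m)" using out unfolding mem_box_cart by blast
    show ?thesis
    proof (cases "m = l")
      case True
      have s1: "\<alpha> $ l \<le> s \<and> s \<le> \<beta> $ l" if "deriv (f l) s \<noteq> 0" for s
        by (rule smooth_deriv_support[OF f(1) _ that]) (use f(2) in blast)
      have "\<alpha> $ l \<le> s \<and> s \<le> \<beta> $ l" if "deriv (deriv (f l)) s \<noteq> 0" for s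
        by (rule smooth_deriv_support[OF smooth_real_deriv[OF f(1)] _ that]) (use s1 in blast)
      then have "deriv (deriv (f l)) (x $ l) = 0" using m True by blast
      then show ?thesis unfolding D\<phi> by simp
    next
      case False
      then have "(\<Prod>m\<in>UNIV - {l}. f m (x $ m)) = 0" using f(2) m by (intro prod_zero) auto
      then show ?thesis unfolding D\<phi> by simp
    qed
  qed
  have locU: "locally_integrable (box a b) U" and locw: "\<And>e. e \<in> Basis \<Longrightarrow> locally_integrable (box a b) (w e)"
    using w[of "axis l 1"] w unfolding weak_deriv_def by (auto simp: axis_in_Basis_iff)
  show "integrable ?B (\<lambda>x. U x * iter_deriv [axis l 1, axis l 1] \<phi> x)"
    by (rule integrable_local_mult[OF locU _ cD Dout sub]) auto
  have intw: "integrable ?B (\<lambda>x. w e x * \<phi> x)" if "e \<in> Basis" for e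
    by (rule integrable_local_mult[OF locw[OF that] _ c\<phi> \<phi>out sub]) auto
  have m\<phi>: "\<phi> \<in> borel_measurable ?B"
    using c\<phi> by (rule continuous_imp_measurable_on_sets_lebesgue) auto
  have "(LINT x|?B. v x * \<phi> x) = (LINT x|?B. (\<Sum>e\<in>Basis. w e x * \<phi> x))"
  proof (rule integral_cong_AE)
    show "(\<lambda>x. v x * \<phi> x) \<in> borel_measurable ?B" using v m\<phi> by simp
    show "(\<lambda>x. \<Sum>e\<in>Basis. w e x * \<phi> x) \<in> borel_measurable ?B"
      using intw by (intro borel_measurable_sum borel_measurable_integrable)
    show "AE x in ?B. v x * \<phi> x = (\<Sum>e\<in>Basis. w e x * \<phi> x)"
      using ae by eventually_elim (simp add: sum_distrib_right)
  qed
  also have "\<dots> = (\<Sum>e\<in>Basis. LINT x|?B. w e x * \<phi> x)"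
    using intw by (rule Bochner_Integration.integral_sum)
  also have "\<dots> = (\<Sum>e\<in>Basis. LINT x|?B. U x * iter_deriv [e, e] \<phi> x)"
    using w test unfolding weak_deriv_def by (intro sum.cong) auto
  also have "\<dots> = (\<Sum>l\<in>UNIV. LINT x|?B. U x * iter_deriv [axis l 1, axis l 1] \<phi> x)"
  proof -
    have B: "(Basis :: (real^'n) set) = range (\<lambda>l. axis l 1)" by (auto simp: Basis_vec_def)
    have inj: "inj (\<lambda>l::'n. axis l (1::real))" by (auto simp: inj_def axis_eq_axis)
    show ?thesis unfolding B by (subst sum.reindex[OF inj]) simp
  qed
  finally show "(LINT x|?B. v x * \<phi> x) = (\<Sum>l\<in>UNIV. LINT x|?B. U x * iter_deriv [axis l 1, axis l 1] \<phi> x)" .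
qed

text \<open>Each potential alone contains the pressure; only the difference u of the two belongs to
  the Neumann class. The Laplacians are therefore subtracted against compactly supported products,
  and the cosine is inserted afterwards.\<close>

lemma weak_laplacian_difference_cosine:
  assumes u: "neumann_class a b M u" and M: "0 \<le> M"
    and lap: "weak_laplacian (box a b) U1 v1" "weak_laplacian (box a b) U2 v2"
    and v: "v1 \<in> L2_space (box a b)" "v2 \<in> L2_space (box a b)"
    and U: "\<And>x. x \<in> box a b \<Longrightarrow> U1 x - U2 x = u x"
  shows "(LINT x|lebesgue_on (box a b). (v1 x - v2 x) * cc k x) = - lam k * coef u k"
proof (rule weak_laplacian_cosine[OF u M])
  let ?B = "lebesgue_on (box a b)"
  have bl: "box a b \<in> lmeasurable" by simp
  have one: "(\<lambda>x. c) \<in> L2_space (box a b)" for c :: real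
    using finite_measure.integrable_const[OF finite_measure_lebesgue_on[OF bl]] by (simp add: L2_space_def)
  have L1: "integrable ?B w" if w: "w \<in> L2_space (box a b)" for w
  proof -
    have m: "w \<in> borel_measurable ?B" and i: "integrable ?B (\<lambda>x. 1 + (w x)\<^sup>2)"
      using w one[of 1] by (auto simp: L2_space_def)
    have "\<bar>w x\<bar> \<le> 1 + (w x)\<^sup>2" for x
      using sum_squares_bound[of 1 "\<bar>w x\<bar>"] by simp
    then show ?thesis
      by (intro Bochner_Integration.integrable_bound[OF i m] AE_I2) (auto intro: order_trans[OF _ abs_ge_self])
  qed
  show "integrable ?B (\<lambda>x. v1 x - v2 x)" using L1 v by auto
  have vm: "v1 \<in> borel_measurable ?B" "v2 \<in> borel_measurable ?B" using v by (auto simp: L2_space_def)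
  fix f :: "'n \<Rightarrow> real \<Rightarrow> real" and \<alpha> \<beta> :: "real^'n"
  assume f: "\<And>l. smooth_real (f l)" "\<And>l s. f l s \<noteq> 0 \<Longrightarrow> \<alpha> $ l \<le> s \<and> s \<le> \<beta> $ l"
    "\<And>l. a $ l < \<alpha> $ l" "\<And>l. \<beta> $ l < b $ l"
  let ?\<phi> = "\<lambda>x::real^'n. \<Prod>l\<in>UNIV. f l (x $ l)"
  have cf: "continuous_on (cbox a b) ?\<phi>"
    by (intro continuous_on_prod continuous_on_compose2[OF smooth_real_continuous_on[OF f(1), of UNIV]] continuous_intros) auto
  obtain C where C: "0 \<le> C" "\<And>x. x \<in> cbox a b \<Longrightarrow> \<bar>?\<phi> x\<bar> \<le> C" using continuous_cbox_bounded[OF cf] by blast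
  have iv: "integrable ?B (\<lambda>x. w x * ?\<phi> x)" if w: "w \<in> L2_space (box a b)" for w
  proof (rule Bochner_Integration.integrable_bound[OF integrable_mult_right[OF L1[OF w], of C]])
    have "?\<phi> \<in> borel_measurable ?B"
      using continuous_on_subset[OF cf box_subset_cbox] by (rule continuous_imp_measurable_on_sets_lebesgue) auto
    then show "(\<lambda>x. w x * ?\<phi> x) \<in> borel_measurable ?B" using w by (auto simp: L2_space_def)
    show "AE x in ?B. norm (w x * ?\<phi> x) \<le> norm (C * w x)"
    proof (rule AE_I2)
      fix x assume "x \<in> space ?B"
      then have "\<bar>?\<phi> x\<bar> \<le> C" using C(2) box_subset_cbox[of a b] by auto
      then have "\<bar>w x\<bar> * \<bar>?\<phi> x\<bar> \<le> \<bar>w x\<bar> * C" by (rule mult_left_mono) simp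
      then show "norm (w x * ?\<phi> x) \<le> norm (C * w x)" using C(1) by (simp only: real_norm_def abs_mult abs_of_nonneg mult.commute)
    qed
  qed
  have "(LINT x|?B. (v1 x - v2 x) * ?\<phi> x) = (LINT x|?B. v1 x * ?\<phi> x) - (LINT x|?B. v2 x * ?\<phi> x)"
    unfolding left_diff_distrib by (rule Bochner_Integration.integral_diff) (intro iv v)+
  also have "\<dots> = (\<Sum>l\<in>UNIV. (LINT x|?B. U1 x * iter_deriv [axis l 1, axis l 1] ?\<phi> x) -
      (LINT x|?B. U2 x * iter_deriv [axis l 1, axis l 1] ?\<phi> x))"
  proof -
    have "(LINT x|?B. v1 x * ?\<phi> x) = (\<Sum>l\<in>UNIV. LINT x|?B. U1 x * iter_deriv [axis l 1, axis l 1] ?\<phi> x)"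
      by (rule weak_laplacian_pairing(1)[where \<alpha> = \<alpha> and \<beta> = \<beta>, OF lap(1) vm(1)]) (use f in blast)+
    moreover have "(LINT x|?B. v2 x * ?\<phi> x) = (\<Sum>l\<in>UNIV. LINT x|?B. U2 x * iter_deriv [axis l 1, axis l 1] ?\<phi> x)"
      by (rule weak_laplacian_pairing(1)[where \<alpha> = \<alpha> and \<beta> = \<beta>, OF lap(2) vm(2)]) (use f in blast)+
    ultimately show ?thesis by (simp only: sum_subtractf)
  qed
  also have "\<dots> = (\<Sum>l\<in>UNIV. LINT x|?B. u x * iter_deriv [axis l 1, axis l 1] ?\<phi> x)"
  proof (rule sum.cong)
    fix l :: 'n
    let ?d = "iter_deriv [axis l 1, axis l 1] ?\<phi>"
    have "(LINT x|?B. U1 x * ?d x) - (LINT x|?B. U2 x * ?d x) = (LINT x|?B. U1 x * ?d x - U2 x * ?d x)"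
    proof (rule Bochner_Integration.integral_diff[symmetric])
      show "integrable ?B (\<lambda>x. U1 x * ?d x)"
        by (rule weak_laplacian_pairing(2)[where \<alpha> = \<alpha> and \<beta> = \<beta>, OF lap(1) vm(1)]) (use f in blast)+
      show "integrable ?B (\<lambda>x. U2 x * ?d x)"
        by (rule weak_laplacian_pairing(2)[where \<alpha> = \<alpha> and \<beta> = \<beta>, OF lap(2) vm(2)]) (use f in blast)+
    qed
    also have "\<dots> = (LINT x|?B. u x * ?d x)"
    proof (rule Bochner_Integration.integral_cong)
      fix x assume "x \<in> space ?B"
      then have "x \<in> box a b" by simp
      then show "U1 x * ?d x - U2 x * ?d x = u x * ?d x" unfolding left_diff_distrib[symmetric] by (simp only: U)
    qed simp
    finally show "(LINT x|?B. U1 x * ?d x) - (LINT x|?B. U2 x * ?d x) = (LINT x|?B. u x * ?d x)" .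
  qed simp
  finally show "(LINT x|?B. (v1 x - v2 x) * ?\<phi> x) = (\<Sum>l\<in>UNIV. LINT x|?B. u x * iter_deriv [axis l 1, axis l 1] ?\<phi> x)" .
qed

end

section \<open>Cosine coefficients of the exact solution\<close>

lemma abs_le_of_dense:
  fixes G :: "real \<Rightarrow> real"
  assumes G: "continuous_on {0..T} G" and t0: "t0 \<in> {0..T}"
    and dense: "\<And>e. 0 < e \<Longrightarrow> \<exists>t. t \<in> {0..T} \<and> \<bar>t - t0\<bar> < e \<and> \<bar>G t\<bar> \<le> B"
  shows "\<bar>G t0\<bar> \<le> B"
proof (rule ccontr)
  assume "\<not> \<bar>G t0\<bar> \<le> B"
  then have pos: "0 < \<bar>G t0\<bar> - B" by simp
  obtain e where e: "0 < e" "\<And>t. t \<in> {0..T} \<Longrightarrow> dist t t0 < e \<Longrightarrow> dist (G t) (G t0) < \<bar>G t0\<bar> - B"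
    using G t0 pos unfolding continuous_on_iff by meson
  obtain t where t: "t \<in> {0..T}" "\<bar>t - t0\<bar> < e" "\<bar>G t\<bar> \<le> B" using dense[OF e(1)] by blast
  have "\<bar>G t - G t0\<bar> < \<bar>G t0\<bar> - B" using e(2)[of t] t by (simp add: dist_real_def)
  then show False using t(3) by linarith
qed

lemma continuous_on_slices:
  assumes "continuous_on (A \<times> B) (\<lambda>(t, x). h t x)"
  shows "t \<in> A \<Longrightarrow> continuous_on B (h t)" "x \<in> B \<Longrightarrow> continuous_on A (\<lambda>t. h t x)"
proof -
  assume "t \<in> A"
  then have "continuous_on B (\<lambda>x. (\<lambda>(t, x). h t x) (t, x))"
    by (intro continuous_on_compose2[OF assms]) (auto intro!: continuous_intros)
  then show "continuous_on B (h t)" by simp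
next
  assume "x \<in> B"
  then have "continuous_on A (\<lambda>t. (\<lambda>(t, x). h t x) (t, x))"
    by (intro continuous_on_compose2[OF assms]) (auto intro!: continuous_intros)
  then show "continuous_on A (\<lambda>t. h t x)" by simp
qed

lemma neumann_class_mono:
  assumes "neumann_class a b M u" "M \<le> M'" shows "neumann_class a b M' u"
proof -
  have "M * s\<^sup>2 \<le> M' * s\<^sup>2" for s :: real using assms(2) by (intro mult_right_mono) auto
  then show ?thesis using assms(1) unfolding neumann_class_def by (meson order_trans)
qed

context cosine_box
begin

lemma continuous_on_coef_time:
  fixes T :: real
  assumes h: "continuous_on ({0..T} \<times> cbox a b) (\<lambda>(t, x). h t x)"
  shows "continuous_on {0..T} (\<lambda>t. coef (h t) k)"
proof -
  have hx: "continuous_on (cbox a b) (h t)" if "t \<in> {0..T}" for t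
    by (rule continuous_on_slices(1)[OF h that])
  have "continuous_on ({0..T} \<times> cbox a b) (\<lambda>(t, x). h t x * cc k x)"
    using h by (auto simp: case_prod_beta intro!: continuous_intros continuous_on_compose2[OF cont_cc[of UNIV]])
  then have "continuous_on {0..T} (\<lambda>t. integral (cbox a b) (\<lambda>x. h t x * cc k x))"
    by (rule integral_continuous_on_param)
  moreover have "coef (h t) k = integral (cbox a b) (\<lambda>x. h t x * cc k x)" if "t \<in> {0..T}" for t
    unfolding coef_def
    by (rule lebesgue_integral_eq_integral) (auto intro!: integrable_Q continuous_intros hx[OF that])
  ultimately show ?thesis by (metis (no_types, lifting) continuous_on_eq)
qed

text \<open>The class consists of closed inequalities between values, so continuity in time carries
  it from a dense set of times to all times.\<close>

lemma neumann_class_dense: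
  fixes T :: real
  assumes S: "continuous_on ({0..T} \<times> cbox a b) (\<lambda>(t, x). h t x)" and t0: "t0 \<in> {0..T}"
    and dense: "\<And>e. 0 < e \<Longrightarrow> \<exists>t. t \<in> {0..T} \<and> \<bar>t - t0\<bar> < e \<and> neumann_class a b M (h t)"
  shows "neumann_class a b M (h t0)"
proof -
  have ct: "continuous_on {0..T} (\<lambda>t. h t x)" if "x \<in> cbox a b" for x
    by (rule continuous_on_slices(2)[OF S that])
  have cx: "continuous_on (cbox a b) (h t0)"
    by (rule continuous_on_slices(1)[OF S t0])
  show ?thesis
    unfolding neumann_class_def
  proof (intro conjI allI impI cx; elim conjE)
    fix l x \<delta> assume A: "0 < \<delta>" "x \<in> cbox a b" "x + \<delta> *\<^sub>R axis l 1 \<in> cbox a b" "x - \<delta> *\<^sub>R axis l 1 \<in> cbox a b"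
    show "\<bar>second_diff l \<delta> (h t0) x\<bar> \<le> M * \<delta>\<^sup>2"
    proof (rule abs_le_of_dense[OF _ t0])
      show "continuous_on {0..T} (\<lambda>t. second_diff l \<delta> (h t) x)"
        unfolding second_diff_def by (intro continuous_intros ct A)
      show "\<exists>t. t \<in> {0..T} \<and> \<bar>t - t0\<bar> < e \<and> \<bar>second_diff l \<delta> (h t) x\<bar> \<le> M * \<delta>\<^sup>2" if "0 < e" for e
        using dense[OF that] A unfolding neumann_class_def by blast
    qed
  next
    fix l x s assume A: "x \<in> cbox a b" "x $ l = a $ l \<or> x $ l = b $ l" "x + s *\<^sub>R axis l 1 \<in> cbox a b"
    show "\<bar>h t0 (x + s *\<^sub>R axis l 1) - h t0 x\<bar> \<le> M * s\<^sup>2"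
    proof (rule abs_le_of_dense[OF _ t0])
      show "continuous_on {0..T} (\<lambda>t. h t (x + s *\<^sub>R axis l 1) - h t x)"
        by (intro continuous_intros ct A)
      show "\<exists>t. t \<in> {0..T} \<and> \<bar>t - t0\<bar> < e \<and> \<bar>h t (x + s *\<^sub>R axis l 1) - h t x\<bar> \<le> M * s\<^sup>2" if "0 < e" for e
        using dense[OF that] A unfolding neumann_class_def by blast
    qed
  qed
qed

text \<open>The norm is an infimum over bounds; the slack 1 yields an actual bound.\<close>

lemma sobolev_inf_boundD:
  assumes "u \<in> sobolev_inf U n" "sobolev_inf_norm U n u \<le> C"
  shows "\<exists>c. sobolev_inf_bound U n u c \<and> c < C + 1"
proof -
  have "{c. sobolev_inf_bound U n u c} \<noteq> {}" using assms(1) by (auto simp: sobolev_inf_def)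
  moreover have "Inf {c. sobolev_inf_bound U n u c} < C + 1"
    using assms(2) by (simp add: sobolev_inf_norm_def)
  ultimately obtain c where "c \<in> {c. sobolev_inf_bound U n u c}" "c < C + 1"
    by (rule cInf_lessD[elim_format]) blast
  then show ?thesis by auto
qed

lemma pot_diff_coercive:
  assumes \<sigma>: "\<And>\<alpha>. 0 < \<sigma> \<alpha>" and pq: "0 < p" "p < 1" "0 < q" "q < 1"
  shows "((sqrt (\<sigma> Wet) + sqrt (\<sigma> NonWet))\<^sup>2 - 2 * \<sigma>wn) * \<bar>p - q\<bar> \<le> \<bar>pot_diff \<sigma> \<sigma>wn p - pot_diff \<sigma> \<sigma>wn q\<bar>"
proof (cases "p = q")
  case False
  let ?G = "(sqrt (\<sigma> Wet) + sqrt (\<sigma> NonWet))\<^sup>2"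
  have "(?G - 2 * \<sigma>wn) * (p - q)\<^sup>2 \<le> (log_pot \<sigma> p - log_pot \<sigma> q) * (p - q) - 2 * \<sigma>wn * (p - q)\<^sup>2"
    using log_pot_coercive[OF \<sigma> pq] by (simp add: left_diff_distrib)
  also have "\<dots> = (pot_diff \<sigma> \<sigma>wn p - pot_diff \<sigma> \<sigma>wn q) * (p - q)"
    by (simp add: pot_diff_def power2_eq_square algebra_simps)
  also have "\<dots> \<le> \<bar>pot_diff \<sigma> \<sigma>wn p - pot_diff \<sigma> \<sigma>wn q\<bar> * \<bar>p - q\<bar>"
    unfolding abs_mult[symmetric] by simp
  finally have "((?G - 2 * \<sigma>wn) * \<bar>p - q\<bar>) * \<bar>p - q\<bar> \<le> \<bar>pot_diff \<sigma> \<sigma>wn p - pot_diff \<sigma> \<sigma>wn q\<bar> * \<bar>p - q\<bar>"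
    by (simp add: power2_eq_square mult.assoc)
  then show ?thesis using False by (simp add: mult_le_cancel_right)
qed simp

text \<open>At almost every time the two no-flow representatives differ by a continuous function
  that equals F(w) almost everywhere, hence everywhere, so F(w) has zero normal derivative.
  Coercivity with \<gamma>0 hands this on to w, and density in time removes the exceptional
  set.\<close>

lemma exact_solution_neumann:
  assumes \<sigma>: "\<And>\<alpha>. 0 < \<sigma> \<alpha>" and \<gamma>: "(sqrt (\<sigma> Wet) + sqrt (\<sigma> NonWet))\<^sup>2 - 2 * \<sigma>wn > 0"
    and T: "0 < T" and ex: "exact_solution \<sigma> \<sigma>wn a b T S p"
  shows "\<exists>M\<ge>0. \<forall>t\<in>{0..T}. neumann_class a b M (S Wet t)"
proof -
  have sum1: "\<And>t x. t \<in> {0..T} \<Longrightarrow> x \<in> cbox a b \<Longrightarrow> S NonWet t x = 1 - S Wet t x"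
    using ex unfolding exact_solution_def by (smt (verit, best))
  have cont: "continuous_on ({0..T} \<times> cbox a b) (\<lambda>(t, x). S Wet t x)"
    and range: "\<And>t x. t \<in> {0..T} \<Longrightarrow> x \<in> cbox a b \<Longrightarrow> 0 < S Wet t x \<and> S Wet t x < 1"
    and linf: "Linf_time {0<..<T} (sobolev_inf (box a b) 4) (sobolev_inf_norm (box a b) 4) (S Wet)"
    and nf: "\<And>\<alpha>. AE t in lebesgue_on {0<..<T}. no_flow a b (\<lambda>x. p t x + chem_pot \<sigma> \<sigma>wn \<alpha> (S \<alpha> t x))"
    using ex unfolding exact_solution_def by blast+
  obtain C where C: "AE t in lebesgue_on {0<..<T}. sobolev_inf_norm (box a b) 4 (S Wet t) \<le> C"
    and inV: "AE t in lebesgue_on {0<..<T}. S Wet t \<in> sobolev_inf (box a b) 4"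
    using linf unfolding Linf_time_def simple_approx_def by auto
  \<comment> \<open>The essential bound C is not known to be nonnegative, hence the maximum with 0;
    the summand 1 is the slack of \<open>sobolev_inf_boundD\<close>.\<close>
  define C0 where "C0 = max 0 (C + 1)"
  let ?F = "pot_diff \<sigma> \<sigma>wn"
  have cx: "continuous_on (cbox a b) (S Wet t)" if "t \<in> {0..T}" for t
    by (rule continuous_on_slices(1)[OF cont that])
  have "AE t in lebesgue_on {0<..<T}. neumann_class a b (4 * C0) (S Wet t)"
    using C inV nf[of Wet] nf[of NonWet] AE_space
  proof eventually_elim
    case (elim t)
    then have t: "t \<in> {0..T}" by simp
    obtain c where c: "sobolev_inf_bound (box a b) 4 (S Wet t) c" "c < C + 1"
      using sobolev_inf_boundD elim by blast
    obtain w1 where W1: "continuous_on (cbox a b) w1 \<and> (AE x in Q. w1 x = p t x + chem_pot \<sigma> \<sigma>wn Wet (S Wet t x)) \<and>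
        (\<forall>x\<in>cbox a b. \<forall>\<nu>. outer_normal a b x \<nu> \<longrightarrow> (\<exists>D. (w1 has_derivative D) (at x within cbox a b) \<and> D \<nu> = 0))"
      using elim(3) unfolding no_flow_def by (rule exE)
    obtain w2 where W2: "continuous_on (cbox a b) w2 \<and> (AE x in Q. w2 x = p t x + chem_pot \<sigma> \<sigma>wn NonWet (S NonWet t x)) \<and>
        (\<forall>x\<in>cbox a b. \<forall>\<nu>. outer_normal a b x \<nu> \<longrightarrow> (\<exists>D. (w2 has_derivative D) (at x within cbox a b) \<and> D \<nu> = 0))"
      using elim(4) unfolding no_flow_def by (rule exE)
    note w1 = W1[THEN conjunct1] W1[THEN conjunct2, THEN conjunct1] W1[THEN conjunct2, THEN conjunct2, rule_format]
    note w2 = W2[THEN conjunct1] W2[THEN conjunct2, THEN conjunct1] W2[THEN conjunct2, THEN conjunct2, rule_format]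
    have cF: "continuous_on (cbox a b) (\<lambda>x. ?F (S Wet t x))"
      unfolding pot_diff_def log_pot_def
      using range[OF t] by (intro continuous_intros cx[OF t]) (force simp: less_imp_neq[symmetric])+
    have "AE x in Q. w1 x - w2 x = ?F (S Wet t x)"
      using w1(2) w2(2) AE_space
    proof eventually_elim
      case (elim x)
      then have n: "S NonWet t x = 1 - S Wet t x" using sum1[OF t] by simp
      show ?case unfolding elim(1,2) n chem_pot_def pot_diff_def log_pot_def by (simp add: algebra_simps)
    qed
    then have weq: "w1 x - w2 x = ?F (S Wet t x)" if "x \<in> cbox a b" for x
      using continuous_AE_eq[OF box_nonempty continuous_on_diff[OF w1(1) w2(1)] cF] that by blast
    show ?case
    proof (rule neumann_classI[OF cx[OF t], where F = ?F and \<gamma> = "(sqrt (\<sigma> Wet) + sqrt (\<sigma> NonWet))\<^sup>2 - 2 * \<sigma>wn"])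
      show "0 \<le> C0" by (simp add: C0_def)
      show "(sqrt (\<sigma> Wet) + sqrt (\<sigma> NonWet))\<^sup>2 - 2 * \<sigma>wn > 0" by (rule \<gamma>)
      show "\<exists>v. weak_deriv (box a b) [axis l 1, axis l 1] (S Wet t) v \<and> (AE x in lebesgue_on (box a b). \<bar>v x\<bar> \<le> C0)" for l
      proof -
        have "set [axis l 1, axis l (1::real)] \<subseteq> Basis \<and> length [axis l 1, axis l (1::real)] \<le> 4"
          by (auto simp: axis_in_Basis_iff)
        then obtain v where "weak_deriv (box a b) [axis l 1, axis l 1] (S Wet t) v" "AE x in lebesgue_on (box a b). \<bar>v x\<bar> \<le> c"
          using c(1) unfolding sobolev_inf_bound_def by blast
        moreover from this(2) have "AE x in lebesgue_on (box a b). \<bar>v x\<bar> \<le> C0"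
          by eventually_elim (use c(2) in \<open>auto simp: C0_def\<close>)
        ultimately show ?thesis by blast
      qed
      show "((sqrt (\<sigma> Wet) + sqrt (\<sigma> NonWet))\<^sup>2 - 2 * \<sigma>wn) * \<bar>S Wet t x - S Wet t y\<bar> \<le> \<bar>?F (S Wet t x) - ?F (S Wet t y)\<bar>"
        if "x \<in> cbox a b" "y \<in> cbox a b" for x y
        using range[OF t that(1)] range[OF t that(2)] by (intro pot_diff_coercive \<sigma>) auto
      fix x \<nu> assume x: "x \<in> cbox a b" "outer_normal a b x \<nu>"
      obtain D1 D2 where D: "(w1 has_derivative D1) (at x within cbox a b)" "D1 \<nu> = 0"
        "(w2 has_derivative D2) (at x within cbox a b)" "D2 \<nu> = 0"
        using w1(3)[OF x] w2(3)[OF x] by blast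
      have "((\<lambda>x. w1 x - w2 x) has_derivative (\<lambda>h. D1 h - D2 h)) (at x within cbox a b)"
        by (rule has_derivative_diff[OF D(1,3)])
      then have "((\<lambda>x. ?F (S Wet t x)) has_derivative (\<lambda>h. D1 h - D2 h)) (at x within cbox a b)"
        by (rule has_derivative_transform[OF x(1), rotated]) (simp add: weq)
      then show "\<exists>D. ((\<lambda>x. ?F (S Wet t x)) has_derivative D) (at x within cbox a b) \<and> D \<nu> = 0"
        using D by (intro exI[of _ "\<lambda>h. D1 h - D2 h"]) simp
    qed
  qed
  note ae = this
  have "neumann_class a b (4 * C0) (S Wet t)" if t: "t \<in> {0..T}" for t
  proof (rule neumann_class_dense[OF cont t])
    fix e :: real assume "0 < e"
    from AE_dense[OF ae t this T]
    obtain t' where "t' \<in> {0<..<T}" "neumann_class a b (4 * C0) (S Wet t')" "\<bar>t' - t\<bar> < e" by blast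
    then show "\<exists>t'. t' \<in> {0..T} \<and> \<bar>t' - t\<bar> < e \<and> neumann_class a b (4 * C0) (S Wet t')"
      by (intro exI[of _ t']) simp
  qed
  then show ?thesis by (intro exI[of _ "4 * C0"]) (auto simp: C0_def)
qed

text \<open>Pairing both phase equations with the mode k and subtracting removes the pressure. As
  the saturations add up to one, the left side is the derivative of twice the wetting coefficient
  minus a constant; both sides being continuous, the weak equation is classical.\<close>

lemma exact_solution_mode_equation:
  assumes T: "0 < T" and ex: "exact_solution \<sigma> \<sigma>wn a b T S p"
    and nc: "\<And>t. t \<in> {0..T} \<Longrightarrow> neumann_class a b M (\<lambda>x. pot_diff \<sigma> \<sigma>wn (S Wet t x))" and M: "0 \<le> M"
    and cF: "continuous_on ({0..T} \<times> cbox a b) (\<lambda>(t, x). pot_diff \<sigma> \<sigma>wn (S Wet t x))"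
    and t: "0 < t" "t < T"
  shows "((\<lambda>t. coef (S Wet t) k) has_real_derivative - lam k / 2 * coef (\<lambda>x. pot_diff \<sigma> \<sigma>wn (S Wet t x)) k) (at t)"
proof -
  let ?I = "{0<..<T}" and ?B = "lebesgue_on (box a b)" and ?F = "pot_diff \<sigma> \<sigma>wn"
  have sum1: "\<And>t x. t \<in> {0..T} \<Longrightarrow> x \<in> cbox a b \<Longrightarrow> S NonWet t x = 1 - S Wet t x"
    using ex unfolding exact_solution_def by (smt (verit, best))
  have cont: "continuous_on ({0..T} \<times> cbox a b) (\<lambda>(t, x). S \<alpha> t x)" for \<alpha>
    using ex unfolding exact_solution_def by blast
  have "\<forall>\<alpha>. \<exists>v. weak_time_deriv ?I (L2_space (box a b)) (L2_norm (box a b)) (S \<alpha>) v \<and>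
      (AE t in lebesgue_on ?I. weak_laplacian (box a b) (\<lambda>x. p t x + chem_pot \<sigma> \<sigma>wn \<alpha> (S \<alpha> t x)) (v t))"
    using ex unfolding exact_solution_def by blast
  from choice[OF this] obtain v where
    V: "\<forall>\<alpha>. weak_time_deriv ?I (L2_space (box a b)) (L2_norm (box a b)) (S \<alpha>) (v \<alpha>) \<and>
      (AE t in lebesgue_on ?I. weak_laplacian (box a b) (\<lambda>x. p t x + chem_pot \<sigma> \<sigma>wn \<alpha> (S \<alpha> t x)) (v \<alpha> t))"
    by (rule exE)
  note v = V[THEN spec, THEN conjunct1] and lap = V[THEN spec, THEN conjunct2]
  have cx: "continuous_on (cbox a b) (S \<alpha> t)" if "t \<in> {0..T}" for t \<alpha>
    by (rule continuous_on_slices(1)[OF cont that])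
  \<comment> \<open>The scaling brings the cosine into the unit ball required by
    \<open>bochner_pairing\<close>; the summand 1 also gives \<beta> \<le> 1.\<close>
  define \<beta> where "\<beta> = 1 / sqrt (vol + 1)"
  have \<beta>: "0 < \<beta>" using vol_pos by (simp add: \<beta>_def)
  let ?c = "\<lambda>x. \<beta> * cc k x"
  have cbox_eq: "(LINT x|?B. g x * ?c x) = \<beta> * coef g k" if "continuous_on (cbox a b) g" for g
  proof -
    have "(LINT x|?B. g x * ?c x) = (LINT x|Q. g x * ?c x)"
      by (intro integral_box_eq_Q continuous_measurable_Q continuous_intros that)
    also have "\<dots> = (LINT x|Q. \<beta> * (g x * cc k x))" by (simp add: mult.left_commute)
    finally show ?thesis by (simp only: coef_def integral_mult_right_zero)
  qed
  have ccm: "?c \<in> borel_measurable ?B"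
    using continuous_on_mult_left[OF cont_cc] by (rule continuous_imp_measurable_on_sets_lebesgue) auto
  have csq: "(LINT x|?B. (?c x)\<^sup>2) \<le> 1"
  proof -
    have "(LINT x|?B. (?c x)\<^sup>2) = (LINT x|Q. (?c x)\<^sup>2)"
      by (intro integral_box_eq_Q continuous_measurable_Q continuous_intros)
    also have "\<dots> \<le> \<beta>\<^sup>2 * vol"
      by (rule integral_square_le) (use abs_cc_le[of k] \<beta> in \<open>auto intro!: continuous_intros simp: abs_mult mult_left_le\<close>)
    also have "\<dots> \<le> 1" using vol_pos by (simp add: \<beta>_def power_divide)
    finally show ?thesis .
  qed
  have cL2: "?c \<in> L2_space (box a b)"
  proof -
    have one: "integrable ?B (\<lambda>x. 1 :: real)"
      by (rule finite_measure.integrable_const[OF finite_measure_lebesgue_on]) simp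
    have "\<beta> \<le> 1" using vol_pos by (simp add: \<beta>_def)
    then have "\<bar>?c x\<bar> \<le> 1" for x
      unfolding abs_mult using abs_cc_le[of k x] \<beta> by (intro mult_le_one) auto
    then have le1: "(?c x)\<^sup>2 \<le> 1" for x by (simp only: abs_square_le_1)
    have "integrable ?B (\<lambda>x. (?c x)\<^sup>2)"
    proof (rule Bochner_Integration.integrable_bound[OF one])
      show "(\<lambda>x. (?c x)\<^sup>2) \<in> borel_measurable ?B" by (rule borel_measurable_power[OF ccm])
      show "AE x in ?B. norm ((?c x)\<^sup>2) \<le> norm (1::real)" using le1 by (intro AE_I2) simp
    qed
    then show ?thesis using ccm by (simp add: L2_space_def)
  qed
  have Ilm: "?I \<in> lmeasurable" by simp
  let ?s = "\<lambda>t. coef (S Wet t) k" and ?f = "\<lambda>t. coef (\<lambda>x. ?F (S Wet t x)) k"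
  let ?one = "coef (\<lambda>_. 1) k"
  have s2: "coef (S NonWet t) k = ?one - ?s t" if "t \<in> {0..T}" for t
  proof -
    have "coef (S NonWet t) = coef (\<lambda>x. 1 - S Wet t x)" by (rule coef_cong) (simp add: sum1[OF that])
    then show ?thesis by (simp add: coef_diff[OF _ cx[OF that]] continuous_intros)
  qed
  have cs: "continuous_on {0..T} ?s" by (rule continuous_on_coef_time[OF cont])
  have cf: "continuous_on {0..T} ?f" by (rule continuous_on_coef_time[OF cF])
  have "((\<lambda>t. 2 * ?s t - ?one) has_real_derivative - lam k * ?f t) (at t)"
  proof (rule weak_time_derivative_classical[where T = T and f = "\<lambda>t. - lam k * ?f t"])
    show "continuous_on {0..T} (\<lambda>t. 2 * ?s t - ?one)" by (intro continuous_intros cs)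
    show "continuous_on {0..T} (\<lambda>t. - lam k * ?f t)" by (intro continuous_intros cf)
    fix \<phi> :: "real \<Rightarrow> real" and \<alpha>0 \<beta>0
    assume \<phi>: "smooth_real \<phi>" "0 < \<alpha>0" "\<beta>0 < T" "\<And>t. \<phi> t \<noteq> 0 \<Longrightarrow> \<alpha>0 \<le> t \<and> t \<le> \<beta>0"
    have "test_fun ?I \<phi>" by (rule test_fun_real[OF \<phi>(1,4,2,3)])
    then have "\<exists>J. has_bochner_integral_into ?I (L2_space (box a b)) (L2_norm (box a b)) (\<lambda>t x. deriv \<phi> t * S \<alpha> t x) J \<and>
        has_bochner_integral_into ?I (L2_space (box a b)) (L2_norm (box a b)) (\<lambda>t x. \<phi> t * v \<alpha> t x) (\<lambda>x. - J x)" for \<alpha>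
      using v unfolding weak_time_deriv_def by blast
    then have "\<forall>\<alpha>. \<exists>J. has_bochner_integral_into ?I (L2_space (box a b)) (L2_norm (box a b)) (\<lambda>t x. deriv \<phi> t * S \<alpha> t x) J \<and>
        has_bochner_integral_into ?I (L2_space (box a b)) (L2_norm (box a b)) (\<lambda>t x. \<phi> t * v \<alpha> t x) (\<lambda>x. - J x)"
      by blast
    from choice[OF this] obtain J where
      J: "\<forall>\<alpha>. has_bochner_integral_into ?I (L2_space (box a b)) (L2_norm (box a b)) (\<lambda>t x. deriv \<phi> t * S \<alpha> t x) (J \<alpha>) \<and>
        has_bochner_integral_into ?I (L2_space (box a b)) (L2_norm (box a b)) (\<lambda>t x. \<phi> t * v \<alpha> t x) (\<lambda>x. - J \<alpha> x)"
      by (rule exE)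
    note J1 = J[THEN spec, THEN conjunct1] and J2 = J[THEN spec, THEN conjunct2]
    from choice[OF allI[OF bochner_pairing[OF J1 cL2 csq Ilm]]] obtain P where
      PP: "\<forall>\<alpha>. integrable (lebesgue_on ?I) (P \<alpha>) \<and>
        (AE t in lebesgue_on ?I. (\<lambda>x. deriv \<phi> t * S \<alpha> t x) \<in> L2_space (box a b) \<and> P \<alpha> t = (LINT x|?B. (deriv \<phi> t * S \<alpha> t x) * ?c x)) \<and>
        (LINT t|lebesgue_on ?I. P \<alpha> t) = (LINT x|?B. J \<alpha> x * ?c x)"
      by (rule exE)
    note P = PP[THEN spec, THEN conjunct1] PP[THEN spec, THEN conjunct2, THEN conjunct1] PP[THEN spec, THEN conjunct2, THEN conjunct2]
    from choice[OF allI[OF bochner_pairing[OF J2 cL2 csq Ilm]]] obtain R where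
      RR: "\<forall>\<alpha>. integrable (lebesgue_on ?I) (R \<alpha>) \<and>
        (AE t in lebesgue_on ?I. (\<lambda>x. \<phi> t * v \<alpha> t x) \<in> L2_space (box a b) \<and> R \<alpha> t = (LINT x|?B. (\<phi> t * v \<alpha> t x) * ?c x)) \<and>
        (LINT t|lebesgue_on ?I. R \<alpha> t) = (LINT x|?B. - J \<alpha> x * ?c x)"
      by (rule exE)
    note R = RR[THEN spec, THEN conjunct1] RR[THEN spec, THEN conjunct2, THEN conjunct1] RR[THEN spec, THEN conjunct2, THEN conjunct2]
    have meas: "h \<in> borel_measurable (lebesgue_on ?I)" if "continuous_on {0..T} h" for h :: "real \<Rightarrow> real"
      by (intro continuous_imp_measurable_on_sets_lebesgue continuous_on_subset[OF that]) auto
    have "(LINT t|lebesgue_on ?I. P Wet t - P NonWet t) = (LINT t|lebesgue_on ?I. \<beta> * (deriv \<phi> t * (2 * ?s t - ?one)))"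
    proof (rule integral_cong_AE)
      show "(\<lambda>t. P Wet t - P NonWet t) \<in> borel_measurable (lebesgue_on ?I)" using P(1) by auto
      show "(\<lambda>t. \<beta> * (deriv \<phi> t * (2 * ?s t - ?one))) \<in> borel_measurable (lebesgue_on ?I)"
        by (intro meas continuous_intros cs smooth_real_continuous_on smooth_real_deriv \<phi>)
      show "AE t in lebesgue_on ?I. P Wet t - P NonWet t = \<beta> * (deriv \<phi> t * (2 * ?s t - ?one))"
        using P(2)[of Wet] P(2)[of NonWet] AE_space
      proof eventually_elim
        case (elim t)
        then have t: "t \<in> {0..T}" by simp
        have Pv: "P \<alpha> t = deriv \<phi> t * (\<beta> * coef (S \<alpha> t) k)" if "P \<alpha> t = (LINT x|?B. (deriv \<phi> t * S \<alpha> t x) * ?c x)" for \<alpha>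
          unfolding that mult.assoc[of "deriv \<phi> t"] integral_mult_right_zero cbox_eq[OF cx[OF t]] ..
        have 1: "P Wet t = deriv \<phi> t * (\<beta> * ?s t)" using Pv elim(1) by blast
        have 2: "P NonWet t = deriv \<phi> t * (\<beta> * (?one - ?s t))"
          unfolding s2[OF t, symmetric] using Pv elim(2) by blast
        show ?case unfolding 1 2 by (simp add: algebra_simps)
      qed
    qed
    then have 1: "\<beta> * (LINT t|lebesgue_on ?I. deriv \<phi> t * (2 * ?s t - ?one)) = (LINT x|?B. J Wet x * ?c x) - (LINT x|?B. J NonWet x * ?c x)"
      using P(1,3) by simp
    have "(LINT t|lebesgue_on ?I. R Wet t - R NonWet t) = (LINT t|lebesgue_on ?I. \<beta> * (\<phi> t * (- lam k * ?f t)))"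
    proof (rule integral_cong_AE)
      show "(\<lambda>t. R Wet t - R NonWet t) \<in> borel_measurable (lebesgue_on ?I)" using R(1) by auto
      show "(\<lambda>t. \<beta> * (\<phi> t * (- lam k * ?f t))) \<in> borel_measurable (lebesgue_on ?I)"
        by (intro meas continuous_intros cf smooth_real_continuous_on \<phi>)
      show "AE t in lebesgue_on ?I. R Wet t - R NonWet t = \<beta> * (\<phi> t * (- lam k * ?f t))"
        using R(2)[of Wet] R(2)[of NonWet] lap[of Wet] lap[of NonWet] AE_space
      proof eventually_elim
        case (elim t)
        then have t: "t \<in> {0..T}" by simp
        have Rv: "R \<alpha> t = \<phi> t * (LINT x|?B. v \<alpha> t x * ?c x)" if "R \<alpha> t = (LINT x|?B. (\<phi> t * v \<alpha> t x) * ?c x)" for \<alpha>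
          unfolding that mult.assoc[of "\<phi> t"] integral_mult_right_zero ..
        show ?case
        \<comment> \<open>Square integrability is known only for \<phi> t times v; where \<phi> t =
          0 this says nothing about v, but both sides vanish.\<close>
        proof (cases "\<phi> t = 0")
          case True
          then show ?thesis using Rv[of Wet] Rv[of NonWet] elim by simp
        next
          case False
          have vL2: "v \<alpha> t \<in> L2_space (box a b)" if "(\<lambda>x. \<phi> t * v \<alpha> t x) \<in> L2_space (box a b)" for \<alpha>
            using L2_space_scale[OF that, of "1 / \<phi> t"] False by simp
          have v12: "v Wet t \<in> L2_space (box a b)" "v NonWet t \<in> L2_space (box a b)" using vL2 elim by auto
          have "(LINT x|?B. (v Wet t x - v NonWet t x) * cc k x) = - lam k * ?f t"
          proof (rule weak_laplacian_difference_cosine[OF nc[OF t] M elim(3,4) v12])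
            fix x assume "x \<in> box a b"
            then have "x \<in> cbox a b" using box_subset_cbox by blast
            then show "p t x + chem_pot \<sigma> \<sigma>wn Wet (S Wet t x) - (p t x + chem_pot \<sigma> \<sigma>wn NonWet (S NonWet t x)) = ?F (S Wet t x)"
              by (simp add: sum1[OF t] chem_pot_def pot_diff_def log_pot_def algebra_simps)
          qed
          moreover have "(LINT x|?B. v Wet t x * ?c x) - (LINT x|?B. v NonWet t x * ?c x) = \<beta> * (LINT x|?B. (v Wet t x - v NonWet t x) * cc k x)"
          proof -
            have "(LINT x|?B. v Wet t x * ?c x) - (LINT x|?B. v NonWet t x * ?c x) = (LINT x|?B. v Wet t x * ?c x - v NonWet t x * ?c x)"
              by (rule Bochner_Integration.integral_diff[symmetric]) (rule L2_pairing_bound(1)[OF _ cL2 csq], rule v12)+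
            also have "\<dots> = (LINT x|?B. \<beta> * ((v Wet t x - v NonWet t x) * cc k x))"
              by (rule Bochner_Integration.integral_cong) (auto simp: algebra_simps)
            finally show ?thesis by (simp only: integral_mult_right_zero)
          qed
          ultimately have "(LINT x|?B. v Wet t x * ?c x) - (LINT x|?B. v NonWet t x * ?c x) = \<beta> * (- lam k * ?f t)" by simp
          moreover have "R Wet t - R NonWet t = \<phi> t * ((LINT x|?B. v Wet t x * ?c x) - (LINT x|?B. v NonWet t x * ?c x))"
            using Rv[of Wet] Rv[of NonWet] elim by (simp only: right_diff_distrib)
          ultimately show ?thesis by simp
        qed
      qed
    qed
    then have 2: "\<beta> * (LINT t|lebesgue_on ?I. \<phi> t * (- lam k * ?f t)) = - (LINT x|?B. J Wet x * ?c x) + (LINT x|?B. J NonWet x * ?c x)"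
      using R(1,3) by simp
    have "\<beta> * (LINT t|lebesgue_on ?I. deriv \<phi> t * (2 * ?s t - ?one)) = \<beta> * (- (LINT t|lebesgue_on ?I. \<phi> t * (- lam k * ?f t)))"
      using 1 2 by simp
    then show "(LINT t|lebesgue_on ?I. deriv \<phi> t * (2 * ?s t - ?one)) = - (LINT t|lebesgue_on ?I. \<phi> t * (- lam k * ?f t))"
      using \<beta> by simp
  qed (use t in auto)
  then have "((\<lambda>t. (1 / 2) * (2 * ?s t - ?one) + ?one / 2) has_real_derivative (1 / 2) * (- lam k * ?f t) + 0) (at t)"
    by (intro DERIV_add DERIV_cmult DERIV_const)
  then show ?thesis by (simp add: algebra_simps)
qed

lemma exact_solution_facts:
  assumes \<sigma>: "\<And>\<alpha>. 0 < \<sigma> \<alpha>" "0 < \<sigma>wn" and \<gamma>: "(sqrt (\<sigma> Wet) + sqrt (\<sigma> NonWet))\<^sup>2 - 2 * \<sigma>wn > 0"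
    and T: "0 < T" and ex: "exact_solution \<sigma> \<sigma>wn a b T S p"
  obtains m M where "0 < m" "0 \<le> M"
    "\<And>t x. t \<in> {0..T} \<Longrightarrow> x \<in> cbox a b \<Longrightarrow> m \<le> S Wet t x \<and> S Wet t x \<le> 1 - m"
    "\<And>t. t \<in> {0..T} \<Longrightarrow> neumann_class a b M (S Wet t)"
    "\<And>t. t \<in> {0..T} \<Longrightarrow> neumann_class a b M (\<lambda>x. pot_diff \<sigma> \<sigma>wn (S Wet t x))"
    "\<And>k. continuous_on {0..T} (\<lambda>t. coef (S Wet t) k)"
    "\<And>k t. 0 < t \<Longrightarrow> t < T \<Longrightarrow> ((\<lambda>t. coef (S Wet t) k) has_real_derivative
        - lam k / 2 * coef (\<lambda>x. pot_diff \<sigma> \<sigma>wn (S Wet t x)) k) (at t)"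
proof -
  have cont: "continuous_on ({0..T} \<times> cbox a b) (\<lambda>(t, x). S Wet t x)"
    and range: "\<And>t x. t \<in> {0..T} \<Longrightarrow> x \<in> cbox a b \<Longrightarrow> 0 < S Wet t x \<and> S Wet t x < 1"
    using ex unfolding exact_solution_def by blast+
  have comp: "compact ({0..T} \<times> cbox a b)" by (intro compact_Times) auto
  have ne: "{0..T} \<times> cbox a b \<noteq> {}" using T box_nonempty box_subset_cbox[of a b] by auto
  obtain z1 where z1: "z1 \<in> {0..T} \<times> cbox a b" "\<And>z. z \<in> {0..T} \<times> cbox a b \<Longrightarrow> (\<lambda>(t, x). S Wet t x) z1 \<le> (\<lambda>(t, x). S Wet t x) z"
    using continuous_attains_inf[OF comp ne cont] by blast
  obtain z2 where z2: "z2 \<in> {0..T} \<times> cbox a b" "\<And>z. z \<in> {0..T} \<times> cbox a b \<Longrightarrow> (\<lambda>(t, x). S Wet t x) z \<le> (\<lambda>(t, x). S Wet t x) z2"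
    using continuous_attains_sup[OF comp ne cont] by blast
  \<comment> \<open>Compactness of the space-time cylinder keeps the saturation at a positive
    distance m from 0 and from 1.\<close>
  define m where "m = min (case z1 of (t, x) \<Rightarrow> S Wet t x) (1 - (case z2 of (t, x) \<Rightarrow> S Wet t x))"
  have m: "0 < m" using z1(1) z2(1) range by (auto simp: m_def)
  have mI: "m \<le> S Wet t x \<and> S Wet t x \<le> 1 - m" if "t \<in> {0..T}" "x \<in> cbox a b" for t x
    using z1(2)[of "(t, x)"] z2(2)[of "(t, x)"] that by (auto simp: m_def)
  obtain M0 where M0: "0 \<le> M0" "\<And>t. t \<in> {0..T} \<Longrightarrow> neumann_class a b M0 (S Wet t)"
    using exact_solution_neumann[of \<sigma>, OF \<sigma>(1) \<gamma> T ex] by blast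
  let ?F = "pot_diff \<sigma> \<sigma>wn"
  let ?F' = "\<lambda>q. (\<sigma> Wet / q + \<sigma> NonWet / (1 - q)) - 2 * \<sigma>wn"
  \<comment> \<open>C1 bounds the slope and C2 the Taylor remainder of F on [m, 1 - m]; the affine
    part of F adds 2 \<sigma>wn to the slope and nothing to the remainder.\<close>
  define C1 where "C1 = (\<sigma> Wet + \<sigma> NonWet) / m + 2 * \<sigma>wn"
  define C2 where "C2 = (\<sigma> Wet + \<sigma> NonWet) / m\<^sup>2"
  define L where "L = (\<Sum>l\<in>UNIV. b $ l - a $ l)"
  have \<sigma>': "\<And>\<alpha>. 0 \<le> \<sigma> \<alpha>" using \<sigma>(1) less_imp_le by blast
  have C0: "0 \<le> C1" "0 \<le> C2" using \<sigma>' \<sigma>(2) m by (auto simp: C1_def C2_def)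
  have cFI: "continuous_on {m..1 - m} ?F"
    unfolding pot_diff_def log_pot_def by (intro continuous_intros) (use m in auto)
  have nF: "neumann_class a b (C1 * M0 + 2 * C2 * (6 * L * M0)\<^sup>2) (\<lambda>x. ?F (S Wet t x))" if t: "t \<in> {0..T}" for t
  proof (rule neumann_class_compose[OF M0(2)[OF t] M0(1), where I = "{m..1 - m}" and F' = ?F'])
    show "S Wet t x \<in> {m..1 - m}" if "x \<in> cbox a b" for x using mI[OF t that] by simp
    show "b $ l - a $ l \<le> L" for l
      unfolding L_def using len_pos by (intro member_le_sum) (auto simp: less_imp_le)
    fix p q :: real assume pq: "p \<in> {m..1 - m}" "q \<in> {m..1 - m}"
    have "?F p - ?F q - ?F' q * (p - q) = log_pot \<sigma> p - log_pot \<sigma> q - (\<sigma> Wet / q + \<sigma> NonWet / (1 - q)) * (p - q)"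
    proof -
      have "(x + \<sigma>wn * (1 - 2 * p)) - (y + \<sigma>wn * (1 - 2 * q)) - (D - 2 * \<sigma>wn) * (p - q) = x - y - D * (p - q)" for x y D
        by (simp add: algebra_simps)
      then show ?thesis unfolding pot_diff_def .
    qed
    then show "\<bar>?F p - ?F q - ?F' q * (p - q)\<bar> \<le> C2 * (p - q)\<^sup>2"
      using log_pot_lipschitz(3)[of \<sigma>, OF \<sigma>(1) m pq] by (simp only: C2_def)
    have "?F p - ?F q = (log_pot \<sigma> p - log_pot \<sigma> q) - 2 * \<sigma>wn * (p - q)"
      by (simp add: pot_diff_def algebra_simps)
    moreover have "\<bar>2 * \<sigma>wn * (p - q)\<bar> = 2 * \<sigma>wn * \<bar>p - q\<bar>" using \<sigma>(2) by (simp add: abs_mult)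
    ultimately have "\<bar>?F p - ?F q\<bar> \<le> (\<sigma> Wet + \<sigma> NonWet) / m * \<bar>p - q\<bar> + 2 * \<sigma>wn * \<bar>p - q\<bar>"
      using log_pot_lipschitz(1)[of \<sigma>, OF \<sigma>(1) m pq] by linarith
    then show "\<bar>?F p - ?F q\<bar> \<le> C1 * \<bar>p - q\<bar>" by (simp only: C1_def distrib_right)
  next
    fix q :: real assume q: "q \<in> {m..1 - m}"
    show "\<bar>?F' q\<bar> \<le> C1"
      using log_pot_lipschitz(2)[of \<sigma>, OF \<sigma>(1) m q q] \<sigma>(2) unfolding C1_def by linarith
  qed (use C0 cFI in auto)
  define M where "M = max M0 (C1 * M0 + 2 * C2 * (6 * L * M0)\<^sup>2)"
  have M: "0 \<le> M" using M0 by (simp add: M_def)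
  have nM: "neumann_class a b M (\<lambda>x. ?F (S Wet t x))" if "t \<in> {0..T}" for t
    using neumann_class_mono[OF nF[OF that]] by (simp add: M_def)
  have cF: "continuous_on ({0..T} \<times> cbox a b) (\<lambda>(t, x). ?F (S Wet t x))"
  proof -
    have "continuous_on ({0..T} \<times> cbox a b) (\<lambda>z. ?F ((\<lambda>(t, x). S Wet t x) z))"
      by (rule continuous_on_compose2[OF cFI cont]) (use mI in auto)
    then show ?thesis by (simp add: case_prod_beta)
  qed
  show ?thesis
  proof (rule that[OF m M mI])
    show "neumann_class a b M (S Wet t)" if "t \<in> {0..T}" for t
      using neumann_class_mono[OF M0(2)[OF that]] by (simp add: M_def)
    show "continuous_on {0..T} (\<lambda>t. coef (S Wet t) k)" for k by (rule continuous_on_coef_time[OF cont])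
    show "((\<lambda>t. coef (S Wet t) k) has_real_derivative - lam k / 2 * coef (\<lambda>x. ?F (S Wet t x)) k) (at t)"
      if "0 < t" "t < T" for k t
      by (rule exact_solution_mode_equation[OF T ex nM M cF that])
  qed (use nM in auto)
qed

end

section \<open>The discrete Neumann Laplacian\<close>

text \<open>Summation by parts on a finite graph. The relation is arbitrary because the lemma serves
  both for all neighbours and for the neighbours in one direction.\<close>

lemma symmetric_difference_selfadjoint:
  fixes c d :: "'a \<Rightarrow> real"
  assumes A: "finite A" and sym: "\<And>P Q. R P Q \<longleftrightarrow> R Q P"
  shows "(\<Sum>P\<in>A. (\<Sum>Q\<in>{Q\<in>A. R P Q}. c Q - c P) * d P) = (\<Sum>P\<in>A. c P * (\<Sum>Q\<in>{Q\<in>A. R P Q}. d Q - d P))"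
    and "(\<Sum>P\<in>A. (\<Sum>Q\<in>{Q\<in>A. R P Q}. c Q - c P) * c P) = - (\<Sum>P\<in>A. \<Sum>Q\<in>{Q\<in>A. R P Q}. (c Q - c P)\<^sup>2) / 2"
proof -
  let ?r = "\<lambda>P Q. if R P Q then 1 else 0 :: real"
  have conv: "(\<Sum>Q\<in>{Q\<in>A. R P Q}. f Q) = (\<Sum>Q\<in>A. ?r P Q * f Q)" for P and f :: "'a \<Rightarrow> real"
    using A by (subst sum.inter_filter) (auto intro!: sum.cong)
  have exp: "(\<Sum>P\<in>A. (\<Sum>Q\<in>{Q\<in>A. R P Q}. c Q - c P) * d P) =
      (\<Sum>P\<in>A. \<Sum>Q\<in>A. ?r P Q * (c Q * d P)) - (\<Sum>P\<in>A. \<Sum>Q\<in>A. ?r P Q * (c P * d P))" for c d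
    unfolding conv sum_subtractf[symmetric] sum_distrib_right by (intro sum.cong refl) (simp add: algebra_simps)
  have swap: "(\<Sum>P\<in>A. \<Sum>Q\<in>A. ?r P Q * g P Q) = (\<Sum>P\<in>A. \<Sum>Q\<in>A. ?r P Q * g Q P)" for g :: "'a \<Rightarrow> 'a \<Rightarrow> real"
    by (subst sum.swap) (auto intro!: sum.cong simp: sym)
  show "(\<Sum>P\<in>A. (\<Sum>Q\<in>{Q\<in>A. R P Q}. c Q - c P) * d P) = (\<Sum>P\<in>A. c P * (\<Sum>Q\<in>{Q\<in>A. R P Q}. d Q - d P))"
  proof -
    have 1: "(\<Sum>P\<in>A. c P * (\<Sum>Q\<in>{Q\<in>A. R P Q}. d Q - d P)) = (\<Sum>P\<in>A. (\<Sum>Q\<in>{Q\<in>A. R P Q}. d Q - d P) * c P)"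
      by (intro sum.cong refl) (rule mult.commute)
    have 2: "(\<Sum>P\<in>A. \<Sum>Q\<in>A. ?r P Q * (c Q * d P)) = (\<Sum>P\<in>A. \<Sum>Q\<in>A. ?r P Q * (d Q * c P))"
      by (subst swap) (simp only: mult.commute)
    have 3: "(\<Sum>P\<in>A. \<Sum>Q\<in>A. ?r P Q * (c P * d P)) = (\<Sum>P\<in>A. \<Sum>Q\<in>A. ?r P Q * (d P * c P))"
      by (simp only: mult.commute)
    show ?thesis unfolding 1 exp 2 3 ..
  qed
  have "(\<Sum>P\<in>A. \<Sum>Q\<in>{Q\<in>A. R P Q}. (c Q - c P)\<^sup>2) =
     (\<Sum>P\<in>A. \<Sum>Q\<in>A. ?r P Q * (c Q * c Q)) + (\<Sum>P\<in>A. \<Sum>Q\<in>A. ?r P Q * (c P * c P)) - 2 * (\<Sum>P\<in>A. \<Sum>Q\<in>A. ?r P Q * (c Q * c P))"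
    unfolding conv sum_distrib_left sum_subtractf[symmetric] sum.distrib[symmetric]
    by (intro sum.cong refl) (simp add: power2_eq_square algebra_simps)
  also have "(\<Sum>P\<in>A. \<Sum>Q\<in>A. ?r P Q * (c Q * c Q)) = (\<Sum>P\<in>A. \<Sum>Q\<in>A. ?r P Q * (c P * c P))"
    by (rule swap)
  finally show "(\<Sum>P\<in>A. (\<Sum>Q\<in>{Q\<in>A. R P Q}. c Q - c P) * c P) = - (\<Sum>P\<in>A. \<Sum>Q\<in>{Q\<in>A. R P Q}. (c Q - c P)\<^sup>2) / 2"
    unfolding exp by simp
qed

text \<open>Orthogonal projection onto finitely many functions by Gram-Schmidt: the new function is
  split into its projection and a remainder r, then the fit is corrected along r. This is the linear
  algebra behind the discrete Neumann problem.\<close>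

lemma least_squares_exists:
  fixes w :: "'j \<Rightarrow> 'a \<Rightarrow> real" and g :: "'a \<Rightarrow> real"
  assumes A: "finite A" and J: "finite J"
  shows "\<exists>x. \<forall>j\<in>J. (\<Sum>P\<in>A. (g P - (\<Sum>i\<in>J. x i * w i P)) * w j P) = 0"
  using J
proof (induction J arbitrary: g)
  case (insert j J)
  obtain y where y: "\<And>i. i \<in> J \<Longrightarrow> (\<Sum>P\<in>A. (w j P - (\<Sum>i\<in>J. y i * w i P)) * w i P) = 0"
    using insert.IH[of "w j"] by blast
  obtain x where x: "\<And>i. i \<in> J \<Longrightarrow> (\<Sum>P\<in>A. (g P - (\<Sum>i\<in>J. x i * w i P)) * w i P) = 0"
    using insert.IH[of g] by blast
  define r where "r P = w j P - (\<Sum>i\<in>J. y i * w i P)" for P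
  define \<rho> where "\<rho> P = g P - (\<Sum>i\<in>J. x i * w i P)" for P
  define rr where "rr = (\<Sum>P\<in>A. r P * r P)"
  \<comment> \<open>If \<open>rr\<close> is zero then r vanishes on A, and every value of t
    serves.\<close>
  define t where "t = (\<Sum>P\<in>A. \<rho> P * r P) / rr"
  define z where "z i = (if i = j then t else x i - t * y i)" for i
  have res: "g P - (\<Sum>i\<in>insert j J. z i * w i P) = \<rho> P - t * r P" for P
  proof -
    have "(\<Sum>i\<in>J. z i * w i P) = (\<Sum>i\<in>J. x i * w i P) - t * (\<Sum>i\<in>J. y i * w i P)"
      unfolding sum_distrib_left sum_subtractf[symmetric] using insert.hyps(2)
      by (intro sum.cong refl) (auto simp: z_def algebra_simps)
    then show ?thesis using insert.hyps by (simp add: \<rho>_def r_def z_def algebra_simps)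
  qed
  have orthJ: "(\<Sum>P\<in>A. (\<rho> P - t * r P) * w i P) = 0" if "i \<in> J" for i
  proof -
    have "(\<Sum>P\<in>A. (\<rho> P - t * r P) * w i P) = (\<Sum>P\<in>A. \<rho> P * w i P) - t * (\<Sum>P\<in>A. r P * w i P)"
      unfolding sum_distrib_left sum_subtractf[symmetric] by (intro sum.cong refl) (simp add: algebra_simps)
    then show ?thesis using x[OF that] y[OF that] by (simp add: \<rho>_def r_def)
  qed
  have orthr: "(\<Sum>P\<in>A. (\<rho> P - t * r P) * r P) = 0"
  proof (cases "rr = 0")
    case True
    then have "\<forall>P\<in>A. r P * r P = 0"
      unfolding rr_def using A by (subst (asm) sum_nonneg_eq_0_iff) auto
    then show ?thesis by (intro sum.neutral) auto
  next
    case False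
    have "(\<Sum>P\<in>A. (\<rho> P - t * r P) * r P) = (\<Sum>P\<in>A. \<rho> P * r P) - t * rr"
      unfolding rr_def sum_distrib_left sum_subtractf[symmetric] by (intro sum.cong refl) (simp add: algebra_simps)
    then show ?thesis using False by (simp add: t_def)
  qed
  have orthj: "(\<Sum>P\<in>A. (\<rho> P - t * r P) * w j P) = 0"
  proof -
    have "(\<Sum>P\<in>A. (\<rho> P - t * r P) * w j P) = (\<Sum>P\<in>A. (\<rho> P - t * r P) * r P) + (\<Sum>i\<in>J. y i * (\<Sum>P\<in>A. (\<rho> P - t * r P) * w i P))"
    proof -
      have "(\<Sum>i\<in>J. y i * (\<Sum>P\<in>A. (\<rho> P - t * r P) * w i P)) = (\<Sum>P\<in>A. \<Sum>i\<in>J. (\<rho> P - t * r P) * (y i * w i P))"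
        unfolding sum_distrib_left by (subst sum.swap) (simp add: mult.left_commute)
      then show ?thesis
        unfolding sum_distrib_left[symmetric] by (simp add: r_def sum.distrib[symmetric] distrib_left[symmetric])
    qed
    then show ?thesis using orthr orthJ by simp
  qed
  show ?case
    by (intro exI[of _ z] ballI) (use orthJ orthj in \<open>auto simp only: res insert_iff\<close>)
qed auto

section \<open>Solvability of the discrete Neumann problem\<close>

lemma share_face_sym: "share_face P Q \<longleftrightarrow> share_face Q P"
  unfolding share_face_def by (metis (no_types, lifting))

lemma finite_cells: "finite (cells K)" for K :: "'n::finite \<Rightarrow> nat"
proof -
  have "cells K = (\<Pi>\<^sub>E l\<in>UNIV. {..<2 * K l + 1})" by (auto simp: cells_def PiE_def)
  then show ?thesis by (simp add: finite_PiE)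
qed

text \<open>The grid is connected: lowering a positive coordinate by one stays in the grid and ends
  at the corner cell.\<close>

lemma constant_on_cells:
  fixes K :: "'n::finite \<Rightarrow> nat"
  assumes "\<And>P Q. P \<in> cells K \<Longrightarrow> Q \<in> cells K \<Longrightarrow> share_face P Q \<Longrightarrow> c P = c Q" "P \<in> cells K"
  shows "c P = c (\<lambda>_. 0)"
  using assms(2)
proof (induction "\<Sum>l\<in>UNIV. P l" arbitrary: P rule: less_induct)
  case less
  show ?case
  proof (cases "P = (\<lambda>_. 0)")
    case False
    then obtain l where l: "0 < P l" by auto
    define Q where "Q = P(l := P l - 1)"
    have Q: "Q \<in> cells K" using less.prems by (auto simp: cells_def Q_def less_imp_diff_less)
    have "(\<Sum>l\<in>UNIV. Q l) < (\<Sum>l\<in>UNIV. P l)"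
      by (rule sum_strict_mono_ex1) (use l in \<open>auto simp: Q_def\<close>)
    then have "c Q = c (\<lambda>_. 0)" using less.hyps Q by blast
    moreover have "share_face P Q" unfolding share_face_def using l by (intro exI[of _ l]) (auto simp: Q_def)
    ultimately show ?thesis using assms(1)[OF less.prems Q] by simp
  qed simp
qed

lemma grid_laplacian_selfadjoint:
  fixes K :: "'n::finite \<Rightarrow> nat"
  shows "(\<Sum>P\<in>cells K. grid_laplacian K h c P * d P) = (\<Sum>P\<in>cells K. c P * grid_laplacian K h d P)"
  using symmetric_difference_selfadjoint(1)[where A = "cells K" and R = share_face and c = c and d = d, OF finite_cells share_face_sym]
  unfolding grid_laplacian_def times_divide_eq_left times_divide_eq_right sum_divide_distrib[symmetric] by simp

lemma grid_laplacian_energy: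
  fixes K :: "'n::finite \<Rightarrow> nat"
  shows "(\<Sum>P\<in>cells K. - grid_laplacian K h c P * c P) = (\<Sum>P\<in>cells K. \<Sum>Q\<in>{Q\<in>cells K. share_face P Q}. (c Q - c P)\<^sup>2) / (2 * h\<^sup>2)"
proof -
  have "(\<Sum>P\<in>cells K. - grid_laplacian K h c P * c P) = - (\<Sum>P\<in>cells K. (\<Sum>Q\<in>{Q\<in>cells K. share_face P Q}. c Q - c P) * c P) / h\<^sup>2"
    unfolding grid_laplacian_def mult_minus_left sum_negf times_divide_eq_left sum_divide_distrib[symmetric] by simp
  also have "(\<Sum>P\<in>cells K. (\<Sum>Q\<in>{Q\<in>cells K. share_face P Q}. c Q - c P) * c P) =
      - (\<Sum>P\<in>cells K. \<Sum>Q\<in>{Q\<in>cells K. share_face P Q}. (c Q - c P)\<^sup>2) / 2"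
    by (rule symmetric_difference_selfadjoint(2)[OF finite_cells share_face_sym])
  finally show ?thesis by simp
qed

lemma grid_laplacian_sum:
  fixes K :: "'n::finite \<Rightarrow> nat"
  shows "(\<Sum>P\<in>cells K. grid_laplacian K h c P) = 0"
  using grid_laplacian_selfadjoint[of K h c "\<lambda>_. 1"] by (simp add: grid_laplacian_def)

lemma grid_laplacian_zero_constant:
  fixes K :: "'n::finite \<Rightarrow> nat"
  assumes h: "0 < h" and z: "\<And>P. P \<in> cells K \<Longrightarrow> grid_laplacian K h c P = 0" and P: "P \<in> cells K"
  shows "c P = c (\<lambda>_. 0)"
proof (rule constant_on_cells[OF _ P])
  have "(\<Sum>P\<in>cells K. \<Sum>Q\<in>{Q\<in>cells K. share_face P Q}. (c Q - c P)\<^sup>2) / (2 * h\<^sup>2) = 0"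
    unfolding grid_laplacian_energy[symmetric] using z by (intro sum.neutral) auto
  then have "(\<Sum>P\<in>cells K. \<Sum>Q\<in>{Q\<in>cells K. share_face P Q}. (c Q - c P)\<^sup>2) = 0" using h by simp
  then have "\<forall>P\<in>cells K. (\<Sum>Q\<in>{Q\<in>cells K. share_face P Q}. (c Q - c P)\<^sup>2) = 0"
    by (subst (asm) sum_nonneg_eq_0_iff) (auto simp: finite_cells intro: sum_nonneg)
  then have "\<forall>P\<in>cells K. \<forall>Q\<in>{Q\<in>cells K. share_face P Q}. (c Q - c P)\<^sup>2 = 0"
    by (subst (asm) sum_nonneg_eq_0_iff) (auto simp: finite_cells)
  then show "c P = c Q" if "P \<in> cells K" "Q \<in> cells K" "share_face P Q" for P Q
    using that by auto
qed

lemma grid_laplacian_diff: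
  "grid_laplacian K h (\<lambda>i. c i - d i) P = grid_laplacian K h c P - grid_laplacian K h d P"
  unfolding grid_laplacian_def diff_divide_distrib[symmetric] sum_subtractf[symmetric]
  by (intro arg_cong2[of _ _ _ _ "(/)"] sum.cong refl) simp

lemma grid_laplacian_cong:
  assumes "\<And>i. i \<in> cells K \<Longrightarrow> c i = d i" "P \<in> cells K"
  shows "grid_laplacian K h c P = grid_laplacian K h d P"
  unfolding grid_laplacian_def using assms by (intro arg_cong2[of _ _ _ _ "(/)"] sum.cong refl) auto

lemma grid_laplacian_lincomb:
  "grid_laplacian K h (\<lambda>i. \<Sum>j\<in>J. x j * c j i) P = (\<Sum>j\<in>J. x j * grid_laplacian K h (c j) P)"
proof -
  have "(\<Sum>Q\<in>N. (\<Sum>j\<in>J. x j * c j Q) - (\<Sum>j\<in>J. x j * c j P)) = (\<Sum>j\<in>J. x j * (\<Sum>Q\<in>N. c j Q - c j P))" for N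
    unfolding sum_subtractf[symmetric] right_diff_distrib[symmetric] sum_distrib_left by (rule sum.swap)
  then show ?thesis
    unfolding grid_laplacian_def times_divide_eq_right sum_divide_distrib[symmetric] by simp
qed

text \<open>The least-squares residual is orthogonal to the range of the self-adjoint Laplacian,
  hence harmonic, hence constant; it sums to zero because \<phi> and every discrete Laplacian do, so
  it vanishes.\<close>

lemma neg_laplacian_solution_exists:
  fixes K :: "'n::finite \<Rightarrow> nat"
  assumes h: "0 < h" and \<phi>: "\<phi> \<in> grid_fun0 K"
  shows "\<exists>\<psi>. \<psi> \<in> grid_fun0 K \<and> (\<forall>i\<in>cells K. - grid_laplacian K h \<psi> i = \<phi> i)"
proof -
  let ?A = "cells K"
  define e where "e j i = (if i = j then 1 else 0 :: real)" for j i :: "'n \<Rightarrow> nat"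
  obtain x where x: "\<And>j. j \<in> ?A \<Longrightarrow> (\<Sum>P\<in>?A. (\<phi> P - (\<Sum>i\<in>?A. x i * grid_laplacian K h (e i) P)) * grid_laplacian K h (e j) P) = 0"
    using least_squares_exists[OF finite_cells[of K] finite_cells[of K], of \<phi> "\<lambda>i. grid_laplacian K h (e i)"] by blast
  define \<rho> where "\<rho> P = \<phi> P - grid_laplacian K h x P" for P
  have xe: "grid_laplacian K h x P = (\<Sum>i\<in>?A. x i * grid_laplacian K h (e i) P)" if "P \<in> ?A" for P
  proof -
    have "grid_laplacian K h x P = grid_laplacian K h (\<lambda>i. \<Sum>j\<in>?A. x j * e j i) P"
      
    proof (rule grid_laplacian_cong[OF _ that])
      fix i assume i: "i \<in> ?A"
      have "(\<Sum>j\<in>?A. x j * e j i) = (\<Sum>j\<in>?A. if j = i then x j else 0)"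
        by (intro sum.cong) (auto simp: e_def)
      then show "x i = (\<Sum>j\<in>?A. x j * e j i)" using i by (simp add: finite_cells)
    qed
    then show ?thesis by (simp only: grid_laplacian_lincomb)
  qed
  have "grid_laplacian K h \<rho> j = 0" if j: "j \<in> ?A" for j
  proof -
    have "(\<Sum>P\<in>?A. grid_laplacian K h \<rho> P * e j P) = (\<Sum>P\<in>?A. \<rho> P * grid_laplacian K h (e j) P)"
      by (rule grid_laplacian_selfadjoint)
    also have "\<dots> = (\<Sum>P\<in>?A. (\<phi> P - (\<Sum>i\<in>?A. x i * grid_laplacian K h (e i) P)) * grid_laplacian K h (e j) P)"
      by (intro sum.cong refl) (simp only: \<rho>_def xe)
    also have "\<dots> = 0" by (rule x[OF j])
    also have "(\<Sum>P\<in>?A. grid_laplacian K h \<rho> P * e j P) = (\<Sum>P\<in>?A. if P = j then grid_laplacian K h \<rho> P else 0)"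
      by (intro sum.cong) (auto simp: e_def)
    finally have "(\<Sum>P\<in>?A. if P = j then grid_laplacian K h \<rho> P else 0) = 0" .
    then show ?thesis using j by (simp add: finite_cells)
  qed
  then have const: "\<rho> P = \<rho> (\<lambda>_. 0)" if "P \<in> ?A" for P
    using grid_laplacian_zero_constant[OF h _ that] by blast
  have z: "(\<lambda>_. 0) \<in> ?A" by (simp add: cells_def)
  have "(\<Sum>P\<in>?A. \<rho> P) = 0"
    using \<phi> grid_laplacian_sum[of K h x] by (simp add: \<rho>_def sum_subtractf grid_fun0_def)
  moreover have "(\<Sum>P\<in>?A. \<rho> P) = real (card ?A) * \<rho> (\<lambda>_. 0)"
    using const by (simp cong: sum.cong)
  ultimately have "\<rho> (\<lambda>_. 0) = 0" using z finite_cells[of K] by auto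
  then have sol: "grid_laplacian K h x P = \<phi> P" if "P \<in> ?A" for P
    using const[OF that] by (simp add: \<rho>_def)
  \<comment> \<open>\<open>x\<close> solves the equation with the opposite sign and has an
    undetermined mean; \<open>m - x\<close> corrects both.\<close>
  define m where "m = (\<Sum>P\<in>?A. x P) / real (card ?A)"
  define \<psi> where "\<psi> i = (if i \<in> ?A then m - x i else 0)" for i
  have "card ?A \<noteq> 0" using z finite_cells[of K] by auto
  then have "(\<Sum>i\<in>?A. \<psi> i) = 0" by (simp add: \<psi>_def sum_subtractf m_def)
  then have "\<psi> \<in> grid_fun0 K" by (simp add: grid_fun0_def grid_fun_def \<psi>_def)
  moreover have "- grid_laplacian K h \<psi> i = \<phi> i" if "i \<in> ?A" for i
  proof -
    have "grid_laplacian K h \<psi> i = grid_laplacian K h (\<lambda>i. m - x i) i"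
      by (rule grid_laplacian_cong[OF _ that]) (simp add: \<psi>_def)
    also have "\<dots> = grid_laplacian K h (\<lambda>_. m) i - grid_laplacian K h x i" by (rule grid_laplacian_diff)
    also have "grid_laplacian K h (\<lambda>_. m) i = 0" by (simp add: grid_laplacian_def)
    finally show ?thesis using sol[OF that] by simp
  qed
  ultimately show ?thesis by blast
qed

lemma inv_neg_laplacian:
  fixes K :: "'n::finite \<Rightarrow> nat"
  assumes h: "0 < h" and \<phi>: "\<phi> \<in> grid_fun0 K"
  shows "inv_neg_laplacian K h \<phi> \<in> grid_fun0 K"
    and "\<And>i. i \<in> cells K \<Longrightarrow> - grid_laplacian K h (inv_neg_laplacian K h \<phi>) i = \<phi> i"
    and "\<And>\<psi>. \<psi> \<in> grid_fun0 K \<Longrightarrow> (\<And>i. i \<in> cells K \<Longrightarrow> - grid_laplacian K h \<psi> i = \<phi> i) \<Longrightarrow> inv_neg_laplacian K h \<phi> = \<psi>"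
proof -
  let ?S = "\<lambda>\<psi>. \<psi> \<in> grid_fun0 K \<and> (\<forall>i\<in>cells K. - grid_laplacian K h \<psi> i = \<phi> i)"
  have uniq: "\<psi> = \<psi>'" if "?S \<psi>" "?S \<psi>'" for \<psi> \<psi>'
  proof -
    let ?d = "\<lambda>i. \<psi> i - \<psi>' i"
    have "grid_laplacian K h ?d P = 0" if "P \<in> cells K" for P
      using \<open>?S \<psi>\<close> \<open>?S \<psi>'\<close> that unfolding grid_laplacian_diff by force
    then have const: "?d P = ?d (\<lambda>_. 0)" if "P \<in> cells K" for P
      using grid_laplacian_zero_constant[OF h _ that, of ?d] by blast
    have "(\<Sum>P\<in>cells K. ?d P) = real (card (cells K)) * ?d (\<lambda>_. 0)"
      using const by (simp cong: sum.cong)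
    moreover have "(\<Sum>P\<in>cells K. ?d P) = 0" using that by (simp add: sum_subtractf grid_fun0_def)
    moreover have "card (cells K) \<noteq> 0"
    proof -
      have "(\<lambda>_. 0) \<in> cells K" by (simp add: cells_def)
      then show ?thesis using finite_cells[of K] by auto
    qed
    ultimately have "?d (\<lambda>_. 0) = 0" by auto
    then have "\<psi> P = \<psi>' P" if "P \<in> cells K" for P using const[OF that] by simp
    moreover have "\<psi> P = \<psi>' P" if "P \<notin> cells K" for P
      using \<open>?S \<psi>\<close> \<open>?S \<psi>'\<close> that by (simp add: grid_fun0_def grid_fun_def)
    ultimately show ?thesis by blast
  qed
  obtain \<psi>0 where \<psi>0: "?S \<psi>0" using neg_laplacian_solution_exists[OF h \<phi>] by blast
  have eq: "inv_neg_laplacian K h \<phi> = \<psi>" if "?S \<psi>" for \<psi>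
    unfolding inv_neg_laplacian_def by (rule the_equality) (use that uniq in blast)+
  show "- grid_laplacian K h (inv_neg_laplacian K h \<phi>) i = \<phi> i" if "i \<in> cells K" for i
    using \<psi>0 that unfolding eq[OF \<psi>0] by auto
  show "inv_neg_laplacian K h \<phi> \<in> grid_fun0 K" using \<psi>0 unfolding eq[OF \<psi>0] by auto
  show "inv_neg_laplacian K h \<phi> = \<psi>" if "\<psi> \<in> grid_fun0 K" "\<And>i. i \<in> cells K \<Longrightarrow> - grid_laplacian K h \<psi> i = \<phi> i" for \<psi>
    using that by (intro eq) auto
qed

lemma grid_fun0_diff: "c \<in> grid_fun0 K \<Longrightarrow> d \<in> grid_fun0 K \<Longrightarrow> (\<lambda>i. c i - d i) \<in> grid_fun0 K"
  by (simp add: grid_fun0_def grid_fun_def sum_subtractf)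

lemma inv_neg_laplacian_symmetric:
  fixes K :: "'n::finite \<Rightarrow> nat"
  assumes h: "0 < h" and c: "c \<in> grid_fun0 K" and d: "d \<in> grid_fun0 K"
  shows "grid_inner K h (inv_neg_laplacian K h c) d = grid_inner K h c (inv_neg_laplacian K h d)"
proof -
  let ?C = "inv_neg_laplacian K h c" and ?D = "inv_neg_laplacian K h d"
  have "(\<Sum>P\<in>cells K. ?C P * d P) = (\<Sum>P\<in>cells K. ?C P * - grid_laplacian K h ?D P)"
    using inv_neg_laplacian(2)[OF h d] by (intro sum.cong) auto
  also have "\<dots> = - (\<Sum>P\<in>cells K. ?C P * grid_laplacian K h ?D P)" by (simp add: sum_negf)
  also have "\<dots> = - (\<Sum>P\<in>cells K. grid_laplacian K h ?C P * ?D P)" by (simp only: grid_laplacian_selfadjoint)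
  also have "\<dots> = (\<Sum>P\<in>cells K. - grid_laplacian K h ?C P * ?D P)" by (simp add: sum_negf)
  also have "\<dots> = (\<Sum>P\<in>cells K. c P * ?D P)"
    using inv_neg_laplacian(2)[OF h c] by (intro sum.cong) auto
  finally show ?thesis by (simp add: grid_inner_def)
qed

text \<open>Self-adjointness moves the Laplacian from \<Phi> onto the inverse, where it cancels up
  to sign.\<close>

lemma grid_inner_inv_laplacian:
  fixes K :: "'n::finite \<Rightarrow> nat"
  assumes h: "0 < h" and e: "e \<in> grid_fun0 K" and c: "\<And>i. i \<in> cells K \<Longrightarrow> c i = grid_laplacian K h \<Phi> i"
  shows "grid_inner K h c (inv_neg_laplacian K h e) = - grid_inner K h \<Phi> e"
proof -
  let ?E = "inv_neg_laplacian K h e"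
  have "(\<Sum>P\<in>cells K. c P * ?E P) = (\<Sum>P\<in>cells K. grid_laplacian K h \<Phi> P * ?E P)"
    using c by (intro sum.cong) auto
  also have "\<dots> = (\<Sum>P\<in>cells K. \<Phi> P * grid_laplacian K h ?E P)" by (rule grid_laplacian_selfadjoint)
  also have "\<dots> = (\<Sum>P\<in>cells K. - (\<Phi> P * e P))"
  proof (intro sum.cong refl)
    fix P assume "P \<in> cells K"
    from inv_neg_laplacian(2)[OF h e this] have "grid_laplacian K h ?E P = - e P" by linarith
    then show "\<Phi> P * grid_laplacian K h ?E P = - (\<Phi> P * e P)" by simp
  qed
  finally show ?thesis by (simp add: grid_inner_def sum_negf)
qed

lemma grid_neg_norm_square:
  fixes K :: "'n::finite \<Rightarrow> nat"
  assumes h: "0 < h" and c: "c \<in> grid_fun0 K"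
  shows "0 \<le> grid_inner K h c (inv_neg_laplacian K h c)"
    and "(grid_neg_norm K h c)\<^sup>2 = grid_inner K h c (inv_neg_laplacian K h c)"
proof -
  let ?C = "inv_neg_laplacian K h c"
  have "(\<Sum>P\<in>cells K. c P * ?C P) = (\<Sum>P\<in>cells K. - grid_laplacian K h ?C P * ?C P)"
    using inv_neg_laplacian(2)[OF h c] by (intro sum.cong) auto
  also have "\<dots> \<ge> 0" unfolding grid_laplacian_energy by (intro divide_nonneg_nonneg sum_nonneg) auto
  finally show "0 \<le> grid_inner K h c ?C" using h by (simp add: grid_inner_def)
  then show "(grid_neg_norm K h c)\<^sup>2 = grid_inner K h c ?C" by (simp add: grid_neg_norm_def)
qed

lemma inv_neg_laplacian_diff:
  fixes K :: "'n::finite \<Rightarrow> nat"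
  assumes h: "0 < h" and c: "c \<in> grid_fun0 K" and d: "d \<in> grid_fun0 K"
  shows "inv_neg_laplacian K h (\<lambda>i. c i - d i) = (\<lambda>i. inv_neg_laplacian K h c i - inv_neg_laplacian K h d i)"
proof (rule inv_neg_laplacian(3)[OF h grid_fun0_diff[OF c d] grid_fun0_diff[OF inv_neg_laplacian(1)[OF h c] inv_neg_laplacian(1)[OF h d]]])
  fix i assume i: "i \<in> cells K"
  show "- grid_laplacian K h (\<lambda>i. inv_neg_laplacian K h c i - inv_neg_laplacian K h d i) i = c i - d i"
    unfolding grid_laplacian_diff using inv_neg_laplacian(2)[OF h c i] inv_neg_laplacian(2)[OF h d i] by linarith
qed

text \<open>Maclaurin expansion to order four: the remainder is cos t x^4 / 24 with t between 0 and
  x \<le> pi / 2, so its sign is known.\<close>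

lemma two_minus_two_cos_bounds:
  assumes "0 \<le> x" "x \<le> pi / 2"
  shows "2 - 2 * cos x \<le> x\<^sup>2" "x\<^sup>2 - x ^ 4 / 12 \<le> 2 - 2 * cos x"
proof -
  have "2 - 2 * cos x \<le> x\<^sup>2 \<and> x\<^sup>2 - x ^ 4 / 12 \<le> 2 - 2 * cos x"
  proof (cases "x = 0")
    case False
    then have "0 < x" using assms by simp
    then obtain t where t: "0 < t" "t < x"
      "cos x = (\<Sum>m<4. cos_coeff m * x ^ m) + (cos (t + 1 / 2 * real 4 * pi) / fact 4) * x ^ 4"
      using Maclaurin_cos_expansion2[of x 4] by auto
    have "(\<Sum>m<4. f m) = f 0 + f 1 + f 2 + f 3" for f :: "nat \<Rightarrow> real"
      by (simp add: eval_nat_numeral)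
    then have "(\<Sum>m<4. cos_coeff m * x ^ m) = 1 - x\<^sup>2 / 2"
      by (simp add: cos_coeff_def fact_numeral)
    moreover have "cos (t + 1 / 2 * real 4 * pi) = cos t" by (simp add: cos_add)
    ultimately have e: "cos x = 1 - x\<^sup>2 / 2 + cos t * x ^ 4 / 24" using t(3) by (simp add: fact_numeral)
    have "0 \<le> cos t" using t assms by (intro cos_ge_zero) auto
    moreover have "cos t * x ^ 4 \<le> 1 * x ^ 4" by (intro mult_right_mono) auto
    ultimately show ?thesis unfolding e by simp
  qed simp
  then show "2 - 2 * cos x \<le> x\<^sup>2" "x\<^sup>2 - x ^ 4 / 12 \<le> 2 - 2 * cos x" by auto
qed

section \<open>Cosine polynomials on the grid\<close>

locale cosine_grid = cosine_box a b for a b :: "real^'n" +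
  fixes K :: "'n \<Rightarrow> nat" and h :: real
  assumes h: "0 < h" and grid: "\<And>l. b $ l - a $ l = real (2 * K l + 1) * h"
begin

abbreviation ctr :: "('n \<Rightarrow> nat) \<Rightarrow> real^'n" where "ctr \<equiv> cell_center a h"

text \<open>One direction of \<open>share_face\<close>. Directions are kept apart because distinct
  modes may share the total eigenvalue \<open>lamh\<close>, while some directional eigenvalue always
  tells them apart.\<close>

definition adj :: "'n \<Rightarrow> ('n \<Rightarrow> nat) \<Rightarrow> ('n \<Rightarrow> nat) \<Rightarrow> bool" where
  "adj l P P' \<longleftrightarrow> (P' l = P l + 1 \<or> P l = P' l + 1) \<and> (\<forall>m. m \<noteq> l \<longrightarrow> P' m = P m)"

definition lamh :: "('n \<Rightarrow> nat) \<Rightarrow> real" where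
  "lamh k = (\<Sum>l\<in>UNIV. (2 - 2 * cos (freq k l * h)) / h\<^sup>2)"

lemma adj_sym: "adj l P P' \<longleftrightarrow> adj l P' P"
  unfolding adj_def by auto

lemma freq_h: "freq k l * h = real (k l) * pi / real (2 * K l + 1)"
  using h by (simp add: freq_def grid)

lemma cc_center: "cc k (ctr P) = cos (freq k l * ((real (P l) + 1 / 2) * h)) * (\<Prod>m\<in>UNIV - {l}. cos (freq k m * ((real (P m) + 1 / 2) * h)))"
  by (subst cc_split[of _ _ l]) (simp add: cell_center_def)

text \<open>Centres sit at half-integer positions, so the cosine takes equal values at the first
  cell and at its ghost with index -1, and likewise at the other end. A missing neighbour therefore
  acts like a ghost cell, and the three-term cosine identity holds at every cell.\<close>

lemma adj_difference:
  assumes P: "P \<in> cells K"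
  shows "(\<Sum>P'\<in>{P'\<in>cells K. adj l P P'}. cc k (ctr P') - cc k (ctr P)) = (2 * cos (freq k l * h) - 2) * cc k (ctr P)"
proof -
  define C where "C s = cos (freq k l * ((s + 1 / 2) * h))" for s :: real
  let ?R = "\<Prod>m\<in>UNIV - {l}. cos (freq k m * ((real (P m) + 1 / 2) * h))"
  let ?N = "2 * K l + 1"
  have cU: "cc k (ctr (P(l := n))) = C (real n) * ?R" for n
    by (subst cc_center[of _ _ l]) (auto simp: C_def intro!: prod.cong)
  have cP: "cc k (ctr P) = C (real (P l)) * ?R" using cU[of "P l"] by simp
  have C3: "C (s + 1) + C (s - 1) = 2 * cos (freq k l * h) * C s" for s
  proof -
    have "freq k l * ((s + 1 + 1 / 2) * h) = freq k l * ((s + 1 / 2) * h) + freq k l * h"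
      "freq k l * ((s - 1 + 1 / 2) * h) = freq k l * ((s + 1 / 2) * h) - freq k l * h"
      by (simp_all add: algebra_simps)
    then show ?thesis by (simp only: C_def cos_add cos_diff) simp
  qed
  have Clo: "C (-1) = C 0"
  proof -
    have "freq k l * ((-1 + 1 / 2) * h) = - (freq k l * ((0 + 1 / 2) * h))" by simp
    then show ?thesis unfolding C_def by (simp only: cos_minus)
  qed
  have Chi: "C (real ?N) = C (real ?N - 1)"
  proof -
    have f: "freq k l * (real ?N * h) = real (k l) * pi" unfolding grid[symmetric] freq_def using ab[of l] by simp
    have "freq k l * ((real ?N + 1 / 2) * h) = real (k l) * pi + freq k l * (h / 2)"
      "freq k l * ((real ?N - 1 + 1 / 2) * h) = real (k l) * pi - freq k l * (h / 2)"
      unfolding f[symmetric] by (simp_all add: algebra_simps)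
    then show ?thesis unfolding C_def by (simp only: cos_add cos_diff sin_npi)
  qed
  define up where "up = (if P l + 1 < ?N then {P(l := P l + 1)} else {})"
  define dn where "dn = (if 0 < P l then {P(l := P l - 1)} else {})"
  have set: "{P'\<in>cells K. adj l P P'} = up \<union> dn"
  proof (intro set_eqI iffI)
    fix P' assume "P' \<in> {P'\<in>cells K. adj l P P'}"
    then have P': "P' \<in> cells K" "adj l P P'" by auto
    then have "P' l = P l + 1 \<and> P' = P(l := P l + 1) \<or> P l = P' l + 1 \<and> P' = P(l := P l - 1)"
      unfolding adj_def fun_eq_iff fun_upd_apply by (metis add_diff_cancel_right')
    then show "P' \<in> up \<union> dn"
    proof
      assume *: "P' l = P l + 1 \<and> P' = P(l := P l + 1)"
      have "P' l < ?N" using P'(1) by (simp add: cells_def)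
      then show ?thesis using * by (simp add: up_def)
    next
      assume *: "P l = P' l + 1 \<and> P' = P(l := P l - 1)"
      from conjunct1[OF *] have "0 < P l" by linarith
      have "P' \<in> dn" unfolding dn_def if_P[OF \<open>0 < P l\<close>] by (rule singleton_iff[THEN iffD2, OF conjunct2[OF *]])
      then show ?thesis by (rule UnI2)
    qed
  next
    fix P' assume "P' \<in> up \<union> dn"
    then show "P' \<in> {P'\<in>cells K. adj l P P'}"
      using P by (auto simp: up_def dn_def cells_def adj_def less_imp_diff_less split: if_splits)
  qed
  have disj: "up \<inter> dn = {}"
  proof -
    have "P(l := P l + 1) \<noteq> P(l := P l - 1)" 
    proof
      assume "P(l := P l + 1) = P(l := P l - 1)"
      from fun_cong[OF this, of l] show False by simp
    qed
    then show ?thesis by (auto simp: up_def dn_def)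
  qed
  have "(\<Sum>P'\<in>{P'\<in>cells K. adj l P P'}. cc k (ctr P') - cc k (ctr P)) =
      (\<Sum>P'\<in>up. cc k (ctr P') - cc k (ctr P)) + (\<Sum>P'\<in>dn. cc k (ctr P') - cc k (ctr P))"
    unfolding set by (rule sum.union_disjoint[OF _ _ disj]) (auto simp: up_def dn_def)
  also have "(\<Sum>P'\<in>up. cc k (ctr P') - cc k (ctr P)) = (C (real (P l) + 1) - C (real (P l))) * ?R"
  proof (cases "P l + 1 < ?N")
    case True
    then show ?thesis using cU[of "P l + 1"] by (simp add: up_def cP left_diff_distrib add.commute)
  next
    case False
    moreover have "P l < ?N" using P by (simp add: cells_def)
    ultimately have "P l + 1 = ?N" by linarith
    then have "real (P l) = real ?N - 1" by linarith
    then show ?thesis using Chi False by (simp add: up_def add.commute)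
  qed
  also have "(\<Sum>P'\<in>dn. cc k (ctr P') - cc k (ctr P)) = (C (real (P l) - 1) - C (real (P l))) * ?R"
  proof (cases "0 < P l")
    case True
    then show ?thesis using cU[of "P l - 1"] by (simp add: dn_def cP left_diff_distrib of_nat_diff)
  next
    case False
    then show ?thesis using Clo by (simp add: dn_def)
  qed
  also have "(C (real (P l) + 1) - C (real (P l))) * ?R + (C (real (P l) - 1) - C (real (P l))) * ?R =
     ((C (real (P l) + 1) + C (real (P l) - 1)) - 2 * C (real (P l))) * ?R" by (simp add: algebra_simps)
  also have "\<dots> = (2 * cos (freq k l * h) - 2) * cc k (ctr P)"
    unfolding C3 cP by (simp add: algebra_simps)
  finally show ?thesis .
qed

lemma grid_laplacian_cc:
  assumes P: "P \<in> cells K"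
  shows "grid_laplacian K h (\<lambda>i. cc k (ctr i)) P = - lamh k * cc k (ctr P)"
proof -
  have "{P'\<in>cells K. share_face P P'} = (\<Union>l\<in>UNIV. {P'\<in>cells K. adj l P P'})"
    by (auto simp: share_face_def adj_def)
  moreover have "(\<Sum>P'\<in>(\<Union>l\<in>UNIV. {P'\<in>cells K. adj l P P'}). cc k (ctr P') - cc k (ctr P)) =
      (\<Sum>l\<in>UNIV. \<Sum>P'\<in>{P'\<in>cells K. adj l P P'}. cc k (ctr P') - cc k (ctr P))"
  proof (rule sum.UNION_disjoint)
    show "\<forall>l\<in>UNIV. \<forall>m\<in>UNIV. l \<noteq> m \<longrightarrow> {P' \<in> cells K. adj l P P'} \<inter> {P' \<in> cells K. adj m P P'} = {}"
    proof (intro ballI impI)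
      fix l m :: 'n assume "l \<noteq> m"
      have False if "adj l P P'" "adj m P P'" for P'
      proof -
        have "P' l = P l" using that(2) \<open>l \<noteq> m\<close> by (simp add: adj_def)
        then show False using that(1) by (simp add: adj_def)
      qed
      then show "{P' \<in> cells K. adj l P P'} \<inter> {P' \<in> cells K. adj m P P'} = {}" by blast
    qed
  qed (auto simp: finite_cells)
  ultimately have "grid_laplacian K h (\<lambda>i. cc k (ctr i)) P = (\<Sum>l\<in>UNIV. (2 * cos (freq k l * h) - 2) * cc k (ctr P)) / h\<^sup>2"
    unfolding grid_laplacian_def using adj_difference[OF P] by simp
  also have "\<dots> = (\<Sum>l\<in>UNIV. (2 * cos (freq k l * h) - 2) / h\<^sup>2) * cc k (ctr P)"
    by (simp add: sum_divide_distrib sum_distrib_right)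
  also have "(\<Sum>l\<in>UNIV. (2 * cos (freq k l * h) - 2) / h\<^sup>2) = - lamh k"
    unfolding lamh_def sum_negf[symmetric] by (intro sum.cong refl) (simp add: diff_divide_distrib)
  finally show ?thesis by simp
qed

text \<open>Directional differences are self-adjoint on the grid, and the two modes have different
  eigenvalues in some direction: the angles \<open>freq k l * h\<close> lie in [0, pi], where the
  cosine is injective.\<close>

lemma grid_orthogonal:
  assumes k: "k \<in> modes K" "k' \<in> modes K" "k \<noteq> k'"
  shows "(\<Sum>P\<in>cells K. cc k (ctr P) * cc k' (ctr P)) = 0"
proof -
  obtain l where l: "k l \<noteq> k' l" using k(3) by auto
  let ?X = "\<Sum>P\<in>cells K. cc k (ctr P) * cc k' (ctr P)"
  have bd: "0 \<le> freq j l * h" "freq j l * h \<le> pi" if "j \<in> modes K" for j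
  proof -
    have "j l \<le> K l" using that by (simp add: modes_def)
    then have "real (j l) \<le> real (2 * K l + 1)" by linarith
    then have "real (j l) / real (2 * K l + 1) \<le> 1" by simp
    then have "real (j l) / real (2 * K l + 1) * pi \<le> 1 * pi" by (intro mult_right_mono) auto
    then show "0 \<le> freq j l * h" "freq j l * h \<le> pi" unfolding freq_h by auto
  qed
  have "cos (freq k l * h) \<noteq> cos (freq k' l * h)"
  proof
    assume "cos (freq k l * h) = cos (freq k' l * h)"
    then have "freq k l * h = freq k' l * h"
      by (rule cos_inj_pi[OF bd[OF k(1)] bd[OF k(2)]])
    then show False using l unfolding freq_h by (simp add: divide_eq_eq)
  qed
  moreover have "(2 * cos (freq k l * h) - 2) * ?X = (2 * cos (freq k' l * h) - 2) * ?X"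
  proof -
    have "(\<Sum>P\<in>cells K. (\<Sum>P'\<in>{P'\<in>cells K. adj l P P'}. cc k (ctr P') - cc k (ctr P)) * cc k' (ctr P)) =
      (\<Sum>P\<in>cells K. cc k (ctr P) * (\<Sum>P'\<in>{P'\<in>cells K. adj l P P'}. cc k' (ctr P') - cc k' (ctr P)))"
      by (rule symmetric_difference_selfadjoint(1)[OF finite_cells adj_sym])
    then show ?thesis
      by (simp add: adj_difference sum_distrib_left mult.assoc mult.left_commute cong: sum.cong)
  qed
  ultimately show ?thesis by simp
qed

lemma grid_sum_cc: "k \<in> modes K \<Longrightarrow> k \<noteq> (\<lambda>_. 0) \<Longrightarrow> (\<Sum>P\<in>cells K. cc k (ctr P)) = 0"
  using grid_orthogonal[of k "\<lambda>_. 0"] by (simp add: cc_zero modes_def)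

text \<open>Since 2 k \<le> 2 K + 1 = N, the angles x = \<open>freq k l * h\<close> stay within
  [0, pi / 2], the range of the Taylor bounds. For the lower bound, x^2 \<le> 4 reduces x^4 / 12 to
  x^2 / 3.\<close>

lemma lamh_bounds:
  assumes k: "k \<in> modes K"
  shows "lam k / 2 \<le> lamh k" "lamh k \<le> lam k" "lam k - lamh k \<le> h\<^sup>2 * (lam k)\<^sup>2 / 12"
proof -
  have x: "0 \<le> freq k l * h" "freq k l * h \<le> pi / 2" for l
  proof -
    have "2 * k l \<le> 2 * K l + 1" using k by (simp add: modes_def le_SucI)
    then have "2 * real (k l) \<le> real (2 * K l + 1)" by linarith
    then have "real (k l) / real (2 * K l + 1) \<le> 1 / 2" by (simp add: divide_le_eq)
    then have "real (k l) / real (2 * K l + 1) * pi \<le> 1 / 2 * pi" by (intro mult_right_mono) auto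
    then show "0 \<le> freq k l * h" "freq k l * h \<le> pi / 2" unfolding freq_h by auto
  qed
  have up: "(2 - 2 * cos (freq k l * h)) / h\<^sup>2 \<le> (freq k l)\<^sup>2" for l
    using two_minus_two_cos_bounds(1)[OF x[of l]] h by (simp add: divide_le_eq power_mult_distrib)
  have lo: "(freq k l)\<^sup>2 - h\<^sup>2 * ((freq k l)\<^sup>2)\<^sup>2 / 12 \<le> (2 - 2 * cos (freq k l * h)) / h\<^sup>2" for l
  proof -
    have "((freq k l)\<^sup>2 - h\<^sup>2 * ((freq k l)\<^sup>2)\<^sup>2 / 12) * h\<^sup>2 = (freq k l * h)\<^sup>2 - (freq k l * h) ^ 4 / 12"
      by (simp add: power2_eq_square power4_eq_xxxx algebra_simps)
    then show ?thesis using two_minus_two_cos_bounds(2)[OF x[of l]] h by (simp add: le_divide_eq)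
  qed
  show "lamh k \<le> lam k" unfolding lamh_def lam_def by (intro sum_mono up)
  have "(\<Sum>l\<in>UNIV. ((freq k l)\<^sup>2)\<^sup>2) \<le> (lam k)\<^sup>2"
  proof -
    have "((freq k l)\<^sup>2)\<^sup>2 \<le> lam k * (freq k l)\<^sup>2" for l
    proof -
      have "(freq k l)\<^sup>2 \<le> lam k" unfolding lam_def by (rule member_le_sum) auto
      then show ?thesis unfolding power2_eq_square[of "(freq k l)\<^sup>2"] by (intro mult_right_mono) auto
    qed
    then have "(\<Sum>l\<in>UNIV. ((freq k l)\<^sup>2)\<^sup>2) \<le> (\<Sum>l\<in>UNIV. lam k * (freq k l)\<^sup>2)" by (intro sum_mono)
    also have "\<dots> = (lam k)\<^sup>2" unfolding sum_distrib_left[symmetric] lam_def[symmetric] by (simp only: power2_eq_square)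
    finally show ?thesis .
  qed
  then have q: "h\<^sup>2 * (\<Sum>l\<in>UNIV. ((freq k l)\<^sup>2)\<^sup>2) / 12 \<le> h\<^sup>2 * (lam k)\<^sup>2 / 12"
    by (intro divide_right_mono mult_left_mono) auto
  have "lam k - lamh k \<le> (\<Sum>l\<in>UNIV. h\<^sup>2 * ((freq k l)\<^sup>2)\<^sup>2 / 12)"
    unfolding lam_def lamh_def sum_subtractf[symmetric]
  proof (rule sum_mono)
    fix l show "(freq k l)\<^sup>2 - (2 - 2 * cos (freq k l * h)) / h\<^sup>2 \<le> h\<^sup>2 * ((freq k l)\<^sup>2)\<^sup>2 / 12" using lo[of l] by linarith
  qed
  also have "\<dots> = h\<^sup>2 * (\<Sum>l\<in>UNIV. ((freq k l)\<^sup>2)\<^sup>2) / 12" by (simp add: sum_distrib_left sum_divide_distrib)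
  finally show "lam k - lamh k \<le> h\<^sup>2 * (lam k)\<^sup>2 / 12" using q by simp
  show "lam k / 2 \<le> lamh k"
    unfolding lam_def lamh_def sum_divide_distrib
  proof (rule sum_mono)
    fix l
    have "(freq k l * h)\<^sup>2 \<le> (pi / 2)\<^sup>2" using x[of l] by (intro power_mono) auto
    also have "\<dots> \<le> 2\<^sup>2" using pi_less_4 by (intro power_mono) auto
    finally have "(freq k l)\<^sup>2 * (h\<^sup>2 * (freq k l)\<^sup>2) \<le> (freq k l)\<^sup>2 * 4"
      by (intro mult_left_mono) (simp_all add: power_mult_distrib mult.commute)
    then have "h\<^sup>2 * ((freq k l)\<^sup>2)\<^sup>2 / 12 \<le> (freq k l)\<^sup>2 / 3" by (simp add: power2_eq_square algebra_simps)
    then show "(freq k l)\<^sup>2 / 2 \<le> (2 - 2 * cos (freq k l * h)) / h\<^sup>2" using lo[of l] zero_le_power2[of "freq k l"] by linarith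
  qed
qed

lemma lam_pos: "k \<noteq> (\<lambda>_. 0) \<Longrightarrow> 0 < lam k"
proof -
  assume "k \<noteq> (\<lambda>_. 0)"
  then obtain l where "k l \<noteq> 0" by auto
  then have "0 < (freq k l)\<^sup>2" using len_pos[of l] by (simp add: freq_def)
  also have "\<dots> \<le> lam k" unfolding lam_def by (rule member_le_sum) auto
  finally show "0 < lam k" .
qed

text \<open>The factor between the discrete and the exact eigenvalue. Both vanish for the zero mode,
  where the value 1 keeps the mean of a function unchanged.\<close>

definition ratio :: "('n \<Rightarrow> nat) \<Rightarrow> real" where "ratio k = (if k = (\<lambda>_. 0) then 1 else lam k / lamh k)"

lemma ratio: assumes k: "k \<in> modes K" shows "ratio k * lamh k = lam k" "\<bar>ratio k - 1\<bar> \<le> h\<^sup>2 * lam k"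
proof -
  have "ratio k * lamh k = lam k \<and> \<bar>ratio k - 1\<bar> \<le> h\<^sup>2 * lam k"
  proof (cases "k = (\<lambda>_. 0)")
    case True
    then show ?thesis by (simp add: ratio_def lam_def lamh_def freq_def)
  next
    case False
    note b = lamh_bounds[OF k] and p = lam_pos[OF False]
    have lp: "0 < lamh k" using b(1) p by linarith
    have "\<bar>ratio k - 1\<bar> = (lam k - lamh k) / lamh k"
      using False lp b(2) by (simp add: ratio_def diff_divide_distrib abs_of_nonneg)
    also have "\<dots> \<le> (h\<^sup>2 * (lam k)\<^sup>2 / 12) / lamh k" using b(3) lp by (intro divide_right_mono) auto
    also have "\<dots> \<le> (h\<^sup>2 * (lam k)\<^sup>2 / 12) / (lam k / 2)" using b(1) p by (intro divide_left_mono) auto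
    also have "\<dots> = h\<^sup>2 * lam k / 6" using p by (simp add: power2_eq_square)
    also have "\<dots> \<le> h\<^sup>2 * lam k" using p by simp
    finally show ?thesis using False lp by (simp add: ratio_def)
  qed
  then show "ratio k * lamh k = lam k" "\<bar>ratio k - 1\<bar> \<le> h\<^sup>2 * lam k" by auto
qed

end

section \<open>Grid norms\<close>

text \<open>Sign changes of coordinates and translations preserve Lebesgue measure.
  \<open>SOME\<close> inverts the map from indices to basis vectors.\<close>

lemma integral_lborel_signed_shift:
  fixes f :: "real^'n \<Rightarrow> real" and \<sigma> :: "'n \<Rightarrow> real"
  assumes f: "f \<in> borel_measurable borel" and \<sigma>: "\<And>l. \<bar>\<sigma> l\<bar> = 1"
  shows "(LINT x|lborel. f (\<chi> l. t $ l + \<sigma> l * x $ l)) = (LINT x|lborel. f x)"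
    and "integrable lborel f \<Longrightarrow> integrable lborel (\<lambda>x. f (\<chi> l. t $ l + \<sigma> l * x $ l))"
proof -
  define T where "T x = t + (\<Sum>j\<in>Basis. (\<sigma> (SOME l. j = axis l 1) * (x \<bullet> j)) *\<^sub>R j)" for x :: "real^'n"
  define c where "c j = \<sigma> (SOME l. j = (axis l 1 :: real^'n))" for j
  have cax: "c (axis l 1) = \<sigma> l" for l
  proof -
    have "(SOME l'. (axis l 1 :: real^'n) = axis l' 1) = l" by (rule some_equality) (auto simp: axis_eq_axis)
    then show ?thesis by (simp add: c_def)
  qed
  have Teq: "T x = (\<chi> l. t $ l + \<sigma> l * x $ l)" for x
  proof -
    have B: "(Basis :: (real^'n) set) = (\<lambda>l. axis l 1) ` UNIV" by (auto simp: Basis_vec_def)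
    have "(\<Sum>j\<in>Basis. (c j * (x \<bullet> j)) *\<^sub>R j) = (\<Sum>l\<in>UNIV. (\<sigma> l * x $ l) *\<^sub>R axis l 1)"
      unfolding B by (subst sum.reindex) (auto simp: inj_on_def axis_eq_axis cax inner_axis)
    also have "\<dots> = (\<chi> l. \<sigma> l * x $ l)"
      by (auto simp: vec_eq_iff axis_def if_distrib[of "\<lambda>z. _ * z"] cong: if_cong)
    finally show ?thesis by (simp add: T_def c_def vec_eq_iff)
  qed
  have cne: "c j \<noteq> 0" if j: "j \<in> Basis" for j
  proof -
    obtain l where "j = axis l 1" using j by (auto simp: Basis_vec_def)
    then show ?thesis using \<sigma>[of l] by (auto simp: cax)
  qed
  have prod1: "(\<Prod>j\<in>Basis. \<bar>c j\<bar>) = 1"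
    by (rule prod.neutral) (auto simp: Basis_vec_def cax \<sigma>)
  have leb: "lborel = distr lborel borel T"
  proof -
    have "lborel = density (distr lborel borel T) (\<lambda>_. (\<Prod>j\<in>Basis. \<bar>c j\<bar>))"
      using lborel_affine_euclidean[of c t, OF cne] unfolding T_def c_def by simp
    then show ?thesis unfolding prod1 by (simp add: density_1)
  qed
  have mT: "T \<in> borel_measurable borel"
    unfolding T_def by (intro borel_measurable_continuous_onI continuous_intros)
  have "(LINT x|lborel. f x) = (LINT x|distr lborel borel T. f x)" using leb by simp
  also have "\<dots> = (LINT x|lborel. f (T x))" by (rule integral_distr) (use mT f in auto)
  finally show "(LINT x|lborel. f (\<chi> l. t $ l + \<sigma> l * x $ l)) = (LINT x|lborel. f x)" by (simp add: Teq)
  assume "integrable lborel f"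
  then have "integrable (distr lborel borel T) f" using leb by simp
  then have "integrable lborel (\<lambda>x. f (T x))" by (subst (asm) integrable_distr_eq) (use mT f in auto)
  then show "integrable lborel (\<lambda>x. f (\<chi> l. t $ l + \<sigma> l * x $ l))" by (simp add: Teq)
qed

text \<open>Averaged over all sign patterns A, a shift by y loses its first-order term, so samples
  at offset y represent the centre up to O(h^2). The set L lets an induction treat one coordinate at
  a time.\<close>

definition sign_shift :: "'n set \<Rightarrow> 'n set \<Rightarrow> real^'n \<Rightarrow> real^'n \<Rightarrow> real^'n" where
  "sign_shift L A y x = (\<chi> l. x $ l + (if l \<in> L then if l \<in> A then y $ l else - y $ l else 0))"

lemma sign_shift_insert:
  assumes "l \<notin> L" "A \<subseteq> L"
  shows "sign_shift (insert l L) (insert l A) y x = sign_shift L A y (x + y $ l *\<^sub>R axis l 1)"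
    and "sign_shift (insert l L) A y x = sign_shift L A y (x + (- y $ l) *\<^sub>R axis l 1)"
  using assms by (auto simp: sign_shift_def vec_eq_iff axis_def)

context cosine_grid
begin

definition gsq :: "(('n \<Rightarrow> nat) \<Rightarrow> real) \<Rightarrow> real" where
  "gsq c = h ^ CARD('n) * (\<Sum>i\<in>cells K. (c i)\<^sup>2)"

lemma gsq_nonneg: "0 \<le> gsq c"
  using h by (simp add: gsq_def sum_nonneg)

lemma gsq_mono: "(\<And>i. i \<in> cells K \<Longrightarrow> \<bar>c i\<bar> \<le> \<bar>d i\<bar>) \<Longrightarrow> gsq c \<le> gsq d"
  using h unfolding gsq_def by (intro mult_left_mono sum_mono) (auto simp: abs_le_square_iff)

lemma gsq_cmult: "gsq (\<lambda>i. r * c i) = r\<^sup>2 * gsq c"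
  unfolding gsq_def by (simp add: power_mult_distrib sum_distrib_left[symmetric])

lemma gsq_add: "gsq (\<lambda>i. c i + d i) \<le> 2 * gsq c + 2 * gsq d"
proof -
  have "(x + y)\<^sup>2 \<le> 2 * x\<^sup>2 + 2 * y\<^sup>2" for x y :: real
    using zero_le_power2[of "x - y"] by (simp add: power2_sum power2_diff)
  then have "(\<Sum>i\<in>cells K. (c i + d i)\<^sup>2) \<le> (\<Sum>i\<in>cells K. 2 * (c i)\<^sup>2 + 2 * (d i)\<^sup>2)" by (intro sum_mono)
  then have "h ^ CARD('n) * (\<Sum>i\<in>cells K. (c i + d i)\<^sup>2) \<le> h ^ CARD('n) * (\<Sum>i\<in>cells K. 2 * (c i)\<^sup>2 + 2 * (d i)\<^sup>2)"
    using h by (intro mult_left_mono) auto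
  then show ?thesis by (simp add: gsq_def sum.distrib sum_distrib_left[symmetric] algebra_simps)
qed

section \<open>Sampling at a common offset in all cells\<close>

lemma cell_center_bounds:
  assumes "i \<in> cells K" shows "a $ l + h / 2 \<le> ctr i $ l" "ctr i $ l + h / 2 \<le> b $ l"
proof -
  have "0 \<le> real (i l) * h" using h by simp
  then show "a $ l + h / 2 \<le> ctr i $ l" by (simp add: cell_center_def algebra_simps)
  have "i l < 2 * K l + 1" using assms by (simp add: cells_def)
  then have "real (i l) + 1 \<le> real (2 * K l + 1)" by linarith
  then have "(real (i l) + 1) * h \<le> real (2 * K l + 1) * h" using h by (intro mult_right_mono) auto
  then show "ctr i $ l + h / 2 \<le> b $ l" unfolding grid[symmetric] by (simp add: cell_center_def algebra_simps)
qed

definition cell :: "('n \<Rightarrow> nat) \<Rightarrow> (real^'n) set" where "cell i = {x. \<forall>l. \<bar>x $ l - ctr i $ l\<bar> < h / 2}"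

lemma cell_subset: assumes "i \<in> cells K" "x \<in> cell i" shows "x \<in> cbox a b"
  unfolding mem_box_cart
proof
  fix l
  have "\<bar>x $ l - ctr i $ l\<bar> < h / 2" using assms(2) by (simp add: cell_def)
  then show "a $ l \<le> x $ l \<and> x $ l \<le> b $ l" using cell_center_bounds[OF assms(1), of l] by linarith
qed

lemma cell_disjoint: assumes "x \<in> cell i" "x \<in> cell j" shows "i = j"
proof
  fix l
  have "\<bar>x $ l - ctr i $ l\<bar> < h / 2" "\<bar>x $ l - ctr j $ l\<bar> < h / 2" using assms by (auto simp: cell_def)
  then have "\<bar>ctr i $ l - ctr j $ l\<bar> < h" by linarith
  also have "ctr i $ l - ctr j $ l = (real (i l) - real (j l)) * h" by (simp add: cell_center_def algebra_simps)
  finally have "\<bar>real (i l) - real (j l)\<bar> * h < 1 * h" using h by (simp add: abs_mult)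
  then have "\<bar>real (i l) - real (j l)\<bar> < 1" using h by (simp only: mult_less_cancel_right)
  then show "i l = j l" by linarith
qed

lemma open_cell: "open (cell i)"
proof -
  have "cell i = (\<Inter>l\<in>UNIV. {x. \<bar>x $ l - ctr i $ l\<bar> < h / 2})" by (auto simp: cell_def)
  then show ?thesis by (auto intro!: open_INT open_Collect_less continuous_intros)
qed

lemma center_cube_measure:
  "emeasure lborel {y::real^'n. \<forall>l. \<bar>y $ l\<bar> < h / 2} = ennreal (h ^ CARD('n))"
proof -
  let ?c = "\<chi> l. h / 2 :: real^'n"
  have "\<bar>z\<bar> < h / 2 \<longleftrightarrow> - (h / 2) < z \<and> z < h / 2" for z by (simp only: abs_less_iff) linarith
  then have "{y::real^'n. \<forall>l. \<bar>y $ l\<bar> < h / 2} = box (- ?c) ?c" by (simp add: set_eq_iff mem_box_cart)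
  moreover have "(\<Prod>j\<in>Basis. (?c - (- ?c)) \<bullet> j) = (\<Prod>j\<in>(Basis :: (real^'n) set). h)"
    by (rule prod.cong) (auto simp: Basis_vec_def inner_axis)
  moreover have "- ?c \<bullet> j \<le> ?c \<bullet> j" if "j \<in> Basis" for j
    using that h by (auto simp: Basis_vec_def inner_axis)
  ultimately show ?thesis by (simp add: emeasure_lborel_box)
qed

text \<open>Averaging over the position within the cells: some offset \<open>y\<close> is no worse than the mean.\<close>

lemma cell_sampling:
  assumes f: "continuous_on (cbox a b) f" "\<And>x. 0 \<le> f x" and E: "(LINT x|Q. f x) < E"
  obtains y where "\<And>l. \<bar>y $ l\<bar> < h / 2"
    "h ^ CARD('n) * (\<Sum>A\<in>UNIV. \<Sum>i\<in>cells K. f (sign_shift UNIV A y (ctr i))) \<le> 2 ^ CARD('n) * E"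
proof -
  define g where "g x = indicator (cbox a b) x * f x" for x :: "real^'n"
  define B where "B = {y::real^'n. \<forall>l. \<bar>y $ l\<bar> < h / 2}"
  define \<sigma> where "\<sigma> A l = (if l \<in> A then 1 else - 1 :: real)" for A and l :: 'n
  define ss where "ss A i y = (\<chi> l. ctr i $ l + \<sigma> A l * y $ l)" for A i and y :: "real^'n"
  have ss: "sign_shift UNIV A y (ctr i) = ss A i y" for A i y
    by (auto simp: sign_shift_def ss_def \<sigma>_def vec_eq_iff)
  have \<sigma>: "\<bar>\<sigma> A l\<bar> = 1" for A l by (simp add: \<sigma>_def)
  have gm: "g \<in> borel_measurable borel" unfolding g_def by (rule borel_measurable_indicator_cbox[OF f(1)])
  have Qg: "(LINT x|Q. f x) = (LINT x|lborel. g x)" and gi: "integrable lborel g"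
  proof -
    have il: "integrable lebesgue g"
      using integrable_Q[OF f(1)] unfolding g_def by (subst (asm) integrable_restrict_space) (auto simp: mult.commute)
    have "(LINT x|Q. f x) = (LINT x|lebesgue. g x)"
      unfolding g_def by (subst integral_restrict_space) auto
    also have "\<dots> = (LINT x|lborel. g x)" by (rule integral_completion) (use gm in simp)
    finally show "(LINT x|Q. f x) = (LINT x|lborel. g x)" .
    show "integrable lborel g" using il gm by (subst (asm) integrable_completion) auto
  qed
  have cm: "cell i \<in> sets borel" for i using open_cell by simp
  have gc: "integrable lborel (\<lambda>x. indicator (cell i) x * g x)" for i
    using integrable_mult_indicator[of "cell i" lborel g] gi cm by simp
  have ind: "indicator (cell i) (ss A i y) = (indicator B y :: real)" for A i y
  proof -
    have "\<bar>\<sigma> A l * y $ l\<bar> = \<bar>y $ l\<bar>" for l by (simp add: abs_mult \<sigma>)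
    then show ?thesis by (auto simp: indicator_def cell_def ss_def B_def)
  qed
  have shift: "(LINT y|lborel. indicator B y * g (ss A i y)) = (LINT x|lborel. indicator (cell i) x * g x)"
    "integrable lborel (\<lambda>y. indicator B y * g (ss A i y))" for A i
  proof -
    have m: "(\<lambda>x. indicator (cell i) x * g x) \<in> borel_measurable borel" using cm gm by simp
    have e: "indicator (cell i) (\<chi> l. ctr i $ l + \<sigma> A l * y $ l) * g (\<chi> l. ctr i $ l + \<sigma> A l * y $ l) = indicator B y * g (ss A i y)" for y
      unfolding ss_def[symmetric] ind ..
    show "(LINT y|lborel. indicator B y * g (ss A i y)) = (LINT x|lborel. indicator (cell i) x * g x)"
      using integral_lborel_signed_shift(1)[where t = "ctr i" and \<sigma> = "\<sigma> A", OF m \<sigma>] unfolding e .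
    show "integrable lborel (\<lambda>y. indicator B y * g (ss A i y))"
      using integral_lborel_signed_shift(2)[where t = "ctr i" and \<sigma> = "\<sigma> A", OF m \<sigma> gc] unfolding e .
  qed
  define G where "G y = (\<Sum>A\<in>UNIV. \<Sum>i\<in>cells K. indicator B y * g (ss A i y))" for y
  have Gi: "integrable lborel G" unfolding G_def by (intro Bochner_Integration.integrable_sum shift)
  have per: "(\<Sum>i\<in>cells K. (LINT x|lborel. indicator (cell i) x * g x)) \<le> (LINT x|lborel. g x)"
  proof -
    have "(\<Sum>i\<in>cells K. (LINT x|lborel. indicator (cell i) x * g x)) = (LINT x|lborel. (\<Sum>i\<in>cells K. indicator (cell i) x * g x))"
      by (rule Bochner_Integration.integral_sum[symmetric]) (rule gc)
    also have "\<dots> \<le> (LINT x|lborel. g x)"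
    proof (rule integral_mono)
      show "integrable lborel (\<lambda>x. \<Sum>i\<in>cells K. indicator (cell i) x * g x)"
        by (intro Bochner_Integration.integrable_sum gc)
      show "integrable lborel g" by (rule gi)
      fix x
      have g0: "0 \<le> g x" using f(2) by (simp add: g_def)
      show "(\<Sum>i\<in>cells K. indicator (cell i) x * g x) \<le> g x"
      proof (cases "\<exists>j\<in>cells K. x \<in> cell j")
        case True
        then obtain j where j: "j \<in> cells K" "x \<in> cell j" by blast
        have "(\<Sum>i\<in>cells K. indicator (cell i) x * g x) = (\<Sum>i\<in>cells K. if i = j then g x else 0)"
          by (intro sum.cong) (use j(2) cell_disjoint in \<open>auto simp: indicator_def\<close>)
        also have "\<dots> = g x" using j(1) by (simp add: finite_cells)
        finally show ?thesis by (rule eq_refl)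
      next
        case False
        then have "(\<Sum>i\<in>cells K. indicator (cell i) x * g x) = 0" by (intro sum.neutral) auto
        then show ?thesis using g0 by simp
      qed
    qed
    finally show ?thesis .
  qed
  have GE: "(LINT y|lborel. G y) < 2 ^ CARD('n) * E"
  proof -
    have "(LINT y|lborel. G y) = (\<Sum>A\<in>(UNIV :: 'n set set). (\<Sum>i\<in>cells K. (LINT x|lborel. indicator (cell i) x * g x)))"
      unfolding G_def by (simp add: Bochner_Integration.integral_sum Bochner_Integration.integrable_sum shift)
    also have "\<dots> = 2 ^ CARD('n) * (\<Sum>i\<in>cells K. (LINT x|lborel. indicator (cell i) x * g x))"
      by (simp add: card_UNIV_set)
    also have "\<dots> \<le> 2 ^ CARD('n) * (LINT x|Q. f x)" unfolding Qg by (intro mult_left_mono per) auto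
    also have "\<dots> < 2 ^ CARD('n) * E" using E by simp
    finally show ?thesis .
  qed
  have "\<exists>y\<in>B. h ^ CARD('n) * G y \<le> 2 ^ CARD('n) * E"
  proof (rule ccontr)
    assume "\<not> ?thesis"
    then have lo: "2 ^ CARD('n) * E / h ^ CARD('n) \<le> G y" if "y \<in> B" for y
      using that h by (auto simp: divide_le_eq not_le mult.commute intro: less_imp_le)
    have Bm: "B \<in> sets lborel" unfolding B_def
    proof -
      have "{y::real^'n. \<forall>l. \<bar>y $ l\<bar> < h / 2} = (\<Inter>l\<in>UNIV. {y. \<bar>y $ l\<bar> < h / 2})" by auto
      then have "open {y::real^'n. \<forall>l. \<bar>y $ l\<bar> < h / 2}" by (auto intro!: open_INT open_Collect_less continuous_intros)
      then show "{y::real^'n. \<forall>l. \<bar>y $ l\<bar> < h / 2} \<in> sets lborel" by simp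
    qed
    have mB: "measure lborel B = h ^ CARD('n)" "emeasure lborel B < \<infinity>"
      using center_cube_measure h by (simp_all add: B_def measure_def)
    have "2 ^ CARD('n) * E = (LINT y|lborel. indicator B y * (2 ^ CARD('n) * E / h ^ CARD('n)))"
      using mB Bm h by simp
    also have "\<dots> \<le> (LINT y|lborel. G y)"
    proof (rule integral_mono)
      show "integrable lborel (\<lambda>y. indicator B y * (2 ^ CARD('n) * E / h ^ CARD('n)))"
        using mB(2) Bm by simp
      show "integrable lborel G" by (rule Gi)
      fix y
      show "indicator B y * (2 ^ CARD('n) * E / h ^ CARD('n)) \<le> G y"
        using lo[of y] by (cases "y \<in> B") (auto simp: G_def)
    qed
    finally show False using GE by simp
  qed
  then obtain y where y: "y \<in> B" "h ^ CARD('n) * G y \<le> 2 ^ CARD('n) * E" by blast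
  have "G y = (\<Sum>A\<in>UNIV. \<Sum>i\<in>cells K. f (sign_shift UNIV A y (ctr i)))"
    unfolding G_def ss
  proof (intro sum.cong refl)
    fix A i assume i: "i \<in> cells K"
    have "ss A i y \<in> cell i" using ind[of i A y] y(1) by (simp add: indicator_def split: if_splits)
    then have "ss A i y \<in> cbox a b" by (rule cell_subset[OF i])
    then show "indicator B y * g (ss A i y) = f (ss A i y)" using y(1) by (simp add: g_def)
  qed
  then show thesis using that[of y] y by (auto simp: B_def)
qed

text \<open>The sampling inequality for the constant function 1.\<close>

lemma grid_volume: "h ^ CARD('n) * real (card (cells K)) \<le> vol"
proof (rule field_le_epsilon)
  fix e :: real assume "0 < e"
  then have "(LINT x|Q. 1) < vol + e" by (simp add: vol_def)
  from cell_sampling[OF _ _ this] obtain y :: "real^'n" where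
    "h ^ CARD('n) * (\<Sum>A\<in>(UNIV :: 'n set set). \<Sum>i\<in>cells K. 1) \<le> 2 ^ CARD('n) * (vol + e)" by (auto intro: continuous_on_const)
  then show "h ^ CARD('n) * real (card (cells K)) \<le> vol + e" by (simp add: card_UNIV_set)
qed

lemma gsq_const: assumes "\<And>i. i \<in> cells K \<Longrightarrow> \<bar>c i\<bar> \<le> r" shows "gsq c \<le> r\<^sup>2 * vol"
proof -
  have "0 \<le> r" using assms[of "\<lambda>_. 0"] by (force simp: cells_def)
  then have "gsq c \<le> gsq (\<lambda>_. r)" using assms by (intro gsq_mono) auto
  also have "\<dots> = r\<^sup>2 * (h ^ CARD('n) * real (card (cells K)))" by (simp add: gsq_def)
  also have "\<dots> \<le> r\<^sup>2 * vol" by (intro mult_left_mono grid_volume) auto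
  finally show ?thesis .
qed

text \<open>A discrete Parseval inequality. Grid orthogonality leaves the diagonal, where each
  squared grid norm is at most \<open>vol\<close>, and \<open>vol\<close> is at most 2^n times
  \<open>nrm\<close>.\<close>

lemma gsq_cosine_sum:
  "gsq (\<lambda>i. \<Sum>k\<in>modes K. \<alpha> k * cc k (ctr i)) \<le> 2 ^ CARD('n) * (\<Sum>k\<in>modes K. (\<alpha> k)\<^sup>2 * nrm k)"
proof -
  have "(\<Sum>i\<in>cells K. (\<Sum>k\<in>modes K. \<alpha> k * cc k (ctr i))\<^sup>2) =
      (\<Sum>k\<in>modes K. \<Sum>k'\<in>modes K. \<alpha> k * \<alpha> k' * (\<Sum>i\<in>cells K. cc k (ctr i) * cc k' (ctr i)))"
  proof -
    have "(\<Sum>i\<in>cells K. (\<Sum>k\<in>modes K. \<alpha> k * cc k (ctr i))\<^sup>2) =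
      (\<Sum>i\<in>cells K. \<Sum>k\<in>modes K. \<Sum>k'\<in>modes K. \<alpha> k * \<alpha> k' * (cc k (ctr i) * cc k' (ctr i)))"
      unfolding power2_eq_square sum_product by (intro sum.cong refl) (simp only: mult.assoc mult.left_commute)
    also have "\<dots> = (\<Sum>k\<in>modes K. \<Sum>i\<in>cells K. \<Sum>k'\<in>modes K. \<alpha> k * \<alpha> k' * (cc k (ctr i) * cc k' (ctr i)))"
      by (rule sum.swap)
    also have "\<dots> = (\<Sum>k\<in>modes K. \<Sum>k'\<in>modes K. \<Sum>i\<in>cells K. \<alpha> k * \<alpha> k' * (cc k (ctr i) * cc k' (ctr i)))"
      by (rule sum.cong[OF refl]) (rule sum.swap)
    finally show ?thesis by (simp only: sum_distrib_left)
  qed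
  also have "\<dots> = (\<Sum>k\<in>modes K. (\<alpha> k)\<^sup>2 * (\<Sum>i\<in>cells K. cc k (ctr i) * cc k (ctr i)))"
  proof (intro sum.cong refl)
    fix k assume k: "k \<in> modes K"
    have "(\<Sum>k'\<in>modes K. \<alpha> k * \<alpha> k' * (\<Sum>i\<in>cells K. cc k (ctr i) * cc k' (ctr i))) =
      (\<Sum>k'\<in>modes K. if k' = k then (\<alpha> k)\<^sup>2 * (\<Sum>i\<in>cells K. cc k (ctr i) * cc k (ctr i)) else 0)"
    proof (intro sum.cong refl)
      fix k' assume k': "k' \<in> modes K"
      show "\<alpha> k * \<alpha> k' * (\<Sum>i\<in>cells K. cc k (ctr i) * cc k' (ctr i)) =
        (if k' = k then (\<alpha> k)\<^sup>2 * (\<Sum>i\<in>cells K. cc k (ctr i) * cc k (ctr i)) else 0)"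
        using grid_orthogonal[OF k k'] by (cases "k' = k") (simp_all add: power2_eq_square)
    qed
    then show "(\<Sum>k'\<in>modes K. \<alpha> k * \<alpha> k' * (\<Sum>i\<in>cells K. cc k (ctr i) * cc k' (ctr i))) = (\<alpha> k)\<^sup>2 * (\<Sum>i\<in>cells K. cc k (ctr i) * cc k (ctr i))"
      using k by (simp add: finite_modes)
  qed
  finally have e: "gsq (\<lambda>i. \<Sum>k\<in>modes K. \<alpha> k * cc k (ctr i)) =
     (\<Sum>k\<in>modes K. (\<alpha> k)\<^sup>2 * (h ^ CARD('n) * (\<Sum>i\<in>cells K. cc k (ctr i) * cc k (ctr i))))"
    unfolding gsq_def by (simp add: sum_distrib_left mult.left_commute)
  have "h ^ CARD('n) * (\<Sum>i\<in>cells K. cc k (ctr i) * cc k (ctr i)) \<le> 2 ^ CARD('n) * nrm k" for k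
  proof -
    have "gsq (\<lambda>i. cc k (ctr i)) \<le> 1\<^sup>2 * vol" by (rule gsq_const) (rule abs_cc_le)
    moreover have "vol \<le> 2 ^ CARD('n) * nrm k" using nrm_ge[of k] by (simp add: divide_le_eq mult.commute)
    ultimately show ?thesis by (simp add: gsq_def power2_eq_square)
  qed
  then have "(\<Sum>k\<in>modes K. (\<alpha> k)\<^sup>2 * (h ^ CARD('n) * (\<Sum>i\<in>cells K. cc k (ctr i) * cc k (ctr i)))) \<le>
     (\<Sum>k\<in>modes K. (\<alpha> k)\<^sup>2 * (2 ^ CARD('n) * nrm k))" by (intro sum_mono mult_left_mono) auto
  then show ?thesis unfolding e by (simp add: sum_distrib_left mult.left_commute)
qed

text \<open>\<open>gsq_cosine_sum\<close> combined with \<open>coef_decay\<close>: weights growing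
  like \<open>lam\<close> are exactly what the regularity of u pays for.\<close>

lemma gsq_weighted:
  assumes u: "neumann_class a b M u" "0 \<le> M" and w: "\<And>k. k \<in> modes K \<Longrightarrow> \<bar>w k\<bar> \<le> r * lam k"
  shows "gsq (\<lambda>i. \<Sum>k\<in>modes K. w k * (coef u k / nrm k) * cc k (ctr i)) \<le> 2 ^ CARD('n) * (r\<^sup>2 * ((6 * real CARD('n) * M)\<^sup>2 * vol))"
proof -
  have "(\<Sum>k\<in>modes K. (w k * (coef u k / nrm k))\<^sup>2 * nrm k) \<le> (\<Sum>k\<in>modes K. r\<^sup>2 * ((lam k)\<^sup>2 * (coef u k)\<^sup>2 / nrm k))"
  proof (rule sum_mono)
    fix k assume k: "k \<in> modes K"
    have "(w k)\<^sup>2 \<le> (r * lam k)\<^sup>2" using w[OF k] by (intro power2_le_iff_abs_le[THEN iffD2]) auto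
    have e: "(w k * (coef u k / nrm k))\<^sup>2 * nrm k = (w k)\<^sup>2 * ((coef u k)\<^sup>2 / nrm k)"
      using nrm_pos[of k] by (simp add: power2_eq_square)
    have "(w k)\<^sup>2 * ((coef u k)\<^sup>2 / nrm k) \<le> (r * lam k)\<^sup>2 * ((coef u k)\<^sup>2 / nrm k)"
      using nrm_pos[of k] \<open>(w k)\<^sup>2 \<le> (r * lam k)\<^sup>2\<close> by (intro mult_right_mono) auto
    then show "(w k * (coef u k / nrm k))\<^sup>2 * nrm k \<le> r\<^sup>2 * ((lam k)\<^sup>2 * (coef u k)\<^sup>2 / nrm k)"
      unfolding e by (simp add: power_mult_distrib)
  qed
  also have "\<dots> = r\<^sup>2 * (\<Sum>k\<in>modes K. (lam k)\<^sup>2 * (coef u k)\<^sup>2 / nrm k)" by (simp add: sum_distrib_left)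
  also have "\<dots> \<le> r\<^sup>2 * ((6 * real CARD('n) * M)\<^sup>2 * vol)"
    by (intro mult_left_mono coef_decay u finite_modes) auto
  finally have "2 ^ CARD('n) * (\<Sum>k\<in>modes K. (w k * (coef u k / nrm k))\<^sup>2 * nrm k) \<le> 2 ^ CARD('n) * (r\<^sup>2 * ((6 * real CARD('n) * M)\<^sup>2 * vol))"
    by (intro mult_left_mono) auto
  then show ?thesis using gsq_cosine_sum[of "\<lambda>k. w k * (coef u k / nrm k)"] by linarith
qed

end

section \<open>Projection error at the cell centres\<close>

lemma sum_Pow_insert:
  fixes f :: "'a set \<Rightarrow> real"
  assumes "finite L" "l \<notin> L"
  shows "(\<Sum>A\<in>Pow (insert l L). f A) = (\<Sum>A\<in>Pow L. f (insert l A)) + (\<Sum>A\<in>Pow L. f A)"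
proof -
  have "(\<Sum>A\<in>Pow (insert l L). f A) = (\<Sum>A\<in>Pow L. f A) + (\<Sum>A\<in>insert l ` Pow L. f A)"
    unfolding Pow_insert using assms by (intro sum.union_disjoint) auto
  also have "(\<Sum>A\<in>insert l ` Pow L. f A) = (\<Sum>A\<in>Pow L. f (insert l A))"
    using assms(2) by (subst sum.reindex) (auto simp: inj_on_def dest: insert_ident[THEN iffD1, rotated 2])
  finally show ?thesis by simp
qed

context cosine_box
begin

text \<open>Product-to-sum in every coordinate: the sign average acts on a mode as a scalar
  multiplier.\<close>

lemma cc_sign_average:
  "(\<Sum>A\<in>UNIV. cc k (sign_shift UNIV A y x)) = 2 ^ CARD('n) * ((\<Prod>l\<in>UNIV. cos (freq k l * y $ l)) * cc k x)"
proof -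
  let ?p = "\<lambda>l. cos (freq k l * (x $ l - a $ l) + freq k l * y $ l)"
  let ?m = "\<lambda>l. cos (freq k l * (x $ l - a $ l) - freq k l * y $ l)"
  have t: "cc k (sign_shift UNIV A y x) = (\<Prod>l\<in>A. ?p l) * (\<Prod>l\<in>UNIV - A. ?m l)" for A
  proof -
    have "cc k (sign_shift UNIV A y x) = (\<Prod>l\<in>UNIV. if l \<in> A then ?p l else ?m l)"
      unfolding cc_eq by (intro prod.cong refl) (simp add: sign_shift_def algebra_simps)
    also have "\<dots> = (\<Prod>l\<in>A. ?p l) * (\<Prod>l\<in>UNIV - A. ?m l)"
      by (simp add: prod.If_cases Compl_eq_Diff_UNIV)
    finally show ?thesis .
  qed
  have "(\<Sum>A\<in>UNIV. cc k (sign_shift UNIV A y x)) = (\<Prod>l\<in>UNIV. ?p l + ?m l)"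
    unfolding t by (subst prod_add) auto
  also have "\<dots> = (\<Prod>l\<in>UNIV. 2 * (cos (freq k l * y $ l) * cos (freq k l * (x $ l - a $ l))))"
    by (intro prod.cong refl) (simp add: cos_add cos_diff)
  also have "\<dots> = 2 ^ CARD('n) * ((\<Prod>l\<in>UNIV. cos (freq k l * y $ l)) * cc k x)"
    by (simp add: prod.distrib cc_eq)
  finally show ?thesis .
qed

text \<open>Since 1 - cos t \<le> t^2 / 2, the multiplier of the sign average differs from 1 by
  O(r^2 \<open>lam\<close>), a weight admissible in \<open>gsq_weighted\<close>.\<close>

lemma prod_cos_near_one: "\<bar>(\<Prod>l\<in>UNIV. cos (freq k l * y $ l)) - 1\<bar> \<le> r\<^sup>2 / 2 * lam k"
  if y: "\<And>l. \<bar>y $ l\<bar> \<le> r" for y :: "real^'n"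
proof -
  have c: "\<bar>cos t - 1\<bar> \<le> t\<^sup>2 / 2" for t :: real
  proof -
    have "(sin (t / 2))\<^sup>2 \<le> (t / 2)\<^sup>2" using abs_sin_x_le_abs_x[of "t / 2"] by (simp only: abs_le_square_iff)
    then show ?thesis using cos_double_sin[of "t / 2"] cos_le_one[of t] by (simp add: power_divide)
  qed
  have "norm ((\<Prod>l\<in>UNIV. cos (freq k l * y $ l)) - (\<Prod>l\<in>(UNIV :: 'n set). 1 :: real)) \<le> (\<Sum>l\<in>UNIV. norm (cos (freq k l * y $ l) - 1))"
    by (rule norm_prod_diff) auto
  also have "\<dots> \<le> (\<Sum>l\<in>UNIV. r\<^sup>2 / 2 * (freq k l)\<^sup>2)"
  proof (rule sum_mono)
    fix l
    have "(y $ l)\<^sup>2 \<le> r\<^sup>2" using y[of l] by (intro power2_le_iff_abs_le[THEN iffD2]) (auto intro: order_trans[of 0 "\<bar>y $ l\<bar>"])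
    then have "(freq k l)\<^sup>2 * (y $ l)\<^sup>2 \<le> (freq k l)\<^sup>2 * r\<^sup>2" by (intro mult_left_mono) auto
    then show "norm (cos (freq k l * y $ l) - 1) \<le> r\<^sup>2 / 2 * (freq k l)\<^sup>2"
      using c[of "freq k l * y $ l"] by (simp add: power_mult_distrib mult.commute)
  qed
  also have "\<dots> = r\<^sup>2 / 2 * lam k" by (simp add: lam_def sum_distrib_left)
  finally show ?thesis by simp
qed

text \<open>The summands belong to the sign average of u, to the sampled projection error and to the
  multiplier on the projection; the factor 3 stems from squaring a sum of three terms, the summand 1
  from the strict bound in \<open>cell_sampling\<close>.\<close>

definition grid_const :: "real \<Rightarrow> real" where
  "grid_const M = 3 * ((real CARD('n) * M / 8)\<^sup>2 * vol + ((6 * real CARD('n) * M)\<^sup>2 * vol + 1)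
     + 2 ^ CARD('n) * ((6 * real CARD('n) * M)\<^sup>2 * vol))"

definition mode_const :: "real \<Rightarrow> real" where
  "mode_const M = 2 ^ CARD('n) * ((6 * real CARD('n) * M)\<^sup>2 * vol)"

end

context cosine_grid
begin

text \<open>Induction over the coordinates. Each contributes a second difference of step at most h /
  2, hence at most M h^2 / 4, which the mean over the two signs halves.\<close>

lemma sign_average_near:
  assumes u: "neumann_class a b M u" and M: "0 \<le> M" and i: "i \<in> cells K" and y: "\<And>l. \<bar>y $ l\<bar> < h / 2"
  shows "finite L \<Longrightarrow> x \<in> cell i \<Longrightarrow> (\<And>l. l \<in> L \<Longrightarrow> x $ l = ctr i $ l) \<Longrightarrow>
    \<bar>(\<Sum>A\<in>Pow L. u (sign_shift L A y x)) - 2 ^ card L * u x\<bar> \<le> 2 ^ card L * (real (card L) * (M * h\<^sup>2 / 8))"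
proof (induction L arbitrary: x rule: finite_induct)
  case empty
  have "sign_shift {} {} y x = x" by (simp add: sign_shift_def vec_eq_iff)
  then show ?case by simp
next
  case (insert l L)
  let ?xp = "x + y $ l *\<^sub>R axis l 1" and ?xm = "x + (- y $ l) *\<^sub>R axis l 1"
  define N where "N = (2::real) ^ card L"
  define B where "B = M * h\<^sup>2 / 8"
  define c where "c = real (card L)"
  have xl: "x $ l = ctr i $ l" using insert.prems by simp
  have comp: "(x + s *\<^sub>R axis l 1) $ j = (if j = l then x $ l + s else x $ j)" for s j by (simp add: axis_def)
  have mem': "x + s *\<^sub>R axis l 1 \<in> cell i" if "\<bar>s\<bar> < h / 2" for s
    using insert.prems(1) xl that unfolding cell_def mem_Collect_eq comp by auto
  have mem: "?xp \<in> cell i" "?xm \<in> cell i"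
    using y[of l] by (auto intro!: mem' simp del: minus_mult_left scaleR_minus_left)
  have same: "?xp $ j = ctr i $ j" "?xm $ j = ctr i $ j" if "j \<in> L" for j
    using insert.prems(2)[of j] insert.hyps(2) that unfolding comp by auto
  have p: "\<bar>(\<Sum>A\<in>Pow L. u (sign_shift L A y ?xp)) - N * u ?xp\<bar> \<le> N * (c * B)"
    unfolding N_def B_def c_def by (rule insert.IH[OF mem(1) same(1)])
  have m: "\<bar>(\<Sum>A\<in>Pow L. u (sign_shift L A y ?xm)) - N * u ?xm\<bar> \<le> N * (c * B)"
    unfolding N_def B_def c_def by (rule insert.IH[OF mem(2) same(2)])
  have s: "\<bar>u ?xp + u ?xm - 2 * u x\<bar> \<le> 2 * B"
  proof -
    note box = cell_subset[OF i insert.prems(1)] cell_subset[OF i mem(1)] cell_subset[OF i mem(2)]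
    have d: "\<bar>second_diff l \<delta> u x\<bar> \<le> M * \<delta>\<^sup>2" if "0 < \<delta>" "x + \<delta> *\<^sub>R axis l 1 \<in> cbox a b" "x - \<delta> *\<^sub>R axis l 1 \<in> cbox a b" for \<delta>
      using u box(1) that unfolding neumann_class_def by blast
    have "\<bar>u ?xp + u ?xm - 2 * u x\<bar> \<le> M * (y $ l)\<^sup>2"
    proof (cases "y $ l" "0::real" rule: linorder_cases)
      case less
      then show ?thesis using d[of "- y $ l"] box by (simp add: second_diff_def add.commute)
    next
      case equal
      then show ?thesis by simp
    next
      case greater
      then show ?thesis using d[of "y $ l"] box by (simp add: second_diff_def)
    qed
    also have "\<dots> \<le> M * (h / 2)\<^sup>2"
      using y[of l] h M by (intro mult_left_mono power2_le_iff_abs_le[THEN iffD2]) auto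
    finally show ?thesis by (simp add: B_def power_divide)
  qed
  have N: "0 < N" by (simp add: N_def)
  have "\<bar>N * (u ?xp + u ?xm - 2 * u x)\<bar> \<le> N * (2 * B)"
    unfolding abs_mult using s N by simp
  moreover have "(\<Sum>A\<in>Pow (insert l L). u (sign_shift (insert l L) A y x)) =
      (\<Sum>A\<in>Pow L. u (sign_shift L A y ?xp)) + (\<Sum>A\<in>Pow L. u (sign_shift L A y ?xm))"
    unfolding sum_Pow_insert[OF insert.hyps]
    by (intro arg_cong2[of _ _ _ _ "(+)"] sum.cong refl) (simp_all only: Pow_iff sign_shift_insert[OF insert.hyps(2)])
  ultimately have "\<bar>(\<Sum>A\<in>Pow (insert l L). u (sign_shift (insert l L) A y x)) - N * (2 * u x)\<bar> \<le> N * (c * B) + N * (c * B) + N * (2 * B)"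
    using p m by (simp only: right_diff_distrib distrib_left)
  also have "\<dots> = 2 ^ card (insert l L) * (real (card (insert l L)) * B)"
    using insert.hyps by (simp add: N_def c_def algebra_simps)
  also have "N * (2 * u x) = 2 ^ card (insert l L) * u x" using insert.hyps by (simp add: N_def)
  finally show ?case unfolding B_def .
qed

text \<open>k > K means 2 k \<ge> N, so some frequency is at least pi / (2 h) \<ge> 1 / h.\<close>

lemma high_modes: assumes "k \<notin> modes K" shows "1 / h\<^sup>2 \<le> lam k"
proof -
  obtain l where "K l < k l" using assms by (auto simp: modes_def not_le)
  then have "2 * k l \<ge> 2 * K l + 1" by simp
  then have "real (2 * K l + 1) \<le> 2 * real (k l)" by linarith
  then have "real (2 * K l + 1) * h \<le> 2 * real (k l) * h" using h by (intro mult_right_mono) auto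
  then have "b $ l - a $ l \<le> real (k l) * h * 2" unfolding grid[symmetric] by simp
  also have "\<dots> \<le> real (k l) * h * pi" using h pi_ge_two by (intro mult_left_mono) auto
  finally have "1 \<le> real (k l) * h * pi / (b $ l - a $ l)" using len_pos[of l] by (simp add: le_divide_eq)
  then have "1 / h \<le> freq k l" using h by (simp add: freq_def divide_le_eq mult_ac)
  then have "(1 / h)\<^sup>2 \<le> (freq k l)\<^sup>2" using h by (intro power_mono) auto
  also have "\<dots> \<le> lam k" unfolding lam_def by (rule member_le_sum) auto
  finally show ?thesis by (simp add: power_divide)
qed

text \<open>The L2 bound says nothing about single points, so the error at the centres is compared
  with its sign average at a well-chosen offset y. The three parts are u against its sign average,
  the averaged error, small by the choice of y, and the effect of averaging on the projection, a
  multiplier close to 1.\<close>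

lemma grid_projection_error:
  assumes u: "neumann_class a b M u" and M: "0 \<le> M"
  shows "gsq (\<lambda>i. u (ctr i) - proj (modes K) u (ctr i)) \<le> grid_const M * h ^ 4"
proof -
  define v where "v x = u x - proj (modes K) u x" for x
  define D where "D = (6 * real CARD('n) * M)\<^sup>2 * vol"
  let ?N = "2 ^ CARD('n) :: real"
  have cu: "continuous_on (cbox a b) u" using u by (simp add: neumann_class_def)
  have "(LINT x|Q. (v x)\<^sup>2) \<le> D / (1 / h\<^sup>2)\<^sup>2"
    unfolding v_def D_def using h by (intro projection_error_bound[OF u M finite_modes high_modes]) auto
  also have "\<dots> = D * h ^ 4" using h by (simp add: power2_eq_square power4_eq_xxxx)
  \<comment> \<open>\<open>cell_sampling\<close> asks for a strict bound; adding 1 to D provides it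
    even when D = 0.\<close>
  also have "\<dots> < (D + 1) * h ^ 4" using h by simp
  finally have E: "(LINT x|Q. (v x)\<^sup>2) < (D + 1) * h ^ 4" .
  have cv: "continuous_on (cbox a b) (\<lambda>x. (v x)\<^sup>2)"
    unfolding v_def by (intro continuous_intros cu cont_proj)
  obtain y where y: "\<And>l. \<bar>y $ l\<bar> < h / 2"
    and yE: "h ^ CARD('n) * (\<Sum>A\<in>UNIV. \<Sum>i\<in>cells K. (v (sign_shift UNIV A y (ctr i)))\<^sup>2) \<le> ?N * ((D + 1) * h ^ 4)"
    by (rule cell_sampling[OF cv _ E]) auto
  define sv where "sv i = (\<Sum>A\<in>UNIV. v (sign_shift UNIV A y (ctr i))) / ?N" for i
  define su where "su i = (\<Sum>A\<in>UNIV. u (sign_shift UNIV A y (ctr i))) / ?N" for i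
  define w where "w k = (\<Prod>l\<in>UNIV. cos (freq k l * y $ l)) - 1" for k
  define sp where "sp i = (\<Sum>k\<in>modes K. w k * (coef u k / nrm k) * cc k (ctr i))" for i
  have split: "v (ctr i) = (u (ctr i) - su i) + sv i + sp i" for i
  proof -
    have "(\<Sum>A\<in>UNIV. proj (modes K) u (sign_shift UNIV A y (ctr i))) =
      (\<Sum>k\<in>modes K. coef u k / nrm k * (\<Sum>A\<in>UNIV. cc k (sign_shift UNIV A y (ctr i))))"
      unfolding proj_def by (subst sum.swap) (simp add: sum_distrib_left)
    also have "\<dots> = ?N * (\<Sum>k\<in>modes K. coef u k / nrm k * ((w k + 1) * cc k (ctr i)))"
      unfolding cc_sign_average by (simp add: w_def sum_distrib_left mult.left_commute)
    also have "(\<Sum>k\<in>modes K. coef u k / nrm k * ((w k + 1) * cc k (ctr i))) = sp i + proj (modes K) u (ctr i)"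
      unfolding sp_def proj_def sum.distrib[symmetric] by (intro sum.cong refl) (simp add: algebra_simps)
    finally have "sv i = su i - (sp i + proj (modes K) u (ctr i))"
      by (simp add: sv_def su_def v_def sum_subtractf diff_divide_distrib)
    then show ?thesis by (simp add: v_def)
  qed
  have 1: "gsq (\<lambda>i. u (ctr i) - su i) \<le> (real CARD('n) * M / 8)\<^sup>2 * vol * h ^ 4"
  proof -
    have "\<bar>u (ctr i) - su i\<bar> \<le> real CARD('n) * (M * h\<^sup>2 / 8)" if i: "i \<in> cells K" for i
    proof -
      have "ctr i \<in> cell i" using h by (simp add: cell_def)
      from sign_average_near[where L = UNIV, OF u M i y finite_class.finite_UNIV this refl]
      have "\<bar>?N * su i - ?N * u (ctr i)\<bar> \<le> ?N * (real CARD('n) * (M * h\<^sup>2 / 8))"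
        by (simp add: su_def)
      then have "?N * \<bar>su i - u (ctr i)\<bar> \<le> ?N * (real CARD('n) * (M * h\<^sup>2 / 8))"
        unfolding right_diff_distrib[symmetric] abs_mult by simp
      then have "\<bar>su i - u (ctr i)\<bar> \<le> real CARD('n) * (M * h\<^sup>2 / 8)" by (rule mult_left_le_imp_le) simp
      then show ?thesis by (simp only: abs_minus_commute)
    qed
    then have "gsq (\<lambda>i. u (ctr i) - su i) \<le> (real CARD('n) * (M * h\<^sup>2 / 8))\<^sup>2 * vol" by (rule gsq_const)
    also have "\<dots> = (real CARD('n) * M / 8)\<^sup>2 * vol * h ^ 4" by (simp add: power2_eq_square power4_eq_xxxx)
    finally show ?thesis .
  qed
  have 2: "gsq sv \<le> (D + 1) * h ^ 4"
  proof -
    have "(sv i)\<^sup>2 \<le> (\<Sum>A\<in>UNIV. (v (sign_shift UNIV A y (ctr i)))\<^sup>2) / ?N" for i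
    proof -
      have "(\<Sum>A\<in>UNIV. v (sign_shift UNIV A y (ctr i)))\<^sup>2 \<le> ?N * (\<Sum>A\<in>UNIV. (v (sign_shift UNIV A y (ctr i)))\<^sup>2)"
        using sum_squared_le_sum_of_squares[of "\<lambda>A. v (sign_shift UNIV A y (ctr i))" "UNIV :: 'n set set"]
        by (simp add: mult.commute)
      then have "(\<Sum>A\<in>UNIV. v (sign_shift UNIV A y (ctr i)))\<^sup>2 / (?N * ?N) \<le> ?N * (\<Sum>A\<in>UNIV. (v (sign_shift UNIV A y (ctr i)))\<^sup>2) / (?N * ?N)"
        by (intro divide_right_mono) auto
      then show ?thesis by (simp add: sv_def power_divide power2_eq_square)
    qed
    then have "gsq sv \<le> h ^ CARD('n) * (\<Sum>i\<in>cells K. (\<Sum>A\<in>UNIV. (v (sign_shift UNIV A y (ctr i)))\<^sup>2) / ?N)"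
      unfolding gsq_def using h by (intro mult_left_mono sum_mono) auto
    also have "\<dots> = h ^ CARD('n) * (\<Sum>A\<in>UNIV. \<Sum>i\<in>cells K. (v (sign_shift UNIV A y (ctr i)))\<^sup>2) / ?N"
      unfolding sum_divide_distrib[symmetric] by (subst sum.swap) simp
    also have "\<dots> \<le> ?N * ((D + 1) * h ^ 4) / ?N" by (intro divide_right_mono yE) simp
    finally show ?thesis by simp
  qed
  have 3: "gsq sp \<le> ?N * D * h ^ 4"
  proof -
    have "\<bar>w k\<bar> \<le> h\<^sup>2 * lam k" for k
    proof -
      have "\<bar>w k\<bar> \<le> h\<^sup>2 / 2 * lam k"
        unfolding w_def
      proof (rule prod_cos_near_one)
        fix l show "\<bar>y $ l\<bar> \<le> h" using y[of l] h by linarith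
      qed
      also have "\<dots> \<le> h\<^sup>2 * lam k" by (intro mult_right_mono) (auto simp: lam_def sum_nonneg)
      finally show ?thesis .
    qed
    then have "gsq sp \<le> ?N * ((h\<^sup>2)\<^sup>2 * ((6 * real CARD('n) * M)\<^sup>2 * vol))"
      unfolding sp_def by (intro gsq_weighted[OF u M])
    then show ?thesis by (simp add: D_def power2_eq_square power4_eq_xxxx mult_ac)
  qed
  have "gsq (\<lambda>i. v (ctr i)) \<le> 3 * (gsq (\<lambda>i. u (ctr i) - su i) + gsq sv + gsq sp)"
  proof -
    have q: "(x + y + z)\<^sup>2 \<le> 3 * (x\<^sup>2 + y\<^sup>2 + z\<^sup>2)" for x y z :: real
      using zero_le_power2[of "x - y"] zero_le_power2[of "x - z"] zero_le_power2[of "y - z"]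
      by (simp add: power2_eq_square algebra_simps)
    have "gsq (\<lambda>i. v (ctr i)) \<le> h ^ CARD('n) * (\<Sum>i\<in>cells K. 3 * ((u (ctr i) - su i)\<^sup>2 + (sv i)\<^sup>2 + (sp i)\<^sup>2))"
      unfolding gsq_def split using h by (intro mult_left_mono sum_mono q) auto
    then show ?thesis by (simp add: gsq_def sum.distrib sum_distrib_left[symmetric] distrib_left)
  qed
  also have "\<dots> \<le> 3 * ((real CARD('n) * M / 8)\<^sup>2 * vol * h ^ 4 + (D + 1) * h ^ 4 + ?N * D * h ^ 4)"
    by (intro mult_left_mono add_mono 1 2 3) simp
  also have "\<dots> = grid_const M * h ^ 4" by (simp add: grid_const_def D_def algebra_simps)
  finally show ?thesis by (simp add: v_def)
qed

end

section \<open>One step of the error\<close>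

context cosine_grid
begin

lemma grid_norm_gsq: "(grid_norm K h c)\<^sup>2 = gsq c"
  using gsq_nonneg[of c] by (simp add: grid_norm_def grid_inner_def gsq_def power2_eq_square)

lemma grid_inner_cong:
  assumes "\<And>i. i \<in> cells K \<Longrightarrow> c i = c' i"
  shows "grid_inner K h c d = grid_inner K h c' d"
  unfolding grid_inner_def using assms by (intro arg_cong2[of _ _ _ _ "(*)"] sum.cong refl) simp

lemma grid_inner_diff: "grid_inner K h (\<lambda>i. c i - d i) e = grid_inner K h c e - grid_inner K h d e"
  unfolding grid_inner_def left_diff_distrib sum_subtractf right_diff_distrib ..

lemma grid_inner_cmult: "grid_inner K h (\<lambda>i. r * c i) d = r * grid_inner K h c d"
  unfolding grid_inner_def mult.assoc sum_distrib_left[symmetric] by (rule mult.left_commute)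

lemma grid_inner_commute: "grid_inner K h c d = grid_inner K h d c"
  unfolding grid_inner_def by (simp only: mult.commute)

lemma grid_inner_const: "e \<in> grid_fun0 K \<Longrightarrow> grid_inner K h (\<lambda>_. r) e = 0"
  unfolding grid_inner_def sum_distrib_left[symmetric] by (simp add: grid_fun0_def)

lemma grid_inner_le_squares:
  assumes "\<And>i. i \<in> cells K \<Longrightarrow> c i * d i \<le> x * (e i)\<^sup>2 + y * (f i)\<^sup>2 + z * (g i)\<^sup>2"
  shows "grid_inner K h c d \<le> x * gsq e + y * gsq f + z * gsq g"
proof -
  have "grid_inner K h c d \<le> h ^ CARD('n) * (\<Sum>i\<in>cells K. x * (e i)\<^sup>2 + y * (f i)\<^sup>2 + z * (g i)\<^sup>2)"
    unfolding grid_inner_def using h assms by (intro mult_left_mono sum_mono) auto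
  also have "\<dots> = x * gsq e + y * gsq f + z * gsq g"
    by (simp add: gsq_def sum.distrib sum_distrib_left[symmetric] distrib_left mult.left_commute)
  finally show ?thesis .
qed

text \<open>Polarisation: the right side exceeds the left by the squared negative norm of e' -
  e.\<close>

lemma neg_norm_difference:
  assumes e: "e \<in> grid_fun0 K" and e': "e' \<in> grid_fun0 K"
  shows "(grid_neg_norm K h e')\<^sup>2 - (grid_neg_norm K h e)\<^sup>2 \<le> 2 * grid_inner K h (\<lambda>i. e' i - e i) (inv_neg_laplacian K h e')"
proof -
  let ?E = "inv_neg_laplacian K h e" and ?E' = "inv_neg_laplacian K h e'"
  have "0 \<le> grid_inner K h (\<lambda>i. e' i - e i) (inv_neg_laplacian K h (\<lambda>i. e' i - e i))"
    by (rule grid_neg_norm_square(1)[OF h grid_fun0_diff[OF e' e]])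
  also have "\<dots> = grid_inner K h (\<lambda>i. ?E' i - ?E i) (\<lambda>i. e' i - e i)"
    unfolding inv_neg_laplacian_diff[OF h e' e] by (rule grid_inner_commute)
  also have "\<dots> = grid_inner K h (\<lambda>i. e' i - e i) ?E' - grid_inner K h (\<lambda>i. e' i - e i) ?E"
    unfolding grid_inner_diff[of ?E'] by (simp only: grid_inner_commute)
  also have "\<dots> = grid_inner K h e' ?E' - 2 * grid_inner K h e ?E' + grid_inner K h e ?E"
    unfolding grid_inner_diff using inv_neg_laplacian_symmetric[OF h e' e]
    by (simp add: grid_inner_commute[of ?E'])
  finally show ?thesis
    unfolding grid_neg_norm_square(2)[OF h e] grid_neg_norm_square(2)[OF h e'] grid_inner_diff by simp
qed

text \<open>Testing with the inverse Laplacian of e' removes the constants \<kappa> and \<omega>,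
  since e' has mean zero. Pointwise, coercivity supplies \<gamma> + 2 \<sigma>wn; the explicit cross
  term takes \<sigma>wn of it and charges \<sigma>wn to e, and the residual takes \<gamma> / 2. The
  terms with \<sigma>wn on both sides then telescope over the time levels.\<close>

lemma error_step:
  assumes e: "e \<in> grid_fun0 K" and e': "e' \<in> grid_fun0 K" and d: "d \<in> grid_fun0 K" and dt: "0 < dt"
    and on: "\<And>i. i \<in> cells K \<Longrightarrow> e i = p i - s i \<and> e' i = p' i - s' i \<and> d i = s' i - s i"
    and scheme: "\<And>i. i \<in> cells K \<Longrightarrow> log_pot \<sigma> (s' i) - 2 * \<sigma>wn * s i + 2 / dt * inv_neg_laplacian K h d i = \<kappa>"
    and cons: "grid_inner K h (\<lambda>i. p' i - p i) (inv_neg_laplacian K h e') = - dt / 2 * grid_inner K h \<Phi> e'"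
    and res: "gsq (\<lambda>i. \<Phi> i - (log_pot \<sigma> (p' i) - 2 * \<sigma>wn * p i + \<omega>)) \<le> r"
    and ran: "\<And>i. i \<in> cells K \<Longrightarrow> 0 < p' i \<and> p' i < 1 \<and> 0 < s' i \<and> s' i < 1"
    and \<sigma>: "\<And>\<alpha>. 0 < \<sigma> \<alpha>" "0 < \<sigma>wn" and \<gamma>: "\<gamma> = (sqrt (\<sigma> Wet) + sqrt (\<sigma> NonWet))\<^sup>2 - 2 * \<sigma>wn" "0 < \<gamma>"
  shows "(grid_neg_norm K h e')\<^sup>2 + dt * (\<gamma> / 2) * gsq e' + dt * \<sigma>wn * gsq e' \<le>
     (grid_neg_norm K h e)\<^sup>2 + dt * \<sigma>wn * gsq e + dt * (r / (2 * \<gamma>))"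
proof -
  let ?E' = "inv_neg_laplacian K h e'"
  define \<rho> where "\<rho> i = \<Phi> i - (log_pot \<sigma> (p' i) - 2 * \<sigma>wn * p i + \<omega>)" for i
  define X where "X = grid_inner K h (\<lambda>i. e' i - e i) ?E'"
  define W where "W i = log_pot \<sigma> (s' i) - 2 * \<sigma>wn * s i" for i
  have "X = grid_inner K h (\<lambda>i. (p' i - p i) - d i) ?E'"
    unfolding X_def by (rule grid_inner_cong) (use on in force)
  also have "\<dots> = - dt / 2 * grid_inner K h \<Phi> e' - grid_inner K h (inv_neg_laplacian K h d) e'"
    unfolding grid_inner_diff[where d = d] cons inv_neg_laplacian_symmetric[OF h d e'] ..
  also have "grid_inner K h (inv_neg_laplacian K h d) e' = grid_inner K h (\<lambda>i. dt / 2 * (\<kappa> - W i)) e'"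
  proof (rule grid_inner_cong)
    fix i assume "i \<in> cells K"
    from scheme[OF this] dt show "inv_neg_laplacian K h d i = dt / 2 * (\<kappa> - W i)"
      by (simp add: W_def field_simps)
  qed
  also have "\<dots> = dt / 2 * (0 - grid_inner K h W e')"
    unfolding grid_inner_cmult grid_inner_diff grid_inner_const[OF e'] ..
  finally have "X = dt / 2 * (grid_inner K h W e' - grid_inner K h \<Phi> e' + grid_inner K h (\<lambda>_. \<omega>) e')"
    unfolding grid_inner_const[OF e'] by (simp add: algebra_simps)
  also have "grid_inner K h W e' - grid_inner K h \<Phi> e' + grid_inner K h (\<lambda>_. \<omega>) e' = grid_inner K h (\<lambda>i. (W i - \<Phi> i) - (- \<omega>)) e'"
    unfolding grid_inner_diff grid_inner_const[OF e'] by simp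
  finally have X: "X = dt / 2 * grid_inner K h (\<lambda>i. (W i - \<Phi> i) - (- \<omega>)) e'" .
  have "grid_inner K h (\<lambda>i. (W i - \<Phi> i) - (- \<omega>)) e' \<le> (- (\<gamma> / 2 + \<sigma>wn)) * gsq e' + \<sigma>wn * gsq e + (1 / (2 * \<gamma>)) * gsq \<rho>"
  proof (rule grid_inner_le_squares)
    fix i assume i: "i \<in> cells K"
    define q where "q = e' i"
    have o: "e i = p i - s i" "q = p' i - s' i" using on[OF i] by (simp_all add: q_def)
    have co: "(\<gamma> + 2 * \<sigma>wn) * q\<^sup>2 \<le> (log_pot \<sigma> (p' i) - log_pot \<sigma> (s' i)) * q"
      using log_pot_coercive[of \<sigma>, OF \<sigma>(1)] ran[OF i] unfolding o(2) \<gamma>(1) by simp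
    have y1: "2 * \<sigma>wn * (e i * q) \<le> \<sigma>wn * (e i)\<^sup>2 + \<sigma>wn * q\<^sup>2"
      using mult_left_mono[OF zero_le_power2[of "e i - q"], of \<sigma>wn] \<sigma>(2) by (simp add: power2_diff algebra_simps)
    \<comment> \<open>Young's inequality with weight \<gamma>, which leaves half of \<gamma> for the
      final estimate.\<close>
    have y2: "- (\<rho> i * q) \<le> (\<gamma> / 2) * q\<^sup>2 + (1 / (2 * \<gamma>)) * (\<rho> i)\<^sup>2"
    proof -
      have "0 \<le> (\<gamma> * q + \<rho> i)\<^sup>2 / (2 * \<gamma>)" using \<gamma>(2) by simp
      also have "\<dots> = (\<gamma> / 2) * q\<^sup>2 + (1 / (2 * \<gamma>)) * (\<rho> i)\<^sup>2 + \<rho> i * q"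
        using \<gamma>(2) by (simp add: power2_eq_square field_simps)
      finally show ?thesis by linarith
    qed
    have "((W i - \<Phi> i) - (- \<omega>)) * q = - ((log_pot \<sigma> (p' i) - log_pot \<sigma> (s' i)) * q) + 2 * \<sigma>wn * (e i * q) - \<rho> i * q"
      unfolding \<rho>_def W_def o(1) by (simp add: algebra_simps)
    also have "\<dots> \<le> (- (\<gamma> / 2 + \<sigma>wn)) * q\<^sup>2 + \<sigma>wn * (e i)\<^sup>2 + (1 / (2 * \<gamma>)) * (\<rho> i)\<^sup>2"
      using co y1 y2 unfolding distrib_right by (simp only: mult_minus_left distrib_right)
    finally show "((W i - \<Phi> i) - (- \<omega>)) * e' i \<le> (- (\<gamma> / 2 + \<sigma>wn)) * (e' i)\<^sup>2 + \<sigma>wn * (e i)\<^sup>2 + (1 / (2 * \<gamma>)) * (\<rho> i)\<^sup>2"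
      unfolding q_def .
  qed
  also have "(1 / (2 * \<gamma>)) * gsq \<rho> \<le> (1 / (2 * \<gamma>)) * r"
    using res \<gamma>(2) unfolding \<rho>_def by (intro mult_left_mono) auto
  finally have "2 * X \<le> dt * ((- (\<gamma> / 2 + \<sigma>wn)) * gsq e' + \<sigma>wn * gsq e + (1 / (2 * \<gamma>)) * r)"
    unfolding X using dt by simp
  moreover have "(grid_neg_norm K h e')\<^sup>2 - (grid_neg_norm K h e)\<^sup>2 \<le> 2 * X"
    unfolding X_def by (rule neg_norm_difference[OF e e'])
  ultimately have "(grid_neg_norm K h e')\<^sup>2 - (grid_neg_norm K h e)\<^sup>2 \<le> dt * ((- (\<gamma> / 2 + \<sigma>wn)) * gsq e' + \<sigma>wn * gsq e + (1 / (2 * \<gamma>)) * r)"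
    by linarith
  then show ?thesis by (simp add: algebra_simps)
qed

lemma neg_norm_uminus:
  assumes e: "e \<in> grid_fun0 K"
  shows "grid_neg_norm K h (\<lambda>i. - e i) = grid_neg_norm K h e"
proof -
  have z: "(\<lambda>_. 0) \<in> grid_fun0 K" by (simp add: grid_fun0_def grid_fun_def)
  have "inv_neg_laplacian K h (\<lambda>_. 0) = (\<lambda>_. 0)"
    using inv_neg_laplacian_diff[OF h e e] by simp
  then have "inv_neg_laplacian K h (\<lambda>i. - e i) = (\<lambda>i. - inv_neg_laplacian K h e i)"
    using inv_neg_laplacian_diff[OF h z e] by simp
  then show ?thesis by (simp add: grid_neg_norm_def grid_inner_def)
qed

text \<open>Replacing \<open>lam\<close> by \<open>ratio\<close> times \<open>lamh\<close> writes
  the exact symbol as a discrete Laplacian. The consistency error then sits in the potential, and no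
  differences of it have to be estimated.\<close>

lemma discrete_symbol_potential:
  assumes i: "i \<in> cells K"
  shows "(\<Sum>k\<in>modes K. lam k * \<beta> k * cc k (ctr i)) = - grid_laplacian K h (\<lambda>i. \<Sum>k\<in>modes K. ratio k * \<beta> k * cc k (ctr i)) i"
proof -
  have "grid_laplacian K h (\<lambda>i. \<Sum>k\<in>modes K. ratio k * \<beta> k * cc k (ctr i)) i = (\<Sum>k\<in>modes K. ratio k * \<beta> k * grid_laplacian K h (\<lambda>i. cc k (ctr i)) i)"
    by (rule grid_laplacian_lincomb)
  also have "\<dots> = (\<Sum>k\<in>modes K. - (lam k * \<beta> k * cc k (ctr i)))"
    by (intro sum.cong refl) (simp add: grid_laplacian_cc[OF i] ratio(1)[symmetric])
  finally show ?thesis by (simp add: sum_negf)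
qed

text \<open>Paired with a fixed w the increment is that of a scalar function of time, to which the
  mean value theorem applies. The time \<tau> depends on w, which is harmless because w is fixed
  beforehand in every application.\<close>

lemma projection_increment:
  fixes F :: "real \<Rightarrow> real^'n \<Rightarrow> real" and w :: "('n \<Rightarrow> nat) \<Rightarrow> real"
  assumes cont: "\<And>k. continuous_on {0..T} (\<lambda>t. coef (u t) k)"
    and der: "\<And>k t. 0 < t \<Longrightarrow> t < T \<Longrightarrow> ((\<lambda>t. coef (u t) k) has_real_derivative - lam k / 2 * coef (F t) k) (at t)"
    and st: "0 \<le> s" "s < t" "t \<le> T"
  obtains \<tau> where "s < \<tau>" "\<tau> < t"
    "grid_inner K h (\<lambda>i. proj (modes K) (u t) (ctr i) - proj (modes K) (u s) (ctr i)) w =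
      - (t - s) / 2 * grid_inner K h (\<lambda>i. \<Sum>k\<in>modes K. lam k * (coef (F \<tau>) k / nrm k) * cc k (ctr i)) w"
proof -
  define X where "X k = h ^ CARD('n) * (\<Sum>i\<in>cells K. cc k (ctr i) * w i)" for k
  have gi: "grid_inner K h (\<lambda>i. \<Sum>k\<in>modes K. \<beta> k * cc k (ctr i)) w = (\<Sum>k\<in>modes K. \<beta> k * X k)" for \<beta>
  proof -
    have "(\<Sum>i\<in>cells K. (\<Sum>k\<in>modes K. \<beta> k * cc k (ctr i)) * w i) = (\<Sum>k\<in>modes K. \<beta> k * (\<Sum>i\<in>cells K. cc k (ctr i) * w i))"
      unfolding sum_distrib_right sum_distrib_left by (subst sum.swap) (simp only: mult.assoc)
    then show ?thesis
      unfolding grid_inner_def X_def by (simp add: sum_distrib_left mult.left_commute)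
  qed
  define f where "f r = (\<Sum>k\<in>modes K. coef (u r) k / nrm k * X k)" for r
  have nz: "nrm k \<noteq> 0" for k using nrm_pos[of k] by simp
  have "continuous_on {s..t} f" unfolding f_def
    using st by (intro continuous_intros continuous_on_subset[OF cont]) (auto simp: nz)
  moreover have "(f has_derivative (\<lambda>v. v * (\<Sum>k\<in>modes K. (- lam k / 2 * coef (F r) k) / nrm k * X k))) (at r)" if "s < r" "r < t" for r
  proof -
    have "(f has_real_derivative (\<Sum>k\<in>modes K. (- lam k / 2 * coef (F r) k) / nrm k * X k)) (at r)"
      unfolding f_def by (intro DERIV_sum DERIV_cmult_right DERIV_cdivide der) (use st that in auto)
    then show ?thesis by (rule has_field_derivative_imp_has_derivative[THEN has_derivative_eq_rhs]) (simp add: mult.commute fun_eq_iff)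
  qed
  ultimately obtain \<tau> where \<tau>: "s < \<tau>" "\<tau> < t" "f t - f s = (t - s) * (\<Sum>k\<in>modes K. (- lam k / 2 * coef (F \<tau>) k) / nrm k * X k)"
    by (rule mvt[OF st(2)])
  have A: "grid_inner K h (\<lambda>i. proj (modes K) (u t) (ctr i) - proj (modes K) (u s) (ctr i)) w = f t - f s"
    unfolding grid_inner_diff proj_def gi f_def ..
  have B: "(\<Sum>k\<in>modes K. (- lam k / 2 * coef (F \<tau>) k) / nrm k * X k) = (- 1 / 2) * (\<Sum>k\<in>modes K. lam k * (coef (F \<tau>) k / nrm k) * X k)"
    unfolding sum_distrib_left by (intro sum.cong refl) simp
  have C: "(t - s) * ((- 1 / 2) * x) = - (t - s) / 2 * x" for x :: real by (simp add: field_simps)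
  show thesis by (rule that[OF \<tau>(1,2)]) (simp only: A \<tau>(3) B C gi)
qed

text \<open>Paired with the constant 1, the zero mode drops out because its eigenvalue is 0, all
  others because their grid sums vanish. So the projected solution conserves its grid mass, as the
  scheme does, and the error keeps mean zero.\<close>

lemma projection_increment_sum:
  fixes F :: "real \<Rightarrow> real^'n \<Rightarrow> real"
  assumes cont: "\<And>k. continuous_on {0..T} (\<lambda>t. coef (u t) k)"
    and der: "\<And>k t. 0 < t \<Longrightarrow> t < T \<Longrightarrow> ((\<lambda>t. coef (u t) k) has_real_derivative - lam k / 2 * coef (F t) k) (at t)"
    and st: "0 \<le> s" "s < t" "t \<le> T"
  shows "(\<Sum>i\<in>cells K. proj (modes K) (u t) (ctr i) - proj (modes K) (u s) (ctr i)) = 0"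
proof -
  obtain \<tau> where "s < \<tau>" "\<tau> < t" and \<tau>: "grid_inner K h (\<lambda>i. proj (modes K) (u t) (ctr i) - proj (modes K) (u s) (ctr i)) (\<lambda>_. 1) =
      - (t - s) / 2 * grid_inner K h (\<lambda>i. \<Sum>k\<in>modes K. lam k * (coef (F \<tau>) k / nrm k) * cc k (ctr i)) (\<lambda>_. 1)"
    by (rule projection_increment[OF cont der st])
  have "(\<Sum>i\<in>cells K. \<Sum>k\<in>modes K. lam k * (coef (F \<tau>) k / nrm k) * cc k (ctr i)) =
      (\<Sum>k\<in>modes K. lam k * (coef (F \<tau>) k / nrm k) * (\<Sum>i\<in>cells K. cc k (ctr i)))"
    unfolding sum_distrib_left by (rule sum.swap)
  also have "\<dots> = 0"
  proof (rule sum.neutral, rule ballI)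
    fix k assume k: "k \<in> modes K"
    show "lam k * (coef (F \<tau>) k / nrm k) * (\<Sum>i\<in>cells K. cc k (ctr i)) = 0"
      using grid_sum_cc[OF k] by (cases "k = (\<lambda>_. 0)") (simp_all add: lam_def freq_def)
  qed
  finally show ?thesis using \<tau> h by (simp add: grid_inner_def)
qed

text \<open>The increment is paired with itself, and Young's inequality absorbs half of its square
  norm.\<close>

lemma projection_increment_bound:
  fixes F :: "real \<Rightarrow> real^'n \<Rightarrow> real"
  assumes cont: "\<And>k. continuous_on {0..T} (\<lambda>t. coef (u t) k)"
    and der: "\<And>k t. 0 < t \<Longrightarrow> t < T \<Longrightarrow> ((\<lambda>t. coef (u t) k) has_real_derivative - lam k / 2 * coef (F t) k) (at t)"
    and st: "0 \<le> s" "s < t" "t \<le> T"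
    and F: "\<And>t. t \<in> {0..T} \<Longrightarrow> neumann_class a b M (F t)" "0 \<le> M"
  shows "gsq (\<lambda>i. proj (modes K) (u t) (ctr i) - proj (modes K) (u s) (ctr i)) \<le> (t - s)\<^sup>2 / 4 * mode_const M"
proof -
  define D where "D i = proj (modes K) (u t) (ctr i) - proj (modes K) (u s) (ctr i)" for i
  obtain \<tau> where \<tau>: "s < \<tau>" "\<tau> < t" "grid_inner K h D D =
      - (t - s) / 2 * grid_inner K h (\<lambda>i. \<Sum>k\<in>modes K. lam k * (coef (F \<tau>) k / nrm k) * cc k (ctr i)) D"
    unfolding D_def by (rule projection_increment[OF cont der st])
  have lam_nonneg: "0 \<le> lam k" for k by (simp add: lam_def sum_nonneg)
  define G where "G i = (\<Sum>k\<in>modes K. lam k * (coef (F \<tau>) k / nrm k) * cc k (ctr i))" for i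
  have G: "gsq G \<le> mode_const M"
    unfolding G_def[abs_def] mode_const_def using gsq_weighted[of M "F \<tau>" lam 1] F \<tau>(1,2) st lam_nonneg by simp
  have "gsq D = grid_inner K h (\<lambda>i. - (t - s) / 2 * G i) D"
    using \<tau>(3) unfolding grid_inner_cmult G_def gsq_def by (simp add: grid_inner_def power2_eq_square)
  also have "\<dots> \<le> ((t - s)\<^sup>2 / 8) * gsq G + (1 / 2) * gsq D + 0 * gsq D"
  proof (rule grid_inner_le_squares)
    fix i
    show "- (t - s) / 2 * G i * D i \<le> ((t - s)\<^sup>2 / 8) * (G i)\<^sup>2 + (1 / 2) * (D i)\<^sup>2 + 0 * (D i)\<^sup>2"
      using zero_le_power2[of "(t - s) / 2 * G i + D i"] by (simp add: power2_eq_square field_simps)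
  qed
  finally have "gsq D \<le> (t - s)\<^sup>2 / 4 * gsq G" by simp
  also have "\<dots> \<le> (t - s)\<^sup>2 / 4 * mode_const M" by (intro mult_left_mono G) simp
  finally show ?thesis unfolding D_def .
qed

text \<open>Paired with the inverse Laplacian of e, the discrete Laplacian of the potential cancels
  and leaves the potential against e itself.\<close>

lemma projection_increment_consistent:
  fixes F :: "real \<Rightarrow> real^'n \<Rightarrow> real"
  assumes cont: "\<And>k. continuous_on {0..T} (\<lambda>t. coef (u t) k)"
    and der: "\<And>k t. 0 < t \<Longrightarrow> t < T \<Longrightarrow> ((\<lambda>t. coef (u t) k) has_real_derivative - lam k / 2 * coef (F t) k) (at t)"
    and st: "0 \<le> s" "s < t" "t \<le> T" and e: "e \<in> grid_fun0 K"
  obtains \<tau> where "s < \<tau>" "\<tau> < t"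
    "grid_inner K h (\<lambda>i. proj (modes K) (u t) (ctr i) - proj (modes K) (u s) (ctr i)) (inv_neg_laplacian K h e) =
      - (t - s) / 2 * grid_inner K h (\<lambda>i. \<Sum>k\<in>modes K. ratio k * (coef (F \<tau>) k / nrm k) * cc k (ctr i)) e"
proof -
  obtain \<tau> where \<tau>: "s < \<tau>" "\<tau> < t"
    "grid_inner K h (\<lambda>i. proj (modes K) (u t) (ctr i) - proj (modes K) (u s) (ctr i)) (inv_neg_laplacian K h e) =
      - (t - s) / 2 * grid_inner K h (\<lambda>i. \<Sum>k\<in>modes K. lam k * (coef (F \<tau>) k / nrm k) * cc k (ctr i)) (inv_neg_laplacian K h e)"
    by (rule projection_increment[OF cont der st])
  define \<Phi> where "\<Phi> i = (\<Sum>k\<in>modes K. ratio k * (coef (F \<tau>) k / nrm k) * cc k (ctr i))" for i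
  have "grid_inner K h (\<lambda>i. \<Sum>k\<in>modes K. lam k * (coef (F \<tau>) k / nrm k) * cc k (ctr i)) (inv_neg_laplacian K h e) =
      grid_inner K h (\<lambda>i. (-1) * grid_laplacian K h \<Phi> i) (inv_neg_laplacian K h e)"
  proof (rule grid_inner_cong)
    fix i assume i: "i \<in> cells K"
    show "(\<Sum>k\<in>modes K. lam k * (coef (F \<tau>) k / nrm k) * cc k (ctr i)) = (-1) * grid_laplacian K h \<Phi> i"
      unfolding discrete_symbol_potential[OF i] \<Phi>_def by simp
  qed
  also have "\<dots> = grid_inner K h \<Phi> e"
    unfolding grid_inner_cmult grid_inner_inv_laplacian[OF h e refl] by simp
  finally show thesis using that[OF \<tau>(1,2)] \<tau>(3) unfolding \<Phi>_def by simp
qed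

end

section \<open>Convergence\<close>

context cosine_box
begin

text \<open>The constant 1 is the zero mode, which belongs to every \<open>modes K\<close>, so it is
  its own projection.\<close>

lemma proj_one_minus:
  assumes u: "continuous_on (cbox a b) u" and v: "\<And>x. x \<in> cbox a b \<Longrightarrow> v x = 1 - u x"
  shows "proj (modes K) v x = 1 - proj (modes K) u x"
proof -
  have "coef v k = (if k = (\<lambda>_. 0) then nrm k else 0) - coef u k" for k
  proof -
    have "coef v k = coef (\<lambda>x. cc (\<lambda>_. 0) x - u x) k"
      using coef_cong[of v "\<lambda>x. cc (\<lambda>_. 0) x - u x"] v by (simp add: cc_zero)
    also have "\<dots> = coef (cc (\<lambda>_. 0)) k - coef u k" by (rule coef_diff[OF cont_cc u])
    finally show ?thesis by (simp only: coef_cc) simp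
  qed
  then have "coef v k / nrm k * cc k x = (if k = (\<lambda>_. 0) then 1 else 0) - coef u k / nrm k * cc k x" for k
    using nrm_pos[of k] nrm_pos[of "\<lambda>_. 0"] by (simp add: diff_divide_distrib left_diff_distrib cc_zero)
  then have "proj (modes K) v x = (\<Sum>k\<in>modes K. (if k = (\<lambda>_. 0) then 1 else 0)) - proj (modes K) u x"
    unfolding proj_def by (simp only: sum_subtractf)
  moreover have "(\<lambda>_. 0) \<in> modes K" by (simp add: modes_def)
  ultimately show ?thesis by (simp add: finite_modes)
qed

text \<open>The outer 4 comes from splitting the residual into four parts. The fraction is the
  Lipschitz constant of \<open>log_pot\<close> on [m / 2, 1 - m / 2] and 2 \<sigma>wn the slope of
  the explicit term; their squares multiply the bound of \<open>center_proj_near\<close>.\<close>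

definition residual_const :: "(phase \<Rightarrow> real) \<Rightarrow> real \<Rightarrow> real \<Rightarrow> real \<Rightarrow> real" where
  "residual_const \<sigma> \<sigma>wn m M = 4 * (mode_const M + grid_const M +
     (((\<sigma> Wet + \<sigma> NonWet) / (m / 2))\<^sup>2 + (2 * \<sigma>wn)\<^sup>2) * (2 * grid_const M + mode_const M))"

lemma const_nonneg: "0 \<le> mode_const M" "0 \<le> grid_const M" "0 \<le> residual_const \<sigma> \<sigma>wn m M"
  using vol_pos by (auto simp: mode_const_def grid_const_def residual_const_def intro!: add_nonneg_nonneg mult_nonneg_nonneg)

end

context cosine_grid
begin

context
  fixes \<sigma> :: "phase \<Rightarrow> real" and \<sigma>wn T m M :: real and S :: "phase \<Rightarrow> real \<Rightarrow> real^'n \<Rightarrow> real"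
  assumes \<sigma>: "\<And>\<alpha>. 0 < \<sigma> \<alpha>" "0 < \<sigma>wn" and m: "0 < m" and M: "0 \<le> M"
    and range: "\<And>t x. t \<in> {0..T} \<Longrightarrow> x \<in> cbox a b \<Longrightarrow> m \<le> S Wet t x \<and> S Wet t x \<le> 1 - m"
    and sat: "\<And>t x. t \<in> {0..T} \<Longrightarrow> x \<in> cbox a b \<Longrightarrow> S NonWet t x = 1 - S Wet t x"
    and contN: "\<And>t. t \<in> {0..T} \<Longrightarrow> continuous_on (cbox a b) (S NonWet t)"
    and smooth: "\<And>t. t \<in> {0..T} \<Longrightarrow> neumann_class a b M (S Wet t)"
    and smoothF: "\<And>t. t \<in> {0..T} \<Longrightarrow> neumann_class a b M (\<lambda>x. pot_diff \<sigma> \<sigma>wn (S Wet t x))"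
    and cont: "\<And>k. continuous_on {0..T} (\<lambda>t. coef (S Wet t) k)"
    and der: "\<And>k t. 0 < t \<Longrightarrow> t < T \<Longrightarrow> ((\<lambda>t. coef (S Wet t) k) has_real_derivative
      - lam k / 2 * coef (\<lambda>x. pot_diff \<sigma> \<sigma>wn (S Wet t x)) k) (at t)"
    and dim: "CARD('n) \<le> 3" and h1: "h \<le> 1" and hm: "h * (grid_const M + 1) \<le> (m / 2)\<^sup>2"
begin

definition center_proj :: "real \<Rightarrow> ('n \<Rightarrow> nat) \<Rightarrow> real" where "center_proj t i = proj (modes K) (S Wet t) (ctr i)"

lemma ctr_mem: "i \<in> cells K \<Longrightarrow> ctr i \<in> cbox a b"
  using h by (intro cell_subset[of i]) (auto simp: cell_def)

text \<open>An inverse inequality: one cell carries weight h^n in the squared grid norm, so the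
  squared grid error O(h^4) leaves at most h times \<open>grid_const M\<close> at each centre, as n
  \<le> 3. By \<open>hm\<close> this is at most (m / 2)^2, half of the margin m.\<close>

lemma center_proj_range:
  assumes t: "t \<in> {0..T}" and i: "i \<in> cells K"
  shows "center_proj t i \<in> {m / 2..1 - m / 2}"
proof -
  define z where "z = S Wet t (ctr i) - center_proj t i"
  have "z\<^sup>2 \<le> (\<Sum>i\<in>cells K. (S Wet t (ctr i) - center_proj t i)\<^sup>2)"
    unfolding z_def by (rule member_le_sum[of i "cells K" "\<lambda>i. (S Wet t (ctr i) - center_proj t i)\<^sup>2"]) (use i finite_cells in auto)
  then have "h ^ CARD('n) * z\<^sup>2 \<le> gsq (\<lambda>i. S Wet t (ctr i) - center_proj t i)"
    unfolding gsq_def using h by (intro mult_left_mono) auto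
  also have "\<dots> \<le> grid_const M * h ^ 4" unfolding center_proj_def by (rule grid_projection_error[OF smooth[OF t] M])
  also have "\<dots> \<le> grid_const M * h ^ (CARD('n) + 1)"
    using h h1 dim const_nonneg by (intro mult_left_mono power_decreasing) auto
  also have "\<dots> = h ^ CARD('n) * (h * grid_const M)" by simp
  finally have "z\<^sup>2 \<le> h * grid_const M" using h by simp
  also have "\<dots> \<le> (m / 2)\<^sup>2" using hm h by (simp add: distrib_left)
  finally have "\<bar>z\<bar> \<le> m / 2" using m by (simp only: abs_le_square_iff[symmetric])
  then have "z \<le> m / 2" "- z \<le> m / 2" by (simp_all only: abs_le_iff)
  moreover have "m \<le> S Wet t (ctr i)" "S Wet t (ctr i) \<le> 1 - m" using range[OF t ctr_mem[OF i]] by auto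
  ultimately show ?thesis unfolding z_def atLeastAtMost_iff by (intro conjI; linarith)
qed

text \<open>The exact value at the intermediate time is compared with its projection at the same
  time, and that projection with the one at either end of the step.\<close>

lemma center_proj_near:
  assumes st: "0 \<le> s" "s < t" "t \<le> T" and \<tau>: "s < \<tau>" "\<tau> < t" and r: "r = s \<or> r = t"
  shows "gsq (\<lambda>i. S Wet \<tau> (ctr i) - center_proj r i) \<le> (2 * grid_const M + mode_const M) * ((t - s)\<^sup>2 + h ^ 4)"
proof -
  have bd: "gsq (\<lambda>i. center_proj y i - center_proj x i) \<le> (t - s)\<^sup>2 / 4 * mode_const M" if "s \<le> x" "x < y" "y \<le> t" for x y
  proof -
    have "gsq (\<lambda>i. center_proj y i - center_proj x i) \<le> (y - x)\<^sup>2 / 4 * mode_const M"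
      unfolding center_proj_def by (rule projection_increment_bound[OF cont der _ _ _ smoothF M]) (use that st in auto)
    also have "(y - x)\<^sup>2 \<le> (t - s)\<^sup>2" using that by (intro power_mono) auto
    finally show ?thesis using const_nonneg(1)[of M] by (simp add: mult_right_mono divide_right_mono)
  qed
  have e: "(\<lambda>i. (S Wet \<tau> (ctr i) - center_proj \<tau> i) + (center_proj \<tau> i - center_proj r i)) = (\<lambda>i. S Wet \<tau> (ctr i) - center_proj r i)" by simp
  have "gsq (\<lambda>i. center_proj \<tau> i - center_proj r i) \<le> (t - s)\<^sup>2 / 4 * mode_const M"
  proof (cases "r = s")
    case True
    then show ?thesis using bd[of s \<tau>] \<tau> by simp
  next
    case False
    then have "r = t" using r by simp
    have "gsq (\<lambda>i. center_proj \<tau> i - center_proj r i) \<le> gsq (\<lambda>i. center_proj r i - center_proj \<tau> i)" by (rule gsq_mono) simp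
    then show ?thesis using bd[of \<tau> t] \<tau> \<open>r = t\<close> by simp
  qed
  moreover have "gsq (\<lambda>i. S Wet \<tau> (ctr i) - center_proj \<tau> i) \<le> grid_const M * h ^ 4"
    unfolding center_proj_def by (rule grid_projection_error[OF smooth M]) (use \<tau> st in auto)
  moreover have "gsq (\<lambda>i. (S Wet \<tau> (ctr i) - center_proj \<tau> i) + (center_proj \<tau> i - center_proj r i)) \<le>
      2 * gsq (\<lambda>i. S Wet \<tau> (ctr i) - center_proj \<tau> i) + 2 * gsq (\<lambda>i. center_proj \<tau> i - center_proj r i)" by (rule gsq_add)
  ultimately have "gsq (\<lambda>i. S Wet \<tau> (ctr i) - center_proj r i) \<le> 2 * (grid_const M * h ^ 4) + 2 * ((t - s)\<^sup>2 / 4 * mode_const M)"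
    unfolding e by linarith
  also have "\<dots> \<le> (2 * grid_const M + mode_const M) * ((t - s)\<^sup>2 + h ^ 4)"
  proof -
    have "0 \<le> grid_const M * (t - s)\<^sup>2" "0 \<le> mode_const M * (t - s)\<^sup>2" "0 \<le> mode_const M * h ^ 4"
      using const_nonneg by simp_all
    then show ?thesis by (simp add: algebra_simps)
  qed
  finally show ?thesis .
qed

text \<open>Four sources: A is the eigenvalue defect \<open>ratio - 1\<close>, B the projection
  error of F, C the logarithm at \<tau> against the projected value at the new level, D the linear
  term at \<tau> against the old level.\<close>

lemma residual_bound:
  assumes st: "0 \<le> s" "s < t" "t \<le> T" and \<tau>: "s < \<tau>" "\<tau> < t"
  shows "gsq (\<lambda>i. (\<Sum>k\<in>modes K. ratio k * (coef (\<lambda>x. pot_diff \<sigma> \<sigma>wn (S Wet \<tau> x)) k / nrm k) * cc k (ctr i))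
      - (log_pot \<sigma> (center_proj t i) - 2 * \<sigma>wn * center_proj s i + \<sigma>wn)) \<le> residual_const \<sigma> \<sigma>wn m M * ((t - s)\<^sup>2 + h ^ 4)"
proof -
  define F where "F x = pot_diff \<sigma> \<sigma>wn (S Wet \<tau> x)" for x
  define L where "L = (\<sigma> Wet + \<sigma> NonWet) / (m / 2)"
  define q where "q = (t - s)\<^sup>2 + h ^ 4"
  define N where "N = 2 * grid_const M + mode_const M"
  define A where "A i = (\<Sum>k\<in>modes K. (ratio k - 1) * (coef F k / nrm k) * cc k (ctr i))" for i
  define B where "B i = - 1 * (F (ctr i) - proj (modes K) F (ctr i))" for i
  define C where "C i = log_pot \<sigma> (S Wet \<tau> (ctr i)) - log_pot \<sigma> (center_proj t i)" for i
  define D where "D i = - (2 * \<sigma>wn) * (S Wet \<tau> (ctr i) - center_proj s i)" for i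
  have \<tau>T: "\<tau> \<in> {0..T}" and tT: "t \<in> {0..T}" using \<tau> st by auto
  have nF: "neumann_class a b M F" unfolding F_def by (rule smoothF[OF \<tau>T])
  have hq: "h ^ 4 \<le> q" by (simp add: q_def)
  have gA: "gsq A \<le> mode_const M * q"
  proof -
    have "gsq A \<le> 2 ^ CARD('n) * ((h\<^sup>2)\<^sup>2 * ((6 * real CARD('n) * M)\<^sup>2 * vol))"
      unfolding A_def by (rule gsq_weighted[OF nF M ratio(2)])
    also have "\<dots> = mode_const M * h ^ 4" by (simp add: mode_const_def)
    finally show ?thesis using mult_left_mono[OF hq const_nonneg(1)[of M]] by linarith
  qed
  have gB: "gsq B \<le> grid_const M * q"
  proof -
    have "gsq B \<le> grid_const M * h ^ 4"
      unfolding B_def gsq_cmult using grid_projection_error[OF nF M] by simp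
    then show ?thesis using mult_left_mono[OF hq const_nonneg(2)[of M]] by linarith
  qed
  have gC: "gsq C \<le> L\<^sup>2 * (N * q)"
  proof -
    have "gsq C \<le> gsq (\<lambda>i. L * (S Wet \<tau> (ctr i) - center_proj t i))"
    proof (rule gsq_mono)
      fix i assume i: "i \<in> cells K"
      have "S Wet \<tau> (ctr i) \<in> {m / 2..1 - m / 2}" using range[OF \<tau>T ctr_mem[OF i]] m by auto
      from log_pot_lipschitz(1)[of \<sigma>, OF \<sigma>(1) _ this center_proj_range[OF tT i]] m
      have "\<bar>C i\<bar> \<le> L * \<bar>S Wet \<tau> (ctr i) - center_proj t i\<bar>" by (simp add: C_def L_def)
      also have "\<dots> \<le> \<bar>L\<bar> * \<bar>S Wet \<tau> (ctr i) - center_proj t i\<bar>" by (intro mult_right_mono) auto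
      finally show "\<bar>C i\<bar> \<le> \<bar>L * (S Wet \<tau> (ctr i) - center_proj t i)\<bar>" by (simp only: abs_mult)
    qed
    also have "\<dots> \<le> L\<^sup>2 * (N * q)"
      unfolding gsq_cmult N_def q_def by (intro mult_left_mono center_proj_near[OF st \<tau>]) auto
    finally show ?thesis .
  qed
  have gD: "gsq D \<le> (2 * \<sigma>wn)\<^sup>2 * (N * q)"
    unfolding D_def gsq_cmult power2_minus N_def q_def by (intro mult_left_mono center_proj_near[OF st \<tau>]) auto
  have eq: "(\<Sum>k\<in>modes K. ratio k * (coef F k / nrm k) * cc k (ctr i)) - (log_pot \<sigma> (center_proj t i) - 2 * \<sigma>wn * center_proj s i + \<sigma>wn)
      = (A i + B i) + (C i + D i)" for i
  proof -
    have "(\<Sum>k\<in>modes K. ratio k * (coef F k / nrm k) * cc k (ctr i)) = A i + proj (modes K) F (ctr i)"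
      unfolding A_def proj_def sum.distrib[symmetric] by (intro sum.cong refl) (simp only: left_diff_distrib mult_1 diff_add_cancel)
    then show ?thesis by (simp add: B_def C_def D_def F_def pot_diff_def algebra_simps)
  qed
  have "gsq (\<lambda>i. (A i + B i) + (C i + D i)) \<le> 2 * (2 * gsq A + 2 * gsq B) + 2 * (2 * gsq C + 2 * gsq D)"
    by (rule order_trans[OF gsq_add]) (intro add_mono mult_left_mono gsq_add zero_le_numeral)
  also have "\<dots> \<le> 2 * (2 * (mode_const M * q) + 2 * (grid_const M * q)) + 2 * (2 * (L\<^sup>2 * (N * q)) + 2 * ((2 * \<sigma>wn)\<^sup>2 * (N * q)))"
    by (intro add_mono mult_left_mono gA gB gC gD) auto
  also have "\<dots> = residual_const \<sigma> \<sigma>wn m M * q"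
    unfolding residual_const_def L_def[symmetric] N_def[symmetric] by (simp add: algebra_simps)
  finally show ?thesis unfolding F_def[symmetric] eq q_def .
qed

context
  fixes dt :: real and Sh :: "phase \<Rightarrow> nat \<Rightarrow> ('n \<Rightarrow> nat) \<Rightarrow> real"
  assumes dt: "0 < dt" and T: "0 < T" and num: "numerical_solution \<sigma> \<sigma>wn a b T S K h dt Sh"
begin

lemma time_level: "real n * dt \<le> T \<Longrightarrow> real n * dt \<in> {0..T}"
  using dt by simp

lemma cos_proj_Wet: "t \<in> {0..T} \<Longrightarrow> cos_proj a b K (S Wet t) (ctr i) = center_proj t i"
  using smooth[of t] by (simp add: center_proj_def cos_proj_eq neumann_class_def)

lemma cos_proj_NonWet: "t \<in> {0..T} \<Longrightarrow> cos_proj a b K (S NonWet t) (ctr i) = 1 - center_proj t i"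
  using smooth[of t] proj_one_minus[of "S Wet t" "S NonWet t" K "ctr i"] contN[of t] sat[of t]
  by (simp add: center_proj_def cos_proj_eq neumann_class_def)

lemma scheme_step_at: "real (Suc n) * dt \<le> T \<Longrightarrow> scheme_step \<sigma> \<sigma>wn K h dt (\<lambda>\<alpha>. Sh \<alpha> n) (\<lambda>\<alpha>. Sh \<alpha> (Suc n))"
  using num unfolding numerical_solution_def by blast

lemma initial_level: "Sh \<alpha> 0 = at_centers K a h (cos_proj a b K (S \<alpha> 0))"
  using num unfolding numerical_solution_def by blast

text \<open>At the start this rests on the projection respecting constants; at later levels the
  scheme provides it.\<close>

lemma NonWet_level:
  assumes "real n * dt \<le> T" "i \<in> cells K"
  shows "Sh NonWet n i = 1 - Sh Wet n i"
proof (cases n)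
  case 0
  have "0 \<in> {0..T}" using T by simp
  then show ?thesis using assms(2) unfolding 0 initial_level by (simp add: at_centers_def cos_proj_Wet cos_proj_NonWet)
next
  case (Suc j)
  then show ?thesis using scheme_step_at[of j] assms unfolding scheme_step_def by simp
qed

lemma Wet_error:
  "real n * dt \<le> T \<Longrightarrow> i \<in> cells K \<Longrightarrow> scheme_error a b S K h dt Sh Wet n i = center_proj (real n * dt) i - Sh Wet n i"
  by (simp add: scheme_error_def at_centers_def cos_proj_Wet[OF time_level])

lemma NonWet_error:
  assumes "real (Suc n) * dt \<le> T"
  shows "scheme_error a b S K h dt Sh NonWet (Suc n) = (\<lambda>i. - scheme_error a b S K h dt Sh Wet (Suc n) i)"
proof
  fix i
  have off: "Sh \<alpha> (Suc n) \<in> grid_fun K" for \<alpha>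
    using scheme_step_at[OF assms] unfolding scheme_step_def by blast
  show "scheme_error a b S K h dt Sh NonWet (Suc n) i = - scheme_error a b S K h dt Sh Wet (Suc n) i"
  proof (cases "i \<in> cells K")
    case True
    then show ?thesis
      using NonWet_level[OF assms True] cos_proj_Wet[OF time_level[OF assms]] cos_proj_NonWet[OF time_level[OF assms]]
      by (simp add: scheme_error_def at_centers_def)
  next
    case False
    then show ?thesis using off by (simp add: scheme_error_def at_centers_def grid_fun_def)
  qed
qed

text \<open>Mean zero is part of the induction because the negative norm and the testing argument
  rely on it. The term with \<sigma>wn is the balance carried over from one level to the
  next.\<close>

lemma error_bound:
  assumes \<gamma>: "\<gamma> = (sqrt (\<sigma> Wet) + sqrt (\<sigma> NonWet))\<^sup>2 - 2 * \<sigma>wn" "0 < \<gamma>"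
  defines "e \<equiv> scheme_error a b S K h dt Sh Wet"
    and "R \<equiv> residual_const \<sigma> \<sigma>wn m M * (dt\<^sup>2 + h ^ 4)"
  shows "real n * dt \<le> T \<Longrightarrow> e n \<in> grid_fun0 K \<and>
    (grid_neg_norm K h (e n))\<^sup>2 + dt * (\<gamma> / 2) * (\<Sum>k<n. gsq (e (Suc k))) + dt * \<sigma>wn * gsq (e n) \<le> real n * (dt * (R / (2 * \<gamma>)))"
proof (induction n)
  case 0
  \<comment> \<open>The initial data are the projected ones, so the sum starts from an exact
    zero.\<close>
  have e0: "e 0 = (\<lambda>_. 0)" by (simp add: e_def scheme_error_def initial_level fun_eq_iff)
  have z: "e 0 \<in> grid_fun0 K" by (simp add: e0 grid_fun0_def grid_fun_def)
  have "(grid_neg_norm K h (e 0))\<^sup>2 = 0"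
    unfolding grid_neg_norm_square(2)[OF h z] by (simp add: e0 grid_inner_def)
  then show ?case using z by (simp add: e0 gsq_def)
next
  case (Suc n)
  define t where "t = real n * dt"
  define t' where "t' = real (Suc n) * dt"
  have t'e: "t' = t + dt" by (simp add: t_def t'_def algebra_simps)
  have tt: "0 \<le> t" "t < t'" "t' \<le> T" using Suc.prems dt by (simp add: t_def, simp add: t'e, simp only: t'_def)
  have tn: "real n * dt \<le> T" using tt by (simp add: t_def)
  note IH = Suc.IH[OF tn]
  define d where "d i = Sh Wet (Suc n) i - Sh Wet n i" for i
  note sc = scheme_step_at[OF Suc.prems, unfolded scheme_step_def]
  have d0: "d \<in> grid_fun0 K" unfolding d_def[abs_def] using sc by blast
  have s'off: "Sh Wet (Suc n) \<in> grid_fun K" using sc by blast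
  have s'rng: "0 < Sh Wet (Suc n) i \<and> Sh Wet (Suc n) i < 1" if "i \<in> cells K" for i using sc that by blast
  obtain \<kappa> where \<kappa>: "\<And>i. i \<in> cells K \<Longrightarrow>
        scheme_pot \<sigma> \<sigma>wn (\<lambda>\<alpha>. Sh \<alpha> n) (\<lambda>\<alpha>. Sh \<alpha> (Suc n)) Wet i - scheme_pot \<sigma> \<sigma>wn (\<lambda>\<alpha>. Sh \<alpha> n) (\<lambda>\<alpha>. Sh \<alpha> (Suc n)) NonWet i +
        2 / dt * inv_neg_laplacian K h d i = \<kappa>"
    unfolding d_def[abs_def] using sc by blast
  have e: "e n i = center_proj t i - Sh Wet n i" "e (Suc n) i = center_proj t' i - Sh Wet (Suc n) i" if "i \<in> cells K" for i
    using Wet_error[OF tn that] Wet_error[OF Suc.prems that] by (simp_all only: e_def t_def t'_def)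
  have e'0: "e (Suc n) \<in> grid_fun0 K"
  proof -
    have "(\<Sum>i\<in>cells K. e (Suc n) i) = (\<Sum>i\<in>cells K. (center_proj t' i - center_proj t i) - d i + e n i)"
      by (intro sum.cong refl) (simp add: e d_def)
    also have "\<dots> = (\<Sum>i\<in>cells K. center_proj t' i - center_proj t i) - (\<Sum>i\<in>cells K. d i) + (\<Sum>i\<in>cells K. e n i)"
      by (simp only: sum.distrib sum_subtractf)
    also have "(\<Sum>i\<in>cells K. center_proj t' i - center_proj t i) = 0"
      unfolding center_proj_def by (rule projection_increment_sum[OF cont der tt])
    finally have "(\<Sum>i\<in>cells K. e (Suc n) i) = 0" using d0 IH by (simp add: grid_fun0_def)
    moreover have "e (Suc n) \<in> grid_fun K"
      using s'off by (simp add: e_def scheme_error_def at_centers_def grid_fun_def)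
    ultimately show ?thesis by (simp add: grid_fun0_def)
  qed
  obtain \<tau> where \<tau>: "t < \<tau>" "\<tau> < t'"
    "grid_inner K h (\<lambda>i. center_proj t' i - center_proj t i) (inv_neg_laplacian K h (e (Suc n))) =
      - (t' - t) / 2 * grid_inner K h (\<lambda>i. \<Sum>k\<in>modes K. ratio k * (coef (\<lambda>x. pot_diff \<sigma> \<sigma>wn (S Wet \<tau> x)) k / nrm k) * cc k (ctr i)) (e (Suc n))"
    unfolding center_proj_def by (rule projection_increment_consistent[OF cont der tt e'0])
  have dtt: "t' - t = dt" by (simp add: t'e)
  have "(grid_neg_norm K h (e (Suc n)))\<^sup>2 + dt * (\<gamma> / 2) * gsq (e (Suc n)) + dt * \<sigma>wn * gsq (e (Suc n)) \<le>
     (grid_neg_norm K h (e n))\<^sup>2 + dt * \<sigma>wn * gsq (e n) + dt * (R / (2 * \<gamma>))"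
  \<comment> \<open>The old nonwetting saturation is 1 minus the wetting one and contributes the
    constant \<sigma>wn, moved to the right as \<kappa> - \<sigma>wn; the same constant inside
    \<open>pot_diff\<close> is \<omega>.\<close>
  proof (rule error_step[where p = "center_proj t" and p' = "center_proj t'" and s = "Sh Wet n" and s' = "Sh Wet (Suc n)" and d = d and \<kappa> = "\<kappa> - \<sigma>wn"
        and \<Phi> = "\<lambda>i. \<Sum>k\<in>modes K. ratio k * (coef (\<lambda>x. pot_diff \<sigma> \<sigma>wn (S Wet \<tau> x)) k / nrm k) * cc k (ctr i)" and \<omega> = \<sigma>wn and \<sigma> = \<sigma>])
    show "e n \<in> grid_fun0 K" using IH by simp
    show "e (Suc n) \<in> grid_fun0 K" "d \<in> grid_fun0 K" "0 < dt" by (fact e'0 d0 dt)+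
    show "e n i = center_proj t i - Sh Wet n i \<and> e (Suc n) i = center_proj t' i - Sh Wet (Suc n) i \<and> d i = Sh Wet (Suc n) i - Sh Wet n i"
      if "i \<in> cells K" for i using e[OF that] by (simp add: d_def)
    show "log_pot \<sigma> (Sh Wet (Suc n) i) - 2 * \<sigma>wn * Sh Wet n i + 2 / dt * inv_neg_laplacian K h d i = \<kappa> - \<sigma>wn"
      if i: "i \<in> cells K" for i
      using \<kappa>[OF i] NonWet_level[OF tn i] NonWet_level[OF Suc.prems i]
      by (simp add: scheme_pot_def log_pot_def algebra_simps)
    show "grid_inner K h (\<lambda>i. center_proj t' i - center_proj t i) (inv_neg_laplacian K h (e (Suc n))) =
      - dt / 2 * grid_inner K h (\<lambda>i. \<Sum>k\<in>modes K. ratio k * (coef (\<lambda>x. pot_diff \<sigma> \<sigma>wn (S Wet \<tau> x)) k / nrm k) * cc k (ctr i)) (e (Suc n))"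
      using \<tau>(3) unfolding dtt .
    show "gsq (\<lambda>i. (\<Sum>k\<in>modes K. ratio k * (coef (\<lambda>x. pot_diff \<sigma> \<sigma>wn (S Wet \<tau> x)) k / nrm k) * cc k (ctr i))
      - (log_pot \<sigma> (center_proj t' i) - 2 * \<sigma>wn * center_proj t i + \<sigma>wn)) \<le> R"
      using residual_bound[OF tt \<tau>(1,2)] unfolding dtt R_def .
    show "0 < center_proj t' i \<and> center_proj t' i < 1 \<and> 0 < Sh Wet (Suc n) i \<and> Sh Wet (Suc n) i < 1" if i: "i \<in> cells K" for i
      using center_proj_range[of t' i] i tt m s'rng[OF i] by auto
  qed (fact \<sigma> \<gamma>)+
  moreover have "dt * (\<gamma> / 2) * (\<Sum>k<Suc n. gsq (e (Suc k))) = dt * (\<gamma> / 2) * (\<Sum>k<n. gsq (e (Suc k))) + dt * (\<gamma> / 2) * gsq (e (Suc n))"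
    by (simp only: sum.lessThan_Suc distrib_left)
  moreover have "real (Suc n) * (dt * (R / (2 * \<gamma>))) = real n * (dt * (R / (2 * \<gamma>))) + dt * (R / (2 * \<gamma>))"
    by (simp only: of_nat_Suc distrib_right mult_1 add.commute)
  ultimately show ?case using IH e'0 by linarith
qed

text \<open>The errors of the two phases are opposite, so the estimate for the wetting phase covers
  both. The minimum replaces the weights 1 and \<gamma> / 2 of \<open>error_bound\<close> by a
  common one, and the residuals accumulated over all steps are bounded because the elapsed time is
  at most T.\<close>

lemma scheme_convergence:
  assumes \<gamma>: "\<gamma> = (sqrt (\<sigma> Wet) + sqrt (\<sigma> NonWet))\<^sup>2 - 2 * \<sigma>wn" "0 < \<gamma>" and n: "real (n + 1) * dt \<le> T"
  shows "(grid_neg_norm K h (scheme_error a b S K h dt Sh \<alpha> (n + 1)))\<^sup>2 +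
      dt * (\<Sum>k=0..n. (grid_norm K h (scheme_error a b S K h dt Sh \<alpha> (k + 1)))\<^sup>2)
     \<le> T * residual_const \<sigma> \<sigma>wn m M / (2 * \<gamma>) / min 1 (\<gamma> / 2) * (dt\<^sup>2 + h ^ 4)"
proof -
  define e where "e = scheme_error a b S K h dt Sh Wet"
  define R where "R = residual_const \<sigma> \<sigma>wn m M * (dt\<^sup>2 + h ^ 4)"
  define A where "A = (grid_neg_norm K h (e (Suc n)))\<^sup>2"
  define B where "B = dt * (\<Sum>k<Suc n. gsq (e (Suc k)))"
  define c where "c = min 1 (\<gamma> / 2)"
  have lev: "real (Suc k) * dt \<le> T" if "k \<le> n" for k
  proof -
    have "real (Suc k) * dt \<le> real (n + 1) * dt" using that dt by (intro mult_right_mono) auto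
    then show ?thesis using n by linarith
  qed
  note EB = error_bound[OF \<gamma>, folded e_def R_def]
  have e0: "e (Suc k) \<in> grid_fun0 K" if "k \<le> n" for k using EB[OF lev[OF that]] by blast
  have R0: "0 \<le> R" using const_nonneg(3) h by (simp add: R_def)
  have AB0: "0 \<le> A" "0 \<le> B"
    unfolding A_def B_def using dt by (auto intro!: sum_nonneg mult_nonneg_nonneg gsq_nonneg simp del: sum.lessThan_Suc)
  have "A + (\<gamma> / 2) * B \<le> real (Suc n) * (dt * (R / (2 * \<gamma>)))"
  proof -
    have "0 \<le> dt * \<sigma>wn * gsq (e (Suc n))" using dt \<sigma>(2) gsq_nonneg by simp
    moreover have "(\<gamma> / 2) * B = dt * (\<gamma> / 2) * (\<Sum>k<Suc n. gsq (e (Suc k)))" by (simp only: B_def mult_ac)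
    ultimately show ?thesis using EB[OF lev[OF order_refl]] unfolding A_def by linarith
  qed
  also have "\<dots> = (real (Suc n) * dt) * (R / (2 * \<gamma>))" by (simp only: mult.assoc)
  also have "\<dots> \<le> T * (R / (2 * \<gamma>))" using lev[of n] R0 \<gamma>(2) by (intro mult_right_mono) auto
  finally have "A + (\<gamma> / 2) * B \<le> T * (R / (2 * \<gamma>))" .
  moreover have "c * (A + B) \<le> A + (\<gamma> / 2) * B"
  proof -
    have "c \<le> 1" "c \<le> \<gamma> / 2" by (simp_all add: c_def)
    from mult_right_mono[OF this(1) AB0(1)] mult_right_mono[OF this(2) AB0(2)]
    show ?thesis unfolding distrib_left mult_1 by (rule add_mono)
  qed
  ultimately have "(A + B) * c \<le> T * (R / (2 * \<gamma>))" unfolding mult.commute[of "A + B"] by linarith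
  moreover have "0 < c" using \<gamma>(2) by (simp add: c_def)
  ultimately have "A + B \<le> T * (R / (2 * \<gamma>)) / c" by (simp only: pos_le_divide_eq)
  also have "\<dots> = T * residual_const \<sigma> \<sigma>wn m M / (2 * \<gamma>) / c * (dt\<^sup>2 + h ^ 4)" by (simp add: R_def)
  finally have AB: "A + B \<le> T * residual_const \<sigma> \<sigma>wn m M / (2 * \<gamma>) / c * (dt\<^sup>2 + h ^ 4)" .
  have norms: "(grid_neg_norm K h (scheme_error a b S K h dt Sh \<alpha> (Suc k)))\<^sup>2 = (grid_neg_norm K h (e (Suc k)))\<^sup>2 \<and>
      (grid_norm K h (scheme_error a b S K h dt Sh \<alpha> (Suc k)))\<^sup>2 = gsq (e (Suc k))" if "k \<le> n" for k
  proof (cases \<alpha>)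
    case Wet
    then show ?thesis by (simp add: e_def grid_norm_gsq)
  next
    case NonWet
    have "gsq (\<lambda>i. - e (Suc k) i) = gsq (e (Suc k))" by (simp add: gsq_def)
    then show ?thesis
      using neg_norm_uminus[OF e0[OF that]] NonWet_error[OF lev[OF that]] by (simp add: NonWet grid_norm_gsq e_def)
  qed
  have "(\<Sum>k=0..n. (grid_norm K h (scheme_error a b S K h dt Sh \<alpha> (k + 1)))\<^sup>2) = (\<Sum>k<Suc n. gsq (e (Suc k)))"
    by (rule sum.cong) (use norms in auto)
  then show ?thesis using AB norms[of n] by (simp add: A_def B_def c_def)
qed

end

end

end

theorem theorem5p1:
  fixes a b :: "real^'n"
    and \<sigma> :: "phase \<Rightarrow> real" and \<sigma>wn T :: real
    and S :: "phase \<Rightarrow> real \<Rightarrow> real^'n \<Rightarrow> real"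
    and p :: "real \<Rightarrow> real^'n \<Rightarrow> real"
  assumes dim: "CARD('n) = 2 \<or> CARD('n) = 3"
    and domain: "\<And>l. a $ l < b $ l"
    and sigma_pos: "\<And>\<alpha>. 0 < \<sigma> \<alpha>" "0 < \<sigma>wn"
    and gamma0_pos: "(sqrt (\<sigma> Wet) + sqrt (\<sigma> NonWet))\<^sup>2 - 2 * \<sigma>wn > 0"
    and T_pos: "0 < T"
    and exact: "exact_solution \<sigma> \<sigma>wn a b T S p"
  shows "\<exists>C \<Delta>t0 h0 :: real. 0 < \<Delta>t0 \<and> 0 < h0 \<and>
    (\<forall>(\<Delta>t :: real) (h :: real) (K :: 'n \<Rightarrow> nat) (Sh :: phase \<Rightarrow> nat \<Rightarrow> ('n \<Rightarrow> nat) \<Rightarrow> real).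
       0 < \<Delta>t \<and> \<Delta>t < \<Delta>t0 \<and> 0 < h \<and> h < h0 \<and>
       (\<forall>l. b $ l - a $ l = real (2 * K l + 1) * h) \<and>
       numerical_solution \<sigma> \<sigma>wn a b T S K h \<Delta>t Sh \<longrightarrow>
       (\<forall>m :: nat. real (m + 1) * \<Delta>t \<le> T \<longrightarrow>
          (\<forall>\<alpha>. (grid_neg_norm K h (scheme_error a b S K h \<Delta>t Sh \<alpha> (m + 1)))\<^sup>2 +
               \<Delta>t * (\<Sum>k=0..m. (grid_norm K h (scheme_error a b S K h \<Delta>t Sh \<alpha> (k + 1)))\<^sup>2)
               \<le> C * (\<Delta>t\<^sup>2 + h ^ 4))))"
proof -
  interpret cosine_box a b by unfold_locales (rule domain)
  define \<gamma> where "\<gamma> = (sqrt (\<sigma> Wet) + sqrt (\<sigma> NonWet))\<^sup>2 - 2 * \<sigma>wn"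
  have \<gamma>: "0 < \<gamma>" using gamma0_pos by (simp add: \<gamma>_def)
  have sat: "S NonWet t x = 1 - S Wet t x" if "t \<in> {0..T}" "x \<in> cbox a b" for t x
  proof -
    have "S Wet t x + S NonWet t x = 1" using exact that unfolding exact_solution_def by blast
    then show ?thesis by simp
  qed
  have contN: "continuous_on (cbox a b) (S NonWet t)" if "t \<in> {0..T}" for t
  proof (rule continuous_on_slices(1)[OF _ that])
    show "continuous_on ({0..T} \<times> cbox a b) (\<lambda>(t, x). S NonWet t x)"
      using exact unfolding exact_solution_def by blast
  qed
  show ?thesis
  proof (rule exact_solution_facts[OF sigma_pos gamma0_pos T_pos exact], goal_cases)
    case (1 m M)
    note m = 1(1) and M = 1(2) and facts = 1(3-7)
    \<comment> \<open>The two entries provide \<open>h \<le> 1\<close> and the smallness that keeps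
      the projected saturation at a distance m / 2 from 0 and from 1.\<close>
    define h0 where "h0 = min 1 ((m / 2)\<^sup>2 / (grid_const M + 1))"
    have g1: "0 < grid_const M + 1" using const_nonneg(2)[of M] by linarith
    have h0: "0 < h0" using m g1 by (simp add: h0_def)
    show ?case
    proof (rule exI[of _ "T * residual_const \<sigma> \<sigma>wn m M / (2 * \<gamma>) / min 1 (\<gamma> / 2)"], rule exI[of _ "1::real"], rule exI[of _ h0],
        intro conjI allI impI h0, simp)
      fix dt h :: real and K :: "'n \<Rightarrow> nat" and Sh :: "phase \<Rightarrow> nat \<Rightarrow> ('n \<Rightarrow> nat) \<Rightarrow> real" and n :: nat and \<alpha>
      assume A: "0 < dt \<and> dt < 1 \<and> 0 < h \<and> h < h0 \<and> (\<forall>l. b $ l - a $ l = real (2 * K l + 1) * h) \<and>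
         numerical_solution \<sigma> \<sigma>wn a b T S K h dt Sh" and n: "real (n + 1) * dt \<le> T"
      interpret G: cosine_grid a b K h by unfold_locales (use A in auto)
      have "h \<le> (m / 2)\<^sup>2 / (grid_const M + 1)" using A by (simp add: h0_def)
      then have hm: "h * (grid_const M + 1) \<le> (m / 2)\<^sup>2" using g1 by (simp add: le_divide_eq)
      have h1: "h \<le> 1" using A by (simp add: h0_def)
      have d3: "CARD('n) \<le> 3" using dim by auto
      show "(grid_neg_norm K h (scheme_error a b S K h dt Sh \<alpha> (n + 1)))\<^sup>2 +
        dt * (\<Sum>k=0..n. (grid_norm K h (scheme_error a b S K h dt Sh \<alpha> (k + 1)))\<^sup>2)
       \<le> T * residual_const \<sigma> \<sigma>wn m M / (2 * \<gamma>) / min 1 (\<gamma> / 2) * (dt\<^sup>2 + h ^ 4)"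
        by (rule G.scheme_convergence[where \<sigma> = \<sigma> and \<sigma>wn = \<sigma>wn and T = T and m = m and M = M and S = S and Sh = Sh and dt = dt and n = n,
              OF sigma_pos m M facts(1) sat contN facts(2-5) d3 h1 hm _ T_pos _ \<gamma>_def \<gamma> n]) (use A in auto)
    qed
  qed
qed

end
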